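(* Let $\Phi$ be the unique measure-preserving stochastic continuous flow solving $$\Phi_t(x)=x+\int_0^t\int_{\mathbb{T}^2}K(\Phi_r(x)-\Phi_r(y))\,\xi_0(y)\,dy\,dr+\sum_{k}\int_0^t\sigma_k(\Phi_r(x))\,dW^k_r,$$ and, for $\varepsilon>0$, let $\Phi^\varepsilon$ be the unique measure-preserving stochastic continuous flow solving $$\Phi^\varepsilon_t(x)=x+\int_0^t\int_{\mathbb{T}^2}K^\varepsilon(\Phi^\varepsilon_r(x)-\Phi^\varepsilon_r(y))\,\xi_0(y)\,dy\,dr+\sum_{k}\int_0^t\sigma_k(\Phi^\varepsilon_r(x))\,dW^k_r,$$ where $K^\varepsilon=K*\rho_\varepsilon$. Then the family $(\Phi^\varepsilon)_\varepsilon$ converges to $\Phi$ as $\varepsilon\to0$ in $C([0,T];L^1(\mathbb{T}^2\times\Omega))$.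
   Context: $\mathbb{T}^2=(\mathbb{R}/\mathbb{Z})^2$ is the two-dimensional torus, $T>0$, $\xi_0\in L^\infty(\mathbb{T}^2)$. Convergence in $C([0,T];L^1(\mathbb{T}^2\times\Omega))$ means $\sup_{t\in[0,T]}\int_{\mathbb{T}^2}E|\Phi^\varepsilon_t(x)-\Phi_t(x)|\,dx\to0$, where $|x-y|$ is the distance on $\mathbb{T}^2$. Noise. $W=(W^k)_{k\ge1}$ is a family of independent real Brownian motions on a probability space $(\Omega,\mathcal{A},P)$, with respect to a filtration $\mathbb{F}=(\mathcal{F}_t)_{t\in[0,T]}$. The vector fields $\sigma_k:\mathbb{T}^2\to\mathbb{R}^2$ are divergence-free and Lipschitz, with $L_\sigma^2:=\sup_{x}\sum_{k}|\sigma_k(x)|^2+\|\sum_{k}|D\sigma_k|^2\|_{L^\infty}<\infty$, and $\sum_k\sigma_k(x)\sigma_k(x)^\ast=cI_2$ for all $x$, for a constant $c\ge0$. Kernel. $G$ is the Green function of the Laplacian on $\mathbb{T}^2$ with mean $0$ ($\Delta G=\delta_0-1$), and $K=\nabla^\perp G=(-\partial_2G,\partial_1G)\in L^1(\mathbb{T}^2)$. $(\rho_\varepsilon)_{\varepsilon>0}$ is a family of even compactly supported resolutions of the identity (mollifiers): $\rho_\varepsilon\in C_c^\infty(\mathbb{R}^2)$ is nonnegative, even, has integral $1$, and its support shrinks to $\{0\}$ as $\varepsilon\to0$; the convolution is with the periodic extension of $K$. A stochastic continuous flow is a measurable map $\Phi:[0,T]\times\mathbb{T}^2\times\Omega\to\mathbb{T}^2$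 such that for a.e. $\omega$ the map $\Phi(\omega):[0,T]\times\mathbb{T}^2\to\mathbb{T}^2$ is continuous and, for every $x$, the process $\Phi(x)$ is progressively measurable. It is measure-preserving if for a.e. $\omega$, for every $t$, $\Phi_t(\omega)$ preserves the Lebesgue measure on $\mathbb{T}^2$. For $H=K$ or $H=K^\varepsilon=K*\rho_\varepsilon$, it solves the equation $$\Phi_t(x)=x+\int_0^t\int_{\mathbb{T}^2}H(\Phi_r(x)-\Phi_r(y))\,\xi_0(y)\,dy\,dr+\sum_{k}\int_0^t\sigma_k(\Phi_r(x))\,dW^k_r$$ if for every $x$ the process $\Phi(x)$ satisfies it. Each of the two equations (the one with $H=K$ and the one with $H=K^\varepsilon$) has a unique measure-preserving stochastic continuous flow solution. *)

theory Defs
  imports "HOL-Probability.Probability"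
begin

section \<open>The two-dimensional torus\<close>

definition lattice_rel :: "real^2 \<Rightarrow> real^2 \<Rightarrow> bool" where
  "lattice_rel v w \<longleftrightarrow> (\<forall>i. v $ i - w $ i \<in> \<int>)"

lemma lattice_rel_add:
  assumes "lattice_rel a b" "lattice_rel c d"
  shows "lattice_rel (a + c) (b + d)"
  unfolding lattice_rel_def
proof
  fix i
  have "(a $ i - b $ i) + (c $ i - d $ i) \<in> \<int>"
    using assms by (intro Ints_add) (auto simp: lattice_rel_def)
  then show "(a + c) $ i - (b + d) $ i \<in> \<int>" by (simp add: algebra_simps)
qed

lemma lattice_rel_uminus:
  assumes "lattice_rel a b" shows "lattice_rel (- a) (- b)"
  unfolding lattice_rel_def
proof
  fix i
  have "- (a $ i - b $ i) \<in> \<int>"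
    using assms by (intro Ints_minus) (auto simp: lattice_rel_def)
  then show "(- a) $ i - (- b) $ i \<in> \<int>" by (simp add: algebra_simps)
qed

quotient_type torus2 = "real^2" / lattice_rel
  morphisms rep_torus2 proj
proof (rule equivpI)
  show "reflp lattice_rel" by (simp add: reflp_def lattice_rel_def)
  show "symp lattice_rel"
  proof (rule sympI)
    fix a b assume "lattice_rel a b"
    then have "- (a $ i - b $ i) \<in> \<int>" for i
      by (intro Ints_minus) (auto simp: lattice_rel_def)
    then show "lattice_rel b a" by (simp add: lattice_rel_def)
  qed
  show "transp lattice_rel"
  proof (rule transpI)
    fix a b c assume "lattice_rel a b" "lattice_rel b c"
    then have "(a $ i - b $ i) + (b $ i - c $ i) \<in> \<int>" for i
      by (intro Ints_add) (auto simp: lattice_rel_def)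
    then show "lattice_rel a c" by (simp add: lattice_rel_def)
  qed
qed

instantiation torus2 :: ab_group_add
begin

lift_definition zero_torus2 :: torus2 is "0 :: real^2" .

lift_definition plus_torus2 :: "torus2 \<Rightarrow> torus2 \<Rightarrow> torus2" is "(+)"
  by (rule lattice_rel_add)

lift_definition uminus_torus2 :: "torus2 \<Rightarrow> torus2" is uminus
  by (rule lattice_rel_uminus)

lift_definition minus_torus2 :: "torus2 \<Rightarrow> torus2 \<Rightarrow> torus2" is "(-)"
  using lattice_rel_add[OF _ lattice_rel_uminus] by fastforce

instance
proof
  fix a b c :: torus2
  show "a + b + c = a + (b + c)" by transfer (simp add: lattice_rel_def)
  show "a + b = b + a" by transfer (simp add: lattice_rel_def)
  show "0 + a = a" by transfer (simp add: lattice_rel_def)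
  show "- a + a = 0" by transfer (simp add: lattice_rel_def)
  show "a - b = a + - b" by transfer (simp add: lattice_rel_def)
qed

end

lemma proj_add: "proj (v + w) = proj v + proj w"
  by (simp add: plus_torus2.abs_eq)

lemma proj_minus: "proj (- v) = - proj v"
  by (simp add: uminus_torus2.abs_eq)

lemma proj_diff: "proj (v - w) = proj v - proj w"
  by (simp add: minus_torus2.abs_eq)

lemma proj_zero: "proj 0 = 0"
  by (simp add: zero_torus2.abs_eq)

lemma proj_surj: "\<exists>v. proj v = x"
  by (induction x) auto

lemma proj_eq_0_iff: "proj v = 0 \<longleftrightarrow> (\<forall>i. v $ i \<in> \<int>)"
  by (simp add: zero_torus2.abs_eq torus2.abs_eq_iff lattice_rel_def)

text \<open>The flat (quotient) distance on the torus: the length of the shortest vector of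
  the plane that projects to the difference of the two points.\<close>

definition torus_norm :: "torus2 \<Rightarrow> real" where
  "torus_norm u = Inf (norm ` {v. proj v = u})"

lemma torus_norm_bdd: "bdd_below (norm ` {v. proj v = u})"
  by (rule bdd_belowI[of _ 0]) auto

lemma torus_norm_le: "proj v = u \<Longrightarrow> torus_norm u \<le> norm v"
  unfolding torus_norm_def by (rule cInf_lower[OF _ torus_norm_bdd]) auto

lemma torus_norm_less:
  assumes "e > 0" obtains v where "proj v = u" "norm v < torus_norm u + e"
proof -
  have "norm ` {v. proj v = u} \<noteq> {}" using proj_surj[of u] by auto
  moreover have "Inf (norm ` {v. proj v = u}) < torus_norm u + e"
    using assms by (simp add: torus_norm_def)
  ultimately show ?thesis
    using that by (subst (asm) cInf_less_iff) (auto intro: torus_norm_bdd)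
qed

lemma torus_norm_nonneg: "torus_norm u \<ge> 0"
  unfolding torus_norm_def
  using proj_surj[of u] by (intro cInf_greatest) auto

lemma torus_norm_zero: "torus_norm 0 = 0"
  using torus_norm_le[OF proj_zero] torus_norm_nonneg[of 0] by simp

lemma torus_norm_uminus: "torus_norm (- u) = torus_norm u"
proof -
  have le: "torus_norm (- w) \<le> torus_norm w" for w
  proof (rule field_le_epsilon)
    fix e :: real assume "e > 0"
    then obtain v where "proj v = w" "norm v < torus_norm w + e"
      by (rule torus_norm_less)
    then show "torus_norm (- w) \<le> torus_norm w + e"
      using torus_norm_le[of "- v" "- w"] by (simp add: proj_minus)
  qed
  show ?thesis using le[of u] le[of "- u"] by simp
qed

lemma torus_norm_triangle: "torus_norm (u + w) \<le> torus_norm u + torus_norm w"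
proof (rule field_le_epsilon)
  fix e :: real assume "e > 0"
  then have e2: "e / 2 > 0" by simp
  obtain v where v: "proj v = u" "norm v < torus_norm u + e / 2"
    using torus_norm_less[OF e2] by blast
  obtain v' where v': "proj v' = w" "norm v' < torus_norm w + e / 2"
    using torus_norm_less[OF e2] by blast
  have "torus_norm (u + w) \<le> norm (v + v')"
    using v v' by (intro torus_norm_le) (simp add: proj_add)
  also have "\<dots> \<le> norm v + norm v'" by (rule norm_triangle_ineq)
  finally show "torus_norm (u + w) \<le> torus_norm u + torus_norm w + e"
    using v v' by linarith
qed

lemma torus_norm_eq_0:
  assumes "torus_norm u = 0" shows "u = 0"
proof -
  obtain v where v: "proj v = u" "norm v < 1/2"
    using torus_norm_less[of "1/2" u] assms by auto
  have "v = 0"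
  proof (rule ccontr)
    assume "v \<noteq> 0"
    then have "min (norm v) (1/2) > 0" by simp
    then obtain w where w: "proj w = u" "norm w < min (norm v) (1/2)"
      using torus_norm_less[of "min (norm v) (1/2)" u] assms by auto
    have "proj (v - w) = 0" using v w by (simp add: proj_diff)
    then have int: "(v - w) $ i \<in> \<int>" for i using proj_eq_0_iff by blast
    have "norm (v - w) < 1"
      using norm_triangle_ineq4[of v w] v w by linarith
    then have "\<bar>(v - w) $ i\<bar> < 1" for i
      using component_le_norm_cart[of "v - w" i] by linarith
    then have "(v - w) $ i = 0" for i
      using int Ints_nonzero_abs_less1 by blast
    then have "v = w" by (simp add: vec_eq_iff)
    with w show False by simp
  qed
  with v show ?thesis by (simp add: proj_zero)
qed

instantiation torus2 :: metric_space
begin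

definition dist_torus2 :: "torus2 \<Rightarrow> torus2 \<Rightarrow> real" where
  "dist_torus2 x y = torus_norm (x - y)"

definition uniformity_torus2 :: "(torus2 \<times> torus2) filter" where
  "uniformity_torus2 = (INF e\<in>{0 <..}. principal {(x, y). dist x y < e})"

definition open_torus2 :: "torus2 set \<Rightarrow> bool" where
  "open_torus2 U \<longleftrightarrow> (\<forall>x\<in>U. eventually (\<lambda>(x', y). x' = x \<longrightarrow> y \<in> U) uniformity)"

instance
proof
  show "uniformity = (INF e\<in>{0 <..}. principal {(x :: torus2, y). dist x y < e})"
    by (rule uniformity_torus2_def)
  show "open U \<longleftrightarrow> (\<forall>x\<in>U. eventually (\<lambda>(x', y). x' = x \<longrightarrow> y \<in> U) uniformity)"
    for U :: "torus2 set"
    by (rule open_torus2_def)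
  fix x y z :: torus2
  show "dist x y = 0 \<longleftrightarrow> x = y"
    using torus_norm_eq_0[of "x - y"] by (auto simp: dist_torus2_def torus_norm_zero)
  show "dist x y \<le> dist x z + dist y z"
    using torus_norm_triangle[of "x - z" "- (y - z)"] torus_norm_uminus[of "y - z"]
    by (simp add: dist_torus2_def)
qed

end

text \<open>Lebesgue measure: the image of planar Lebesgue measure on the fundamental cell.\<close>

definition torus_lebesgue :: "torus2 measure" where
  "torus_lebesgue =
     distr (restrict_space lborel {v. \<forall>i. 0 \<le> v $ i \<and> v $ i < 1}) borel proj"

lemma continuous_proj: "continuous_on UNIV proj"
proof (rule continuous_onI)
  fix v :: "real^2" and e :: real assume "e > 0"
  moreover have "dist (proj w) (proj v) \<le> dist w v" for w
    unfolding dist_torus2_def dist_norm by (intro torus_norm_le) (simp add: proj_diff)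
  ultimately show "\<exists>d>0. \<forall>w\<in>UNIV. dist w v < d \<longrightarrow> dist (proj w) (proj v) \<le> e"
    by (meson less_imp_le order_le_less_trans)
qed

lemma prob_space_torus_lebesgue: "prob_space torus_lebesgue"
proof -
  let ?C = "{v :: real^2. \<forall>i. 0 \<le> v $ i \<and> v $ i < 1}"
  have C: "?C \<in> sets lborel" by measurable
  have One: "(One :: real^2) $ i = 1" for i
    using inner_sum_left_Basis[of "axis i (1::real) :: real^2" "\<lambda>_. 1"]
    by (simp add: inner_axis axis_in_Basis_iff del: sum_component)
  have "box 0 One \<subseteq> ?C" "?C \<subseteq> cbox 0 One"
    by (auto simp: mem_box_cart One less_imp_le simp del: sum_component)
  then have "emeasure lborel (box 0 (One :: real^2)) \<le> emeasure lborel ?C"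
    "emeasure lborel ?C \<le> emeasure lborel (cbox 0 (One :: real^2))"
    using C by (intro emeasure_mono; simp)+
  then have "emeasure lborel ?C = 1"
    by (simp add: emeasure_lborel_box emeasure_lborel_cbox)
  then have "prob_space (restrict_space lborel ?C)"
    using C by (intro prob_spaceI) (simp add: emeasure_restrict_space space_restrict_space)
  moreover have "proj \<in> borel_measurable (restrict_space lborel ?C)"
    using borel_measurable_continuous_onI[OF continuous_proj]
    by (intro measurable_restrict_space1) simp
  ultimately show ?thesis
    unfolding torus_lebesgue_def by (rule prob_space.prob_space_distr)
qed


section \<open>Smooth functions and weak derivatives\<close>

fun C_k :: "nat \<Rightarrow> ('a::euclidean_space \<Rightarrow> 'b::real_normed_vector) \<Rightarrow> bool" where
  "C_k 0 f \<longleftrightarrow> continuous_on UNIV f"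
| "C_k (Suc n) f \<longleftrightarrow>
     f differentiable_on UNIV \<and> (\<forall>v. C_k n (\<lambda>x. frechet_derivative f (at x) v))"

definition smooth :: "('a::euclidean_space \<Rightarrow> 'b::real_normed_vector) \<Rightarrow> bool" where
  "smooth f \<longleftrightarrow> (\<forall>n. C_k n f)"

definition torus_smooth :: "(torus2 \<Rightarrow> real) \<Rightarrow> bool" where
  "torus_smooth \<phi> \<longleftrightarrow> smooth (\<lambda>v. \<phi> (proj v))"

definition torus_partial :: "2 \<Rightarrow> (torus2 \<Rightarrow> real) \<Rightarrow> torus2 \<Rightarrow> real" where
  "torus_partial i \<phi> x = deriv (\<lambda>h::real. \<phi> (x + proj (h *\<^sub>R axis i 1))) 0"

definition torus_laplacian :: "(torus2 \<Rightarrow> real) \<Rightarrow> torus2 \<Rightarrow> real" where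
  "torus_laplacian \<phi> x = (\<Sum>i\<in>UNIV. torus_partial i (torus_partial i \<phi>) x)"

definition weak_partial :: "2 \<Rightarrow> (torus2 \<Rightarrow> real) \<Rightarrow> (torus2 \<Rightarrow> real) \<Rightarrow> bool" where
  "weak_partial i f g \<longleftrightarrow>
     integrable torus_lebesgue f \<and> integrable torus_lebesgue g \<and>
     (\<forall>\<phi>. torus_smooth \<phi> \<longrightarrow>
        (LINT x|torus_lebesgue. f x * torus_partial i \<phi> x) =
        - (LINT x|torus_lebesgue. g x * \<phi> x))"

text \<open>The norm of the type \<open>real^2^2\<close>, which the statement applies to a weak
  Jacobian, is the Frobenius norm.\<close>

definition weak_jacobian :: "(torus2 \<Rightarrow> real^2) \<Rightarrow> (torus2 \<Rightarrow> real^2^2) \<Rightarrow> bool" where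
  "weak_jacobian s D \<longleftrightarrow> (\<forall>i j. weak_partial j (\<lambda>x. s x $ i) (\<lambda>x. D x $ i $ j))"

definition divergence_free :: "(torus2 \<Rightarrow> real^2) \<Rightarrow> bool" where
  "divergence_free s \<longleftrightarrow>
     (\<forall>\<phi>. torus_smooth \<phi> \<longrightarrow>
        (LINT x|torus_lebesgue. (\<Sum>i\<in>UNIV. s x $ i * torus_partial i \<phi> x)) = 0)"


section \<open>The Biot--Savart kernel and its mollification\<close>

text \<open>The mean-zero solution of \<open>\<Delta>G = \<delta>\<^sub>0 - 1\<close> in the sense of distributions.\<close>

definition torus_green :: "(torus2 \<Rightarrow> real) \<Rightarrow> bool" where
  "torus_green G \<longleftrightarrow>
     integrable torus_lebesgue G \<and> (LINT x|torus_lebesgue. G x) = 0 \<and>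
     (\<forall>\<phi>. torus_smooth \<phi> \<longrightarrow>
        (LINT x|torus_lebesgue. G x * torus_laplacian \<phi> x) =
        \<phi> 0 - (LINT x|torus_lebesgue. \<phi> x))"

text \<open>\<open>K\<close> is an integrable representative of \<open>\<nabla>\<^sup>\<bottom>G = (-\<partial>\<^sub>2G, \<partial>\<^sub>1G)\<close>;
  the derivatives are distributional.\<close>

definition perp_gradient :: "(torus2 \<Rightarrow> real) \<Rightarrow> (torus2 \<Rightarrow> real^2) \<Rightarrow> bool" where
  "perp_gradient G K \<longleftrightarrow>
     integrable torus_lebesgue K \<and>
     weak_partial 2 G (\<lambda>x. - (K x $ 1)) \<and> weak_partial 1 G (\<lambda>x. K x $ 2)"

definition mollifier_family :: "(real \<Rightarrow> real^2 \<Rightarrow> real) \<Rightarrow> bool" where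
  "mollifier_family \<rho> \<longleftrightarrow>
     (\<forall>\<epsilon>>0. smooth (\<rho> \<epsilon>) \<and> compact (closure {z. \<rho> \<epsilon> z \<noteq> 0}) \<and>
        (\<forall>z. \<rho> \<epsilon> z \<ge> 0) \<and> (\<forall>z. \<rho> \<epsilon> (- z) = \<rho> \<epsilon> z) \<and> (LINT z|lborel. \<rho> \<epsilon> z) = 1) \<and>
     (\<forall>r>0. \<forall>\<^sub>F \<epsilon> in at_right 0. \<forall>z. \<rho> \<epsilon> z \<noteq> 0 \<longrightarrow> norm z < r)"

text \<open>Convolution over the plane of \<open>\<rho>\<close> with the periodic extension of \<open>K\<close>,
  which is \<open>\<lambda>z. K (proj z)\<close>.\<close>

definition mollify :: "(torus2 \<Rightarrow> real^2) \<Rightarrow> (real^2 \<Rightarrow> real) \<Rightarrow> torus2 \<Rightarrow> real^2" where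
  "mollify K \<rho> x = (LINT z|lborel. \<rho> z *\<^sub>R K (x - proj z))"


section \<open>Brownian motions and the Ito integral on \<open>[0,T]\<close>\<close>

definition filtration_upto :: "'a measure \<Rightarrow> real \<Rightarrow> (real \<Rightarrow> 'a measure) \<Rightarrow> bool" where
  "filtration_upto M T F \<longleftrightarrow>
     (\<forall>t\<in>{0..T}. subalgebra M (F t)) \<and>
     (\<forall>s\<in>{0..T}. \<forall>t\<in>{s..T}. sets (F s) \<subseteq> sets (F t))"

definition brownian_motion ::
  "'a measure \<Rightarrow> real \<Rightarrow> (real \<Rightarrow> 'a measure) \<Rightarrow> (real \<Rightarrow> 'a \<Rightarrow> real) \<Rightarrow> bool" where
  "brownian_motion M T F B \<longleftrightarrow>
     (\<forall>t\<in>{0..T}. B t \<in> borel_measurable (F t)) \<and>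
     (AE \<omega> in M. B 0 \<omega> = 0) \<and>
     (AE \<omega> in M. continuous_on {0..T} (\<lambda>t. B t \<omega>)) \<and>
     (\<forall>s\<in>{0..T}. \<forall>t\<in>{s<..T}.
        distributed M lborel (\<lambda>\<omega>. B t \<omega> - B s \<omega>) (normal_density 0 (sqrt (t - s))) \<and>
        prob_space.indep_set M (sets (F s))
          (sets (vimage_algebra (space M) (\<lambda>\<omega>. B t \<omega> - B s \<omega>) borel)))"

text \<open>Independence of the family is independence of the processes, that is, of the
  random paths as elements of the product space over \<open>[0,T]\<close>.\<close>

definition independent_brownian_motions ::
  "'a measure \<Rightarrow> real \<Rightarrow> (real \<Rightarrow> 'a measure) \<Rightarrow> (nat \<Rightarrow> real \<Rightarrow> 'a \<Rightarrow> real) \<Rightarrow> bool" where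
  "independent_brownian_motions M T F W \<longleftrightarrow>
     (\<forall>k. brownian_motion M T F (W k)) \<and>
     prob_space.indep_vars M (\<lambda>_. \<Pi>\<^sub>M t\<in>{0..T}. borel) (\<lambda>k \<omega>. \<lambda>t\<in>{0..T}. W k t \<omega>) UNIV"

definition progressive ::
  "real \<Rightarrow> (real \<Rightarrow> 'a measure) \<Rightarrow> (real \<Rightarrow> 'a \<Rightarrow> 'b::topological_space) \<Rightarrow> bool" where
  "progressive T F X \<longleftrightarrow>
     (\<forall>t\<in>{0..T}. (\<lambda>(s, \<omega>). X s \<omega>) \<in> borel_measurable (restrict_space borel {0..t} \<Otimes>\<^sub>M F t))"

text \<open>A simple integrand is \<open>\<Sum>i<m. Z i\<close> on the interval \<open>(\<tau> i, \<tau> (i+1)]\<close> with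
  \<open>Z i\<close> bounded and known at time \<open>\<tau> i\<close>.\<close>

definition simple_integrand ::
  "real \<Rightarrow> (real \<Rightarrow> 'a measure) \<Rightarrow> nat \<Rightarrow> (nat \<Rightarrow> real) \<Rightarrow>
   (nat \<Rightarrow> 'a \<Rightarrow> 'b::euclidean_space) \<Rightarrow> bool" where
  "simple_integrand T F m \<tau> Z \<longleftrightarrow>
     0 \<le> \<tau> 0 \<and> \<tau> m \<le> T \<and> (\<forall>i<m. \<tau> i \<le> \<tau> (Suc i)) \<and>
     (\<forall>i<m. Z i \<in> borel_measurable (F (\<tau> i)) \<and> bounded (Z i ` space (F (\<tau> i))))"

definition simple_process ::
  "nat \<Rightarrow> (nat \<Rightarrow> real) \<Rightarrow> (nat \<Rightarrow> 'a \<Rightarrow> 'b::euclidean_space) \<Rightarrow> real \<Rightarrow> 'a \<Rightarrow> 'b" where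
  "simple_process m \<tau> Z t \<omega> = (\<Sum>i<m. indicator {\<tau> i<..\<tau> (Suc i)} t *\<^sub>R Z i \<omega>)"

definition simple_integral ::
  "(real \<Rightarrow> 'a \<Rightarrow> real) \<Rightarrow> nat \<Rightarrow> (nat \<Rightarrow> real) \<Rightarrow>
   (nat \<Rightarrow> 'a \<Rightarrow> 'b::euclidean_space) \<Rightarrow> real \<Rightarrow> 'a \<Rightarrow> 'b" where
  "simple_integral B m \<tau> Z t \<omega> =
     (\<Sum>i<m. (B (min t (\<tau> (Suc i))) \<omega> - B (min t (\<tau> i)) \<omega>) *\<^sub>R Z i \<omega>)"

text \<open>\<open>I\<close> is the continuous version of the process \<open>t \<mapsto> \<integral>\<^sub>0\<^sup>t H dB\<close>, for a progressive
  square-integrable integrand: the mean-square limit of the integrals of simple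
  integrands that approximate \<open>H\<close> in \<open>L\<^sup>2([0,T] \<times> \<Omega>)\<close>.\<close>

definition has_ito_integral ::
  "'a measure \<Rightarrow> real \<Rightarrow> (real \<Rightarrow> 'a measure) \<Rightarrow> (real \<Rightarrow> 'a \<Rightarrow> real) \<Rightarrow>
   (real \<Rightarrow> 'a \<Rightarrow> 'b::euclidean_space) \<Rightarrow> (real \<Rightarrow> 'a \<Rightarrow> 'b) \<Rightarrow> bool" where
  "has_ito_integral M T F B H I \<longleftrightarrow>
     progressive T F H \<and>
     (\<forall>t\<in>{0..T}. I t \<in> borel_measurable M) \<and>
     (AE \<omega> in M. continuous_on {0..T} (\<lambda>t. I t \<omega>)) \<and>
     (\<exists>m \<tau> Z.
        (\<forall>n. simple_integrand T F (m n) (\<tau> n) (Z n)) \<and>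
        (\<lambda>n. \<integral>\<^sup>+\<omega>. (\<integral>\<^sup>+t\<in>{0..T}.
            ennreal ((norm (simple_process (m n) (\<tau> n) (Z n) t \<omega> - H t \<omega>))\<^sup>2) \<partial>lborel) \<partial>M)
          \<longlonglongrightarrow> 0 \<and>
        (\<forall>t\<in>{0..T}.
          (\<lambda>n. \<integral>\<^sup>+\<omega>. ennreal ((norm (simple_integral B (m n) (\<tau> n) (Z n) t \<omega> - I t \<omega>))\<^sup>2) \<partial>M)
            \<longlonglongrightarrow> 0))"

text \<open>\<open>S\<close> is the continuous version of \<open>\<Sum>k. \<integral>\<^sub>0\<^sup>t H k dW k\<close>; the series converges in
  mean square.\<close>

definition has_ito_series ::
  "'a measure \<Rightarrow> real \<Rightarrow> (real \<Rightarrow> 'a measure) \<Rightarrow> (nat \<Rightarrow> real \<Rightarrow> 'a \<Rightarrow> real) \<Rightarrow>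
   (nat \<Rightarrow> real \<Rightarrow> 'a \<Rightarrow> 'b::euclidean_space) \<Rightarrow> (real \<Rightarrow> 'a \<Rightarrow> 'b) \<Rightarrow> bool" where
  "has_ito_series M T F W H S \<longleftrightarrow>
     (\<forall>t\<in>{0..T}. S t \<in> borel_measurable M) \<and>
     (AE \<omega> in M. continuous_on {0..T} (\<lambda>t. S t \<omega>)) \<and>
     (\<exists>I. (\<forall>k. has_ito_integral M T F (W k) (H k) (I k)) \<and>
        (\<forall>t\<in>{0..T}.
          (\<lambda>n. \<integral>\<^sup>+\<omega>. ennreal ((norm ((\<Sum>k<n. I k t \<omega>) - S t \<omega>))\<^sup>2) \<partial>M) \<longlonglongrightarrow> 0))"


section \<open>Flows\<close>

definition stochastic_continuous_flow ::
  "'a measure \<Rightarrow> real \<Rightarrow> (real \<Rightarrow> 'a measure) \<Rightarrow> (real \<Rightarrow> torus2 \<Rightarrow> 'a \<Rightarrow> torus2) \<Rightarrow> bool" where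
  "stochastic_continuous_flow M T F \<Phi> \<longleftrightarrow>
     (\<lambda>(t, x, \<omega>). \<Phi> t x \<omega>)
       \<in> borel_measurable (restrict_space borel {0..T} \<Otimes>\<^sub>M (borel \<Otimes>\<^sub>M M)) \<and>
     (AE \<omega> in M. continuous_on ({0..T} \<times> UNIV) (\<lambda>(t, x). \<Phi> t x \<omega>)) \<and>
     (\<forall>x. progressive T F (\<lambda>t. \<Phi> t x))"

definition measure_preserving_flow ::
  "'a measure \<Rightarrow> real \<Rightarrow> (real \<Rightarrow> torus2 \<Rightarrow> 'a \<Rightarrow> torus2) \<Rightarrow> bool" where
  "measure_preserving_flow M T \<Phi> \<longleftrightarrow>
     (AE \<omega> in M. \<forall>t\<in>{0..T}.
        (\<lambda>x. \<Phi> t x \<omega>) \<in> measurable torus_lebesgue torus_lebesgue \<and>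
        distr torus_lebesgue torus_lebesgue (\<lambda>x. \<Phi> t x \<omega>) = torus_lebesgue)"

text \<open>All integrals take values in the plane; the increment of the flow acts on the
  initial point \<open>x\<close> of the torus by translation.\<close>

definition solves_flow_equation ::
  "'a measure \<Rightarrow> real \<Rightarrow> (real \<Rightarrow> 'a measure) \<Rightarrow> (nat \<Rightarrow> real \<Rightarrow> 'a \<Rightarrow> real) \<Rightarrow>
   (nat \<Rightarrow> torus2 \<Rightarrow> real^2) \<Rightarrow> (torus2 \<Rightarrow> real) \<Rightarrow> (torus2 \<Rightarrow> real^2) \<Rightarrow>
   (real \<Rightarrow> torus2 \<Rightarrow> 'a \<Rightarrow> torus2) \<Rightarrow> bool" where
  "solves_flow_equation M T F W \<sigma> \<xi>\<^sub>0 H \<Phi> \<longleftrightarrow>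
     (\<forall>x. \<exists>S. has_ito_series M T F W (\<lambda>k r \<omega>. \<sigma> k (\<Phi> r x \<omega>)) S \<and>
        (AE \<omega> in M. \<forall>t\<in>{0..T}.
           \<Phi> t x \<omega> = x + proj (
             (LINT r:{0..t}|lborel. LINT y|torus_lebesgue. \<xi>\<^sub>0 y *\<^sub>R H (\<Phi> r x \<omega> - \<Phi> r y \<omega>))
             + S t \<omega>)))"

definition flow_solution ::
  "'a measure \<Rightarrow> real \<Rightarrow> (real \<Rightarrow> 'a measure) \<Rightarrow> (nat \<Rightarrow> real \<Rightarrow> 'a \<Rightarrow> real) \<Rightarrow>
   (nat \<Rightarrow> torus2 \<Rightarrow> real^2) \<Rightarrow> (torus2 \<Rightarrow> real) \<Rightarrow> (torus2 \<Rightarrow> real^2) \<Rightarrow>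
   (real \<Rightarrow> torus2 \<Rightarrow> 'a \<Rightarrow> torus2) \<Rightarrow> bool" where
  "flow_solution M T F W \<sigma> \<xi>\<^sub>0 H \<Phi> \<longleftrightarrow>
     stochastic_continuous_flow M T F \<Phi> \<and> measure_preserving_flow M T \<Phi> \<and>
     solves_flow_equation M T F W \<sigma> \<xi>\<^sub>0 H \<Phi>"

end

theory Submission
 imports Defs "HOL-Real_Asymp.Real_Asymp"
begin

abbreviation "TL == torus_lebesgue"
abbreviation "BM N == borel_measurable N"

text \<open>
 The difference of the two flows lifts to a continuous path \<open>Z = A + N\<close> in the plane, where \<open>A\<close> is
 the integral of the difference \<open>a\<close> of the drifts and \<open>N\<close> is a martingale with
 \<open>E|N|\<^sup>2 <= C \<integral> E dist\<^sup>2\<close>. Since \<open>a\<close> is adapted, \<open>E|Z\<^sub>t|\<^sup>2 = 2 \<integral> E (a \<bullet> Z) + E|N\<^sub>t|\<^sup>2\<close>, without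
 Ito's formula. The Biot--Savart kernel satisfies
 \<open>|K x - K y| <= dist x y powr \<alpha> * (g x + g y)\<close> almost everywhere, for every \<open>\<alpha> < 1\<close>, with
 \<open>\<integral> g <= C / (1 - \<alpha>)\<close>. As the flows preserve the measure, this bounds \<open>\<integral>|a|\<^sup>2\<close> by the squared \<open>L\<^sup>1\<close> error
 of the mollified kernel plus \<open>(1 - \<alpha>)\<^sup>-\<^sup>2 \<integral> dist powr (2 * \<alpha>)\<close>. Choosing \<open>1 - \<alpha>\<close> as the reciprocal of
 \<open>\<Lambda> exp (- \<beta> t)\<close> at time \<open>t\<close> turns the energy inequality into an Osgood inequality with barrier
 \<open>exp (- \<Lambda> exp (- \<beta> t))\<close>; it applies once the error is below \<open>exp (- \<Lambda>)\<close>, and \<open>\<Lambda>\<close> is arbitrary.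
\<close>

section \<open>The torus\<close>

text \<open>The gradient of K has size |z|^-2, which just fails to be integrable in the plane.
  Giving up an exponent 1 - \<alpha> makes it integrable at the price 1/(1 - \<alpha>), and adapting
  \<alpha> to the size of the error recovers a logarithmic modulus of continuity, the borderline
  case of Osgood's criterion. The kernel is given only by distributional identities and has to be
  made explicit: Fourier coefficients identify the gradient of G with a lattice sum of
  Gaussian-damped planar kernels plus a Lipschitz sine series, the two halves of a time integral of
  heat kernel gradients. Squares are forced by the noise, which is controlled through the Ito
  isometry; the squared torus distance is not smooth, hence the lift to the plane, where the squared
  norm can be expanded by hand. The Ito integral enters as a relation defined by approximation, so
  isometry and martingale property are derived from Brownian increments. For the noise coefficients
  the bound summed over k concerns weak derivatives, and a Lipschitz estimate summed over k is
  extracted from it by duality.\<close>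

definition unit_cell :: "(real^2) set" where
 "unit_cell = {v. \<forall>i. 0 <= v $ i \<and> v $ i < 1}"

text \<open>Indexing Z^2 by pairs of integers makes lattice sums integrals over a
  \<open>count_space\<close>. The same vectors serve as periods and as Fourier frequencies.\<close>

definition latt :: "int \<times> int => real^2" where
 "latt n = (\<chi> i. of_int (if i = 1 then fst n else snd n))"

text \<open>A section of \<open>proj\<close> with values in the unit cell. It jumps at the edges of
  the cell but is Borel, and through it measurability and integrals pass between torus and
  plane.\<close>

definition sec :: "torus2 => real^2" where
 "sec x = (\<chi> i. frac (rep_torus2 x $ i))"

lemma proj_eq_iff: "proj v = proj w \<longleftrightarrow> (\<exists>n. v = w + latt n)"
proof
 assume "proj v = proj w"
 then have r: "v $ i - w $ i \<in> \<int>" for i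
  by (simp add: torus2.abs_eq_iff lattice_rel_def)
 obtain a b where "v $ 1 - w $ 1 = of_int a" "v $ 2 - w $ 2 = of_int b"
  using r[of 1] r[of 2] by (metis Ints_cases)
 then have "v = w + latt (a, b)"
  by (simp add: vec_eq_iff latt_def forall_2 algebra_simps)
 then show "\<exists>n. v = w + latt n" ..
next
 assume "\<exists>n. v = w + latt n"
 then show "proj v = proj w"
  by (auto simp: torus2.abs_eq_iff lattice_rel_def latt_def)
qed

lemma proj_latt [simp]: "proj (latt n) = 0"
 by (simp add: proj_eq_0_iff latt_def)

lemma inj_latt: "inj latt"
 by (rule injI) (auto simp: latt_def vec_eq_iff forall_2 prod_eq_iff)

lemma proj_sec [simp]: "proj (sec x) = x"
proof -
 have "proj (sec x) = proj (rep_torus2 x)"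
  by (simp add: torus2.abs_eq_iff lattice_rel_def sec_def frac_def)
 then show ?thesis
  using Quotient_abs_rep[OF Quotient_torus2] by simp
qed

lemma sec_in_unit_cell: "sec x \<in> unit_cell"
 by (simp add: sec_def unit_cell_def frac_lt_1)

lemma unit_cell_cong:
 assumes "v \<in> unit_cell" "w \<in> unit_cell" "proj v = proj w" shows "v = w"
proof -
 have "v $ i - w $ i = 0" for i
 proof -
  have "v $ i - w $ i \<in> \<int>" "\<bar>v $ i - w $ i\<bar> < 1"
   using assms by (auto simp: torus2.abs_eq_iff lattice_rel_def unit_cell_def abs_if)
   (smt (verit))+
  then show ?thesis using Ints_nonzero_abs_less1 by blast
 qed
 then show ?thesis by (simp add: vec_eq_iff)
qed

lemma sec_proj: "v \<in> unit_cell ==> sec (proj v) = v"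
 by (rule unit_cell_cong) (auto simp: sec_in_unit_cell)

lemma dist_proj_le: "dist (proj v) (proj w) <= norm (v - w)"
 unfolding dist_torus2_def by (rule torus_norm_le) (simp add: proj_diff)

lemma compact_torus: "compact (UNIV :: torus2 set)"
proof -
 have "proj ` cbox 0 1 = (UNIV :: torus2 set)"
 proof -
  have "x \<in> proj ` cbox 0 1" for x
   using sec_in_unit_cell[of x] proj_sec[of x]
   by (intro image_eqI[of _ _ "sec x"])
   (auto simp: mem_box_cart unit_cell_def less_imp_le)
  then show ?thesis by auto
 qed
 moreover have "compact (proj ` cbox 0 1)"
  by (intro compact_continuous_image continuous_on_subset[OF continuous_proj]) auto
 ultimately show ?thesis by simp
qed

text \<open>A countable base makes the Borel sets of a product the product of the Borel sets;
  measurability of \<open>dist\<close> between two flows relies on it. The base consists of small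
  balls about projections of rational points.\<close>

instance torus2 :: second_countable_topology
proof
 let ?Q = "{v :: real^2. \<forall>i. v $ i \<in> \<rat>}"
 let ?B = "(%(v, k). ball (proj v) (1 / real (Suc k))) ` (?Q \<times> UNIV)"
 have cQ: "countable ?Q"
 proof -
  have "?Q \<subseteq> (%(a, b). \<chi> i. if i = 1 then a else b) ` (\<rat> \<times> \<rat>)"
  proof
   fix v :: "real^2" assume "v \<in> ?Q"
   then show "v \<in> (%(a, b). \<chi> i. if i = 1 then a else b) ` (\<rat> \<times> \<rat>)"
   by (intro image_eqI[of _ _ "(v $ 1, v $ 2)"])
   (auto simp: vec_eq_iff forall_2)
  qed
  moreover have "countable ((%(a, b). (\<chi> i. if i = 1 then a else b) :: real^2) ` (\<rat> \<times> \<rat>))"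
   by (intro countable_image countable_SIGMA countable_rat)
  ultimately show ?thesis by (rule countable_subset)
 qed
 have dense: "\<exists>q\<in>?Q. norm (v - q) < e" if "e > 0" for v :: "real^2" and e
 proof -
  have "\<exists>r\<in>\<rat>. v $ i - e / 4 < r \<and> r < v $ i + e / 4" for i
   using Rats_dense_in_real[of "v $ i - e / 4" "v $ i + e / 4"] that by auto
  then obtain r where r: "!!i. r i \<in> \<rat>" "!!i. v $ i - e / 4 < r i \<and> r i < v $ i + e / 4"
   by metis
  have "norm (v - (\<chi> i. r i)) <= (\<Sum>i\<in>UNIV. \<bar>(v - (\<chi> i. r i)) $ i\<bar>)"
   by (rule norm_le_l1_cart)
  also have "\<dots> <= (\<Sum>i\<in>(UNIV :: 2 set). e / 4)"
  proof (rule sum_mono)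
   fix i
   have "\<bar>v $ i - r i\<bar> <= e / 4" using r(2)[of i] by linarith
   then show "\<bar>(v - (\<chi> i. r i)) $ i\<bar> <= e / 4" by simp
  qed
  also have "\<dots> < e" using that by simp
  finally show ?thesis using r(1) by (intro bexI[of _ "\<chi> i. r i"]) auto
 qed
 have basis: "topological_basis ?B"
 proof (rule topological_basisI)
  fix B' :: "torus2 set" assume "B' \<in> ?B" then show "open B'" by auto
 next
  fix U :: "torus2 set" and x assume "open U" "x \<in> U"
  then obtain e where e: "e > 0" "ball x e \<subseteq> U" by (meson open_contains_ball)
  obtain k where k: "1 / real (Suc k) < e / 2"
   using e(1) nat_approx_posE[of "e / 2"] by auto
  obtain q where q: "q \<in> ?Q" "norm (sec x - q) < 1 / real (Suc k)"
   using dense[of "1 / real (Suc k)" "sec x"] by auto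
  have dx: "dist x (proj q) < 1 / real (Suc k)"
   using dist_proj_le[of "sec x" q] q(2) by simp
  have "ball (proj q) (1 / real (Suc k)) \<subseteq> ball x e"
  proof
   fix y assume "y \<in> ball (proj q) (1 / real (Suc k))"
   then have "dist x y < 1 / real (Suc k) + 1 / real (Suc k)"
   using dx dist_triangle[of x y "proj q"] by auto
   then show "y \<in> ball x e" using k by auto
  qed
  with e(2) have "ball (proj q) (1 / real (Suc k)) \<subseteq> U" by blast
  moreover have "x \<in> ball (proj q) (1 / real (Suc k))"
   using dx by (simp add: dist_commute)
  moreover have "ball (proj q) (1 / real (Suc k)) \<in> ?B" using q(1) by blast
  ultimately show "\<exists>B'\<in>?B. x \<in> B' \<and> B' \<subseteq> U" by (metis (no_types))
 qed
 have "countable ?B" by (intro countable_image countable_SIGMA cQ) auto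
 then show "\<exists>B::torus2 set set. countable B \<and> open = generate_topology B"
  using topological_basis_imp_subbasis[OF basis] by blast
qed

lemma borel_measurable_proj [measurable]: "proj \<in> BM borel"
 by (rule borel_measurable_continuous_onI[OF continuous_proj])

lemma unit_cell_sets [measurable]: "unit_cell \<in> sets borel"
 unfolding unit_cell_def by measurable

text \<open>The half-open cell is a countable union of closed squares \<open>?D j\<close>, on which
  \<open>proj\<close> maps compact sets to compact sets. So the preimage of a closed set under
  \<open>sec\<close> is a countable union of compact sets.\<close>

lemma borel_measurable_sec [measurable]: "sec \<in> BM borel"
proof (rule borel_measurableI)
 have closed_vimage: "sec -` C \<in> sets borel" if "closed C" for C
 proof -
  let ?D = "%j :: nat. {v :: real^2. \<forall>i. 0 <= v $ i \<and> v $ i <= 1 - 1 / real (Suc j)}"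
  have D: "?D j = cbox 0 (\<chi> i. 1 - 1 / real (Suc j))" for j
   by (auto simp: mem_box_cart)
  have "sec -` C = (\<Union>j. proj ` (C \<inter> ?D j))"
  proof (intro set_eqI iffI)
   fix x assume x: "x \<in> sec -` C"
   let ?m = "max (sec x $ 1) (sec x $ 2)"
   have "?m < 1" using sec_in_unit_cell[of x] by (simp add: unit_cell_def)
   then obtain j where "1 / real (Suc j) < 1 - ?m"
   using nat_approx_posE[of "1 - ?m"] by auto
   then have "sec x \<in> ?D j"
   using sec_in_unit_cell[of x] by (auto simp: unit_cell_def forall_2)
   with x show "x \<in> (\<Union>j. proj ` (C \<inter> ?D j))"
   by (intro UN_I[of j] image_eqI[of _ _ "sec x"]) auto
  next
   fix x assume "x \<in> (\<Union>j. proj ` (C \<inter> ?D j))"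
   then obtain j v where v: "x = proj v" "v \<in> C" "v \<in> ?D j" by blast
   have "v $ i < 1" for i
   proof -
   have "v $ i <= 1 - 1 / real (Suc j)" using v(3) by simp
   also have "\<dots> < 1" by simp
   finally show ?thesis .
   qed
   then have "v \<in> unit_cell" using v(3) by (auto simp: unit_cell_def)
   with v show "x \<in> sec -` C" by (simp add: sec_proj)
  qed
  moreover have "closed (proj ` (C \<inter> ?D j))" for j
  proof -
   have "compact (C \<inter> ?D j)" unfolding D using that by (intro closed_Int_compact) auto
   then show ?thesis
   by (intro compact_imp_closed compact_continuous_image
   continuous_on_subset[OF continuous_proj]) auto
  qed
  ultimately show ?thesis by (auto intro!: sets.countable_UN borel_closed)
 qed
 fix U :: "(real^2) set" assume "open U"
 then have "- (sec -` (- U)) \<in> sets borel" by (intro borel_comp closed_vimage) auto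
 then show "sec -` U \<inter> space borel \<in> sets borel" by (simp add: vimage_Compl)
qed

text \<open>Addition is read through \<open>sec\<close>: the sum of Borel representatives is
  projected. This replaces continuity of the group operation.\<close>

lemma borel_measurable_torus_add [measurable (raw)]:
 fixes f g :: "'b => torus2"
 assumes [measurable]: "f \<in> BM N" "g \<in> BM N"
 shows "(%x. f x + g x) \<in> BM N"
proof -
 have "(%x. proj (sec (f x) + sec (g x))) \<in> BM N" by measurable
 then show ?thesis by (simp add: proj_add)
qed

lemma borel_measurable_torus_diff [measurable (raw)]:
 fixes f g :: "'b => torus2"
 assumes [measurable]: "f \<in> BM N" "g \<in> BM N"
 shows "(%x. f x - g x) \<in> BM N"
proof -
 have "(%x. proj (sec (f x) - sec (g x))) \<in> BM N" by measurable
 then show ?thesis by (simp add: proj_diff)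
qed

section \<open>Lebesgue measure on the torus: unfolding and invariance\<close>

lemma sets_torus_lebesgue [simp, measurable_cong]: "sets TL = sets borel"
 by (simp add: torus_lebesgue_def)

lemma space_torus_lebesgue [simp]: "space TL = UNIV"
 by (simp add: torus_lebesgue_def)

interpretation torus: prob_space TL
 by (rule prob_space_torus_lebesgue)

lemma nn_integral_torus:
 assumes [measurable]: "f \<in> BM borel"
 shows "(\<integral>\<^sup>+x. f x \<partial>TL) = (\<integral>\<^sup>+v. f (proj v) * indicator unit_cell v \<partial>lborel)"
proof -
 have "proj \<in> restrict_space lborel unit_cell \<rightarrow>\<^sub>M borel"
  by (intro measurable_restrict_space1) simp
 then show ?thesis
  unfolding torus_lebesgue_def unit_cell_def[symmetric]
  by (subst nn_integral_distr) (auto simp: nn_integral_restrict_space)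
qed

lemma nn_integral_lborel_shift:
 fixes f :: "real^2 => ennreal"
 assumes [measurable]: "f \<in> BM borel"
 shows "(\<integral>\<^sup>+v. f (v + w) \<partial>lborel) = (\<integral>\<^sup>+v. f v \<partial>lborel)"
proof -
 have "(\<integral>\<^sup>+v. f v \<partial>lborel) = (\<integral>\<^sup>+v. f v \<partial>distr lborel borel ((+) w))"
  by (simp add: lborel_distr_plus)
 also have "\<dots> = (\<integral>\<^sup>+v. f (v + w) \<partial>lborel)"
  by (subst nn_integral_distr) (auto simp: add.commute)
 finally show ?thesis by simp
qed

lemma borel_measurable_nn_integral_count_space [measurable (raw)]:
 fixes f :: "'i::countable => 'b => ennreal"
 assumes [measurable]: "!!n. f n \<in> BM N"
 shows "(%x. \<integral>\<^sup>+n. f n x \<partial>count_space UNIV) \<in> BM N"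
proof -
 interpret sigma_finite_measure "count_space (UNIV :: 'i set)"
  by (rule sigma_finite_measure_count_space)
 have "(%(x, n). f n x) \<in> BM (N \<Otimes>\<^sub>M count_space UNIV)"
  unfolding split_beta
  by (rule measurable_compose_countable'[where f = "%n p. f n (fst p)" and g = snd]) auto
 then show ?thesis by (rule borel_measurable_nn_integral)
qed

lemma count_singleton:
 assumes "!!n. P n \<longleftrightarrow> n = m"
 shows "(\<integral>\<^sup>+n. of_bool (P n) \<partial>count_space UNIV) = 1"
proof -
 have "(\<integral>\<^sup>+n. of_bool (P n) \<partial>count_space UNIV) = (\<integral>\<^sup>+n. indicator {m} n \<partial>count_space UNIV)"
  using assms by (intro nn_integral_cong) (auto simp: indicator_def)
 then show ?thesis by simp
qed

text \<open>The assumptions say that \<open>S\<close> is a fundamental domain of the lattice, so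
  exactly one translate of \<open>v\<close> falls into it. It is applied to the unit cell, a
  translated cell and the reflected cell.\<close>

lemma count_latt:
 assumes "!!v w. v \<in> S ==> w \<in> S ==> proj v = proj w ==> v = w"
  and "!!x. \<exists>v\<in>S. proj v = x"
 shows "(\<integral>\<^sup>+n. indicator S (v + latt n) \<partial>count_space UNIV) = 1"
proof -
 obtain w where w: "w \<in> S" "proj w = proj v" using assms(2) by metis
 then obtain m where m: "w = v + latt m" unfolding proj_eq_iff by metis
 have "v + latt n \<in> S \<longleftrightarrow> n = m" for n
 proof
  assume "v + latt n \<in> S"
  then have "v + latt n = w"
   using w by (intro assms(1)) (auto simp: proj_add)
  then show "n = m" using m inj_latt by (auto dest: injD)
 qed (use m w in auto)
 then show ?thesis
  using count_singleton[of "%n. v + latt n \<in> S" m] by (simp add: indicator_def of_bool_def)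
qed

text \<open>Insert the constant 1 as the sum over n of the indicator of the cell at v + n, exchange
  sum and integral, and move each term back into the cell by translation invariance in the
  plane.\<close>

lemma nn_integral_unfold:
 fixes F :: "real^2 => ennreal"
 assumes [measurable]: "F \<in> BM borel"
 shows "(\<integral>\<^sup>+v. F v \<partial>lborel) =
  (\<integral>\<^sup>+x. (\<integral>\<^sup>+n. F (sec x + latt n) \<partial>count_space UNIV) \<partial>TL)"
proof -
 have c: "(\<integral>\<^sup>+n. indicator unit_cell (v + latt n) \<partial>count_space UNIV) = 1" for v
  by (rule count_latt[OF unit_cell_cong]) (auto intro: sec_in_unit_cell proj_sec)
 have "(\<integral>\<^sup>+v. F v \<partial>lborel) =
   (\<integral>\<^sup>+v. F v * (\<integral>\<^sup>+n. indicator unit_cell (v + latt n) \<partial>count_space UNIV) \<partial>lborel)"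
  by (simp add: c)
 also have "\<dots> = (\<integral>\<^sup>+v. (\<integral>\<^sup>+n. F v * indicator unit_cell (v + latt n) \<partial>count_space UNIV) \<partial>lborel)"
  by (subst nn_integral_cmult) auto
 also have "\<dots> = (\<integral>\<^sup>+n. (\<integral>\<^sup>+v. F v * indicator unit_cell (v + latt n) \<partial>lborel) \<partial>count_space UNIV)"
  by (rule nn_integral_count_space_nn_integral) auto
 also have "\<dots> = (\<integral>\<^sup>+n. (\<integral>\<^sup>+v. F (v - latt n) * indicator unit_cell v \<partial>lborel) \<partial>count_space UNIV)"
 proof (rule nn_integral_cong)
  fix n show "(\<integral>\<^sup>+v. F v * indicator unit_cell (v + latt n) \<partial>lborel) =
   (\<integral>\<^sup>+v. F (v - latt n) * indicator unit_cell v \<partial>lborel)"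
   using nn_integral_lborel_shift[of "%v. F (v - latt n) * indicator unit_cell v" "latt n"]
   by simp
 qed
 also have "\<dots> = (\<integral>\<^sup>+v. (\<integral>\<^sup>+n. F (v - latt n) * indicator unit_cell v \<partial>count_space UNIV) \<partial>lborel)"
  by (rule nn_integral_count_space_nn_integral[symmetric]) auto
 also have "\<dots> = (\<integral>\<^sup>+v. (\<integral>\<^sup>+n. F (sec (proj v) - latt n) \<partial>count_space UNIV) * indicator unit_cell v \<partial>lborel)"
  by (intro nn_integral_cong) (auto simp: indicator_def sec_proj)
 also have "\<dots> = (\<integral>\<^sup>+x. (\<integral>\<^sup>+n. F (sec x - latt n) \<partial>count_space UNIV) \<partial>TL)"
  by (subst nn_integral_torus) (auto intro!: borel_measurable_nn_integral_count_space)
 also have "\<dots> = (\<integral>\<^sup>+x. (\<integral>\<^sup>+n. F (sec x + latt n) \<partial>count_space UNIV) \<partial>TL)"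
 proof (rule nn_integral_cong)
  fix x
  \<comment> \<open>The shift left the sum with - n; negation permutes the index set.\<close>
  have m: "- latt n = latt (map_prod uminus uminus n)" for n
   by (simp add: latt_def vec_eq_iff)
  have "bij (map_prod uminus uminus :: int \<times> int => _)"
   by (rule o_bij[of "map_prod uminus uminus"]) (auto simp: fun_eq_iff)
  from nn_integral_bij_count_space[OF this, of "%n. F (sec x + latt n)"]
  show "(\<integral>\<^sup>+n. F (sec x - latt n) \<partial>count_space UNIV) = (\<integral>\<^sup>+n. F (sec x + latt n) \<partial>count_space UNIV)"
   by (simp add: m[symmetric])
 qed
 finally show ?thesis .
qed

text \<open>A plane translation carries the unit cell to another fundamental domain
  \<open>?S\<close>, and by unfolding a periodic function has the same integral over every
  fundamental domain.\<close>

lemma nn_integral_torus_translate: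
 assumes [measurable]: "f \<in> BM borel"
 shows "(\<integral>\<^sup>+x. f (x + a) \<partial>TL) = (\<integral>\<^sup>+x. f x \<partial>TL)"
proof -
 let ?S = "{v. v - sec a \<in> unit_cell}"
 have [measurable]: "?S \<in> sets borel" by measurable
 have c: "(\<integral>\<^sup>+n. indicator ?S (v + latt n) \<partial>count_space UNIV) = 1" for v
 proof (rule count_latt)
  fix v w assume "v \<in> ?S" "w \<in> ?S" "proj v = proj w"
  then show "v = w" using unit_cell_cong[of "v - sec a" "w - sec a"] by (simp add: proj_diff)
 next
  fix x show "\<exists>v\<in>?S. proj v = x"
   by (intro bexI[of _ "sec (x - a) + sec a"]) (auto simp: proj_add sec_in_unit_cell)
 qed
 have "(\<integral>\<^sup>+x. f (x + a) \<partial>TL) =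
   (\<integral>\<^sup>+v. f (proj (v + sec a)) * indicator ?S (v + sec a) \<partial>lborel)"
  by (subst nn_integral_torus) (auto simp: proj_add indicator_def intro!: nn_integral_cong)
 also have "\<dots> = (\<integral>\<^sup>+v. f (proj v) * indicator ?S v \<partial>lborel)"
  by (rule nn_integral_lborel_shift) auto
 also have "\<dots> = (\<integral>\<^sup>+x. (\<integral>\<^sup>+n. f x * indicator ?S (sec x + latt n) \<partial>count_space UNIV) \<partial>TL)"
  by (subst nn_integral_unfold) (auto simp: proj_add)
 also have "\<dots> = (\<integral>\<^sup>+x. f x \<partial>TL)"
  by (subst nn_integral_cmult) (auto simp: c)
 finally show ?thesis .
qed

lemma lborel_distr_uminus_euclidean:
 "distr lborel borel uminus = (lborel :: 'b::euclidean_space measure)"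
 using lborel_affine_euclidean[of "%_. - 1" "0 :: 'b"]
 by (simp add: sum_negf euclidean_representation density_1)

text \<open>The argument for translations, with the reflected cell as fundamental domain.\<close>

lemma nn_integral_torus_uminus:
 assumes [measurable]: "f \<in> BM borel"
 shows "(\<integral>\<^sup>+x. f (- x) \<partial>TL) = (\<integral>\<^sup>+x. f x \<partial>TL)"
proof -
 let ?S = "{v. - v \<in> unit_cell}"
 have [measurable]: "?S \<in> sets borel" by measurable
 have c: "(\<integral>\<^sup>+n. indicator ?S (v + latt n) \<partial>count_space UNIV) = 1" for v
 proof (rule count_latt)
  fix v w assume "v \<in> ?S" "w \<in> ?S" "proj v = proj w"
  then show "v = w" using unit_cell_cong[of "- v" "- w"] by (simp add: proj_minus)
 next
  fix x show "\<exists>v\<in>?S. proj v = x"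
   by (intro bexI[of _ "- sec (- x)"]) (auto simp: proj_minus sec_in_unit_cell)
 qed
 have [measurable]: "(%x. f (- x)) \<in> BM borel"
 proof -
  have "(%x. f (proj (- sec x))) \<in> BM borel" by measurable
  then show ?thesis by (simp add: proj_minus)
 qed
 have "(\<integral>\<^sup>+x. f (- x) \<partial>TL) =
   (\<integral>\<^sup>+v. f (proj (- v)) * indicator ?S (- v) \<partial>lborel)"
  by (subst nn_integral_torus) (auto simp: proj_minus indicator_def intro!: nn_integral_cong)
 also have "\<dots> = (\<integral>\<^sup>+v. f (proj v) * indicator ?S v \<partial>distr lborel borel uminus)"
  by (subst nn_integral_distr) auto
 also have "\<dots> = (\<integral>\<^sup>+v. f (proj v) * indicator ?S v \<partial>lborel)"
  by (simp add: lborel_distr_uminus_euclidean)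
 also have "\<dots> = (\<integral>\<^sup>+x. (\<integral>\<^sup>+n. f x * indicator ?S (sec x + latt n) \<partial>count_space UNIV) \<partial>TL)"
  by (subst nn_integral_unfold) (auto simp: proj_add)
 also have "\<dots> = (\<integral>\<^sup>+x. f x \<partial>TL)"
  by (subst nn_integral_cmult) (auto simp: c)
 finally show ?thesis .
qed

lemma nn_integral_torus_reflect:
 assumes [measurable]: "f \<in> BM borel"
 shows "(\<integral>\<^sup>+x. f (a - x) \<partial>TL) = (\<integral>\<^sup>+x. f x \<partial>TL)"
 using nn_integral_torus_uminus[of "%x. f (x + a)"] nn_integral_torus_translate[of f a]
 by simp

lemma distr_torus_translate: "distr TL TL (%x. x + a) = TL"
proof (rule measure_eqI)
 fix A assume "A \<in> sets (distr TL TL (%x. x + a))"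
 then have [measurable]: "A \<in> sets borel" by simp
 have "emeasure (distr TL TL (%x. x + a)) A =
   (\<integral>\<^sup>+x. indicator A x \<partial>distr TL TL (%x. x + a))"
  by simp
 also have "\<dots> = (\<integral>\<^sup>+x. indicator A (x + a) \<partial>TL)"
  by (subst nn_integral_distr) auto
 also have "\<dots> = emeasure TL A"
  using nn_integral_torus_translate[of "indicator A" a] by simp
 finally show "emeasure (distr TL TL (%x. x + a)) A = emeasure TL A" .
qed simp

lemma integral_torus_translate:
 fixes f :: "torus2 => 'b::{banach, second_countable_topology}"
 assumes [measurable]: "f \<in> BM borel"
 shows "(LINT x|TL. f (x + a)) = (LINT x|TL. f x)"
 using integral_distr[of "%x. x + a" TL TL f]
 by (simp add: distr_torus_translate)

text \<open>The representative with coordinates in [-1/2, 1/2] has l1 norm at most 1. The bound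
  makes \<open>dist x y\<close> at most \<open>dist x y powr \<alpha>\<close> for \<alpha> < 1 and
  bounds the noise term outright.\<close>

lemma dist_torus_le_1: "dist x y <= (1 :: real)" for x y :: torus2
proof -
 define v where "v = sec (x - y)"
 define w :: "real^2" where "w = (\<chi> i. if v $ i < 1/2 then v $ i else v $ i - 1)"
 have "proj w = proj v"
  by (auto simp: torus2.abs_eq_iff lattice_rel_def w_def)
 then have "dist x y <= norm w"
  unfolding dist_torus2_def v_def by (intro torus_norm_le) simp
 also have "\<dots> <= (\<Sum>i\<in>UNIV. \<bar>w $ i\<bar>)" by (rule norm_le_l1_cart)
 also have "\<dots> <= (\<Sum>i\<in>(UNIV :: 2 set). 1/2)"
 proof (rule sum_mono)
  fix i
  have "0 <= v $ i" "v $ i < 1" using sec_in_unit_cell[of "x - y"] by (auto simp: v_def unit_cell_def)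
  then show "\<bar>w $ i\<bar> <= 1/2" by (auto simp: w_def abs_le_iff)
 qed
 also have "\<dots> = 1" by simp
 finally show ?thesis .
qed

section \<open>Trigonometric polynomials\<close>

definition tcos :: "int \<times> int => torus2 => real" where
 "tcos k x = cos (2 * pi * (latt k \<bullet> sec x))"

definition tsin :: "int \<times> int => torus2 => real" where
 "tsin k x = sin (2 * pi * (latt k \<bullet> sec x))"

text \<open>The real span of the characters. It is the class of test functions for all weak
  derivatives below: closed under products, partial derivatives and translations, and dense among
  continuous functions.\<close>

inductive trig_poly :: "(torus2 => real) => bool" where
 trig_poly_tcos: "trig_poly (tcos k)"
| trig_poly_tsin: "trig_poly (tsin k)"
| trig_poly_add: "trig_poly f ==> trig_poly g ==> trig_poly (%x. f x + g x)"
| trig_poly_scale: "trig_poly f ==> trig_poly (%x. c * f x)"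

lemma latt_add: "latt (k + l) = latt k + latt l"
 and latt_diff: "latt (k - l) = latt k - latt l"
 and latt_uminus: "latt (- k) = - latt k"
 and latt_zero: "latt 0 = 0"
 by (simp_all add: latt_def vec_eq_iff)

lemma inner_latt: "latt k \<bullet> latt n \<in> \<int>"
 by (auto simp: inner_vec_def latt_def sum_2)

text \<open>A frequency paired with a lattice vector is an integer, so a change of representative
  changes the phase by a multiple of 2 pi.\<close>

lemma tcos_proj: "tcos k (proj v) = cos (2 * pi * (latt k \<bullet> v))"
 and tsin_proj: "tsin k (proj v) = sin (2 * pi * (latt k \<bullet> v))"
proof -
 obtain n where n: "v = sec (proj v) + latt n" by (metis proj_eq_iff proj_sec)
 obtain m where "latt k \<bullet> latt n = of_int m" using inner_latt by (metis Ints_cases)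
 then have "2 * pi * (latt k \<bullet> v) = 2 * pi * (latt k \<bullet> sec (proj v)) + 2 * pi * of_int m"
  by (subst n) (simp add: inner_add_right algebra_simps)
 then show "tcos k (proj v) = cos (2 * pi * (latt k \<bullet> v))"
  "tsin k (proj v) = sin (2 * pi * (latt k \<bullet> v))"
  unfolding tcos_def tsin_def
  using sin_cos_eq_iff[of "2 * pi * (latt k \<bullet> v)" "2 * pi * (latt k \<bullet> sec (proj v))"]
  by (auto simp: algebra_simps)
qed

lemma tcos_add: "tcos k (x + a) = tcos k x * tcos k a - tsin k x * tsin k a"
 and tsin_add: "tsin k (x + a) = tsin k x * tcos k a + tcos k x * tsin k a"
proof -
 have "x + a = proj (sec x + sec a)" by (simp add: proj_add)
 then have e: "tcos k (x + a) = cos (2 * pi * (latt k \<bullet> (sec x + sec a)))"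
  "tsin k (x + a) = sin (2 * pi * (latt k \<bullet> (sec x + sec a)))"
  by (simp_all only: tcos_proj tsin_proj)
 show "tcos k (x + a) = tcos k x * tcos k a - tsin k x * tsin k a"
  "tsin k (x + a) = tsin k x * tcos k a + tcos k x * tsin k a"
  unfolding e by (simp_all add: tcos_def tsin_def inner_add_right distrib_left cos_add sin_add)
qed

lemma tcos_diff_freq: "tcos (k - l) x = tcos k x * tcos l x + tsin k x * tsin l x"
 and tcos_add_freq: "tcos (k + l) x = tcos k x * tcos l x - tsin k x * tsin l x"
 and tsin_add_freq: "tsin (k + l) x = tsin k x * tcos l x + tcos k x * tsin l x"
 and tsin_diff_freq: "tsin (k - l) x = tsin k x * tcos l x - tcos k x * tsin l x"
 by (simp_all add: tcos_def tsin_def latt_add latt_diff inner_add_left inner_diff_left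
   distrib_left right_diff_distrib cos_add sin_add cos_diff sin_diff)

lemma tcos_zero [simp]: "tcos 0 x = 1" and tsin_zero [simp]: "tsin 0 x = 0"
 by (simp_all add: tcos_def tsin_def latt_zero)

lemma trig_poly_const: "trig_poly (%_. c)"
 using trig_poly_scale[OF trig_poly_tcos[of 0], of c] by simp

lemma trig_poly_sum:
 "finite A ==> (!!a. a \<in> A ==> trig_poly (f a)) ==> trig_poly (%x. \<Sum>a\<in>A. f a x)"
 by (induction A rule: finite_induct) (auto intro: trig_poly_const trig_poly_add)

text \<open>Product-to-sum formulas settle two characters, and bilinearity the rest, by induction on
  either factor. Closure under products is what Stone-Weierstrass asks for.\<close>

lemma trig_poly_mult:
 assumes "trig_poly f" "trig_poly g" shows "trig_poly (%x. f x * g x)"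
proof -
 have s: "(%x. F x * G x) = H ==> trig_poly H ==> trig_poly (%x. F x * G x)" for F G H
  by simp
 have cc: "trig_poly (%x. tcos k x * tcos l x)" for k l
  by (rule s[of _ _ "%x. (1/2) * tcos (k - l) x + (1/2) * tcos (k + l) x"])
   (simp add: fun_eq_iff tcos_diff_freq tcos_add_freq field_simps, intro trig_poly.intros)
 have ss: "trig_poly (%x. tsin k x * tsin l x)" for k l
  by (rule s[of _ _ "%x. (1/2) * tcos (k - l) x + (- 1/2) * tcos (k + l) x"])
   (simp add: fun_eq_iff tcos_diff_freq tcos_add_freq field_simps, intro trig_poly.intros)
 have sc: "trig_poly (%x. tsin k x * tcos l x)" for k l
  by (rule s[of _ _ "%x. (1/2) * tsin (k - l) x + (1/2) * tsin (k + l) x"])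
   (simp add: fun_eq_iff tsin_diff_freq tsin_add_freq field_simps, intro trig_poly.intros)
 have cs: "trig_poly (%x. tcos k x * tsin l x)" for k l
  using sc[of l k] by (simp add: mult.commute)
 have cg: "trig_poly (%x. tcos k x * g x)" for k
  using assms(2)
 proof induction
  case (trig_poly_scale f c)
  have "trig_poly (%x. c * (tcos k x * f x))" by (rule trig_poly.trig_poly_scale) fact
  then show ?case by (simp add: mult.left_commute)
 qed (auto simp: distrib_left intro: cc cs trig_poly.intros)
 have sg: "trig_poly (%x. tsin k x * g x)" for k
  using assms(2)
 proof induction
  case (trig_poly_scale f c)
  have "trig_poly (%x. c * (tsin k x * f x))" by (rule trig_poly.trig_poly_scale) fact
  then show ?case by (simp add: mult.left_commute)
 qed (auto simp: distrib_left intro: ss sc trig_poly.intros)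
 show ?thesis using assms(1)
 proof induction
  case (trig_poly_scale f c)
  have "trig_poly (%x. c * (f x * g x))" by (rule trig_poly.trig_poly_scale) fact
  then show ?case by (simp add: mult.assoc)
 qed (auto simp: distrib_right intro: cg sg trig_poly.intros)
qed

lemma trig_poly_translate: "trig_poly f ==> trig_poly (%x. f (x + a))"
proof (induction rule: trig_poly.induct)
 case (trig_poly_tcos k)
 have "trig_poly (%x. tcos k a * tcos k x + (- tsin k a) * tsin k x)"
  by (intro trig_poly.intros)
 then show ?case by (simp add: tcos_add mult.commute)
next
 case (trig_poly_tsin k)
 have "trig_poly (%x. tcos k a * tsin k x + tsin k a * tcos k x)"
  by (intro trig_poly.intros)
 then show ?case by (simp add: tsin_add mult.commute)
qed (auto intro: trig_poly.intros)

lemma has_derivative_tcos: "((%v. tcos k (proj v)) has_derivative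
   (%h. \<Sum>j\<in>UNIV. h $ j * ((- 2 * pi * latt k $ j) * tsin k (proj v)))) (at v)"
 and has_derivative_tsin: "((%v. tsin k (proj v)) has_derivative
   (%h. \<Sum>j\<in>UNIV. h $ j * ((2 * pi * latt k $ j) * tcos k (proj v)))) (at v)"
proof -
 have "((%v. cos (2 * pi * (latt k \<bullet> v))) has_derivative
   (%h. - sin (2 * pi * (latt k \<bullet> v)) * (2 * pi * (latt k \<bullet> h)))) (at v)"
  "((%v. sin (2 * pi * (latt k \<bullet> v))) has_derivative
   (%h. cos (2 * pi * (latt k \<bullet> v)) * (2 * pi * (latt k \<bullet> h)))) (at v)"
  by (auto intro!: derivative_eq_intros)
 moreover have "(%h. - sin (2 * pi * (latt k \<bullet> v)) * (2 * pi * (latt k \<bullet> h))) =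
   (%h. \<Sum>j\<in>UNIV. h $ j * ((- 2 * pi * latt k $ j) * sin (2 * pi * (latt k \<bullet> v))))"
  "(%h. cos (2 * pi * (latt k \<bullet> v)) * (2 * pi * (latt k \<bullet> h))) =
   (%h. \<Sum>j\<in>UNIV. h $ j * ((2 * pi * latt k $ j) * cos (2 * pi * (latt k \<bullet> v))))"
  by (simp_all add: fun_eq_iff inner_vec_def[of "latt k" h for h] sum_2 algebra_simps)
 ultimately show "((%v. tcos k (proj v)) has_derivative
   (%h. \<Sum>j\<in>UNIV. h $ j * ((- 2 * pi * latt k $ j) * tsin k (proj v)))) (at v)"
  "((%v. tsin k (proj v)) has_derivative
   (%h. \<Sum>j\<in>UNIV. h $ j * ((2 * pi * latt k $ j) * tcos k (proj v)))) (at v)"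
  unfolding tcos_proj tsin_proj by simp_all
qed

text \<open>The induction produces the gradient as another family of trigonometric polynomials. Only
  afterwards is it identified with \<open>torus_partial\<close>, which is defined by
  \<open>deriv\<close> and by itself says nothing about differentiability.\<close>

lemma trig_poly_has_gradient:
 "trig_poly f ==> \<exists>g. (\<forall>j. trig_poly (g j)) \<and>
   (\<forall>v. ((%v. f (proj v)) has_derivative (%h. \<Sum>j\<in>UNIV. h $ j * g j (proj v))) (at v))"
proof (induction rule: trig_poly.induct)
 case (trig_poly_tcos k)
 show ?case
 proof (intro exI[of _ "%j x. (- 2 * pi * latt k $ j) * tsin k x"] conjI allI)
  fix v
  show "((%v. tcos k (proj v)) has_derivative
   (%h. \<Sum>j\<in>UNIV. h $ j * ((- 2 * pi * latt k $ j) * tsin k (proj v)))) (at v)"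
   by (rule has_derivative_tcos)
 qed (intro trig_poly.intros)
next
 case (trig_poly_tsin k)
 show ?case
 proof (intro exI[of _ "%j x. (2 * pi * latt k $ j) * tcos k x"] conjI allI)
  fix v
  show "((%v. tsin k (proj v)) has_derivative
   (%h. \<Sum>j\<in>UNIV. h $ j * ((2 * pi * latt k $ j) * tcos k (proj v)))) (at v)"
   by (rule has_derivative_tsin)
 qed (intro trig_poly.intros)
next
 case (trig_poly_add f1 f2)
 then obtain g1 g2 where g: "\<forall>j. trig_poly (g1 j)" "\<forall>j. trig_poly (g2 j)"
  "!!v. ((%v. f1 (proj v)) has_derivative (%h. \<Sum>j\<in>UNIV. h $ j * g1 j (proj v))) (at v)"
  "!!v. ((%v. f2 (proj v)) has_derivative (%h. \<Sum>j\<in>UNIV. h $ j * g2 j (proj v))) (at v)"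
  by auto
 show ?case
 proof (intro exI[of _ "%j x. g1 j x + g2 j x"] conjI allI)
  fix v show "((%v. f1 (proj v) + f2 (proj v)) has_derivative
   (%h. \<Sum>j\<in>UNIV. h $ j * (g1 j (proj v) + g2 j (proj v)))) (at v)"
   using has_derivative_add[OF g(3,4)] by (simp add: distrib_left sum.distrib)
 qed (use g in \<open>auto intro: trig_poly.intros\<close>)
next
 case (trig_poly_scale f c)
 then obtain g where g: "\<forall>j. trig_poly (g j)"
  "!!v. ((%v. f (proj v)) has_derivative (%h. \<Sum>j\<in>UNIV. h $ j * g j (proj v))) (at v)"
  by auto
 show ?case
 proof (intro exI[of _ "%j x. c * g j x"] conjI allI)
  fix v show "((%v. c * f (proj v)) has_derivative
   (%h. \<Sum>j\<in>UNIV. h $ j * (c * g j (proj v)))) (at v)"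
   using has_derivative_mult_right[OF g(2), of c]
   by (simp add: sum_distrib_left mult.left_commute)
 qed (use g in \<open>auto intro: trig_poly.intros\<close>)
qed

lemma torus_partial_eq:
 assumes "!!v. ((%v. f (proj v)) has_derivative (%h. \<Sum>j\<in>UNIV. h $ j * g j (proj v))) (at v)"
 shows "torus_partial i f x = g i x"
proof -
 have "((%h. sec x + h *\<^sub>R axis i 1) has_derivative (%h. h *\<^sub>R axis i 1)) (at (0::real))"
  by (auto intro!: derivative_eq_intros)
 moreover have "((%v. f (proj v)) has_derivative (%h. \<Sum>j\<in>UNIV. h $ j * g j (proj (sec x))))
   (at (sec x + 0 *\<^sub>R axis i 1))"
  using assms[of "sec x"] by simp
 ultimately have "((%h. f (proj (sec x + h *\<^sub>R axis i 1))) has_derivative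
   (%h. \<Sum>j\<in>UNIV. (h *\<^sub>R axis i 1) $ j * g j (proj (sec x)))) (at 0)"
  by (rule has_derivative_compose)
 moreover have "(\<Sum>j\<in>UNIV. (h *\<^sub>R axis i (1::real)) $ j * g j (proj (sec x))) = g i x * h" for h
  using exhaust_2[of i] by (auto simp: axis_def sum_2)
 ultimately have "((%h. f (x + proj (h *\<^sub>R axis i 1))) has_derivative (%h. g i x * h)) (at 0)"
  by (simp add: proj_add)
 then show ?thesis
  unfolding torus_partial_def by (intro DERIV_imp_deriv) (simp add: has_field_derivative_def)
qed

lemma trig_poly_partial: "trig_poly f ==> trig_poly (torus_partial i f)"
 and trig_poly_has_derivative: "trig_poly f ==> ((%v. f (proj v)) has_derivative
   (%h. \<Sum>j\<in>UNIV. h $ j * torus_partial j f (proj v))) (at v)"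
proof -
 assume "trig_poly f"
 from trig_poly_has_gradient[OF this] obtain g where g: "\<forall>j. trig_poly (g j)"
  "\<forall>v. ((%v. f (proj v)) has_derivative (%h. \<Sum>j\<in>UNIV. h $ j * g j (proj v))) (at v)"
  by blast
 have "torus_partial j f = g j" for j
  by (rule ext, rule torus_partial_eq) (use g in blast)
 with g show "trig_poly (torus_partial i f)" "((%v. f (proj v)) has_derivative
   (%h. \<Sum>j\<in>UNIV. h $ j * torus_partial j f (proj v))) (at v)" by simp_all
qed

lemma torus_partial_tcos: "torus_partial i (tcos k) x = - 2 * pi * latt k $ i * tsin k x"
 and torus_partial_tsin: "torus_partial i (tsin k) x = 2 * pi * latt k $ i * tcos k x"
 by (rule torus_partial_eq[OF has_derivative_tcos], rule torus_partial_eq[OF has_derivative_tsin])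

lemma trig_poly_C_k: "trig_poly f ==> C_k n (%v. f (proj v))"
proof (induction n arbitrary: f)
 case 0
 have "isCont (%v. f (proj v)) v" for v
  by (rule has_derivative_continuous[OF trig_poly_has_derivative[OF 0]])
 then show ?case by (simp add: continuous_at_imp_continuous_on)
next
 case (Suc n)
 note D = trig_poly_has_derivative[OF Suc.prems]
 have "frechet_derivative (%v. f (proj v)) (at v) h = (\<Sum>j\<in>UNIV. h $ j * torus_partial j f (proj v))"
  for v h by (rule fun_cong[OF frechet_derivative_at[OF D], symmetric])
 moreover have "C_k n (%v. (%x. \<Sum>j\<in>UNIV. h $ j * torus_partial j f x) (proj v))" for h :: "real^2"
  by (intro Suc.IH trig_poly_sum trig_poly_scale trig_poly_partial Suc.prems) auto
 moreover have "(%v. f (proj v)) differentiable_on UNIV"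
  unfolding differentiable_on_def differentiable_def using D by blast
 ultimately show ?case by simp
qed

lemma trig_poly_smooth: "trig_poly f ==> torus_smooth f"
 unfolding torus_smooth_def smooth_def using trig_poly_C_k by blast

lemma abs_cos_diff_le: "\<bar>cos a - cos b\<bar> <= \<bar>a - b\<bar>" for a b :: real
proof -
 have "\<bar>cos a - cos b\<bar> = 2 * (\<bar>sin ((a + b) / 2)\<bar> * \<bar>sin ((b - a) / 2)\<bar>)"
  unfolding cos_diff_cos abs_mult by simp
 also have "\<dots> <= 2 * (1 * \<bar>(b - a) / 2\<bar>)"
  using mult_mono[of "\<bar>sin ((a + b) / 2)\<bar>" 1 "\<bar>sin ((b - a) / 2)\<bar>" "\<bar>(b - a) / 2\<bar>"]
   abs_sin_x_le_abs_x[of "(b - a) / 2"] abs_sin_le_one[of "(a + b) / 2"] by linarith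
 finally show ?thesis by simp
qed
lemma abs_sin_diff_le: "\<bar>sin a - sin b\<bar> <= \<bar>a - b\<bar>" for a b :: real
proof -
 have "\<bar>sin a - sin b\<bar> = 2 * (\<bar>sin ((a - b) / 2)\<bar> * \<bar>cos ((a + b) / 2)\<bar>)"
  unfolding sin_diff_sin abs_mult by simp
 also have "\<dots> <= 2 * (\<bar>(a - b) / 2\<bar> * 1)"
  using mult_mono[of "\<bar>sin ((a - b) / 2)\<bar>" "\<bar>(a - b) / 2\<bar>" "\<bar>cos ((a + b) / 2)\<bar>" 1]
   abs_sin_x_le_abs_x[of "(a - b) / 2"] abs_cos_le_one[of "(a + b) / 2"] by linarith
 finally show ?thesis by simp
qed

text \<open>The torus norm is an infimum over representatives. Comparing f along a representative
  within e/(L + 1) of the infimum carries the Lipschitz bound over from the plane.\<close>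

lemma torus_lipschitzI:
 fixes f :: "torus2 => 'b::metric_space"
 assumes "!!v w. dist (f (proj v)) (f (proj w)) <= L * norm (v - w)" "L >= 0"
 shows "L-lipschitz_on UNIV f"
proof (rule lipschitz_onI)
 fix x y
 show "dist (f x) (f y) <= L * dist x y"
 proof (rule field_le_epsilon)
  fix e :: real assume e: "e > 0"
  then have "e / (L + 1) > 0" using assms(2) by simp
  then obtain v where v: "proj v = x - y" "norm v < torus_norm (x - y) + e / (L + 1)"
   by (rule torus_norm_less)
  have "dist (f x) (f y) <= L * norm v"
   using assms(1)[of "sec y + v" "sec y"] v(1) by (simp add: proj_add)
  also have "\<dots> <= L * (dist x y + e / (L + 1))"
   using v(2) assms(2) by (intro mult_left_mono) (auto simp: dist_torus2_def)
  also have "\<dots> <= L * dist x y + e"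
   using e assms(2) by (simp add: field_simps)
  finally show "dist (f x) (f y) <= L * dist x y + e" .
 qed
qed (fact assms(2))

lemma lipschitz_tcos: "(2 * pi * norm (latt k))-lipschitz_on UNIV (tcos k)"
 and lipschitz_tsin: "(2 * pi * norm (latt k))-lipschitz_on UNIV (tsin k)"
proof -
 have *: "\<bar>2 * pi * (latt k \<bullet> v) - 2 * pi * (latt k \<bullet> w)\<bar> <= 2 * pi * norm (latt k) * norm (v - w)" for v w
 proof -
  have "\<bar>2 * pi * (latt k \<bullet> v) - 2 * pi * (latt k \<bullet> w)\<bar> = 2 * pi * \<bar>latt k \<bullet> (v - w)\<bar>"
   by (simp add: inner_diff_right abs_mult flip: right_diff_distrib)
  also have "\<dots> <= 2 * pi * (norm (latt k) * norm (v - w))"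
   by (intro mult_left_mono Cauchy_Schwarz_ineq2) auto
  finally show ?thesis by (simp add: mult.assoc)
 qed
 show "(2 * pi * norm (latt k))-lipschitz_on UNIV (tcos k)"
  "(2 * pi * norm (latt k))-lipschitz_on UNIV (tsin k)"
  using order_trans[OF abs_cos_diff_le *] order_trans[OF abs_sin_diff_le *]
  by (auto intro!: torus_lipschitzI simp: tcos_proj tsin_proj dist_real_def)
qed

section \<open>Density of trigonometric polynomials and uniqueness of Fourier coefficients\<close>

lemma continuous_tcos: "continuous_on UNIV (tcos k)" and continuous_tsin: "continuous_on UNIV (tsin k)"
 using lipschitz_on_continuous_on lipschitz_tcos lipschitz_tsin by blast+

lemma trig_poly_continuous: "trig_poly f ==> continuous_on UNIV f"
 by (induction rule: trig_poly.induct)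
   (auto intro: continuous_tcos continuous_tsin continuous_on_add continuous_on_mult_left)

text \<open>The characters of frequencies (1,0) and (0,1) determine both coordinates modulo 1, so
  the algebra separates points.\<close>

lemma trig_poly_dense:
 assumes "continuous_on UNIV f" "e > 0"
 shows "\<exists>g. trig_poly g \<and> (\<forall>x. \<bar>f x - g x\<bar> < e)"
proof -
 have "\<exists>g. trig_poly g \<and> (\<forall>x\<in>UNIV. \<bar>f x - g x\<bar> < e)"
 proof (rule Stone_Weierstrass_HOL[OF compact_torus])
  fix x y :: torus2 assume xy: "x \<in> UNIV \<and> y \<in> UNIV \<and> x \<noteq> y"
  show "\<exists>f. trig_poly f \<and> f x \<noteq> f y"
  proof (rule ccontr)
   assume "\<not> ?thesis"
   then have eq: "tcos k x = tcos k y" "tsin k x = tsin k y" for k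
   using trig_poly.intros(1,2) by blast+
   have "sec x $ i - sec y $ i \<in> \<int>" for i
   proof -
   obtain k where k: "latt k \<bullet> v = v $ i" for v
   proof (cases "i = 1")
   case True
   then show ?thesis using that[of "(1, 0)"] by (auto simp: latt_def inner_vec_def sum_2)
   next
   case False
   then have "i = 2" using exhaust_2[of i] by simp
   then show ?thesis using that[of "(0, 1)"] by (auto simp: latt_def inner_vec_def sum_2)
   qed
   then obtain n :: int where "2 * pi * sec x $ i = 2 * pi * sec y $ i + 2 * pi * n"
   using eq[of k] sin_cos_eq_iff[of "2 * pi * sec x $ i" "2 * pi * sec y $ i"]
   by (auto simp: tcos_def tsin_def)
   then have "2 * pi * (sec x $ i - sec y $ i - n) = 0" by (simp add: algebra_simps)
   then show ?thesis by simp
   qed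
   then have "proj (sec x) = proj (sec y)" unfolding torus2.abs_eq_iff lattice_rel_def by simp
   with xy show False by simp
  qed
 qed (use assms in \<open>auto intro: trig_poly_continuous trig_poly_const trig_poly_add trig_poly_mult\<close>)
 then show ?thesis by simp
qed

lemma bounded_continuous_torus:
 fixes f :: "torus2 => 'b::real_normed_vector"
 assumes "continuous_on UNIV f" obtains C where "!!x. norm (f x) <= C"
 using compact_imp_bounded[OF compact_continuous_image[OF assms compact_torus]]
 by (auto simp: bounded_iff)

lemma integrable_mult_continuous:
 fixes f g :: "torus2 => real"
 assumes "integrable TL f" "continuous_on UNIV g"
 shows "integrable TL (%x. f x * g x)"
proof -
 obtain C where C: "!!x. norm (g x) <= C" using bounded_continuous_torus[OF assms(2)] by blast
 have [measurable]: "g \<in> BM borel"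
  by (rule borel_measurable_continuous_onI[OF assms(2)])
 have [measurable]: "f \<in> BM borel" using assms(1) by auto
 show ?thesis
 proof (rule Bochner_Integration.integrable_bound)
  show "integrable TL (%x. C * f x)" using assms(1) by simp
  show "AE x in TL. norm (f x * g x) <= norm (C * f x)"
  proof (rule AE_I2)
   fix x have "\<bar>g x\<bar> <= \<bar>C\<bar>" using C[of x] by simp
   then show "norm (f x * g x) <= norm (C * f x)"
   using mult_left_mono[of "\<bar>g x\<bar>" "\<bar>C\<bar>" "\<bar>f x\<bar>"] by (simp add: abs_mult mult.commute)
  qed
 qed simp
qed

lemma integrable_continuous_torus:
 fixes g :: "torus2 => real"
 assumes "continuous_on UNIV g" shows "integrable TL g"
 using integrable_mult_continuous[OF _ assms, of "%_. 1"] by simp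

lemma fourier_vanish_trig_poly:
 assumes "integrable TL f"
  and "!!k. (LINT x|TL. f x * tcos k x) = 0"
  and "!!k. (LINT x|TL. f x * tsin k x) = 0"
  and "trig_poly g"
 shows "(LINT x|TL. f x * g x) = 0"
 using assms(4)
proof induction
 case (trig_poly_add g1 g2)
 then show ?case
  using integrable_mult_continuous[OF assms(1)] trig_poly_continuous
  by (simp add: distrib_left Bochner_Integration.integral_add)
next
 case (trig_poly_scale g c)
 then show ?case by (simp add: mult.left_commute)
qed (use assms in auto)

text \<open>Vanishing coefficients annihilate all continuous functions by uniform density, hence the
  indicators of open sets by pointwise approximation, hence those of all Borel sets by a Dynkin
  class argument.\<close>

lemma fourier_uniqueness:
 assumes f: "integrable TL f"
  and "!!k. (LINT x|TL. f x * tcos k x) = 0"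
  and "!!k. (LINT x|TL. f x * tsin k x) = 0"
 shows "AE x in TL. f x = (0::real)"
proof -
 have [measurable]: "f \<in> BM borel" using f by auto
 let ?N = "LINT x|TL. \<bar>f x\<bar>"
 have N: "?N >= 0" by simp
 have cont: "(LINT x|TL. f x * g x) = 0" if g: "continuous_on UNIV g" for g
 proof -
  have "\<bar>LINT x|TL. f x * g x\<bar> <= e" if "e > 0" for e
  proof -
   have "\<exists>d>0. d * c <= e" if "c >= 0" for c
   using \<open>e > 0\<close> that by (intro exI[of _ "e / (c + 1)"]) (auto simp: field_simps)
   from this[OF N] obtain d where d: "d > 0" "d * ?N <= e" by blast
   obtain h where h: "trig_poly h" "!!x. \<bar>g x - h x\<bar> < d"
   using trig_poly_dense[OF g d(1)] by blast
   note ch = trig_poly_continuous[OF h(1)]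
   have ig: "integrable TL (%x. f x * (g x - h x))"
   by (intro integrable_mult_continuous f continuous_on_diff g ch)
   have "(LINT x|TL. f x * g x) = (LINT x|TL. f x * (g x - h x))"
   using fourier_vanish_trig_poly[OF assms h(1)] integrable_mult_continuous[OF f g]
   integrable_mult_continuous[OF f ch]
   by (simp add: right_diff_distrib)
   also have "\<bar>\<dots>\<bar> <= (LINT x|TL. \<bar>f x * (g x - h x)\<bar>)"
   by (rule integral_abs_bound)
   also have "\<dots> <= (LINT x|TL. d * \<bar>f x\<bar>)"
   proof (rule integral_mono)
   show "integrable TL (%x. \<bar>f x * (g x - h x)\<bar>)"
   using ig by (rule integrable_abs)
   show "integrable TL (%x. d * \<bar>f x\<bar>)" using f by simp
   show "\<bar>f x * (g x - h x)\<bar> <= d * \<bar>f x\<bar>" for x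
   using mult_left_mono[OF less_imp_le[OF h(2)[of x]], of "\<bar>f x\<bar>"]
   by (simp add: abs_mult mult.commute)
   qed
   also have "\<dots> <= e" using d by simp
   finally show ?thesis .
  qed
  then have "\<bar>LINT x|TL. f x * g x\<bar> <= 0" by (rule field_le_epsilon[of _ 0, simplified])
  then show ?thesis by simp
 qed
 have op: "(LINT x:U|TL. f x) = 0" if "open U" for U
 proof (cases "U = UNIV")
  case True
  then show ?thesis using cont[of "%_. 1"] by (simp add: set_lebesgue_integral_def)
 next
  case False
  \<comment> \<open>Continuous functions increasing to the indicator of \<open>U\<close>. The whole
    torus is treated apart because the distance to an empty complement is 0 by convention.\<close>
  let ?g = "%n x. min 1 (real n * infdist x (- U))"
  have [measurable]: "U \<in> sets borel" using that by simp
  have [measurable]: "?g n \<in> BM borel" for n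
   by (intro borel_measurable_continuous_onI continuous_intros)
  have "(%n. LINT x|TL. f x * ?g n x) \<longlonglongrightarrow> (LINT x|TL. f x * indicator U x)"
  proof (rule integral_dominated_convergence[where w = "%x. \<bar>f x\<bar>"])
   show "AE x in TL. (%n. f x * ?g n x) \<longlonglongrightarrow> f x * indicator U x"
   proof (rule AE_I2, intro tendsto_mult tendsto_const)
   fix x show "(%n. ?g n x) \<longlonglongrightarrow> indicator U x"
   proof (cases "x \<in> U")
   case True
   then have pos: "infdist x (- U) > 0"
   using False that in_closed_iff_infdist_zero[of "- U" x] infdist_nonneg[of x "- U"]
   by (auto simp: less_le)
   obtain n0 :: nat where n0: "1 / infdist x (- U) <= real n0" using real_arch_simple by blast
   have "?g n x = 1" if "n >= n0" for n
   proof -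
   have "1 / infdist x (- U) <= real n" using n0 that by simp
   then have "1 <= real n * infdist x (- U)" using pos by (simp add: field_simps)
   then show ?thesis by simp
   qed
   then have "eventually (%n. ?g n x = 1) sequentially"
   unfolding eventually_sequentially by blast
   then show ?thesis using True by (simp add: tendsto_eventually)
   qed simp
   qed
   show "AE x in TL. norm (f x * ?g n x) <= \<bar>f x\<bar>" for n
   proof (rule AE_I2)
   fix x
   have "\<bar>?g n x\<bar> <= 1" using infdist_nonneg[of x "- U"] by (simp add: abs_le_iff min_def)
   then show "norm (f x * ?g n x) <= \<bar>f x\<bar>" by (simp add: abs_mult mult_left_le)
   qed
  qed (use f in auto)
  moreover have "(LINT x|TL. f x * ?g n x) = 0" for n
   by (intro cont continuous_intros)
  ultimately have "(LINT x|TL. f x * indicator U x) = 0"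
   by (simp only: LIMSEQ_const_iff)
  then show ?thesis by (simp add: set_lebesgue_integral_def mult.commute)
 qed
 have si: "set_integrable TL A f" if "A \<in> sets borel" for A
  unfolding set_integrable_def using f that by (intro integrable_mult_indicator) auto
 have all: "(LINT x:A|TL. f x) = 0" if "A \<in> sets borel" for A
 proof -
  have "Int_stable {U :: torus2 set. open U}" by (auto simp: Int_stable_def)
  moreover have "{U :: torus2 set. open U} \<subseteq> Pow UNIV" by simp
  moreover have "A \<in> sigma_sets UNIV {U. open U}" using that by (simp add: borel_def)
  ultimately show ?thesis
  proof (induction rule: sigma_sets_induct_disjoint)
   case (compl A)
   then have A: "A \<in> sets borel" by (simp add: borel_def)
   have "(LINT x:A \<union> (UNIV - A)|TL. f x) =
   (LINT x:A|TL. f x) + (LINT x:UNIV - A|TL. f x)"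
   using A by (intro set_integral_Un si) auto
   then show ?case using compl op[of UNIV] by simp
  next
   case (union A)
   then have A: "A i \<in> sets borel" for i by (auto simp: borel_def)
   have "(LINT x:(\<Union>i. A i)|TL. f x) = (\<Sum>i. LINT x:A i|TL. f x)"
   using A union(1) by (intro lebesgue_integral_countable_add si) (auto simp: disjoint_family_on_def)
   then show ?case using union by simp
  qed (use op in \<open>auto simp: set_lebesgue_integral_def\<close>)
 qed
 have "AE x in TL. f x = (%_. 0) x"
  by (rule density_unique_real) (use f all in \<open>auto simp: set_lebesgue_integral_def\<close>)
 then show ?thesis by simp
qed

text \<open>Translation by a point \<open>a\<close> at half a period, where \<open>tcos k\<close> is
  -1 and \<open>tsin k\<close> is 0, changes the sign of both integrands but not the
  integrals.\<close>

lemma integral_tcos: "(LINT x|TL. tcos k x) = (if k = 0 then 1 else 0)"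
 and integral_tsin: "(LINT x|TL. tsin k x) = 0"
proof -
 have "(LINT x|TL. tcos k x) = 0 \<and> (LINT x|TL. tsin k x) = 0" if "k \<noteq> 0"
 proof -
  have nz: "latt k \<noteq> 0"
   using that inj_latt latt_zero by (metis injD)
  then have "2 * pi * (latt k \<bullet> ((1 / (2 * (latt k \<bullet> latt k))) *\<^sub>R latt k)) = pi"
   using nz by simp
  then obtain a where a: "tcos k a = - 1" "tsin k a = 0"
   using tcos_proj[of k "(1 / (2 * (latt k \<bullet> latt k))) *\<^sub>R latt k"]
   tsin_proj[of k "(1 / (2 * (latt k \<bullet> latt k))) *\<^sub>R latt k"] nz by auto
  have [measurable]: "tcos k \<in> BM borel" "tsin k \<in> BM borel"
   by (intro borel_measurable_continuous_onI continuous_tcos continuous_tsin)+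
  show ?thesis
   using integral_torus_translate[of "tcos k" a] integral_torus_translate[of "tsin k" a]
   by (simp add: tcos_add tsin_add a)
 qed
 note nonzero = this
 have "measure TL UNIV = 1" using torus.prob_space by simp
 then have "(LINT x|TL. tcos 0 x) = 1" "(LINT x|TL. tsin 0 x) = 0" by simp_all
 with nonzero show "(LINT x|TL. tcos k x) = (if k = 0 then 1 else 0)"
  "(LINT x|TL. tsin k x) = 0"
  by metis+
qed

section \<open>The Biot--Savart kernel\<close>

lemma gauss_integrable:
 assumes "t > 0"
 shows "integrable lborel (%s::real. exp (- s\<^sup>2 / (4 * t)))"
  and "integrable lborel (%s::real. s * exp (- s\<^sup>2 / (4 * t)))"
proof -
 define \<sigma> where "\<sigma> = sqrt (2 * t)"
 have \<sigma>: "\<sigma> > 0" "2 * \<sigma>\<^sup>2 = 4 * t" using assms by (auto simp: \<sigma>_def)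
 have d: "normal_density 0 \<sigma> s = exp (- s\<^sup>2 / (4 * t)) / sqrt (2 * pi * \<sigma>\<^sup>2)" for s
  by (simp add: normal_density_def \<sigma>(2))
 have n: "sqrt (2 * pi * \<sigma>\<^sup>2) \<noteq> 0" using \<sigma>(1) by simp
 have "integrable lborel (%s. normal_density 0 \<sigma> s * (s - 0) ^ k * sqrt (2 * pi * \<sigma>\<^sup>2))" for k
  by (intro integrable_mult_left integrable_normal_moment \<sigma>(1))
 from this[of 0] this[of 1] show "integrable lborel (%s::real. exp (- s\<^sup>2 / (4 * t)))"
  "integrable lborel (%s::real. s * exp (- s\<^sup>2 / (4 * t)))"
  using n by (simp_all add: d mult.commute)
qed

lemma integrable_bounded_mult:
 fixes f g :: "'b => real"
 assumes "integrable N f" "g \<in> BM N" "!!x. \<bar>g x\<bar> <= 1"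
 shows "integrable N (%x. f x * g x)"
 by (rule Bochner_Integration.integrable_bound[OF assms(1)])
   (use assms in \<open>auto simp: abs_mult mult_left_le\<close>)

text \<open>After the substitution s = \<sigma> u with \<sigma>^2 = 2 t this is the real part of the
  characteristic function of the standard normal law.\<close>

lemma gauss_cos:
 assumes "t > 0"
 shows "(LBINT s. exp (- s\<^sup>2 / (4 * t)) * cos (c * s)) = sqrt (4 * pi * t) * exp (- c\<^sup>2 * t)"
proof -
 define \<sigma> where "\<sigma> = sqrt (2 * t)"
 have \<sigma>: "\<sigma> > 0" "\<sigma>\<^sup>2 = 2 * t" using assms by (auto simp: \<sigma>_def)
 interpret N: prob_space std_normal_distribution
  using real_dist_normal_dist by (simp add: real_distribution_def)
 have "(LBINT s. std_normal_density s * cos (c * \<sigma> * s)) =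
   (LINT s|std_normal_distribution. cos (c * \<sigma> * s))"
  by (subst integral_density) auto
 also have "\<dots> = (LINT s|std_normal_distribution. Re (iexp (c * \<sigma> * s)))"
  by (simp add: Re_exp)
 also have "\<dots> = Re (char std_normal_distribution (c * \<sigma>))"
  unfolding char_def
  by (intro integral_Re N.integrable_const_bound[where B = 1]) auto
 also have "\<dots> = exp (- (c * \<sigma>)\<^sup>2 / 2)"
  by (simp only: char_std_normal_distribution Re_complex_of_real)
 finally have 1: "(LBINT s. std_normal_density s * cos (c * \<sigma> * s)) = exp (- c\<^sup>2 * t)"
  by (simp add: power_mult_distrib \<sigma>(2))
 have "(LBINT s. exp (- s\<^sup>2 / (4 * t)) * cos (c * s)) =
   \<sigma> * (LBINT s. exp (- (\<sigma> * s)\<^sup>2 / (4 * t)) * cos (c * (\<sigma> * s)))"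
  using lborel_integral_real_affine[of \<sigma> "%s. exp (- s\<^sup>2 / (4 * t)) * cos (c * s)" 0] \<sigma>(1)
  by simp
 also have "(%s. exp (- (\<sigma> * s)\<^sup>2 / (4 * t)) * cos (c * (\<sigma> * s))) =
   (%s. sqrt (2 * pi) * (std_normal_density s * cos (c * \<sigma> * s)))"
  using assms by (auto simp: fun_eq_iff std_normal_density_def power_mult_distrib \<sigma>(2) mult.assoc)
 finally show ?thesis
  unfolding integral_mult_right_zero 1
  using assms by (simp add: \<sigma>_def real_sqrt_mult)
qed

text \<open>Integration by parts: \<open>?f\<close> is the derivative of \<open>?F\<close>, which
  vanishes at both ends, so the sine moment reduces to \<open>gauss_cos\<close>.\<close>

lemma gauss_sin_moment:
 assumes "t > 0"
 shows "(LBINT s. (s * exp (- s\<^sup>2 / (4 * t))) * sin (c * s)) =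
  2 * t * c * (sqrt (4 * pi * t) * exp (- c\<^sup>2 * t))"
proof -
 let ?f = "%s. (s * exp (- s\<^sup>2 / (4 * t))) * sin (c * s) - 2 * t * c * (exp (- s\<^sup>2 / (4 * t)) * cos (c * s))"
 let ?F = "%s. - 2 * t * exp (- s\<^sup>2 / (4 * t)) * sin (c * s)"
 have i1: "integrable lborel (%s. (s * exp (- s\<^sup>2 / (4 * t))) * sin (c * s))"
  by (intro integrable_bounded_mult gauss_integrable assms) auto
 have i2: "integrable lborel (%s. exp (- s\<^sup>2 / (4 * t)) * cos (c * s))"
  by (intro integrable_bounded_mult gauss_integrable assms) auto
 have lim: "((%s. 2 * t * exp (- s\<^sup>2 / (4 * t))) \<longlongrightarrow> 0) at_top"
  "((%s. 2 * t * exp (- s\<^sup>2 / (4 * t))) \<longlongrightarrow> 0) at_bot"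
  using assms by real_asymp+
 have bd: "\<forall>\<^sub>F s in G. norm (?F s) <= 2 * t * exp (- s\<^sup>2 / (4 * t))" for G
  using assms by (intro always_eventually allI) (auto simp: abs_mult mult_left_le)
 have "(LBINT s=-\<infinity>..\<infinity>. ?f s) = 0 - 0"
 proof (rule interval_integral_FTC_integrable)
  show "(?F has_vector_derivative ?f s) (at s)" for s
   unfolding has_real_derivative_iff_has_vector_derivative[symmetric]
   using assms by (auto intro!: derivative_eq_intros simp: field_simps)
  show "isCont ?f s" for s using assms by (intro continuous_intros) auto
  show "set_integrable lborel (einterval (-\<infinity>) \<infinity>) ?f"
   using i1 i2 by (simp add: set_integrable_def)
  show "((?F \<circ> real_of_ereal) \<longlongrightarrow> 0) (at_right (-\<infinity>))"
   unfolding ereal_tendsto_simps1 by (rule Lim_null_comparison[OF bd lim(2)])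
  show "((?F \<circ> real_of_ereal) \<longlongrightarrow> 0) (at_left \<infinity>)"
   unfolding ereal_tendsto_simps1 by (rule Lim_null_comparison[OF bd lim(1)])
 qed simp
 then have "(LBINT s. ?f s) = 0"
  by (simp add: interval_lebesgue_integral_def set_lebesgue_integral_def)
 then have "(LBINT s. (s * exp (- s\<^sup>2 / (4 * t))) * sin (c * s)) =
   (LBINT s. 2 * t * c * (exp (- s\<^sup>2 / (4 * t)) * cos (c * s)))"
  using i1 i2 by (subst (asm) Bochner_Integration.integral_diff) auto
 then show ?thesis unfolding integral_mult_right_zero gauss_cos[OF assms] .
qed

lemma integral_odd_zero:
 fixes f :: "'b::euclidean_space => real"
 assumes "!!x. f (- x) = - f x" and [measurable]: "f \<in> BM borel"
 shows "(LINT x|lborel. f x) = 0"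
proof -
 have "(LINT x|lborel. f x) = (LINT x|distr lborel borel uminus. f x)"
  by (simp add: lborel_distr_uminus_euclidean)
 also have "\<dots> = - (LINT x|lborel. f x)"
  by (subst integral_distr) (auto simp: assms(1))
 finally show ?thesis by simp
qed

text \<open>Pairs are identified with vectors. Once this map is known to preserve Lebesgue measure,
  Fubini computes plane integrals coordinate by coordinate.\<close>

definition vec2 :: "real \<times> real => real^2" where
 "vec2 p = (\<chi> i. if i = 1 then fst p else snd p)"

lemma vec2_nth [simp]: "vec2 p $ 1 = fst p" "vec2 p $ 2 = snd p"
 by (simp_all add: vec2_def)

lemma borel_measurable_vec2 [measurable]: "vec2 \<in> BM borel"
 unfolding vec2_def
proof (intro borel_measurable_continuous_onI continuous_on_vec_lambda)
 fix i :: 2 show "continuous_on UNIV (%p :: real \<times> real. if i = 1 then fst p else snd p)"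
  by (cases "i = 1") (auto intro!: continuous_intros)
qed

lemma distr_vec2: "distr (lborel \<Otimes>\<^sub>M lborel) borel vec2 = lborel"
proof (rule lborel_eqI[symmetric])
 fix l u :: "real^2" assume le: "!!b. b \<in> Basis ==> l \<bullet> b <= u \<bullet> b"
 have B: "(Basis :: (real^2) set) = {axis 1 1, axis 2 1}"
  by (auto simp: Basis_vec_def exhaust_2) (metis exhaust_2)
 have "axis 1 1 \<noteq> (axis 2 1 :: real^2)" by (simp add: axis_eq_axis)
 then have P: "(\<Prod>b\<in>Basis. (u - l) \<bullet> b) = (u $ 1 - l $ 1) * (u $ 2 - l $ 2)"
  by (simp add: B inner_axis)
 have le12: "l $ 1 <= u $ 1" "l $ 2 <= u $ 2"
  using le[of "axis 1 1"] le[of "axis 2 1"] by (auto simp: B inner_axis)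
 have "vec2 -` box l u \<inter> space (lborel \<Otimes>\<^sub>M lborel) = {l $ 1<..<u $ 1} \<times> {l $ 2<..<u $ 2}"
  by (auto simp: mem_box_cart forall_2 space_pair_measure)
 then have "emeasure (distr (lborel \<Otimes>\<^sub>M lborel) borel vec2) (box l u) =
   emeasure (lborel \<Otimes>\<^sub>M lborel) ({l $ 1<..<u $ 1} \<times> {l $ 2<..<u $ 2})"
  by (subst emeasure_distr) (auto simp: lborel_prod)
 also have "\<dots> = emeasure lborel {l $ 1<..<u $ 1} * emeasure lborel {l $ 2<..<u $ 2}"
  by (rule lborel.emeasure_pair_measure_Times) auto
 finally show "emeasure (distr (lborel \<Otimes>\<^sub>M lborel) borel vec2) (box l u) = (\<Prod>b\<in>Basis. (u - l) \<bullet> b)"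
  using le12 by (simp add: P ennreal_mult)
qed simp

lemma
 fixes f g :: "real => real"
 assumes f: "integrable lborel f" and g: "integrable lborel g"
 shows integrable_vec2_prod: "integrable lborel (%z :: real^2. f (z $ 1) * g (z $ 2))"
  and integral_vec2_prod: "(LINT z|(lborel :: (real^2) measure). f (z $ 1) * g (z $ 2)) =
   (LBINT s. f s) * (LBINT r. g r)"
proof -
 have [measurable]: "f \<in> BM borel" "g \<in> BM borel"
  using f g by auto
 have i: "integrable (lborel \<Otimes>\<^sub>M lborel) (%(s, r). f s * g r)"
 proof (rule lborel_pair.Fubini_integrable)
  show "integrable lborel (%s. LINT r|lborel. norm (case (s, r) of (s, r) => f s * g r))"
   using f by (simp add: abs_mult)
 qed (use g in \<open>auto intro!: AE_I2\<close>)
 have m: "vec2 \<in> lborel \<Otimes>\<^sub>M lborel \<rightarrow>\<^sub>M borel" by (simp add: lborel_prod)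
 show "integrable lborel (%z :: real^2. f (z $ 1) * g (z $ 2))"
  unfolding distr_vec2[symmetric]
  by (subst integrable_distr_eq[OF m]) (use i in \<open>auto simp: split_beta'\<close>)
 have "(LINT z|(lborel :: (real^2) measure). f (z $ 1) * g (z $ 2)) =
   (LINT p|(lborel \<Otimes>\<^sub>M lborel). f (fst p) * g (snd p))"
  unfolding distr_vec2[symmetric] by (subst integral_distr[OF m]) auto
 also have "\<dots> = (LBINT s. LBINT r. f s * g r)"
  using lborel_pair.integral_fst[OF i] by (simp add: split_beta')
 also have "\<dots> = (LBINT s. f s) * (LBINT r. g r)" by simp
 finally show "(LINT z|(lborel :: (real^2) measure). f (z $ 1) * g (z $ 2)) =
   (LBINT s. f s) * (LBINT r. g r)" .
qed

lemma norm_vec2_sq: "(norm z)\<^sup>2 = (z $ 1)\<^sup>2 + (z $ 2)\<^sup>2" for z :: "real^2"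
 by (simp add: norm_vec_def L2_set_def sum_2)

lemma exp_norm_vec2: "exp (- (norm z)\<^sup>2 / c) = exp (- (z $ 1)\<^sup>2 / c) * exp (- (z $ 2)\<^sup>2 / c)"
 for z :: "real^2"
 unfolding norm_vec2_sq exp_add[symmetric] by (metis add_divide_distrib minus_add_distrib)

lemma gauss_integrable_plane:
 assumes "t > 0" shows "integrable lborel (%z::real^2. exp (- (norm z)\<^sup>2 / (4 * t)))"
 unfolding exp_norm_vec2 by (intro integrable_vec2_prod gauss_integrable assms)

text \<open>The addition theorem for the sine gives two products of one-dimensional integrals, one
  of which contains the integral of an odd function and vanishes.\<close>

lemma gauss_sin_moment_plane:
 fixes C :: "real^2"
 assumes "t > 0"
 shows "(LINT z|lborel. z $ j * exp (- (norm z)\<^sup>2 / (4 * t)) * sin (C \<bullet> z)) =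
  8 * pi * t\<^sup>2 * C $ j * exp (- (norm C)\<^sup>2 * t)"
proof -
 let ?e = "%s. exp (- s\<^sup>2 / (4 * t))"
 have odd1: "(LBINT s. ?e s * sin (c * s)) = 0" for c
  by (rule integral_odd_zero) auto
 have es: "integrable lborel (%s. ?e s * sin (c * s))" "integrable lborel (%s. ?e s * cos (c * s))"
  "integrable lborel (%s. (s * ?e s) * sin (c * s))" "integrable lborel (%s. (s * ?e s) * cos (c * s))" for c
  by (intro integrable_bounded_mult gauss_integrable assms; simp)+
 have Cn: "exp (- (norm C)\<^sup>2 * t) = exp (- (C $ 1)\<^sup>2 * t) * exp (- (C $ 2)\<^sup>2 * t)"
  unfolding norm_vec2_sq exp_add[symmetric] by (metis distrib_right minus_add_distrib)
 have sq: "sqrt (4 * pi * t) * sqrt (4 * pi * t) = 4 * pi * t" using assms by simp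
 have s: "sin (C \<bullet> z) = sin (C $ 1 * z $ 1) * cos (C $ 2 * z $ 2) + cos (C $ 1 * z $ 1) * sin (C $ 2 * z $ 2)" for z
  by (simp add: inner_vec_def sum_2 sin_add)
 consider "j = 1" | "j = 2" using exhaust_2 by blast
 then show ?thesis
 proof cases
  case 1
  have "(LINT z|lborel. z $ j * exp (- (norm z)\<^sup>2 / (4 * t)) * sin (C \<bullet> z)) =
   (LINT z|(lborel :: (real^2) measure). ((z $ 1 * ?e (z $ 1)) * sin (C $ 1 * z $ 1)) * (?e (z $ 2) * cos (C $ 2 * z $ 2))
   + ((z $ 1 * ?e (z $ 1)) * cos (C $ 1 * z $ 1)) * (?e (z $ 2) * sin (C $ 2 * z $ 2)))"
   unfolding s exp_norm_vec2 1 by (intro Bochner_Integration.integral_cong) (auto simp: algebra_simps)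
  also have "\<dots> = (LBINT s. (s * ?e s) * sin (C $ 1 * s)) * (LBINT s. ?e s * cos (C $ 2 * s))"
   by (subst Bochner_Integration.integral_add)
   (simp_all only: integrable_vec2_prod[OF es(3) es(2)] integrable_vec2_prod[OF es(4) es(1)]
   integral_vec2_prod[OF es(3) es(2)] integral_vec2_prod[OF es(4) es(1)] odd1 mult_zero_right add_0_right)
  also have "\<dots> = (2 * t * C $ 1) * (sqrt (4 * pi * t) * sqrt (4 * pi * t)) * exp (- (norm C)\<^sup>2 * t)"
   unfolding gauss_sin_moment[OF assms] gauss_cos[OF assms] Cn by (simp only: mult_ac)
  finally show ?thesis unfolding sq 1 by (simp add: power2_eq_square)
 next
  case 2
  have "(LINT z|lborel. z $ j * exp (- (norm z)\<^sup>2 / (4 * t)) * sin (C \<bullet> z)) =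
   (LINT z|(lborel :: (real^2) measure). (?e (z $ 1) * sin (C $ 1 * z $ 1)) * ((z $ 2 * ?e (z $ 2)) * cos (C $ 2 * z $ 2))
   + (?e (z $ 1) * cos (C $ 1 * z $ 1)) * ((z $ 2 * ?e (z $ 2)) * sin (C $ 2 * z $ 2)))"
   unfolding s exp_norm_vec2 2 by (intro Bochner_Integration.integral_cong) (auto simp: algebra_simps)
  also have "\<dots> = (LBINT s. ?e s * cos (C $ 1 * s)) * (LBINT s. (s * ?e s) * sin (C $ 2 * s))"
   by (subst Bochner_Integration.integral_add)
   (simp_all only: integrable_vec2_prod[OF es(1) es(4)] integrable_vec2_prod[OF es(2) es(3)]
   integral_vec2_prod[OF es(1) es(4)] integral_vec2_prod[OF es(2) es(3)] odd1 mult_zero_left add_0_left)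
  also have "\<dots> = (2 * t * C $ 2) * (sqrt (4 * pi * t) * sqrt (4 * pi * t)) * exp (- (norm C)\<^sup>2 * t)"
   unfolding gauss_sin_moment[OF assms] gauss_cos[OF assms] Cn by (simp only: mult_ac)
  finally show ?thesis unfolding sq 2 by (simp add: power2_eq_square)
 qed
qed

text \<open>Minus the integral over 0 < t < 1 of the j-th derivative of the planar heat kernel. The
  gradient of G is minus the integral of the heat kernel gradient of the torus over all t > 0; this
  is its singular short-time half before summation over the lattice, as in Ewald's splitting. The
  times t > 1 give \<open>smooth_part\<close>.\<close>

definition ewald :: "2 => real^2 => real" where
 "ewald j z = z $ j * exp (- (norm z)\<^sup>2 / 4) / (2 * pi * (norm z)\<^sup>2)"

text \<open>Dominates Hoelder quotients of \<open>ewald\<close>: a singularity of order 1 loses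
  \<alpha> further orders, and the Gaussian is weakened from 1/4 to 1/8 to absorb polynomial
  factors.\<close>

definition ewald_bound :: "real => real^2 => real" where
 "ewald_bound \<alpha> z = exp (- (norm z)\<^sup>2 / 8) * (1 / norm z + 1 / norm z powr (1 + \<alpha>))"

lemma ewald_bound_nonneg: "ewald_bound \<alpha> z >= 0"
 by (simp add: ewald_bound_def)

lemma borel_measurable_ewald [measurable]:
 "ewald j \<in> BM borel" "ewald_bound \<alpha> \<in> BM borel"
 unfolding ewald_def ewald_bound_def by measurable

lemma powr_subadd:
 fixes x y \<alpha> :: real
 assumes "x >= 0" "y >= 0" "0 < \<alpha>" "\<alpha> <= 1"
 shows "(x + y) powr \<alpha> <= x powr \<alpha> + y powr \<alpha>"
proof (cases "x = 0 \<or> y = 0")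
 case False
 then have p: "x > 0" "y > 0" using assms by auto
 have e: "z powr \<alpha> = z * z powr (\<alpha> - 1)" if "z > 0" for z :: real
  using that by (simp add: powr_diff)
 have "(x + y) powr \<alpha> = x * (x + y) powr (\<alpha> - 1) + y * (x + y) powr (\<alpha> - 1)"
  using p e[of "x + y"] by (simp add: distrib_right)
 also have "\<dots> <= x * x powr (\<alpha> - 1) + y * y powr (\<alpha> - 1)"
  using p assms by (intro add_mono mult_left_mono powr_mono2') auto
 finally show ?thesis using e p by simp
qed auto

lemma abs_ewald_le: "\<bar>ewald j z\<bar> <= exp (- (norm z)\<^sup>2 / 4) / (2 * pi * norm z)"
proof (cases "z = 0")
 case False
 have "\<bar>ewald j z\<bar> = \<bar>z $ j\<bar> * (exp (- (norm z)\<^sup>2 / 4) / (2 * pi * (norm z)\<^sup>2))"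
  by (simp add: ewald_def abs_mult)
 also have "\<dots> <= norm z * (exp (- (norm z)\<^sup>2 / 4) / (2 * pi * (norm z)\<^sup>2))"
  by (intro mult_right_mono component_le_norm_cart) auto
 also have "\<dots> = exp (- (norm z)\<^sup>2 / 4) / (2 * pi * norm z)"
  using False by (simp add: power2_eq_square)
 finally show ?thesis .
qed (simp add: ewald_def)

text \<open>z / |z|^2 is inversion in the unit sphere, for which the distance of two images is known
  exactly. It is the singular factor of \<open>ewald\<close>.\<close>

lemma norm_inversion_diff:
 fixes a b :: "'a::real_inner"
 assumes "a \<noteq> 0" "b \<noteq> 0"
 shows "norm ((1 / (norm a)\<^sup>2) *\<^sub>R a - (1 / (norm b)\<^sup>2) *\<^sub>R b) = norm (a - b) / (norm a * norm b)"
proof -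
 define A where "A = (norm a)\<^sup>2"
 define B where "B = (norm b)\<^sup>2"
 have AB: "A > 0" "B > 0" "a \<bullet> a = A" "b \<bullet> b = B"
  using assms by (auto simp: A_def B_def power2_norm_eq_inner)
 have "(norm ((1 / A) *\<^sub>R a - (1 / B) *\<^sub>R b))\<^sup>2 = 1 / A - 2 * (a \<bullet> b) / (A * B) + 1 / B"
  unfolding power2_norm_eq_inner
  using AB by (simp add: inner_diff_left inner_diff_right inner_commute[of b a] field_simps)
 also have "\<dots> = (A - 2 * (a \<bullet> b) + B) / (A * B)" using AB by (simp add: field_simps)
 also have "A - 2 * (a \<bullet> b) + B = (norm (a - b))\<^sup>2"
  unfolding power2_norm_eq_inner
  using AB by (simp add: inner_diff_left inner_diff_right inner_commute[of b a])
 also have "(norm (a - b))\<^sup>2 / (A * B) = (norm (a - b) / (norm a * norm b))\<^sup>2"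
  by (simp add: A_def B_def power_divide power_mult_distrib)
 finally show ?thesis
  unfolding A_def B_def by (rule power2_eq_imp_eq) auto
qed

text \<open>For a gap of at most 1 the difference is controlled by the derivative, and half of the
  Gaussian absorbs its linear factor. For a larger gap the difference is already below the weaker
  Gaussian.\<close>

lemma gauss_diff_le:
 fixes r s :: real
 assumes "0 <= r" "r <= s"
 shows "exp (- r\<^sup>2 / 4) - exp (- s\<^sup>2 / 4) <= (s - r) * exp (- r\<^sup>2 / 8)"
proof (cases "s - r <= 1")
 case True
 have e: "exp (- r\<^sup>2 / 4) = exp (- r\<^sup>2 / 8) * exp (- r\<^sup>2 / 8)"
  by (simp add: exp_add[symmetric])
 have "exp (- s\<^sup>2 / 4) = exp (- r\<^sup>2 / 4) * exp (- (s\<^sup>2 - r\<^sup>2) / 4)"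
  by (simp add: exp_add[symmetric] diff_divide_distrib)
 moreover have "exp (- r\<^sup>2 / 4) * (1 - (s\<^sup>2 - r\<^sup>2) / 4) <= exp (- r\<^sup>2 / 4) * exp (- (s\<^sup>2 - r\<^sup>2) / 4)"
  using exp_ge_add_one_self[of "- (s\<^sup>2 - r\<^sup>2) / 4"] by (intro mult_left_mono) (linarith, simp)
 ultimately have "exp (- r\<^sup>2 / 4) - exp (- s\<^sup>2 / 4) <= exp (- r\<^sup>2 / 4) * ((s\<^sup>2 - r\<^sup>2) / 4)"
  unfolding right_diff_distrib[of _ 1] by linarith
 also have "(s\<^sup>2 - r\<^sup>2) / 4 = (s - r) * ((s + r) / 4)"
  by (simp add: power2_eq_square algebra_simps)
 also have "exp (- r\<^sup>2 / 4) * ((s - r) * ((s + r) / 4)) <= exp (- r\<^sup>2 / 4) * ((s - r) * exp (r\<^sup>2 / 8))"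
 proof (intro mult_left_mono)
  \<comment> \<open>Together with s <= r + 1 this gives (s + r)/4 <= 1 + r^2/8.\<close>
  have "0 <= (r - 2)\<^sup>2" by simp
  then have "(s + r) / 4 <= 1 + r\<^sup>2 / 8"
   using True by (simp add: power2_eq_square algebra_simps)
  also have "\<dots> <= exp (r\<^sup>2 / 8)" by (rule exp_ge_add_one_self)
  finally show "(s + r) / 4 <= exp (r\<^sup>2 / 8)" .
 qed (use assms in auto)
 also have "\<dots> = (s - r) * exp (- r\<^sup>2 / 8)"
  unfolding e by (simp add: exp_minus)
 finally show ?thesis .
next
 case False
 have "exp (- r\<^sup>2 / 4) - exp (- s\<^sup>2 / 4) <= exp (- r\<^sup>2 / 8)"
  by (smt (verit) exp_ge_zero exp_le_cancel_iff divide_left_mono divide_minus_left zero_le_power2 frac_le)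
 also have "\<dots> <= (s - r) * exp (- r\<^sup>2 / 8)" using False by simp
 finally show ?thesis .
qed

text \<open>Interpolation: with \<open>a\<close> the point nearer to the origin, the difference is
  bounded by a Lipschitz estimate (\<open>b1\<close>) and by the size of the two values
  (\<open>b2\<close>), and min y 1 <= y powr \<alpha> combines them. Adding the bounds of both
  points makes the estimate symmetric.\<close>

lemma ewald_holder:
 assumes "1/2 <= \<alpha>" "\<alpha> < 1"
 shows "\<bar>ewald j a - ewald j b\<bar> <= norm (a - b) powr \<alpha> * (ewald_bound \<alpha> a + ewald_bound \<alpha> b)"
proof -
 have main: "\<bar>ewald j a - ewald j b\<bar> <= norm (a - b) powr \<alpha> * (ewald_bound \<alpha> a + ewald_bound \<alpha> b)"
  if le: "norm a <= norm b" for a b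
 proof (cases "a = 0")
  case True
  show ?thesis
  proof (cases "b = 0")
   case False
   \<comment> \<open>Division by zero gives \<open>ewald\<close> and \<open>ewald_bound\<close> the
     value 0 at the origin, so the term of \<open>b\<close> carries the estimate alone.\<close>
   have "\<bar>ewald j a - ewald j b\<bar> <= exp (- (norm b)\<^sup>2 / 4) / (2 * pi * norm b)"
   using abs_ewald_le[of j b] True by (simp add: ewald_def)
   also have "\<dots> <= exp (- (norm b)\<^sup>2 / 8) / (1 * norm b)"
   using False pi_gt3 by (intro frac_le mult_right_mono) auto
   also have "\<dots> = norm b powr \<alpha> * (exp (- (norm b)\<^sup>2 / 8) * (1 / norm b powr (1 + \<alpha>)))"
   using False by (simp add: powr_add)
   also have "\<dots> <= norm b powr \<alpha> * ewald_bound \<alpha> b"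
   unfolding ewald_bound_def by (intro mult_left_mono) auto
   also have "\<dots> <= norm (a - b) powr \<alpha> * (ewald_bound \<alpha> a + ewald_bound \<alpha> b)"
   using True ewald_bound_nonneg[of \<alpha> a] by (simp add: mult_left_mono)
   finally show ?thesis .
  qed (use True in \<open>simp add: ewald_def\<close>)
 next
  case False
  define ra where "ra = norm a"
  define rb where "rb = norm b"
  define h where "h = norm (a - b)"
  define w where "w = exp (- ra\<^sup>2 / 8)"
  have r: "0 < ra" "ra <= rb" "0 < rb" using False le by (auto simp: ra_def rb_def)
  have bn: "b \<noteq> 0" using r by (auto simp: rb_def)
  have hr: "rb - ra <= h" unfolding h_def ra_def rb_def by (metis norm_minus_commute norm_triangle_ineq2)
  have h0: "h >= 0" by (simp add: h_def)
  have Ea: "exp (- ra\<^sup>2 / 4) <= w" by (simp add: w_def)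
  have Eb: "exp (- rb\<^sup>2 / 4) <= w"
  proof -
   have "ra\<^sup>2 <= rb\<^sup>2" using r by (intro power_mono) auto
   then show ?thesis by (simp add: w_def) (smt (verit) zero_le_power2)
  qed
  let ?p = "%z :: real^2. ((1 / (norm z)\<^sup>2) *\<^sub>R z) $ j"
  have p1: "\<bar>?p a - ?p b\<bar> <= h / (ra * rb)"
   using component_le_norm_cart[of "(1 / (norm a)\<^sup>2) *\<^sub>R a - (1 / (norm b)\<^sup>2) *\<^sub>R b" j]
   norm_inversion_diff[OF False bn] by (simp add: h_def ra_def rb_def)
  have p2: "\<bar>?p a\<bar> <= 1 / ra"
   using component_le_norm_cart[of "(1 / (norm a)\<^sup>2) *\<^sub>R a" j] False
   by (simp add: ra_def power2_eq_square)
  have ew: "2 * pi * ewald j z = ?p z * exp (- (norm z)\<^sup>2 / 4)" for z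
   by (simp add: ewald_def)
  \<comment> \<open>A product-rule splitting: increments of the inversion are weighted by the
    smaller Gaussian, increments of the Gaussian by at most 1/ra.\<close>
  have "2 * pi * (ewald j a - ewald j b) =
   (?p a - ?p b) * exp (- rb\<^sup>2 / 4) + ?p a * (exp (- ra\<^sup>2 / 4) - exp (- rb\<^sup>2 / 4))"
   unfolding right_diff_distrib ew ra_def rb_def by (simp add: algebra_simps)
  also have "\<bar>\<dots>\<bar> <= \<bar>?p a - ?p b\<bar> * exp (- rb\<^sup>2 / 4) + \<bar>?p a\<bar> * \<bar>exp (- ra\<^sup>2 / 4) - exp (- rb\<^sup>2 / 4)\<bar>"
   by (rule order_trans[OF abs_triangle_ineq]) (simp add: abs_mult)
  also have "\<dots> <= h / (ra * rb) * w + 1 / ra * (h * w)"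
  proof (intro add_mono mult_mono p1 p2 Eb)
   have "exp (- rb\<^sup>2 / 4) <= exp (- ra\<^sup>2 / 4)" using r by (simp add: power_mono)
   then have "\<bar>exp (- ra\<^sup>2 / 4) - exp (- rb\<^sup>2 / 4)\<bar> <= (rb - ra) * w"
   using gauss_diff_le[of ra rb] r by (simp add: w_def)
   also have "\<dots> <= h * w" using hr by (intro mult_right_mono) (auto simp: w_def)
   finally show "\<bar>exp (- ra\<^sup>2 / 4) - exp (- rb\<^sup>2 / 4)\<bar> <= h * w" .
  qed (use r h0 in auto)
  also have "\<dots> <= (w / ra) * (h * (1 + 1 / ra))"
  proof -
   have "h / (ra * rb) * w + 1 / ra * (h * w) = (w / ra) * (h * (1 + 1 / rb))"
   using r by (simp add: field_simps)
   also have "\<dots> <= (w / ra) * (h * (1 + 1 / ra))"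
   using r h0 by (intro mult_left_mono add_mono) (auto simp: w_def frac_le)
   finally show ?thesis .
  qed
  finally have b1: "2 * pi * \<bar>ewald j a - ewald j b\<bar> <= (w / ra) * (h * (1 + 1 / ra))"
   by (simp add: abs_mult)
  have b2: "2 * pi * \<bar>ewald j a - ewald j b\<bar> <= (w / ra) * 2"
  proof -
   have "2 * pi * \<bar>ewald j a\<bar> <= exp (- ra\<^sup>2 / 4) / ra"
   using abs_ewald_le[of j a] r by (simp add: field_simps ra_def)
   also have "\<dots> <= w / ra" using r Ea by (simp add: divide_right_mono)
   finally have 1: "2 * pi * \<bar>ewald j a\<bar> <= w / ra" .
   have "2 * pi * \<bar>ewald j b\<bar> <= exp (- rb\<^sup>2 / 4) / rb"
   using abs_ewald_le[of j b] r by (simp add: field_simps rb_def)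
   also have "\<dots> <= w / ra" using r Eb by (intro frac_le) (auto simp: w_def)
   finally have 2: "2 * pi * \<bar>ewald j b\<bar> <= w / ra" .
   have "2 * pi * \<bar>ewald j a - ewald j b\<bar> <= 2 * pi * (\<bar>ewald j a\<bar> + \<bar>ewald j b\<bar>)"
   by (intro mult_left_mono) auto
   also have "\<dots> <= w / ra + w / ra" unfolding distrib_left by (intro add_mono 1 2)
   finally show ?thesis by (simp add: mult.commute)
  qed
  \<comment> \<open>In this variable the two bounds are (w / ra) * y and 2 * (w / ra), both covered
    by 2 * (w / ra) * min y 1 in their ranges.\<close>
  define y where "y = h * (1 + 1 / ra)"
  have y0: "y >= 0" using h0 r by (simp add: y_def)
  have "min y 1 <= y powr \<alpha>"
  proof (cases "y >= 1")
   case True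
   then show ?thesis using assms ge_one_powr_ge_zero[of y \<alpha>] by simp
  next
   case False
   show ?thesis
   proof (cases "y = 0")
   case False
   then have "y powr 1 <= y powr \<alpha>" using y0 assms \<open>\<not> y >= 1\<close> by (intro powr_mono') auto
   then show ?thesis using y0 False by simp
   qed simp
  qed
  also have "y powr \<alpha> = h powr \<alpha> * (1 + 1 / ra) powr \<alpha>"
   using h0 r by (simp add: y_def powr_mult)
  also have "\<dots> <= h powr \<alpha> * (1 + 1 / ra powr \<alpha>)"
   using powr_subadd[of 1 "1 / ra" \<alpha>] r assms by (intro mult_left_mono) (auto simp: powr_divide)
  finally have "min y 1 <= h powr \<alpha> * (1 + 1 / ra powr \<alpha>)" .
  then have m: "2 * (w / ra) * min y 1 <= 2 * (w / ra) * (h powr \<alpha> * (1 + 1 / ra powr \<alpha>))"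
   using r by (intro mult_left_mono) (auto simp: w_def)
  have "2 * pi * \<bar>ewald j a - ewald j b\<bar> <= 2 * (w / ra) * min y 1"
  proof (cases "y <= 1")
   case True
   have "0 <= (w / ra) * y" using r y0 by (simp add: w_def)
   then have "(w / ra) * y <= 2 * (w / ra) * y" by linarith
   then show ?thesis using b1 True by (simp add: y_def)
  qed (use b2 in \<open>simp add: mult.commute\<close>)
  also note m
  also have "2 * (w / ra) * (h powr \<alpha> * (1 + 1 / ra powr \<alpha>)) = 2 * (h powr \<alpha> * ewald_bound \<alpha> a)"
   using r by (simp add: ewald_bound_def w_def ra_def powr_add field_simps)
  finally have "pi * \<bar>ewald j a - ewald j b\<bar> <= h powr \<alpha> * ewald_bound \<alpha> a" by simp
  moreover have "1 * \<bar>ewald j a - ewald j b\<bar> <= pi * \<bar>ewald j a - ewald j b\<bar>"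
   using pi_gt3 by (intro mult_right_mono) auto
  moreover have "h powr \<alpha> * ewald_bound \<alpha> a <= h powr \<alpha> * (ewald_bound \<alpha> a + ewald_bound \<alpha> b)"
   using ewald_bound_nonneg[of \<alpha> b] by (intro mult_left_mono) auto
  ultimately show ?thesis by (simp add: h_def)
 qed
 show ?thesis
 proof (cases "norm a <= norm b")
  case True then show ?thesis by (rule main)
 next
  case False
  then show ?thesis using main[of b a] by (simp add: norm_minus_commute abs_minus_commute add.commute)
 qed
qed

lemma borel_measurable_vec_nth [measurable (raw)]:
 fixes f :: "'b => real^'n"
 assumes "f \<in> BM N" shows "(%x. f x $ i) \<in> BM N"
 by (rule measurable_compose[OF assms borel_measurable_nth])

text \<open>Write |z|^-\<beta> as the integral of \<beta> r^(-\<beta> - 1) over r > |z| and exchange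
  the order. Discs of radius r < 1 have area at most 4 r^2, larger ones carry at most the total
  Gaussian mass. The factor 1/(2 - \<beta>), taken at \<beta> = 1 + \<alpha>, is the origin of every
  1/(1 - \<alpha>) below.\<close>

lemma nn_integral_inverse_norm_le:
 assumes "1 <= \<beta>" "\<beta> < 2"
 shows "(\<integral>\<^sup>+z. ennreal (exp (- (norm z)\<^sup>2 / 8) * (1 / norm z powr \<beta>)) \<partial>(lborel :: (real^2) measure))
  <= ennreal (4 * \<beta> / (2 - \<beta>) + (LINT z|(lborel :: (real^2) measure). exp (- (norm z)\<^sup>2 / 8)))"
proof -
 let ?e = "%z :: real^2. exp (- (norm z)\<^sup>2 / 8)"
 let ?E = "LINT z|(lborel :: (real^2) measure). ?e z"
 let ?k = "%r :: real. \<beta> * r powr (- \<beta> - 1)"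
 have ei: "integrable lborel ?e" using gauss_integrable_plane[of 2] by simp
 have E0: "?E >= 0" by simp
 have tail: "(\<integral>\<^sup>+r. ennreal (?k r) * indicator {a..} r \<partial>lborel) = ennreal (1 / a powr \<beta>)" if "a > 0" for a
 proof -
  have "(\<integral>\<^sup>+r. ennreal (?k r) * indicator {a..} r \<partial>lborel) = ennreal (0 - (- (a powr (- \<beta>))))"
  proof (rule nn_integral_FTC_atLeast)
   show "((%r. - (r powr (- \<beta>))) has_real_derivative ?k r) (at r)" if "a <= r" for r
   using that \<open>a > 0\<close> by (auto intro!: derivative_eq_intros simp: field_simps)
   show "((%r. - (r powr (- \<beta>))) \<longlongrightarrow> 0) at_top" using assms by real_asymp
  qed (use assms in auto)
  then show ?thesis by (simp add: powr_minus_divide)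
 qed
 have vol: "emeasure lborel {z :: real^2. norm z <= r} <= ennreal (4 * r\<^sup>2)" if "r >= 0" for r
 proof -
  have "emeasure lborel {z :: real^2. norm z <= r} =
   emeasure (lborel \<Otimes>\<^sub>M lborel) (vec2 -` {z. norm z <= r})"
   unfolding distr_vec2[symmetric]
   by (subst emeasure_distr) (auto simp: lborel_prod space_pair_measure)
  also have "\<dots> <= emeasure (lborel \<Otimes>\<^sub>M lborel) ({- r..r} \<times> {- r..r})"
  proof (rule emeasure_mono)
   show "vec2 -` {z. norm z <= r} \<subseteq> {- r..r} \<times> {- r..r}"
   proof
   fix p assume "p \<in> vec2 -` {z. norm z <= r}"
   then have "norm (vec2 p) <= r" by simp
   then have "\<bar>vec2 p $ 1\<bar> <= r" "\<bar>vec2 p $ 2\<bar> <= r"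
   using component_le_norm_cart[of "vec2 p" 1] component_le_norm_cart[of "vec2 p" 2]
   by linarith+
   then show "p \<in> {- r..r} \<times> {- r..r}" by (cases p) auto
   qed
  qed (auto simp: lborel_prod)
  also have "\<dots> = emeasure lborel {- r..r} * emeasure lborel {- r..r}"
   by (rule lborel.emeasure_pair_measure_Times) auto
  also have "\<dots> = ennreal (4 * r\<^sup>2)"
   using that by (simp add: ennreal_mult[symmetric] power2_eq_square)
  finally show ?thesis .
 qed
 have "(\<integral>\<^sup>+z. ennreal (?e z * (1 / norm z powr \<beta>)) \<partial>(lborel :: (real^2) measure)) \<le>
   (\<integral>\<^sup>+z. (\<integral>\<^sup>+r. ennreal (?e z) * (ennreal (?k r) * indicator {norm z..} r) \<partial>lborel) \<partial>lborel)"
 proof (rule nn_integral_mono)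
  fix z :: "real^2"
  show "ennreal (?e z * (1 / norm z powr \<beta>)) \<le>
   (\<integral>\<^sup>+r. ennreal (?e z) * (ennreal (?k r) * indicator {norm z..} r) \<partial>lborel)"
  proof (cases "z = 0")
   case False
   then show ?thesis
   by (subst nn_integral_cmult) (simp_all add: tail ennreal_mult[symmetric])
  qed simp
 qed
 also have "\<dots> = (\<integral>\<^sup>+r. (\<integral>\<^sup>+z. ennreal (?e z) * (ennreal (?k r) * indicator {norm z..} r) \<partial>lborel) \<partial>lborel)"
 proof (rule lborel_pair.Fubini'[symmetric])
  have [measurable]: "Measurable.pred (borel \<Otimes>\<^sub>M borel) (%p :: (real^2) \<times> real. norm (fst p) <= snd p)"
   by measurable
  have "(%(z :: real^2, r). ennreal (?e z) * (ennreal (?k r) * indicator {p :: (real^2) \<times> real. norm (fst p) <= snd p} (z, r)))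
   \<in> BM (lborel \<Otimes>\<^sub>M lborel)" by measurable
  then show "(%(z :: real^2, r). ennreal (?e z) * (ennreal (?k r) * indicator {norm z..} r))
   \<in> BM (lborel \<Otimes>\<^sub>M lborel)"
   by (simp add: indicator_def)
 qed
 also have "\<dots> <= (\<integral>\<^sup>+r. ennreal (4 * \<beta> * r powr (1 - \<beta>)) * indicator {0..1} r
   + ennreal ?E * (ennreal (?k r) * indicator {1..} r) \<partial>lborel)"
 proof (rule nn_integral_mono)
  fix r :: real
  have eq: "(\<integral>\<^sup>+z. ennreal (?e z) * (ennreal (?k r) * indicator {norm z..} r) \<partial>lborel) =
   ennreal (?k r) * (\<integral>\<^sup>+z. ennreal (?e z) * indicator {z. norm z <= r} z \<partial>lborel)"
   by (subst nn_integral_cmult[symmetric]) (auto simp: indicator_def mult.commute intro!: nn_integral_cong)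
  consider "r <= 0" | "0 < r" "r < 1" | "1 <= r" by linarith
  then show "(\<integral>\<^sup>+z. ennreal (?e z) * (ennreal (?k r) * indicator {norm z..} r) \<partial>lborel) \<le>
   ennreal (4 * \<beta> * r powr (1 - \<beta>)) * indicator {0..1} r
   + ennreal ?E * (ennreal (?k r) * indicator {1..} r)"
  proof cases
   case 1
   then have "r = 0 \<or> {z :: real^2. norm z <= r} = {}" by (auto dest: order_trans[OF norm_ge_zero])
   then have "(\<integral>\<^sup>+z. ennreal (?e z) * (ennreal (?k r) * indicator {norm z..} r) \<partial>lborel) = 0"
   unfolding eq by auto
   then show ?thesis by simp
  next
   case 2
   have "(\<integral>\<^sup>+z. ennreal (?e z) * indicator {z. norm z <= r} z \<partial>lborel) \<le>
   (\<integral>\<^sup>+z. indicator {z :: real^2. norm z <= r} z \<partial>lborel)"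
   by (intro nn_integral_mono) (auto simp: indicator_def)
   also have "\<dots> = emeasure lborel {z :: real^2. norm z <= r}" by simp
   also have "\<dots> <= ennreal (4 * r\<^sup>2)" using 2 by (intro vol) auto
   finally have "ennreal (?k r) * (\<integral>\<^sup>+z. ennreal (?e z) * indicator {z. norm z <= r} z \<partial>lborel)
   <= ennreal (?k r) * ennreal (4 * r\<^sup>2)" by (intro mult_left_mono) auto
   also have "\<dots> = ennreal (4 * \<beta> * r powr (1 - \<beta>))"
   proof -
   have "r powr (- \<beta> - 1) * r\<^sup>2 = r powr (1 - \<beta>)"
   using 2 powr_add[of r "- \<beta> - 1" 2] by (simp add: powr_numeral)
   then have "?k r * (4 * r\<^sup>2) = 4 * \<beta> * r powr (1 - \<beta>)"
   by (metis (no_types, opaque_lifting) mult.assoc mult.commute)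
   then show ?thesis using assms by (simp add: ennreal_mult[symmetric])
   qed
   finally show ?thesis unfolding eq using 2 by simp
  next
   case 3
   have "(\<integral>\<^sup>+z. ennreal (?e z) * indicator {z. norm z <= r} z \<partial>lborel) <= (\<integral>\<^sup>+z. ennreal (?e z) \<partial>lborel)"
   by (intro nn_integral_mono) (auto simp: indicator_def)
   also have "\<dots> = ennreal ?E" by (rule nn_integral_eq_integral[OF ei]) simp
   finally have "ennreal (?k r) * (\<integral>\<^sup>+z. ennreal (?e z) * indicator {z. norm z <= r} z \<partial>lborel)
   <= ennreal (?k r) * ennreal ?E" by (intro mult_left_mono) auto
   then show ?thesis unfolding eq using 3 by (simp add: mult.commute add_increasing)
  qed
 qed
 also have "\<dots> = (\<integral>\<^sup>+r. ennreal (4 * \<beta> * r powr (1 - \<beta>)) * indicator {0..1} r \<partial>lborel)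
   + ennreal ?E * (\<integral>\<^sup>+r. ennreal (?k r) * indicator {1..} r \<partial>lborel)"
  by (subst nn_integral_add) (auto simp: nn_integral_cmult)
 also have "(\<integral>\<^sup>+r. ennreal (4 * \<beta> * r powr (1 - \<beta>)) * indicator {0..1} r \<partial>lborel) =
   ennreal (4 * \<beta> * (1 powr (1 - \<beta> + 1) / (1 - \<beta> + 1)))"
  using assms
  by (intro nn_integral_has_integral_lebesgue' has_integral_mult_right has_integral_powr_from_0) auto
 also have "ennreal ?E * (\<integral>\<^sup>+r. ennreal (?k r) * indicator {1..} r \<partial>lborel) = ennreal ?E"
  by (simp add: tail)
 finally show ?thesis using assms E0 by (simp add: ennreal_plus[symmetric] del: ennreal_plus)
qed

lemma nn_integral_ewald_bound:
 obtains C where "C >= 0" "!!\<alpha>. 1/2 <= \<alpha> ==> \<alpha> < 1 ==>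
  (\<integral>\<^sup>+z. ennreal (ewald_bound \<alpha> z) \<partial>lborel) <= ennreal (C / (1 - \<alpha>))"
proof
 let ?E = "LINT z|(lborel :: (real^2) measure). exp (- (norm z)\<^sup>2 / 8)"
 have E0: "?E >= 0" by simp
 \<comment> \<open>4 stems from the power 1, 8 bounds the 4 (1 + \<alpha>) of the power 1 +
   \<alpha>, and each power contributes one Gaussian mass.\<close>
 show "12 + 2 * ?E >= 0" using E0 by linarith
 fix \<alpha> :: real assume \<alpha>: "1/2 <= \<alpha>" "\<alpha> < 1"
 have "(\<integral>\<^sup>+z. ennreal (ewald_bound \<alpha> z) \<partial>lborel) =
   (\<integral>\<^sup>+z. ennreal (exp (- (norm z)\<^sup>2 / 8) * (1 / norm z powr 1))
   + ennreal (exp (- (norm z)\<^sup>2 / 8) * (1 / norm z powr (1 + \<alpha>))) \<partial>(lborel :: (real^2) measure))"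
  by (intro nn_integral_cong) (simp add: ewald_bound_def ennreal_plus[symmetric] distrib_left del: ennreal_plus)
 also have "\<dots> = (\<integral>\<^sup>+z. ennreal (exp (- (norm z)\<^sup>2 / 8) * (1 / norm z powr 1)) \<partial>(lborel :: (real^2) measure))
   + (\<integral>\<^sup>+z. ennreal (exp (- (norm z)\<^sup>2 / 8) * (1 / norm z powr (1 + \<alpha>))) \<partial>(lborel :: (real^2) measure))"
  by (rule nn_integral_add) measurable
 also have "\<dots> <= ennreal (4 * 1 / (2 - 1) + ?E) + ennreal (4 * (1 + \<alpha>) / (2 - (1 + \<alpha>)) + ?E)"
  using \<alpha> by (intro add_mono nn_integral_inverse_norm_le) auto
 also have "\<dots> = ennreal ((4 + ?E) + (4 * (1 + \<alpha>) / (1 - \<alpha>) + ?E))"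
  using \<alpha> E0 by (simp add: ennreal_plus[symmetric] del: ennreal_plus)
 also have "\<dots> <= ennreal ((12 + 2 * ?E) / (1 - \<alpha>))"
 proof (rule ennreal_leI)
  have "(4 + ?E) + ?E <= (4 + 2 * ?E) / (1 - \<alpha>)"
  proof -
   have "(4 + 2 * ?E) * (1 - \<alpha>) <= (4 + 2 * ?E) * 1" using \<alpha> E0 by (intro mult_left_mono) auto
   then have "4 + 2 * ?E <= (4 + 2 * ?E) / (1 - \<alpha>)" using \<alpha> by (simp add: pos_le_divide_eq)
   then show ?thesis by linarith
  qed
  moreover have "4 * (1 + \<alpha>) / (1 - \<alpha>) <= 8 / (1 - \<alpha>)" using \<alpha> by (intro divide_right_mono) auto
  ultimately have "(4 + ?E) + (4 * (1 + \<alpha>) / (1 - \<alpha>) + ?E) <= (4 + 2 * ?E) / (1 - \<alpha>) + 8 / (1 - \<alpha>)"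
   by linarith
  also have "\<dots> = (12 + 2 * ?E) / (1 - \<alpha>)" by (simp add: add_divide_distrib[symmetric])
  finally show "(4 + ?E) + (4 * (1 + \<alpha>) / (1 - \<alpha>) + ?E) <= (12 + 2 * ?E) / (1 - \<alpha>)" .
 qed
 finally show "(\<integral>\<^sup>+z. ennreal (ewald_bound \<alpha> z) \<partial>lborel) <= ennreal ((12 + 2 * ?E) / (1 - \<alpha>))" .
qed

lemma integrable_ewald: "integrable lborel (ewald j)"
proof (rule integrableI_bounded)
 obtain C where C: "!!\<alpha>. 1/2 <= \<alpha> ==> \<alpha> < 1 ==>
  (\<integral>\<^sup>+z. ennreal (ewald_bound \<alpha> z) \<partial>lborel) <= ennreal (C / (1 - \<alpha>))"
  using nn_integral_ewald_bound by blast
 have "(\<integral>\<^sup>+z. ennreal (norm (ewald j z)) \<partial>lborel) <= (\<integral>\<^sup>+z. ennreal (ewald_bound (1/2) z) \<partial>lborel)"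
 proof (intro nn_integral_mono ennreal_leI)
  fix z :: "real^2"
  show "norm (ewald j z) <= ewald_bound (1/2) z"
  proof (cases "z = 0")
   case False
   have "norm (ewald j z) <= exp (- (norm z)\<^sup>2 / 4) / (2 * pi * norm z)"
   using abs_ewald_le[of j z] by simp
   also have "\<dots> <= exp (- (norm z)\<^sup>2 / 8) / (1 * norm z)"
   using False pi_gt3 by (intro frac_le mult_right_mono) auto
   also have "\<dots> <= ewald_bound (1/2) z" by (simp add: ewald_bound_def distrib_left)
   finally show ?thesis .
  qed (simp add: ewald_def ewald_bound_nonneg)
 qed
 also have "\<dots> <= ennreal (C / (1 - 1/2))" by (rule C) auto
 also have "\<dots> < \<infinity>" by simp
 finally show "(\<integral>\<^sup>+z. ennreal (norm (ewald j z)) \<partial>lborel) < \<infinity>" .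
qed simp

text \<open>exp(-R^2/(4 t)) / (2 pi R^2) is an antiderivative in t and tends to 0 with t. For R =
  |z| and with the factor z $ j this exhibits \<open>ewald\<close> as a superposition of
  Gaussians.\<close>

lemma
 fixes R :: real
 assumes "R > 0"
 defines "q \<equiv> %t. indicator {0<..<1::real} t * (exp (- R\<^sup>2 / (4 * t)) / (8 * pi * t\<^sup>2))"
 shows heat_time_integrable: "integrable lborel q"
  and heat_time_integral: "(LBINT t. q t) = exp (- R\<^sup>2 / 4) / (2 * pi * R\<^sup>2)"
proof -
 have R: "R \<noteq> 0" using assms(1) by simp
 let ?F = "%t. exp (- R\<^sup>2 / (4 * t)) / (2 * pi * R\<^sup>2)"
 let ?f = "%t. exp (- R\<^sup>2 / (4 * t)) / (8 * pi * t\<^sup>2)"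
 have "((%t. exp (- R\<^sup>2 / (4 * t)) / (2 * pi * R\<^sup>2)) \<longlongrightarrow> 0) (at_right 0)"
  using assms(1) by real_asymp
 then have A: "((?F \<circ> real_of_ereal) \<longlongrightarrow> 0) (at_right (ereal 0))"
  unfolding ereal_tendsto_simps1 .
 have "isCont ?F 1" using R by (intro continuous_intros) auto
 then have "(?F \<longlongrightarrow> ?F 1) (at_left 1)" by (simp add: isCont_def filterlim_at_split)
 then have B: "((?F \<circ> real_of_ereal) \<longlongrightarrow> ?F 1) (at_left (ereal 1))"
  unfolding ereal_tendsto_simps1 .
 have D: "(?F has_real_derivative ?f t) (at t)" if "ereal 0 < ereal t" "ereal t < ereal 1" for t
 proof -
  have t: "t > 0" using that by simp
  have "((%t. - R\<^sup>2 / (4 * t)) has_real_derivative R\<^sup>2 / (4 * t\<^sup>2)) (at t)"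
   using t by (auto intro!: derivative_eq_intros simp: power2_eq_square field_simps)
  then have "(?F has_real_derivative exp (- R\<^sup>2 / (4 * t)) * (R\<^sup>2 / (4 * t\<^sup>2)) / (2 * pi * R\<^sup>2)) (at t)"
   by (intro DERIV_cdivide DERIV_fun_exp)
  moreover have "exp (- R\<^sup>2 / (4 * t)) * (R\<^sup>2 / (4 * t\<^sup>2)) / (2 * pi * R\<^sup>2) = ?f t"
   using R t by (simp add: field_simps)
  ultimately show ?thesis by simp
 qed
 have c: "isCont ?f t" if "ereal 0 < ereal t" "ereal t < ereal 1" for t
  using that by (intro continuous_intros) auto
 have p: "AE t in lborel. ereal 0 < ereal t \<longrightarrow> ereal t < ereal 1 \<longrightarrow> 0 <= ?f t" by simp
 have ei: "einterval (ereal 0) (ereal 1) = {0<..<1}" by (auto simp: einterval_def)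
 note FTC = interval_integral_FTC_nonneg[OF _ D c p A B, simplified ei]
 show "integrable lborel q" using FTC(1) by (simp add: set_integrable_def q_def)
 show "(LBINT t. q t) = exp (- R\<^sup>2 / 4) / (2 * pi * R\<^sup>2)"
  using FTC(2) by (simp add: interval_lebesgue_integral_def ei set_lebesgue_integral_def q_def)
qed

text \<open>Fubini reduces the sine transform to that of Gaussians; there remains the integral of
  exp(-|C|^2 t) over 0 < t < 1. Its upper end leaves the term exp(-|C|^2), which
  \<open>smooth_coeff\<close> compensates.\<close>

lemma ewald_sin:
 fixes C :: "real^2"
 shows "(LINT z|lborel. ewald j z * sin (C \<bullet> z)) = C $ j * (1 - exp (- (norm C)\<^sup>2)) / (norm C)\<^sup>2"
proof (cases "C = 0")
 case False
 define q where "q = (%(z :: real^2) t. indicator {0<..<1::real} t * (exp (- (norm z)\<^sup>2 / (4 * t)) / (8 * pi * t\<^sup>2)))"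
 have q0: "q z t >= 0" for z t by (simp add: q_def)
 have qi: "integrable lborel (q z)" "(LBINT t. q z t) = exp (- (norm z)\<^sup>2 / 4) / (2 * pi * (norm z)\<^sup>2)"
  if "z \<noteq> 0" for z
  using heat_time_integrable[of "norm z"] heat_time_integral[of "norm z"] that by (simp_all add: q_def)
 have meas: "(%(z, t). z $ j * q z t * sin (C \<bullet> z)) \<in> BM (lborel \<Otimes>\<^sub>M lborel)"
 proof -
  have [measurable]: "(%p. q (fst p) (snd p)) \<in> BM (lborel \<Otimes>\<^sub>M lborel)"
   "(%p. fst p $ j :: real) \<in> BM (lborel \<Otimes>\<^sub>M (lborel :: real measure))"
   unfolding q_def by measurable
  show ?thesis unfolding split_beta' by measurable
 qed
 have int: "integrable lborel (%t. z $ j * q z t * sin (C \<bullet> z))" for z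
  by (cases "z = 0") (use qi in auto)
 have abs: "(LBINT t. norm (z $ j * q z t * sin (C \<bullet> z))) = norm (ewald j z * sin (C \<bullet> z))" for z
 proof (cases "z = 0")
  case False
  then show ?thesis
   using q0 by (simp add: abs_mult qi(2) ewald_def)
 qed (simp add: ewald_def)
 have val: "(LBINT t. z $ j * q z t * sin (C \<bullet> z)) = ewald j z * sin (C \<bullet> z)" for z
 proof (cases "z = 0")
  case False
  then show ?thesis by (simp add: qi(2) ewald_def)
 qed (simp add: ewald_def)
 have "integrable lborel (%z. ewald j z * sin (C \<bullet> z))"
  by (intro integrable_bounded_mult integrable_ewald) auto
 then have I: "integrable (lborel \<Otimes>\<^sub>M lborel) (%(z, t). z $ j * q z t * sin (C \<bullet> z))"
  by (intro lborel_pair.Fubini_integrable) (use int meas in \<open>auto simp: abs simp del: norm_mult real_norm_def intro: integrable_norm\<close>)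
 have "(LINT z|lborel. ewald j z * sin (C \<bullet> z)) = (LINT z|lborel. (LBINT t. z $ j * q z t * sin (C \<bullet> z)))"
  by (simp only: val)
 also have "\<dots> = (LBINT t. (LINT z|lborel. z $ j * q z t * sin (C \<bullet> z)))"
  using lborel_pair.integral_fst[OF I] lborel_pair.integral_snd[OF I] by simp
 also have "\<dots> = (LBINT t. indicator {0<..<1} t * (C $ j * exp (- (norm C)\<^sup>2 * t)))"
 proof (rule Bochner_Integration.integral_cong[OF refl])
  fix t :: real
  show "(LINT z|lborel. z $ j * q z t * sin (C \<bullet> z)) = indicator {0<..<1} t * (C $ j * exp (- (norm C)\<^sup>2 * t))"
  proof (cases "t \<in> {0<..<1}")
   case True
   have "(LINT z|lborel. z $ j * q z t * sin (C \<bullet> z)) =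
   (LINT z|lborel. (1 / (8 * pi * t\<^sup>2)) * (z $ j * exp (- (norm z)\<^sup>2 / (4 * t)) * sin (C \<bullet> z)))"
   using True by (simp add: q_def)
   then show ?thesis
   using True unfolding integral_mult_right_zero by (subst (asm) gauss_sin_moment_plane) auto
  qed (simp add: q_def)
 qed
 also have "\<dots> = (LBINT t=ereal 0..ereal 1. C $ j * exp (- (norm C)\<^sup>2 * t))"
  by (simp add: interval_lebesgue_integral_def set_lebesgue_integral_def einterval_def greaterThanLessThan_def
   greaterThan_def lessThan_def Int_def mult.left_commute)
 also have "\<dots> = (- C $ j / (norm C)\<^sup>2 * exp (- (norm C)\<^sup>2 * 1)) - (- C $ j / (norm C)\<^sup>2 * exp (- (norm C)\<^sup>2 * 0))"
  using False
  by (intro interval_integral_FTC_finite[where F = "%t. - C $ j / (norm C)\<^sup>2 * exp (- (norm C)\<^sup>2 * t)"])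
   (auto intro!: continuous_intros derivative_eq_intros
   simp: has_real_derivative_iff_has_vector_derivative[symmetric] power2_eq_square power4_eq_xxxx)
 finally show ?thesis by (simp add: right_diff_distrib diff_divide_distrib)
qed simp

lemma ewald_cos: "(LINT z|lborel. ewald j z * cos (C \<bullet> z)) = 0"
 by (rule integral_odd_zero) (auto simp: ewald_def)

section \<open>Lattice sums of the short-time kernel\<close>

interpretation torus_latt: pair_sigma_finite TL "count_space (UNIV :: (int \<times> int) set)"
 by (intro pair_sigma_finite.intro torus.sigma_finite_measure_axioms
   sigma_finite_measure_count_space)

lemma measurable_unfold_map [measurable]:
 "(%(x, n). sec x + latt n) \<in> TL \<Otimes>\<^sub>M count_space UNIV \<rightarrow>\<^sub>M borel"
 unfolding split_beta
 by (rule measurable_compose_countable'[where f = "%n p. sec (fst p) + latt n" and g = snd]) auto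

text \<open>Unfolding as an identity of measures, in which form it also serves Bochner integrals of
  signed functions.\<close>

lemma distr_unfold:
 "distr (TL \<Otimes>\<^sub>M count_space UNIV) borel (%(x, n). sec x + latt n) = lborel"
proof (rule measure_eqI)
 fix A assume "A \<in> sets (distr (TL \<Otimes>\<^sub>M count_space UNIV) borel (%(x, n). sec x + latt n))"
 then have [measurable]: "A \<in> sets borel" by simp
 have "emeasure (distr (TL \<Otimes>\<^sub>M count_space UNIV) borel (%(x, n). sec x + latt n)) A =
   (\<integral>\<^sup>+v. indicator A v \<partial>distr (TL \<Otimes>\<^sub>M count_space UNIV) borel (%(x, n). sec x + latt n))"
  by simp
 also have "\<dots> = (\<integral>\<^sup>+p. indicator A (case p of (x, n) => sec x + latt n) \<partial>(TL \<Otimes>\<^sub>M count_space UNIV))"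
  by (rule nn_integral_distr) auto
 also have "\<dots> = (\<integral>\<^sup>+x. (\<integral>\<^sup>+n. indicator A (sec x + latt n) \<partial>count_space UNIV) \<partial>TL)"
  by (subst torus_latt.M2.nn_integral_fst[symmetric]) (auto simp: split_beta')
 also have "\<dots> = (\<integral>\<^sup>+v. indicator A v \<partial>lborel)"
  by (rule nn_integral_unfold[symmetric]) simp
 finally show "emeasure (distr (TL \<Otimes>\<^sub>M count_space UNIV) borel (%(x, n). sec x + latt n)) A
   = emeasure lborel A" by simp
qed simp

lemma integrable_unfold:
 fixes F :: "real^2 => real"
 assumes "integrable lborel F"
 shows "integrable (TL \<Otimes>\<^sub>M count_space UNIV) (%(x, n). F (sec x + latt n))"
proof -
 have [measurable]: "F \<in> BM borel" using assms by auto
 show ?thesis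
  using assms unfolding distr_unfold[symmetric]
  by (subst (asm) integrable_distr_eq) (auto simp: split_beta')
qed

lemma integral_unfold:
 fixes F :: "real^2 => real"
 assumes F: "integrable lborel F"
 shows "(LINT v|lborel. F v) = (LINT x|TL. (LINT n|count_space UNIV. F (sec x + latt n)))"
proof -
 have [measurable]: "F \<in> BM borel" using F by auto
 have "(LINT v|lborel. F v) = (LINT p|(TL \<Otimes>\<^sub>M count_space UNIV). F (case p of (x, n) => sec x + latt n))"
  unfolding distr_unfold[symmetric] by (subst integral_distr) auto
 also have "\<dots> = (LINT x|TL. (LINT n|count_space UNIV. F (sec x + latt n)))"
  using torus_latt.integral_fst[OF integrable_unfold[OF F]] by (simp add: split_beta')
 finally show ?thesis .
qed

text \<open>Where the lattice sum does not converge absolutely, the Bochner integral is 0 by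
  default. Summability is known almost everywhere and is carried along as a side condition.\<close>

definition ewald_sum :: "2 => torus2 => real" where
 "ewald_sum j x = (LINT n|count_space UNIV. ewald j (sec x + latt n))"

definition ewald_bound_sum :: "real => torus2 => ennreal" where
 "ewald_bound_sum \<alpha> x = (\<integral>\<^sup>+n. ennreal (ewald_bound \<alpha> (sec x + latt n)) \<partial>count_space UNIV)"

lemma borel_measurable_ewald_bound_sum [measurable]: "ewald_bound_sum \<alpha> \<in> BM borel"
 unfolding ewald_bound_sum_def by measurable

lemma nn_integral_ewald_bound_sum:
 "(\<integral>\<^sup>+x. ewald_bound_sum \<alpha> x \<partial>TL) = (\<integral>\<^sup>+z. ennreal (ewald_bound \<alpha> z) \<partial>lborel)"
 unfolding ewald_bound_sum_def by (rule nn_integral_unfold[symmetric]) simp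

lemma bij_latt_shift: "bij_betw (%n :: int \<times> int. n + m) UNIV UNIV"
 by (rule bij_betwI[where g = "%n. n - m"]) auto

text \<open>Every representative gives the same lattice sum, so y is represented by w = sec x - v
  with v almost shortest, and the pointwise estimate is summed term by term. The factor 2 is the
  cost of |v| <= 2 dist x y in place of a minimiser.\<close>

lemma ewald_sum_holder:
 assumes \<alpha>: "1/2 <= \<alpha>" "\<alpha> < 1"
  and x: "integrable (count_space UNIV) (%n. ewald j (sec x + latt n))"
  and y: "integrable (count_space UNIV) (%n. ewald j (sec y + latt n))"
 shows "ennreal \<bar>ewald_sum j x - ewald_sum j y\<bar> \<le>
  ennreal (2 * dist x y powr \<alpha>) * (ewald_bound_sum \<alpha> x + ewald_bound_sum \<alpha> y)"
proof (cases "x = y")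
 case False
 define d where "d = dist x y"
 have d: "d > 0" using False by (simp add: d_def)
 obtain v where v: "proj v = x - y" "norm v < torus_norm (x - y) + d"
  using torus_norm_less[OF d] by blast
 have v2: "norm v <= 2 * d" using v(2) by (simp add: d_def dist_torus2_def)
 define w where "w = sec x - v"
 have "proj w = proj (sec y)" by (simp add: w_def proj_diff v(1))
 then obtain m where m: "w = sec y + latt m" unfolding proj_eq_iff by blast
 have wn: "w + latt n = sec y + latt (n + m)" for n by (simp add: m latt_add)
 have wi: "integrable (count_space UNIV) (%n. ewald j (w + latt n))"
  unfolding wn
  using integrable_bij_count_space[OF bij_latt_shift, of "%n. ewald j (sec y + latt n)" m] y by simp
 have ws: "ewald_sum j y = (LINT n|count_space UNIV. ewald j (w + latt n))"
  unfolding ewald_sum_def wn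
  using integral_bij_count_space[OF bij_latt_shift, of "%n. ewald j (sec y + latt n)" m] by simp
 have bs: "ewald_bound_sum \<alpha> y = (\<integral>\<^sup>+n. ennreal (ewald_bound \<alpha> (w + latt n)) \<partial>count_space UNIV)"
  unfolding ewald_bound_sum_def wn
  using nn_integral_bij_count_space[OF bij_latt_shift, of "%n. ennreal (ewald_bound \<alpha> (sec y + latt n))" m] by simp
 have "ewald_sum j x - ewald_sum j y =
   (LINT n|count_space UNIV. ewald j (sec x + latt n) - ewald j (w + latt n))"
  unfolding ws unfolding ewald_sum_def by (rule Bochner_Integration.integral_diff[symmetric, OF x wi])
 then have "ennreal \<bar>ewald_sum j x - ewald_sum j y\<bar> =
   ennreal (norm (LINT n|count_space UNIV. ewald j (sec x + latt n) - ewald j (w + latt n)))"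
  by simp
 also have "\<dots> <= (\<integral>\<^sup>+n. ennreal (norm (ewald j (sec x + latt n) - ewald j (w + latt n))) \<partial>count_space UNIV)"
  by (rule integral_norm_bound_ennreal) (intro Bochner_Integration.integrable_diff x wi)
 also have "\<dots> <= (\<integral>\<^sup>+n. ennreal (2 * d powr \<alpha>) * (ennreal (ewald_bound \<alpha> (sec x + latt n))
   + ennreal (ewald_bound \<alpha> (w + latt n))) \<partial>count_space UNIV)"
 proof (rule nn_integral_mono)
  fix n
  have "norm (ewald j (sec x + latt n) - ewald j (w + latt n)) \<le>
   norm v powr \<alpha> * (ewald_bound \<alpha> (sec x + latt n) + ewald_bound \<alpha> (w + latt n))"
   using ewald_holder[OF \<alpha>, of j "sec x + latt n" "w + latt n"] by (simp add: w_def)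
  also have "\<dots> <= (2 * d powr \<alpha>) * (ewald_bound \<alpha> (sec x + latt n) + ewald_bound \<alpha> (w + latt n))"
  proof (intro mult_right_mono)
   have "norm v powr \<alpha> <= (2 * d) powr \<alpha>" using v2 \<alpha> by (intro powr_mono2) auto
   also have "\<dots> = 2 powr \<alpha> * d powr \<alpha>" using d by (simp add: powr_mult)
   also have "\<dots> <= 2 powr 1 * d powr \<alpha>" using \<alpha> by (intro mult_right_mono powr_mono) auto
   finally show "norm v powr \<alpha> <= 2 * d powr \<alpha>" by simp
  qed (simp add: ewald_bound_nonneg)
  finally show "ennreal (norm (ewald j (sec x + latt n) - ewald j (w + latt n))) \<le>
   ennreal (2 * d powr \<alpha>) * (ennreal (ewald_bound \<alpha> (sec x + latt n)) + ennreal (ewald_bound \<alpha> (w + latt n)))"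
   using ewald_bound_nonneg by (simp add: ennreal_leI ennreal_mult[symmetric] ennreal_plus[symmetric] del: ennreal_plus)
 qed
 also have "\<dots> = ennreal (2 * d powr \<alpha>) * (ewald_bound_sum \<alpha> x + ewald_bound_sum \<alpha> y)"
  unfolding bs unfolding ewald_bound_sum_def by (simp add: nn_integral_cmult nn_integral_add)
 finally show ?thesis by (simp add: d_def)
qed simp

lemma integrable_ewald_sum_mult:
 assumes "continuous_on UNIV \<phi>" "!!x. \<bar>\<phi> x\<bar> <= 1"
 shows "AE x in TL. integrable (count_space UNIV) (%n. ewald j (sec x + latt n))"
  and "integrable TL (ewald_sum j)"
  and "(LINT x|TL. ewald_sum j x * \<phi> x) = (LINT z|lborel. ewald j z * \<phi> (proj z))"
proof -
 show "AE x in TL. integrable (count_space UNIV) (%n. ewald j (sec x + latt n))"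
  using torus_latt.AE_integrable_fst[OF integrable_unfold[OF integrable_ewald]] .
 show "integrable TL (ewald_sum j)"
  unfolding ewald_sum_def using torus_latt.integrable_fst[OF integrable_unfold[OF integrable_ewald]] .
 have [measurable]: "\<phi> \<in> BM borel"
  by (rule borel_measurable_continuous_onI[OF assms(1)])
 have "integrable lborel (%z. ewald j z * \<phi> (proj z))"
  by (intro integrable_bounded_mult integrable_ewald) (auto simp: assms(2))
 then show "(LINT x|TL. ewald_sum j x * \<phi> x) = (LINT z|lborel. ewald j z * \<phi> (proj z))"
  by (subst integral_unfold) (simp_all add: proj_add ewald_sum_def)
qed

section \<open>The long-time part: a rapidly convergent sine series\<close>

lemma abs_tcos_le_1: "\<bar>tcos k x\<bar> <= 1" and abs_tsin_le_1: "\<bar>tsin k x\<bar> <= 1"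
 by (simp_all add: tcos_def tsin_def)

lemma latt_norm_ge_1: "k \<noteq> 0 ==> norm (latt k) >= 1"
proof -
 assume "k \<noteq> 0"
 then have "fst k \<noteq> 0 \<or> snd k \<noteq> 0" by (simp add: prod_eq_iff)
 then have "\<bar>latt k $ 1\<bar> >= 1 \<or> \<bar>latt k $ 2\<bar> >= 1" by (auto simp: latt_def)
 then show ?thesis
  using component_le_norm_cart[of "latt k" 1] component_le_norm_cart[of "latt k" 2] by linarith
qed

text \<open>Integrability of a Gaussian over the plane gives, by unfolding, one summable translate
  of the lattice sum. Moving it to the origin uses (p + q)^2 <= 2 p^2 + 2 q^2, which is why the
  exponent 1/8 becomes 1/4.\<close>

lemma gauss_sum_integrable: "integrable (count_space UNIV) (%k. exp (- (norm (latt k))\<^sup>2 / 4))"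
proof -
 have "integrable lborel (%z::real^2. exp (- (norm z)\<^sup>2 / 8))"
  using gauss_integrable_plane[of 2] by simp
 from torus_latt.AE_integrable_fst[OF integrable_unfold[OF this]]
 have "AE x in TL. integrable (count_space UNIV) (%n. exp (- (norm (sec x + latt n))\<^sup>2 / 8))" .
 then have "\<exists>x. integrable (count_space UNIV) (%n. exp (- (norm (sec x + latt n))\<^sup>2 / 8))"
  using torus.AE_False[symmetric] by (metis (mono_tags, lifting) torus.AE_contr eventually_mono)
 then obtain x where x: "integrable (count_space UNIV) (%n. exp (- (norm (sec x + latt n))\<^sup>2 / 8))" ..
 define c where "c = (norm (sec x))\<^sup>2"
 show ?thesis
 proof (rule Bochner_Integration.integrable_bound)
  show "integrable (count_space UNIV) (%n. exp (c / 4) * exp (- (norm (sec x + latt n))\<^sup>2 / 8))"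
   using x by simp
  show "AE n in count_space UNIV. norm (exp (- (norm (latt n))\<^sup>2 / 4)) \<le>
   norm (exp (c / 4) * exp (- (norm (sec x + latt n))\<^sup>2 / 8))"
  proof (rule AE_I2)
   fix n
   have "(norm (sec x + latt n))\<^sup>2 <= (norm (sec x) + norm (latt n))\<^sup>2"
   by (intro power_mono norm_triangle_ineq) auto
   also have "\<dots> <= 2 * c + 2 * (norm (latt n))\<^sup>2"
   using sum_squares_bound[of "norm (sec x)" "norm (latt n)"] by (simp add: c_def power2_sum)
   finally have "- (norm (latt n))\<^sup>2 / 4 <= c / 4 + - (norm (sec x + latt n))\<^sup>2 / 8" by simp
   then show "norm (exp (- (norm (latt n))\<^sup>2 / 4)) \<le>
   norm (exp (c / 4) * exp (- (norm (sec x + latt n))\<^sup>2 / 8))"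
   by (simp add: exp_add[symmetric])
  qed
 qed simp
qed

text \<open>The k-th sine coefficient of the j-th derivative of the heat kernel of the torus, with
  its sign changed, integrated over the times t > 1.\<close>

definition smooth_coeff :: "2 => int \<times> int => real" where
 "smooth_coeff j k = latt k $ j / (2 * pi * (norm (latt k))\<^sup>2) * exp (- (norm ((2 * pi) *\<^sub>R latt k))\<^sup>2)"

definition smooth_part :: "2 => torus2 => real" where
 "smooth_part j x = (LINT k|count_space UNIV. smooth_coeff j k * tsin k x)"

lemma smooth_coeff_bound:
 "\<bar>smooth_coeff j k\<bar> <= exp (- (norm (latt k))\<^sup>2 / 4)"
 "\<bar>smooth_coeff j k\<bar> * norm (latt k) <= exp (- (norm (latt k))\<^sup>2 / 4)"
proof -
 define r where "r = norm (latt k)"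
 have r0: "r >= 0" by (simp add: r_def)
 have e: "exp (- (norm ((2 * pi) *\<^sub>R latt k))\<^sup>2) <= exp (- r\<^sup>2 / 4)"
 proof -
  have "(1/2)\<^sup>2 <= (2 * pi)\<^sup>2" using pi_gt3 by (intro power_mono) auto
  then have "(1/2)\<^sup>2 * r\<^sup>2 <= (2 * pi)\<^sup>2 * r\<^sup>2" by (intro mult_right_mono) auto
  then show ?thesis by (simp add: r_def power_mult_distrib power_divide)
 qed
 have main: "\<bar>smooth_coeff j k\<bar> * r <= exp (- r\<^sup>2 / 4)"
 proof (cases "r = 0")
  case False
  have "\<bar>smooth_coeff j k\<bar> * r = (\<bar>latt k $ j\<bar> * r / (2 * pi * r\<^sup>2)) * exp (- (norm ((2 * pi) *\<^sub>R latt k))\<^sup>2)"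
   by (simp add: smooth_coeff_def abs_mult r_def)
  also have "\<dots> <= 1 * exp (- r\<^sup>2 / 4)"
  proof (intro mult_mono e)
   have "\<bar>latt k $ j\<bar> * r <= r * r"
   unfolding r_def by (intro mult_right_mono component_le_norm_cart) auto
   also have "\<dots> <= 2 * pi * r\<^sup>2" using mult_right_mono[of 1 "2 * pi" "r * r"] pi_gt3 by (simp add: power2_eq_square)
   finally show "\<bar>latt k $ j\<bar> * r / (2 * pi * r\<^sup>2) <= 1" using False r0 by simp
  qed (use r0 in auto)
  finally show ?thesis by simp
 qed simp
 then show "\<bar>smooth_coeff j k\<bar> * norm (latt k) <= exp (- (norm (latt k))\<^sup>2 / 4)"
  by (simp add: r_def)
 show "\<bar>smooth_coeff j k\<bar> <= exp (- (norm (latt k))\<^sup>2 / 4)"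
 proof (cases "k = 0")
  case False
  have "\<bar>smooth_coeff j k\<bar> * 1 <= \<bar>smooth_coeff j k\<bar> * r"
   using latt_norm_ge_1[OF False] by (intro mult_left_mono) (auto simp: r_def)
  with main show ?thesis by (simp add: r_def)
 qed (simp add: smooth_coeff_def latt_zero)
qed

lemma smooth_coeff_integrable:
 "integrable (count_space UNIV) (smooth_coeff j)"
 by (rule Bochner_Integration.integrable_bound[OF gauss_sum_integrable])
   (use smooth_coeff_bound(1) in auto)

lemma smooth_part_integrable: "integrable (count_space UNIV) (%k. smooth_coeff j k * tsin k x)"
 by (intro integrable_bounded_mult smooth_coeff_integrable) (auto simp: tsin_def)

text \<open>The factor |k| from the Lipschitz constant of a sine is absorbed by the second bound of
  \<open>smooth_coeff_bound\<close>.\<close>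

lemma smooth_part_lipschitz: "\<exists>L\<ge>0. \<forall>x y. \<bar>smooth_part j x - smooth_part j y\<bar> <= L * dist x y"
proof -
 let ?E = "LINT k|count_space UNIV. exp (- (norm (latt k))\<^sup>2 / 4)"
 have "\<bar>smooth_part j x - smooth_part j y\<bar> <= 2 * pi * ?E * dist x y" for x y
 proof -
  have "\<bar>smooth_part j x - smooth_part j y\<bar> =
   \<bar>LINT k|count_space UNIV. smooth_coeff j k * tsin k x - smooth_coeff j k * tsin k y\<bar>"
   unfolding smooth_part_def
   by (subst Bochner_Integration.integral_diff) (auto intro: smooth_part_integrable)
  also have "\<dots> <= (LINT k|count_space UNIV. \<bar>smooth_coeff j k * tsin k x - smooth_coeff j k * tsin k y\<bar>)"
   by (rule integral_abs_bound)
  also have "\<dots> <= (LINT k|count_space UNIV. (2 * pi * dist x y) * exp (- (norm (latt k))\<^sup>2 / 4))"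
  proof (rule integral_mono)
   show "integrable (count_space UNIV) (%k. \<bar>smooth_coeff j k * tsin k x - smooth_coeff j k * tsin k y\<bar>)"
   by (intro integrable_abs Bochner_Integration.integrable_diff smooth_part_integrable)
   show "integrable (count_space UNIV) (%k. (2 * pi * dist x y) * exp (- (norm (latt k))\<^sup>2 / 4))"
   by (intro integrable_mult_right gauss_sum_integrable)
   fix k
   have "\<bar>tsin k x - tsin k y\<bar> <= (2 * pi * norm (latt k)) * dist x y"
   using lipschitz_onD[OF lipschitz_tsin, of x y k] by (simp add: dist_real_def)
   then have "\<bar>smooth_coeff j k\<bar> * \<bar>tsin k x - tsin k y\<bar> <= \<bar>smooth_coeff j k\<bar> * ((2 * pi * norm (latt k)) * dist x y)"
   by (intro mult_left_mono) auto
   also have "\<dots> = (2 * pi * dist x y) * (\<bar>smooth_coeff j k\<bar> * norm (latt k))" by simp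
   also have "\<dots> <= (2 * pi * dist x y) * exp (- (norm (latt k))\<^sup>2 / 4)"
   by (intro mult_left_mono smooth_coeff_bound) auto
   finally show "\<bar>smooth_coeff j k * tsin k x - smooth_coeff j k * tsin k y\<bar> \<le>
   (2 * pi * dist x y) * exp (- (norm (latt k))\<^sup>2 / 4)"
   by (simp add: abs_mult right_diff_distrib[symmetric])
  qed
  also have "\<dots> = 2 * pi * ?E * dist x y" by simp
  finally show ?thesis .
 qed
 moreover have "2 * pi * ?E >= 0" by simp
 ultimately show ?thesis by blast
qed

lemma smooth_part_continuous: "continuous_on UNIV (smooth_part j)"
proof -
 obtain L where "L >= 0" "!!x y. \<bar>smooth_part j x - smooth_part j y\<bar> <= L * dist x y"
  using smooth_part_lipschitz by blast
 then have "L-lipschitz_on UNIV (smooth_part j)"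
  by (intro lipschitz_onI) (auto simp: dist_real_def)
 then show ?thesis by (rule lipschitz_on_continuous_on)
qed

lemma smooth_part_fourier:
 assumes "continuous_on UNIV \<phi>" "!!x. \<bar>\<phi> x\<bar> <= 1"
 shows "(LINT x|TL. smooth_part j x * \<phi> x) =
  (LINT k|count_space UNIV. smooth_coeff j k * (LINT x|TL. tsin k x * \<phi> x))"
proof -
 have [measurable]: "\<phi> \<in> BM borel"
  by (rule borel_measurable_continuous_onI[OF assms(1)])
 have [measurable]: "tsin k \<in> BM borel" for k
  by (intro borel_measurable_continuous_onI continuous_tsin)
 have meas: "(%(x, k). smooth_coeff j k * tsin k x * \<phi> x) \<in> BM (TL \<Otimes>\<^sub>M count_space UNIV)"
  unfolding split_beta
  by (rule measurable_compose_countable'[where f = "%k p. smooth_coeff j k * tsin k (fst p) * \<phi> (fst p)" and g = snd]) auto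
 have b: "norm (smooth_coeff j k * tsin k x * \<phi> x) <= norm (smooth_coeff j k)" for k x
 proof -
  have "\<bar>tsin k x\<bar> * \<bar>\<phi> x\<bar> <= 1 * 1" using assms(2)[of x] by (intro mult_mono) (auto simp: tsin_def)
  then have "\<bar>smooth_coeff j k\<bar> * (\<bar>tsin k x\<bar> * \<bar>\<phi> x\<bar>) <= \<bar>smooth_coeff j k\<bar> * 1"
   by (intro mult_left_mono) auto
  then show ?thesis by (simp add: abs_mult mult.assoc)
 qed
 have I: "integrable (TL \<Otimes>\<^sub>M count_space UNIV) (%(x, k). smooth_coeff j k * tsin k x * \<phi> x)"
 proof (rule integrableI_bounded[OF meas])
  have "(\<integral>\<^sup>+p. ennreal (norm (case p of (x, k) => smooth_coeff j k * tsin k x * \<phi> x)) \<partial>(TL \<Otimes>\<^sub>M count_space UNIV))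
   = (\<integral>\<^sup>+x. (\<integral>\<^sup>+k. ennreal (norm (smooth_coeff j k * tsin k x * \<phi> x)) \<partial>count_space UNIV) \<partial>TL)"
   using meas by (subst torus_latt.M2.nn_integral_fst[symmetric]) (auto simp: split_beta')
  also have "\<dots> <= (\<integral>\<^sup>+x. (\<integral>\<^sup>+k. ennreal (norm (smooth_coeff j k)) \<partial>count_space UNIV) \<partial>TL)"
   by (intro nn_integral_mono ennreal_leI b)
  also have "\<dots> = (\<integral>\<^sup>+k. ennreal (norm (smooth_coeff j k)) \<partial>count_space UNIV)"
   using torus.emeasure_space_1 by simp
  also have "\<dots> < \<infinity>" using smooth_coeff_integrable[of j] unfolding integrable_iff_bounded by simp
  finally show "(\<integral>\<^sup>+p. ennreal (norm (case p of (x, k) => smooth_coeff j k * tsin k x * \<phi> x)) \<partial>(TL \<Otimes>\<^sub>M count_space UNIV)) < \<infinity>" .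
 qed
 have "(LINT x|TL. smooth_part j x * \<phi> x) =
   (LINT x|TL. (LINT k|count_space UNIV. smooth_coeff j k * tsin k x * \<phi> x))"
  unfolding smooth_part_def by simp
 also have "\<dots> = (LINT k|count_space UNIV. (LINT x|TL. smooth_coeff j k * tsin k x * \<phi> x))"
  using torus_latt.integral_fst[OF I] torus_latt.integral_snd[OF I] by simp
 finally show ?thesis by (simp add: mult.assoc)
qed

section \<open>Fourier coefficients and identification of the kernel\<close>

lemma integral_tsin_tcos: "(LINT x|TL. tsin k x * tcos l x) = 0"
proof -
 have "(LINT x|TL. tsin k x * tcos l x) =
   (LINT x|TL. (1/2) * tsin (k + l) x + (1/2) * tsin (k - l) x)"
  by (simp add: tsin_add_freq tsin_diff_freq field_simps)
 also have "\<dots> = 0"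
  by (subst Bochner_Integration.integral_add)
   (simp_all add: integral_tsin integrable_continuous_torus continuous_tsin)
 finally show ?thesis .
qed

lemma integral_tsin_tsin: "(LINT x|TL. tsin k x * tsin l x) =
  (1/2) * (indicator {l} k - indicator {- l} k)"
proof -
 have "(LINT x|TL. tsin k x * tsin l x) =
   (LINT x|TL. (1/2) * tcos (k - l) x - (1/2) * tcos (k + l) x)"
  by (simp add: tcos_add_freq tcos_diff_freq field_simps)
 also have "\<dots> = (1/2) * (LINT x|TL. tcos (k - l) x) - (1/2) * (LINT x|TL. tcos (k + l) x)"
  by (subst Bochner_Integration.integral_diff)
   (simp_all add: integrable_continuous_torus continuous_tcos)
 also have "\<dots> = (1/2) * (indicator {l} k - indicator {- l} k)"
  by (auto simp: integral_tcos indicator_def eq_neg_iff_add_eq_0)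
 finally show ?thesis .
qed

text \<open>The series runs over all frequencies, and l and -l carry the same sine up to sign.
  Coefficients and sines are both odd, so the two halves add up to one coefficient.\<close>

lemma smooth_part_tsin: "(LINT x|TL. smooth_part j x * tsin l x) = smooth_coeff j l"
proof -
 have c: "smooth_coeff j (- l) = - smooth_coeff j l"
  by (simp add: smooth_coeff_def latt_uminus)
 have one: "(LINT k|count_space UNIV. smooth_coeff j k * indicator {m} k) = smooth_coeff j m" for m
 proof -
  have "(LINT k|count_space UNIV. smooth_coeff j k * indicator {m} k) =
   (LINT k|count_space UNIV. indicator {m} k *\<^sub>R smooth_coeff j m)"
   by (intro Bochner_Integration.integral_cong) (auto simp: indicator_def)
  then show ?thesis by simp
 qed
 have int: "integrable (count_space UNIV) (%k. smooth_coeff j k * indicator {m} k)" for m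
  by (intro integrable_bounded_mult smooth_coeff_integrable) (auto simp: indicator_def)
 have "(LINT x|TL. smooth_part j x * tsin l x) =
   (LINT k|count_space UNIV. (1/2) * (smooth_coeff j k * indicator {l} k - smooth_coeff j k * indicator {- l} k))"
  by (subst smooth_part_fourier)
   (auto simp: continuous_tsin integral_tsin_tsin abs_tsin_le_1 algebra_simps intro!: Bochner_Integration.integral_cong)
 also have "\<dots> = (1/2) * (smooth_coeff j l - smooth_coeff j (- l))"
  by (simp add: Bochner_Integration.integral_diff[OF int int] one)
 finally show ?thesis using c by simp
qed

lemma smooth_part_tcos: "(LINT x|TL. smooth_part j x * tcos l x) = 0"
 by (subst smooth_part_fourier) (auto simp: continuous_tcos integral_tsin_tcos abs_tcos_le_1)

lemma ewald_sum_tcos: "(LINT x|TL. ewald_sum j x * tcos l x) = 0"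
proof -
 have "(LINT z|lborel. ewald j z * cos (((2 * pi) *\<^sub>R latt l) \<bullet> z)) = 0" by (rule ewald_cos)
 then show ?thesis
  by (subst integrable_ewald_sum_mult(3)) (auto simp: continuous_tcos tcos_proj abs_tcos_le_1)
qed

text \<open>The terms exp(-|2 pi l|^2) of the short-time and the long-time part cancel. What remains
  is the sine coefficient of the j-th derivative of G.\<close>

lemma ewald_sum_tsin: "(LINT x|TL. ewald_sum j x * tsin l x) + smooth_coeff j l =
  latt l $ j / (2 * pi * (norm (latt l))\<^sup>2)"
proof -
 have "(LINT z|lborel. ewald j z * sin (((2 * pi) *\<^sub>R latt l) \<bullet> z)) =
   ((2 * pi) *\<^sub>R latt l) $ j * (1 - exp (- (norm ((2 * pi) *\<^sub>R latt l))\<^sup>2)) / (norm ((2 * pi) *\<^sub>R latt l))\<^sup>2"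
  by (rule ewald_sin)
 then have "(LINT x|TL. ewald_sum j x * tsin l x) =
   ((2 * pi) *\<^sub>R latt l) $ j * (1 - exp (- (norm ((2 * pi) *\<^sub>R latt l))\<^sup>2)) / (norm ((2 * pi) *\<^sub>R latt l))\<^sup>2"
  by (subst integrable_ewald_sum_mult(3)) (auto simp: continuous_tsin tsin_proj abs_tsin_le_1)
 also have "\<dots> = latt l $ j / (2 * pi * (norm (latt l))\<^sup>2) - smooth_coeff j l"
 proof (cases "l = 0")
  case False
  then have "norm (latt l) \<noteq> 0" using latt_norm_ge_1[OF False] by auto
  then show ?thesis
   by (simp add: smooth_coeff_def power_mult_distrib power2_eq_square field_simps)
 qed (simp add: smooth_coeff_def latt_zero)
 finally show ?thesis by simp
qed

lemma torus_partial_scaled: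
 assumes "trig_poly f" shows "torus_partial i (%x. c * f x) x = c * torus_partial i f x"
proof (rule torus_partial_eq)
 fix v
 show "((%v. c * f (proj v)) has_derivative (%h. \<Sum>j\<in>UNIV. h $ j * (c * torus_partial j f (proj v)))) (at v)"
  using has_derivative_mult_right[OF trig_poly_has_derivative[OF assms], of c]
  by (simp add: sum_distrib_left mult.left_commute)
qed

lemma torus_laplacian_tcos: "torus_laplacian (tcos l) x = - (2 * pi * norm (latt l))\<^sup>2 * tcos l x"
 and torus_laplacian_tsin: "torus_laplacian (tsin l) x = - (2 * pi * norm (latt l))\<^sup>2 * tsin l x"
proof -
 have c: "torus_partial i (tcos l) = (%x. (- 2 * pi * latt l $ i) * tsin l x)"
  and s: "torus_partial i (tsin l) = (%x. (2 * pi * latt l $ i) * tcos l x)" for i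
  by (simp_all add: fun_eq_iff torus_partial_tcos torus_partial_tsin)
 have n: "(norm (latt l))\<^sup>2 = (latt l $ 1)\<^sup>2 + (latt l $ 2)\<^sup>2" by (rule norm_vec2_sq)
 show "torus_laplacian (tcos l) x = - (2 * pi * norm (latt l))\<^sup>2 * tcos l x"
  "torus_laplacian (tsin l) x = - (2 * pi * norm (latt l))\<^sup>2 * tsin l x"
  unfolding torus_laplacian_def c s torus_partial_scaled[OF trig_poly_tsin]
   torus_partial_scaled[OF trig_poly_tcos] torus_partial_tcos torus_partial_tsin
  by (simp_all add: sum_2 power_mult_distrib n power2_eq_square[of "latt l $ 1"]
   power2_eq_square[of "latt l $ 2"] power2_eq_square[of pi] algebra_simps)
qed

text \<open>Characters are eigenfunctions of the Laplacian, so the Green identity yields the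
  coefficients of G at nonzero frequencies, and the weak derivative those of g. At frequency 0 the
  factor \<open>latt l\<close> makes the coefficient of g vanish. All coefficients agree with those
  of the Ewald decomposition, and uniqueness concludes.\<close>

lemma green_derivative:
 assumes G: "torus_green G" and g: "weak_partial j G g"
 shows "AE x in TL. g x = ewald_sum j x + smooth_part j x"
proof -
 have gi: "integrable TL g" and
  gp: "!!\<phi>. trig_poly \<phi> ==> (LINT x|TL. G x * torus_partial j \<phi> x) = - (LINT x|TL. g x * \<phi> x)"
  using g trig_poly_smooth by (auto simp: weak_partial_def)
 have GL: "(LINT x|TL. G x * torus_laplacian \<phi> x) = \<phi> 0 - (LINT x|TL. \<phi> x)"
  if "trig_poly \<phi>" for \<phi>
  using G that trig_poly_smooth by (auto simp: torus_green_def)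
 have at0: "tcos l 0 = 1" "tsin l 0 = 0" for l
  using tcos_proj[of l 0] tsin_proj[of l 0] by (simp_all add: proj_zero)
 have Gc: "- (2 * pi * norm (latt l))\<^sup>2 * (LINT x|TL. G x * tcos l x) = 1 - (if l = 0 then 1 else 0)"
  and Gs: "- (2 * pi * norm (latt l))\<^sup>2 * (LINT x|TL. G x * tsin l x) = 0" for l
 proof -
  have "(LINT x|TL. G x * torus_laplacian (tcos l) x) =
   (LINT x|TL. - (2 * pi * norm (latt l))\<^sup>2 * (G x * tcos l x))"
   "(LINT x|TL. G x * torus_laplacian (tsin l) x) =
   (LINT x|TL. - (2 * pi * norm (latt l))\<^sup>2 * (G x * tsin l x))"
   by (simp_all add: torus_laplacian_tcos torus_laplacian_tsin mult.left_commute)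
  then show "- (2 * pi * norm (latt l))\<^sup>2 * (LINT x|TL. G x * tcos l x) = 1 - (if l = 0 then 1 else 0)"
   "- (2 * pi * norm (latt l))\<^sup>2 * (LINT x|TL. G x * tsin l x) = 0"
   unfolding GL[OF trig_poly_tcos] GL[OF trig_poly_tsin] integral_mult_right_zero at0 integral_tcos integral_tsin
   by simp_all
 qed
 have gs: "(LINT x|TL. g x * tsin l x) = latt l $ j / (2 * pi * (norm (latt l))\<^sup>2)" for l
 proof -
  have "- (LINT x|TL. g x * tsin l x) = (LINT x|TL. 2 * pi * latt l $ j * (G x * tcos l x))"
   unfolding gp[OF trig_poly_tsin, symmetric] torus_partial_tsin by (simp add: mult.left_commute)
  then have e: "(LINT x|TL. g x * tsin l x) = - (2 * pi * latt l $ j) * (LINT x|TL. G x * tcos l x)"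
   unfolding integral_mult_right_zero by simp
  show ?thesis
  proof (cases "l = 0")
   case False
   then have n: "norm (latt l) \<noteq> 0" using latt_norm_ge_1[OF False] by auto
   then have "(LINT x|TL. G x * tcos l x) = - 1 / (2 * pi * norm (latt l))\<^sup>2"
   using Gc[of l] False by (simp add: field_simps)
   then show ?thesis unfolding e using n by (simp add: power2_eq_square)
  qed (simp add: latt_zero)
 qed
 have gc: "(LINT x|TL. g x * tcos l x) = 0" for l
 proof -
  have "- (LINT x|TL. g x * tcos l x) = (LINT x|TL. (- 2 * pi * latt l $ j) * (G x * tsin l x))"
   unfolding gp[OF trig_poly_tcos, symmetric] torus_partial_tcos by (simp add: mult.left_commute)
  then have e: "(LINT x|TL. g x * tcos l x) = (2 * pi * latt l $ j) * (LINT x|TL. G x * tsin l x)"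
   unfolding integral_mult_right_zero by simp
  show ?thesis
  proof (cases "l = 0")
   case False
   then have "norm (latt l) \<noteq> 0" using latt_norm_ge_1[OF False] by auto
   then have "(LINT x|TL. G x * tsin l x) = 0" using Gs[of l] by simp
   then show ?thesis unfolding e by simp
  next
   case True
   show ?thesis unfolding e by (simp add: True latt_zero)
  qed
 qed
 have ei: "integrable TL (ewald_sum j)" by (rule integrable_ewald_sum_mult[of "%_. 0"]) auto
 have si: "integrable TL (smooth_part j)"
  by (rule integrable_continuous_torus[OF smooth_part_continuous])
 have d: "(LINT x|TL. (g x - (ewald_sum j x + smooth_part j x)) * \<phi> x) =
   (LINT x|TL. g x * \<phi> x) - ((LINT x|TL. ewald_sum j x * \<phi> x) + (LINT x|TL. smooth_part j x * \<phi> x))"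
  if "continuous_on UNIV \<phi>" for \<phi>
  using integrable_mult_continuous[OF gi that] integrable_mult_continuous[OF ei that]
   integrable_mult_continuous[OF si that]
  by (simp add: left_diff_distrib distrib_right)
 have "AE x in TL. g x - (ewald_sum j x + smooth_part j x) = 0"
 proof (rule fourier_uniqueness)
  show "integrable TL (%x. g x - (ewald_sum j x + smooth_part j x))" using gi ei si by simp
  show "(LINT x|TL. (g x - (ewald_sum j x + smooth_part j x)) * tcos k x) = 0" for k
   by (simp add: d continuous_tcos gc ewald_sum_tcos smooth_part_tcos)
  show "(LINT x|TL. (g x - (ewald_sum j x + smooth_part j x)) * tsin k x) = 0" for k
   using ewald_sum_tsin[of j k] by (simp add: d continuous_tsin gs smooth_part_tsin)
 qed
 then show ?thesis by eventually_elim simp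
qed

text \<open>The set \<open>good\<close> is fixed before \<alpha>, because \<alpha> will vary with
  time. K is the rotated gradient, so its first component involves the derivative of index 2 and its
  second the derivative of index 1.\<close>

theorem biot_savart_holder:
 assumes "torus_green G" "perp_gradient G K"
 obtains C good where "C >= 0" "AE x in TL. good x"
  "!!\<alpha>. 1/2 <= \<alpha> ==> \<alpha> < 1 ==> \<exists>g. g \<in> BM borel \<and>
   (\<integral>\<^sup>+x. g x \<partial>TL) <= ennreal (C / (1 - \<alpha>)) \<and>
   (\<forall>x y. good x \<longrightarrow> good y \<longrightarrow>
   ennreal (norm (K x - K y)) <= ennreal (dist x y powr \<alpha>) * (g x + g y))"
proof -
 obtain C where C: "C >= 0" "!!\<alpha>. 1/2 <= \<alpha> ==> \<alpha> < 1 ==>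
  (\<integral>\<^sup>+z. ennreal (ewald_bound \<alpha> z) \<partial>lborel) <= ennreal (C / (1 - \<alpha>))"
  using nn_integral_ewald_bound by blast
 obtain L1 where L1: "L1 >= 0" "!!x y. \<bar>smooth_part 1 x - smooth_part 1 y\<bar> <= L1 * dist x y"
  using smooth_part_lipschitz by blast
 obtain L2 where L2: "L2 >= 0" "!!x y. \<bar>smooth_part 2 x - smooth_part 2 y\<bar> <= L2 * dist x y"
  using smooth_part_lipschitz by blast
 define L where "L = L1 + L2"
 have L0: "L >= 0" using L1 L2 by (simp add: L_def)
 define good where "good x \<longleftrightarrow>
   - (K x $ 1) = ewald_sum 2 x + smooth_part 2 x \<and> K x $ 2 = ewald_sum 1 x + smooth_part 1 x \<and>
   (\<forall>j. integrable (count_space UNIV) (%n. ewald j (sec x + latt n)))" for x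
 have ae: "AE x in TL. integrable (count_space UNIV) (%n. ewald j (sec x + latt n))" for j
  by (rule integrable_ewald_sum_mult[of "%_. 0"]) auto
 have "AE x in TL. - (K x $ 1) = ewald_sum 2 x + smooth_part 2 x"
  "AE x in TL. K x $ 2 = ewald_sum 1 x + smooth_part 1 x"
  using green_derivative[OF assms(1)] assms(2) by (auto simp: perp_gradient_def)
 with ae[of 1] ae[of 2] have good: "AE x in TL. good x"
  by eventually_elim (auto simp: good_def forall_2)
 have bound: "\<exists>g. g \<in> BM borel \<and>
   (\<integral>\<^sup>+x. g x \<partial>TL) <= ennreal ((4 * C + L) / (1 - \<alpha>)) \<and>
   (\<forall>x y. good x \<longrightarrow> good y \<longrightarrow>
   ennreal (norm (K x - K y)) <= ennreal (dist x y powr \<alpha>) * (g x + g y))"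
  if \<alpha>: "1/2 <= \<alpha>" "\<alpha> < 1" for \<alpha>
 proof (intro exI conjI allI impI)
  let ?b = "ewald_bound_sum \<alpha>"
  \<comment> \<open>Two components with a factor 2 each give 4. The Lipschitz part enters as a
    constant because dist <= dist powr \<alpha>.\<close>
  show "(%x. 4 * ?b x + ennreal L) \<in> BM borel" by measurable
  have "(\<integral>\<^sup>+x. 4 * ?b x + ennreal L \<partial>TL) = 4 * (\<integral>\<^sup>+z. ennreal (ewald_bound \<alpha> z) \<partial>lborel) + ennreal L"
   using torus.emeasure_space_1 by (simp add: nn_integral_add nn_integral_cmult nn_integral_ewald_bound_sum)
  also have "\<dots> <= ennreal 4 * ennreal (C / (1 - \<alpha>)) + ennreal (L / (1 - \<alpha>))"
  proof (intro add_mono mult_mono C \<alpha> ennreal_leI)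
   show "L <= L / (1 - \<alpha>)" using \<alpha> L0 by (simp add: pos_le_divide_eq mult_left_le)
  qed auto
  also have "\<dots> = ennreal ((4 * C + L) / (1 - \<alpha>))"
  proof -
   have "ennreal 4 * ennreal (C / (1 - \<alpha>)) = ennreal (4 * (C / (1 - \<alpha>)))"
   using \<alpha> C(1) by (intro ennreal_mult[symmetric]) auto
   then show ?thesis
   using \<alpha> C(1) L0 by (simp only:) (simp add: ennreal_plus[symmetric] add_divide_distrib del: ennreal_plus)
  qed
  finally show "(\<integral>\<^sup>+x. 4 * ?b x + ennreal L \<partial>TL) <= ennreal ((4 * C + L) / (1 - \<alpha>))" .
  fix x y assume gd: "good x" "good y"
  let ?d = "dist x y"
  have comp: "\<bar>K x $ 1 - K y $ 1\<bar> <= \<bar>ewald_sum 2 x - ewald_sum 2 y\<bar> + L2 * ?d"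
   "\<bar>K x $ 2 - K y $ 2\<bar> <= \<bar>ewald_sum 1 x - ewald_sum 1 y\<bar> + L1 * ?d"
   using gd L1(2)[of x y] L2(2)[of x y] unfolding good_def by linarith+
  have "norm (K x - K y) <= (\<Sum>i\<in>UNIV. \<bar>(K x - K y) $ i\<bar>)" by (rule norm_le_l1_cart)
  also have "\<dots> <= \<bar>ewald_sum 2 x - ewald_sum 2 y\<bar> + \<bar>ewald_sum 1 x - ewald_sum 1 y\<bar> + L * ?d"
   using comp by (simp add: sum_2 L_def distrib_right)
  also have "\<dots> <= \<bar>ewald_sum 2 x - ewald_sum 2 y\<bar> + \<bar>ewald_sum 1 x - ewald_sum 1 y\<bar> + ?d powr \<alpha> * L"
  proof -
   have "?d powr 1 <= ?d powr \<alpha>"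
   using \<alpha> dist_torus_le_1[of x y] by (intro powr_mono') auto
   then have "?d * L <= ?d powr \<alpha> * L" using L0 by (intro mult_right_mono) auto
   then show ?thesis by (simp add: mult.commute)
  qed
  finally have "ennreal (norm (K x - K y)) <= ennreal \<bar>ewald_sum 2 x - ewald_sum 2 y\<bar>
   + ennreal \<bar>ewald_sum 1 x - ewald_sum 1 y\<bar> + ennreal (?d powr \<alpha>) * ennreal L"
   using L0 by (simp add: ennreal_leI ennreal_mult[symmetric] ennreal_plus[symmetric] del: ennreal_plus)
  also have "\<dots> <= ennreal (2 * ?d powr \<alpha>) * (?b x + ?b y) + ennreal (2 * ?d powr \<alpha>) * (?b x + ?b y)
   + ennreal (?d powr \<alpha>) * ennreal L"
   using gd by (intro add_mono ewald_sum_holder \<alpha>) (auto simp: good_def)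
  also have "\<dots> = ennreal (?d powr \<alpha>) * (4 * ?b x + 4 * ?b y + ennreal L)"
   by (simp add: ennreal_mult distrib_left distrib_right mult.assoc mult.left_commute)
   (simp add: algebra_simps mult_2[symmetric])
  also have "\<dots> <= ennreal (?d powr \<alpha>) * ((4 * ?b x + ennreal L) + (4 * ?b y + ennreal L))"
   by (intro mult_left_mono) (simp_all add: add_increasing add.assoc add.left_commute add_left_mono)
  finally show "ennreal (norm (K x - K y)) <= ennreal (?d powr \<alpha>) * ((4 * ?b x + ennreal L) + (4 * ?b y + ennreal L))" .
 qed
 show thesis
  by (rule that[of "4 * C + L" good]) (use C(1) L0 good bound in auto)
qed

section \<open>The noise coefficients are Lipschitz\<close>

lemma torus_partial_translate: "torus_partial j (%x. f (x + a)) x = torus_partial j f (x + a)"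
 by (simp add: torus_partial_def add.assoc add.commute add.left_commute)

lemma torus_partial_sum2:
 assumes "trig_poly f" "trig_poly g"
 shows "torus_partial i (%x. f x + g x) x = torus_partial i f x + torus_partial i g x"
proof (rule torus_partial_eq)
 fix v
 show "((%v. f (proj v) + g (proj v)) has_derivative
   (%h. \<Sum>j\<in>UNIV. h $ j * (torus_partial j f (proj v) + torus_partial j g (proj v)))) (at v)"
  using has_derivative_add[OF trig_poly_has_derivative[OF assms(1)] trig_poly_has_derivative[OF assms(2)]]
  by (simp add: distrib_left sum.distrib)
qed

text \<open>Partial derivatives of trigonometric polynomials are again such, hence continuous, so
  every product in the identity is integrable and the relation is closed under finite linear
  combinations.\<close>

definition weak_partial_trig :: "2 => (torus2 => real) => (torus2 => real) => bool" where
 "weak_partial_trig j f g \<longleftrightarrow> integrable TL f \<and> integrable TL g \<and>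
   (\<forall>\<phi>. trig_poly \<phi> \<longrightarrow>
   (LINT x|TL. f x * torus_partial j \<phi> x) = - (LINT x|TL. g x * \<phi> x))"

lemma weak_partial_imp_trig: "weak_partial j f g ==> weak_partial_trig j f g"
 by (auto simp: weak_partial_def weak_partial_trig_def trig_poly_smooth)

lemma weak_partial_trig_sum:
 assumes "finite A" "!!a. a \<in> A ==> weak_partial_trig j (f a) (g a)"
 shows "weak_partial_trig j (%x. \<Sum>a\<in>A. c a * f a x) (%x. \<Sum>a\<in>A. c a * g a x)"
 unfolding weak_partial_trig_def
proof (intro conjI allI impI)
 show "integrable TL (%x. \<Sum>a\<in>A. c a * f a x)"
  "integrable TL (%x. \<Sum>a\<in>A. c a * g a x)"
  using assms(2) by (auto simp: weak_partial_trig_def)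
 fix \<phi> assume \<phi>: "trig_poly \<phi>"
 have i: "integrable TL (%x. f a x * torus_partial j \<phi> x)"
  "integrable TL (%x. g a x * \<phi> x)" if "a \<in> A" for a
  using assms(2)[OF that] \<phi>
  by (auto simp: weak_partial_trig_def intro!: integrable_mult_continuous trig_poly_continuous trig_poly_partial)
 have "(LINT x|TL. (\<Sum>a\<in>A. c a * f a x) * torus_partial j \<phi> x) =
   (LINT x|TL. (\<Sum>a\<in>A. c a * (f a x * torus_partial j \<phi> x)))"
  by (simp add: sum_distrib_right mult.assoc)
 also have "\<dots> = (\<Sum>a\<in>A. c a * (LINT x|TL. f a x * torus_partial j \<phi> x))"
  by (subst Bochner_Integration.integral_sum) (simp_all add: i)
 also have "\<dots> = - (\<Sum>a\<in>A. c a * (LINT x|TL. g a x * \<phi> x))"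
  unfolding sum_negf[symmetric]
  using assms(2) \<phi> by (intro sum.cong) (auto simp: weak_partial_trig_def)
 also have "(\<Sum>a\<in>A. c a * (LINT x|TL. g a x * \<phi> x)) =
   (LINT x|TL. (\<Sum>a\<in>A. c a * (g a x * \<phi> x)))"
  by (subst Bochner_Integration.integral_sum) (simp_all add: i)
 finally show "(LINT x|TL. (\<Sum>a\<in>A. c a * f a x) * torus_partial j \<phi> x) =
   - (LINT x|TL. (\<Sum>a\<in>A. c a * g a x) * \<phi> x)"
  by (simp add: sum_distrib_right mult.assoc)
qed

lemma sum_nth_inner:
 fixes v w :: "real^'n" shows "(\<Sum>j\<in>UNIV. v $ j * ((b * w $ j) * r)) = b * (w \<bullet> v) * r"
 by (simp add: inner_vec_def sum_distrib_left sum_distrib_right mult_ac)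

text \<open>For a character the addition formulas separate s from x. The integral is then a
  combination of cos(\<theta> s) and sin(\<theta> s), differentiated without any exchange of limit
  and integral.\<close>

lemma trig_poly_shift_deriv:
 assumes f: "integrable TL f" and "trig_poly \<phi>"
 shows "((%s. LINT x|TL. f x * \<phi> (x + proj (s *\<^sub>R v))) has_real_derivative
  (\<Sum>j\<in>UNIV. v $ j * (LINT x|TL. f x * torus_partial j \<phi> (x + proj (s *\<^sub>R v))))) (at s)"
 using assms(2)
proof induction
 case (trig_poly_tcos k)
 define A where "A = (LINT x|TL. f x * tcos k x)"
 define B where "B = (LINT x|TL. f x * tsin k x)"
 define \<theta> where "\<theta> = 2 * pi * (latt k \<bullet> v)"
 have i: "integrable TL (%x. f x * tcos k x)" "integrable TL (%x. f x * tsin k x)"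
  by (intro integrable_mult_continuous f continuous_tcos continuous_tsin)+
 have c: "(LINT x|TL. f x * tcos k (x + proj (s *\<^sub>R v))) = A * cos (\<theta> * s) - B * sin (\<theta> * s)"
  and si: "(LINT x|TL. f x * tsin k (x + proj (s *\<^sub>R v))) = B * cos (\<theta> * s) + A * sin (\<theta> * s)" for s
  using i unfolding tcos_add tsin_add tcos_proj tsin_proj A_def B_def \<theta>_def
  by (simp_all add: right_diff_distrib distrib_left mult.assoc[symmetric] mult.commute[of s])
 have "(\<Sum>j\<in>UNIV. v $ j * (LINT x|TL. f x * torus_partial j (tcos k) (x + proj (s *\<^sub>R v)))) =
   (\<Sum>j\<in>UNIV. v $ j * ((- 2 * pi * latt k $ j) * (B * cos (\<theta> * s) + A * sin (\<theta> * s))))"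
  unfolding torus_partial_tcos si[symmetric] integral_mult_right_zero[symmetric] by (simp add: mult.left_commute)
 also have "\<dots> = - \<theta> * (B * cos (\<theta> * s) + A * sin (\<theta> * s))"
  unfolding sum_nth_inner by (simp add: \<theta>_def)
 finally show ?case
  unfolding c by (auto intro!: derivative_eq_intros simp: algebra_simps)
next
 case (trig_poly_tsin k)
 define A where "A = (LINT x|TL. f x * tcos k x)"
 define B where "B = (LINT x|TL. f x * tsin k x)"
 define \<theta> where "\<theta> = 2 * pi * (latt k \<bullet> v)"
 have i: "integrable TL (%x. f x * tcos k x)" "integrable TL (%x. f x * tsin k x)"
  by (intro integrable_mult_continuous f continuous_tcos continuous_tsin)+
 have c: "(LINT x|TL. f x * tcos k (x + proj (s *\<^sub>R v))) = A * cos (\<theta> * s) - B * sin (\<theta> * s)"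
  and si: "(LINT x|TL. f x * tsin k (x + proj (s *\<^sub>R v))) = B * cos (\<theta> * s) + A * sin (\<theta> * s)" for s
  using i unfolding tcos_add tsin_add tcos_proj tsin_proj A_def B_def \<theta>_def
  by (simp_all add: right_diff_distrib distrib_left mult.assoc[symmetric] mult.commute[of s])
 have "(\<Sum>j\<in>UNIV. v $ j * (LINT x|TL. f x * torus_partial j (tsin k) (x + proj (s *\<^sub>R v)))) =
   (\<Sum>j\<in>UNIV. v $ j * ((2 * pi * latt k $ j) * (A * cos (\<theta> * s) - B * sin (\<theta> * s))))"
  unfolding torus_partial_tsin c[symmetric] integral_mult_right_zero[symmetric] by (simp add: mult.left_commute)
 also have "\<dots> = \<theta> * (A * cos (\<theta> * s) - B * sin (\<theta> * s))"
  unfolding sum_nth_inner by (simp add: \<theta>_def)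
 finally show ?case
  unfolding si by (auto intro!: derivative_eq_intros simp: algebra_simps)
next
 case (trig_poly_add g h)
 have i: "integrable TL (%x. f x * q (x + a))" if "trig_poly q" for q a
  by (intro integrable_mult_continuous f trig_poly_continuous trig_poly_translate that)
 show ?case
  using DERIV_add[OF trig_poly_add.IH]
  by (simp add: torus_partial_sum2 trig_poly_add.hyps distrib_left i trig_poly_partial sum.distrib)
next
 case (trig_poly_scale g c)
 show ?case
  using DERIV_cmult[OF trig_poly_scale.IH, of c]
  by (simp add: torus_partial_scaled trig_poly_scale.hyps mult.left_commute sum_distrib_left)
qed

text \<open>By compactness finitely many translates of \<open>U\<close> cover the torus, and all of
  them have the measure of \<open>U\<close>.\<close>

lemma emeasure_open_pos:
 assumes "open U" "U \<noteq> {}" shows "emeasure TL U > 0"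
proof (rule ccontr)
 assume "\<not> ?thesis"
 then have z: "emeasure TL U = 0" by (simp add: zero_less_iff_neq_zero)
 obtain u where u: "u \<in> U" using assms(2) by blast
 let ?V = "%a :: torus2. (%x. x + (u - a)) -` U"
 have cont: "continuous_on UNIV (%x :: torus2. x + b)" for b
  by (intro lipschitz_on_continuous_on[of 1] lipschitz_onI) (auto simp: dist_torus2_def)
 have op: "open (?V a)" for a using open_vimage[OF assms(1) cont] .
 have "x \<in> ?V x" for x using u by simp
 then have "UNIV \<subseteq> (\<Union>a\<in>UNIV. ?V a)" by blast
 then obtain S where S: "finite S" "UNIV \<subseteq> (\<Union>a\<in>S. ?V a)"
  by (rule compactE_image[OF compact_torus op])
 have "emeasure TL (?V a) = 0" for a
 proof -
  have "emeasure TL (?V a) = (\<integral>\<^sup>+x. indicator U (x + (u - a)) \<partial>TL)"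
  proof -
   have "(%x. indicator U (x + (u - a))) = (indicator (?V a) :: torus2 => ennreal)"
   by (simp add: fun_eq_iff indicator_def)
   moreover have "?V a \<in> sets TL" using op[of a] by simp
   ultimately show ?thesis by (simp only: nn_integral_indicator)
  qed
  also have "\<dots> = 0"
   using nn_integral_torus_translate[of "indicator U" "u - a"] assms(1) z by simp
  finally show ?thesis .
 qed
 then have "?V a \<in> null_sets TL" for a using op[of a] by (auto simp: null_sets_def)
 then have "(\<Union>a\<in>S. ?V a) \<in> null_sets TL" using S(1) by (intro null_sets.finite_UN) auto
 moreover have "(\<Union>a\<in>S. ?V a) = space TL" using S(2) by auto
 ultimately show False using torus.emeasure_space_1 by (simp add: null_sets_def)
qed

text \<open>The shift is moved onto a test function and the derivative from there onto
  \<open>g\<close>, so the integral of the increment h against \<phi> is at most C times the L1 norm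
  of \<phi>. This forces h <= C almost everywhere, and by continuity everywhere.\<close>

lemma weak_partial_increment_bound:
 assumes f: "continuous_on UNIV f" and g: "!!j. weak_partial_trig j f (g j)"
  and C: "C >= 0" "AE x in TL. \<bar>\<Sum>j\<in>UNIV. v $ j * g j x\<bar> <= C"
 shows "f (x + proj v) - f x <= C"
proof -
 have fi: "integrable TL f" and gi: "!!j. integrable TL (g j)"
  using g by (auto simp: weak_partial_trig_def)
 have cont: "continuous_on UNIV (%x :: torus2. x + b)" for b
  by (intro lipschitz_on_continuous_on[of 1] lipschitz_onI) (auto simp: dist_torus2_def)
 define h where "h x = f (x + proj v) - f x" for x
 have hc: "continuous_on UNIV h"
  unfolding h_def by (intro continuous_on_diff f continuous_on_compose2[OF f cont]) auto
 have abs_i: "integrable TL (%x. \<bar>\<phi> x\<bar>)" if "continuous_on UNIV \<phi>" for \<phi> :: "torus2 => real"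
  by (intro integrable_abs integrable_continuous_torus that)
 have trig: "(LINT x|TL. h x * \<phi> x) <= C * (LINT x|TL. \<bar>\<phi> x\<bar>)"
  if \<phi>: "trig_poly \<phi>" for \<phi>
 proof -
  note pc = trig_poly_continuous[OF \<phi>]
  \<comment> \<open>Shifting \<phi> by - v instead of f by v: u 1 - u 0 is the integral of h *
    \<phi>, and the mean value theorem applies to u although f has only weak derivatives.\<close>
  define u where "u s = (LINT x|TL. f x * \<phi> (x + proj (s *\<^sub>R (- v))))" for s
  have "\<exists>s. 0 < s \<and> s < 1 \<and> u 1 - u 0 = (1 - 0) * (\<Sum>j\<in>UNIV. (- v) $ j *
   (LINT x|TL. f x * torus_partial j \<phi> (x + proj (s *\<^sub>R (- v)))))"
   unfolding u_def by (intro MVT2 trig_poly_shift_deriv fi \<phi>) auto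
  then obtain s where s: "u 1 - u 0 = (\<Sum>j\<in>UNIV. (- v) $ j *
   (LINT x|TL. f x * torus_partial j \<phi> (x + proj (s *\<^sub>R (- v)))))" by auto
  define a where "a = proj (s *\<^sub>R (- v))"
  have pa: "trig_poly (%x. \<phi> (x + a))" by (rule trig_poly_translate[OF \<phi>])
  have ci: "integrable TL (%x. g j x * \<phi> (x + a))" for j
   by (intro integrable_mult_continuous gi trig_poly_continuous pa)
  have "u 1 - u 0 = (\<Sum>j\<in>UNIV. v $ j * (LINT x|TL. g j x * \<phi> (x + a)))"
   unfolding s a_def[symmetric] torus_partial_translate[symmetric]
   using g pa by (simp add: weak_partial_trig_def)
  also have "\<dots> = (LINT x|TL. (\<Sum>j\<in>UNIV. v $ j * g j x) * \<phi> (x + a))"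
   by (simp add: sum_distrib_right mult.assoc Bochner_Integration.integral_sum ci)
  also have "\<dots> <= (LINT x|TL. C * \<bar>\<phi> (x + a)\<bar>)"
  proof (rule integral_mono_AE)
   show "integrable TL (%x. (\<Sum>j\<in>UNIV. v $ j * g j x) * \<phi> (x + a))"
   by (simp add: sum_distrib_right mult.assoc ci)
   show "integrable TL (%x. C * \<bar>\<phi> (x + a)\<bar>)"
   using abs_i[OF trig_poly_continuous[OF pa]] by simp
   show "AE x in TL. (\<Sum>j\<in>UNIV. v $ j * g j x) * \<phi> (x + a) <= C * \<bar>\<phi> (x + a)\<bar>"
   using C(2)
   proof eventually_elim
   case (elim x)
   have "(\<Sum>j\<in>UNIV. v $ j * g j x) * \<phi> (x + a) <= \<bar>\<Sum>j\<in>UNIV. v $ j * g j x\<bar> * \<bar>\<phi> (x + a)\<bar>"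
   by (metis abs_ge_self abs_mult)
   also have "\<dots> <= C * \<bar>\<phi> (x + a)\<bar>" using elim by (intro mult_right_mono) auto
   finally show ?case .
   qed
  qed
  also have "\<dots> = C * (LINT x|TL. \<bar>\<phi> x\<bar>)"
   using integral_torus_translate[of "%x. \<bar>\<phi> x\<bar>" a] borel_measurable_continuous_onI[OF pc] by simp
  also have "u 1 - u 0 = (LINT x|TL. h x * \<phi> x)"
  proof -
   have fp: "continuous_on UNIV (%x. f (x + proj v))" by (intro continuous_on_compose2[OF f cont]) auto
   have m: "(%x. f x * \<phi> (x - proj v)) \<in> BM borel"
   proof (intro borel_measurable_continuous_onI continuous_on_mult f)
   show "continuous_on UNIV (%x. \<phi> (x - proj v))"
   using trig_poly_continuous[OF trig_poly_translate[OF \<phi>, of "- proj v"]] by simp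
   qed
   have "u 1 = (LINT x|TL. f (x + proj v) * \<phi> x)"
   using integral_torus_translate[OF m, of "proj v"] by (simp add: u_def proj_minus)
   moreover have "u 0 = (LINT x|TL. f x * \<phi> x)" by (simp add: u_def proj_zero)
   ultimately show ?thesis
   using integrable_mult_continuous[OF fi pc]
   integrable_mult_continuous[OF integrable_continuous_torus[OF fp] pc]
   by (simp add: h_def left_diff_distrib)
  qed
  finally show ?thesis .
 qed
 have cts: "(LINT x|TL. h x * \<phi> x) <= C * (LINT x|TL. \<bar>\<phi> x\<bar>)"
  if \<phi>: "continuous_on UNIV \<phi>" for \<phi>
 proof (rule field_le_epsilon)
  fix e :: real assume "e > 0"
  obtain H where H: "!!x. norm (h x) <= H" using bounded_continuous_torus[OF hc] by blast
  have H0: "H >= 0" using H[of 0] norm_ge_zero order_trans by blast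
  define d where "d = e / (H + C + 1)"
  have d: "d > 0" "d * (H + C) <= e"
   using \<open>e > 0\<close> H0 C(1) by (auto simp: d_def field_simps)
  obtain \<psi> where \<psi>: "trig_poly \<psi>" "!!x. \<bar>\<phi> x - \<psi> x\<bar> < d" using trig_poly_dense[OF \<phi> d(1)] by blast
  note pc = trig_poly_continuous[OF \<psi>(1)]
  have p1: "measure TL UNIV = 1" using torus.prob_space by simp
  have hi: "integrable TL (%x. h x * \<phi> x)" "integrable TL (%x. h x * \<psi> x)"
   by (intro integrable_mult_continuous integrable_continuous_torus hc \<phi> pc)+
  have "(LINT x|TL. h x * \<phi> x) <= (LINT x|TL. h x * \<psi> x + H * d)"
  proof (intro integral_mono hi)
   show "integrable TL (%x. h x * \<psi> x + H * d)" using hi by simp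
   fix x
   have "h x * (\<phi> x - \<psi> x) <= \<bar>h x\<bar> * \<bar>\<phi> x - \<psi> x\<bar>" by (metis abs_ge_self abs_mult)
   also have "\<dots> <= H * d" using H[of x] \<psi>(2)[of x] H0 by (intro mult_mono) auto
   finally show "h x * \<phi> x <= h x * \<psi> x + H * d" by (simp add: right_diff_distrib)
  qed
  also have "\<dots> <= C * (LINT x|TL. \<bar>\<psi> x\<bar>) + H * d"
   using trig[OF \<psi>(1)] hi by (simp add: p1)
  also have "(LINT x|TL. \<bar>\<psi> x\<bar>) <= (LINT x|TL. \<bar>\<phi> x\<bar> + d)"
  proof (intro integral_mono abs_i pc)
   show "integrable TL (%x. \<bar>\<phi> x\<bar> + d)" using abs_i[OF \<phi>] by simp
   show "\<bar>\<psi> x\<bar> <= \<bar>\<phi> x\<bar> + d" for x using \<psi>(2)[of x] by linarith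
  qed
  also have "\<dots> = (LINT x|TL. \<bar>\<phi> x\<bar>) + d" using abs_i[OF \<phi>] by (simp add: p1)
  finally have "(LINT x|TL. h x * \<phi> x) <= C * ((LINT x|TL. \<bar>\<phi> x\<bar>) + d) + H * d"
   using C(1) by (simp add: mult_left_mono)
  also have "\<dots> <= C * (LINT x|TL. \<bar>\<phi> x\<bar>) + e"
   using d(2) by (simp add: algebra_simps)
  finally show "(LINT x|TL. h x * \<phi> x) <= C * (LINT x|TL. \<bar>\<phi> x\<bar>) + e" .
 qed
 \<comment> \<open>The excess of h over C as test function makes the integral of its own square at
   most 0.\<close>
 define \<phi> where "\<phi> x = max 0 (h x - C)" for x
 have pc: "continuous_on UNIV \<phi>" unfolding \<phi>_def by (intro continuous_intros hc)
 have sq: "(\<phi> x)\<^sup>2 = h x * \<phi> x - C * \<bar>\<phi> x\<bar>" for x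
  by (simp add: \<phi>_def max_def power2_eq_square left_diff_distrib)
 have pi: "integrable TL (%x. (\<phi> x)\<^sup>2)"
  by (intro integrable_continuous_torus continuous_intros pc)
 have "(LINT x|TL. (\<phi> x)\<^sup>2) <= 0"
  unfolding sq
  using cts[OF pc] abs_i[OF pc] integrable_mult_continuous[OF integrable_continuous_torus[OF hc] pc]
  by simp
 then have "(LINT x|TL. (\<phi> x)\<^sup>2) = 0" by (intro antisym) auto
 then have ae: "AE x in TL. (\<phi> x)\<^sup>2 = 0"
  using integral_nonneg_eq_0_iff_AE[OF pi] by simp
 have "\<phi> x = 0"
 proof (rule ccontr)
  assume nz: "\<phi> x \<noteq> 0"
  have op: "open {x. \<phi> x \<noteq> 0}" by (rule open_Collect_neq[OF pc continuous_on_const])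
  then have "emeasure TL {x. \<phi> x \<noteq> 0} > 0" by (rule emeasure_open_pos) (use nz in auto)
  moreover have "emeasure TL {x. \<phi> x \<noteq> 0} = 0"
   using ae op AE_iff_measurable[of "{x. \<phi> x \<noteq> 0}" TL "%x. (\<phi> x)\<^sup>2 = 0"] by auto
  ultimately show False by simp
 qed
 then show ?thesis by (simp add: \<phi>_def h_def max_def split: if_splits)
qed

text \<open>Duality: freeze c k = \<sigma> k x - \<sigma> k y and apply the scalar bound to the
  single function \<open>f\<close>, the sum of c k \<bullet> \<sigma> k. With S the l2 norm of c
  this reads S^2 <= S L |v|, so the estimate stays summed over k.\<close>

lemma sum_sq_increment_bound:
 fixes \<sigma> :: "nat => torus2 => real^2" and D :: "nat => torus2 => real^2^2"
 assumes lip: "!!k. continuous_on UNIV (\<sigma> k)" and D: "!!k. weak_jacobian (\<sigma> k) (D k)"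
  and L: "L >= 0" "AE x in TL. (\<Sum>k<n. (norm (D k x))\<^sup>2) <= L\<^sup>2"
 shows "(\<Sum>k<n. (norm (\<sigma> k x - \<sigma> k y))\<^sup>2) <= (2 * L * dist x y)\<^sup>2"
proof (cases "x = y")
 case False
 then have d: "dist x y > 0" by simp
 obtain v where v: "proj v = x - y" "norm v < torus_norm (x - y) + dist x y"
  using torus_norm_less[OF d] by blast
 have nv: "norm v <= 2 * dist x y" using v(2) by (simp add: dist_torus2_def)
 define c where "c k = \<sigma> k x - \<sigma> k y" for k
 define S where "S = sqrt (\<Sum>k<n. (norm (c k))\<^sup>2)"
 have S0: "S >= 0" by (simp add: S_def sum_nonneg)
 have S2: "S\<^sup>2 = (\<Sum>k<n. (norm (c k))\<^sup>2)" by (simp add: S_def sum_nonneg)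
 define f where "f z = (\<Sum>p\<in>{..<n} \<times> UNIV. c (fst p) $ snd p * (\<sigma> (fst p) z $ snd p))" for z
 define g where "g j z = (\<Sum>p\<in>{..<n} \<times> UNIV. c (fst p) $ snd p * (D (fst p) z $ snd p $ j))" for j z
 have f_eq: "f z = (\<Sum>k<n. c k \<bullet> \<sigma> k z)" for z
  unfolding f_def by (simp add: inner_vec_def sum.cartesian_product split_beta)
 have "f (y + proj v) - f y <= S * L * norm v"
 proof (rule weak_partial_increment_bound)
  show "continuous_on UNIV f" unfolding f_eq by (intro continuous_intros lip)
  show "weak_partial_trig j f (g j)" for j
   unfolding f_def g_def
   using D by (intro weak_partial_trig_sum weak_partial_imp_trig) (auto simp: weak_jacobian_def)
  show "AE z in TL. \<bar>\<Sum>j\<in>UNIV. v $ j * g j z\<bar> <= S * L * norm v"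
   using L(2)
  proof eventually_elim
   case (elim z)
   have "(\<Sum>j\<in>UNIV. v $ j * g j z) = (\<Sum>k<n. c k \<bullet> (D k z *v v))"
   proof -
   have "(\<Sum>k<n. c k \<bullet> (D k z *v v)) =
   (\<Sum>p\<in>{..<n} \<times> UNIV. c (fst p) $ snd p * (\<Sum>j\<in>UNIV. D (fst p) z $ snd p $ j * v $ j))"
   by (simp add: inner_vec_def matrix_vector_mult_def sum.cartesian_product split_beta del: sum_2)
   also have "\<dots> = (\<Sum>j\<in>UNIV. v $ j * g j z)"
   unfolding g_def sum_distrib_left by (subst sum.swap) (simp add: mult_ac)
   finally show ?thesis by simp
   qed
   also have "\<bar>\<dots>\<bar> <= (\<Sum>k<n. \<bar>norm (c k)\<bar> * \<bar>norm (D k z) * norm v\<bar>)"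
   proof (rule order_trans[OF sum_abs], rule sum_mono)
   fix k
   have "norm (D k z *v v) <= norm (D k z) * norm v"
   proof (rule power2_le_imp_le)
   have "(norm (D k z *v v))\<^sup>2 = (\<Sum>i\<in>UNIV. (D k z $ i \<bullet> v)\<^sup>2)"
   by (simp add: norm_vec_def L2_set_def matrix_vector_mul_component sum_nonneg)
   also have "\<dots> <= (\<Sum>i\<in>UNIV. (norm (D k z $ i) * norm v)\<^sup>2)"
   by (intro sum_mono) (metis Cauchy_Schwarz_ineq2 abs_ge_zero power2_abs power_mono)
   also have "\<dots> = (norm (D k z) * norm v)\<^sup>2"
   by (simp add: norm_vec_def[of "D k z"] L2_set_def sum_nonneg power_mult_distrib sum_distrib_right)
   finally show "(norm (D k z *v v))\<^sup>2 <= (norm (D k z) * norm v)\<^sup>2" .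
   qed simp
   then have "norm (c k) * norm (D k z *v v) <= norm (c k) * (norm (D k z) * norm v)"
   by (intro mult_left_mono) auto
   then show "\<bar>c k \<bullet> (D k z *v v)\<bar> <= \<bar>norm (c k)\<bar> * \<bar>norm (D k z) * norm v\<bar>"
   using Cauchy_Schwarz_ineq2[of "c k" "D k z *v v"] by simp
   qed
   also have "\<dots> <= L2_set (%k. norm (c k)) {..<n} * L2_set (%k. norm (D k z) * norm v) {..<n}"
   by (rule L2_set_mult_ineq)
   also have "\<dots> <= S * (L * norm v)"
   proof (rule mult_mono)
   have "(\<Sum>k<n. (norm (D k z) * norm v)\<^sup>2) <= (L * norm v)\<^sup>2"
   using elim by (simp add: power_mult_distrib sum_distrib_right[symmetric] mult_right_mono)
   then show "L2_set (%k. norm (D k z) * norm v) {..<n} <= L * norm v"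
   unfolding L2_set_def using L(1) by (intro real_le_lsqrt) auto
   qed (auto simp: S_def L2_set_def sum_nonneg)
   finally show ?case by (simp add: mult.assoc)
  qed
 qed (use S0 L(1) in auto)
 moreover have "f (y + proj v) - f y = S\<^sup>2"
  unfolding f_eq S2 v(1)
  by (simp add: c_def sum_subtractf[symmetric] inner_diff_right[symmetric] power2_norm_eq_inner)
 ultimately have "S * S <= S * (L * norm v)" by (simp add: power2_eq_square mult.assoc)
 then have "S <= L * norm v"
  using S0 L(1) by (cases "S = 0") auto
 also have "\<dots> <= L * (2 * dist x y)" using nv L(1) by (intro mult_left_mono)
 finally have "S\<^sup>2 <= (L * (2 * dist x y))\<^sup>2" using S0 by (intro power_mono)
 then show ?thesis unfolding S2 c_def by (simp add: mult.left_commute mult.assoc)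
qed simp

text \<open>The essential supremum bounds all partial sums at once, so the constant does not depend
  on n. It is 4 times this supremum, 4 being the square of the factor 2 in
  \<open>sum_sq_increment_bound\<close>.\<close>

lemma sigma_lipschitz:
 fixes \<sigma> :: "nat => torus2 => real^2" and D :: "nat => torus2 => real^2^2"
 assumes "!!k. continuous_on UNIV (\<sigma> k)" and D: "!!k. weak_jacobian (\<sigma> k) (D k)"
  and fin: "esssup TL (%x. \<Sum>k. ennreal ((norm (D k x))\<^sup>2)) < \<infinity>"
 obtains L where "L >= 0" "!!n x y. (\<Sum>k<n. (norm (\<sigma> k x - \<sigma> k y))\<^sup>2) <= L * (dist x y)\<^sup>2"
proof -
 define E where "E = esssup TL (%x. \<Sum>k. ennreal ((norm (D k x))\<^sup>2))"
 obtain e where e: "E = ennreal e" "e >= 0" using fin unfolding E_def[symmetric] by (cases E) auto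
 have ae: "AE x in TL. (\<Sum>k. ennreal ((norm (D k x))\<^sup>2)) <= E"
  unfolding E_def by (rule esssup_AE)
 have "(\<Sum>k<n. (norm (\<sigma> k x - \<sigma> k y))\<^sup>2) <= (2 * sqrt e * dist x y)\<^sup>2" for n x y
 proof (rule sum_sq_increment_bound[OF assms(1,2)])
  show "AE x in TL. (\<Sum>k<n. (norm (D k x))\<^sup>2) <= (sqrt e)\<^sup>2"
   using ae
  proof eventually_elim
   case (elim x)
   have "ennreal (\<Sum>k<n. (norm (D k x))\<^sup>2) = (\<Sum>k<n. ennreal ((norm (D k x))\<^sup>2))"
   by (simp add: sum_ennreal)
   also have "\<dots> <= (\<Sum>k. ennreal ((norm (D k x))\<^sup>2))" by (intro sum_le_suminf) auto
   also have "\<dots> <= ennreal e" using elim e by simp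
   finally show ?case using e(2) by simp
  qed
 qed (use e in auto)
 then show thesis
  using that[of "4 * e"] e(2) by (simp add: power_mult_distrib)
qed

section \<open>Ito integrals with respect to independent Brownian motions\<close>

lemma
 fixes g :: "'i => 'j => 'b => real"
 assumes "!!i j. i \<in> I ==> j \<in> J ==> integrable N (g i j)"
 shows integrable_double_sum: "integrable N (%x. \<Sum>i\<in>I. \<Sum>j\<in>J. g i j x)"
  and integral_double_sum: "(LINT x|N. (\<Sum>i\<in>I. \<Sum>j\<in>J. g i j x)) = (\<Sum>i\<in>I. \<Sum>j\<in>J. LINT x|N. g i j x)"
proof -
 have i: "integrable N (%x. \<Sum>j\<in>J. g i j x)" if "i \<in> I" for i
  using assms that by (intro Bochner_Integration.integrable_sum)
 then show "integrable N (%x. \<Sum>i\<in>I. \<Sum>j\<in>J. g i j x)"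
  by (rule Bochner_Integration.integrable_sum)
 have "(LINT x|N. (\<Sum>i\<in>I. \<Sum>j\<in>J. g i j x)) = (\<Sum>i\<in>I. LINT x|N. (\<Sum>j\<in>J. g i j x))"
  by (intro Bochner_Integration.integral_sum i)
 also have "\<dots> = (\<Sum>i\<in>I. \<Sum>j\<in>J. LINT x|N. g i j x)"
  using assms by (auto intro!: sum.cong Bochner_Integration.integral_sum)
 finally show "(LINT x|N. (\<Sum>i\<in>I. \<Sum>j\<in>J. g i j x)) = (\<Sum>i\<in>I. \<Sum>j\<in>J. LINT x|N. g i j x)" .
qed

text \<open>The Ito integral is given as a relation. Its properties are derived here from the normal
  law of the increments, their independence of the past, and the mutual independence of the
  processes.\<close>

locale filtered_brownian = prob_space M for M :: "'a measure" +
 fixes T :: real and F :: "real => 'a measure" and W :: "nat => real => 'a => real"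
 assumes T: "T > 0" and filtration: "filtration_upto M T F"
  and brownian: "independent_brownian_motions M T F W"
begin

lemma space_F: "t \<in> {0..T} ==> space (F t) = space M"
 using filtration by (auto simp: filtration_upto_def subalgebra_def)

lemma sets_F: "t \<in> {0..T} ==> sets (F t) \<subseteq> sets M"
 using filtration by (auto simp: filtration_upto_def subalgebra_def)

lemma measurable_F_M: "f \<in> F t \<rightarrow>\<^sub>M N ==> t \<in> {0..T} ==> f \<in> M \<rightarrow>\<^sub>M N"
 using filtration by (auto simp: filtration_upto_def intro: measurable_from_subalg)

lemma measurable_F_mono: "f \<in> F s \<rightarrow>\<^sub>M N ==> 0 <= s ==> s <= t ==> t <= T ==> f \<in> F t \<rightarrow>\<^sub>M N"
proof -
 assume f: "f \<in> F s \<rightarrow>\<^sub>M N" and st: "0 <= s" "s <= t" "t <= T"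
 then have "sets (F s) \<subseteq> sets (F t)" using filtration by (auto simp: filtration_upto_def)
 moreover have "space (F s) = space (F t)" using space_F[of s] space_F[of t] st by simp
 ultimately show "f \<in> F t \<rightarrow>\<^sub>M N" using f by (auto simp: measurable_def)
qed

section \<open>Increments of the Brownian motions\<close>

definition incr :: "nat => real => real => 'a => real" where
 "incr k s t om = W k t om - W k s om"

lemma bm: "brownian_motion M T F (W k)"
 using brownian by (auto simp: independent_brownian_motions_def)

lemma W_meas_F: "t \<in> {0..T} ==> W k t \<in> BM (F t)"
 using bm[of k] by (auto simp: brownian_motion_def)

lemma W_meas: "t \<in> {0..T} ==> W k t \<in> BM M"
 using W_meas_F measurable_F_M by blast

lemma incr_meas_F: "0 <= s ==> s <= t ==> t <= T ==> incr k s t \<in> BM (F t)"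
 unfolding incr_def
 by (intro borel_measurable_diff W_meas_F measurable_F_mono[OF W_meas_F, of s]) auto

lemma incr_meas [measurable (raw)]: "0 <= s ==> s <= T ==> 0 <= t ==> t <= T ==> incr k s t \<in> BM M"
 unfolding incr_def by (intro borel_measurable_diff W_meas) auto

lemma incr_moments:
 assumes "0 <= s" "s <= t" "t <= T"
 shows "integrable M (%om. (incr k s t om)\<^sup>2)" "integrable M (incr k s t)"
  "expectation (incr k s t) = 0" "expectation (%om. (incr k s t om)\<^sup>2) = t - s"
proof -
 have "integrable M (%om. (incr k s t om)\<^sup>2) \<and> integrable M (incr k s t) \<and>
  expectation (incr k s t) = 0 \<and> expectation (%om. (incr k s t om)\<^sup>2) = t - s"
 proof (cases "s = t")
  case False
  then have st: "0 < sqrt (t - s)" using assms by simp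
  have D: "distributed M lborel (incr k s t) (normal_density 0 (sqrt (t - s)))"
   using bm[of k] assms False unfolding brownian_motion_def incr_def by auto
  have m: "integrable lborel (%x. normal_density 0 (sqrt (t - s)) x * x ^ n)" for n
   using integrable_normal_moment[OF st, of 0 n] by simp
  have "integrable M (%om. (incr k s t om) ^ n)" for n
   using m[of n] distributed_integrable[OF D, of "%x. x ^ n"] by simp
  from this[of 1] this[of 2]
  have i: "integrable M (incr k s t)" "integrable M (%om. (incr k s t om)\<^sup>2)" by simp_all
  have e: "expectation (incr k s t) = 0" by (rule normal_distributed_expectation[OF st D])
  have "variance (incr k s t) = (sqrt (t - s))\<^sup>2" by (rule normal_distributed_variance[OF st D])
  then show ?thesis using i e assms by simp
 qed (simp add: incr_def[abs_def])
 then show "integrable M (%om. (incr k s t om)\<^sup>2)" "integrable M (incr k s t)"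
  "expectation (incr k s t) = 0" "expectation (%om. (incr k s t om)\<^sup>2) = t - s" by auto
qed

text \<open>Independence of sigma-algebras, as in \<open>brownian_motion\<close>, is turned into
  independence of random variables. For s = t the definition is silent, but the increment is
  0.\<close>

lemma incr_indep:
 fixes Y :: "'a => real" and g :: "real => real"
 assumes "0 <= s" "s <= t" "t <= T" and Y: "Y \<in> BM (F s)" "integrable M Y"
  and g: "g \<in> BM borel" "integrable M (%om. g (incr k s t om))"
 shows "integrable M (%om. Y om * g (incr k s t om))"
  "expectation (%om. Y om * g (incr k s t om)) = expectation Y * expectation (%om. g (incr k s t om))"
proof -
 have "integrable M (%om. Y om * g (incr k s t om)) \<and>
  expectation (%om. Y om * g (incr k s t om)) = expectation Y * expectation (%om. g (incr k s t om))"
 proof (cases "s = t")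
  case True
  have "integrable M (%om. Y om * g 0)" by (intro integrable_mult_left Y)
  then show ?thesis using True prob_space by (simp add: incr_def)
 next
  case False
  have s: "s \<in> {0..T}" using assms by auto
  have ind: "indep_set (sets (F s)) (sets (vimage_algebra (space M) (incr k s t) borel))"
   using bm[of k] assms False unfolding brownian_motion_def incr_def[abs_def] by auto
  have YM: "Y \<in> BM M" using Y(1) s by (rule measurable_F_M)
  have "indep_var borel Y borel (incr k s t)"
   unfolding indep_var_eq
  proof (intro conjI YM)
   show "random_variable borel (incr k s t)" by (rule incr_meas) (use assms in auto)
   show "indep_set (sigma_sets (space M) {Y -` A \<inter> space M |A. A \<in> sets borel})
   (sigma_sets (space M) {incr k s t -` A \<inter> space M |A. A \<in> sets borel})"
   unfolding indep_sets2_eq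
   proof (intro conjI ballI)
   have sub1: "sigma_sets (space M) {Y -` A \<inter> space M |A. A \<in> sets borel} \<subseteq> sets (F s)"
   using Y(1) space_F[OF s] by (intro sets.sigma_sets_subset'[of _ "F s", simplified]) (auto dest: measurable_sets)
   have sub2: "sigma_sets (space M) {incr k s t -` A \<inter> space M |A. A \<in> sets borel}
   = sets (vimage_algebra (space M) (incr k s t) borel)"
   by (simp add: sets_vimage_algebra)
   show "sigma_sets (space M) {Y -` A \<inter> space M |A. A \<in> sets borel} \<subseteq> events"
   using sub1 sets_F[OF s] by blast
   show "sigma_sets (space M) {incr k s t -` A \<inter> space M |A. A \<in> sets borel} \<subseteq> events"
   using ind unfolding sub2 indep_sets2_eq by blast
   fix a b assume "a \<in> sigma_sets (space M) {Y -` A \<inter> space M |A. A \<in> sets borel}"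
   "b \<in> sigma_sets (space M) {incr k s t -` A \<inter> space M |A. A \<in> sets borel}"
   then show "prob (a \<inter> b) = prob a * prob b"
   using ind sub1 unfolding sub2 indep_sets2_eq by blast
   qed
  qed
  then have iv: "indep_var borel Y borel (%om. g (incr k s t om))"
   using indep_var_compose[of borel Y borel "incr k s t" "%x. x" borel g borel] g(1) by (simp add: comp_def)
  show ?thesis
   using indep_var_integrable[OF iv Y(2) g(2)] indep_var_lebesgue_integral[OF iv Y(2) g(2)] by simp
 qed
 then show "integrable M (%om. Y om * g (incr k s t om))"
  "expectation (%om. Y om * g (incr k s t om)) = expectation Y * expectation (%om. g (incr k s t om))" by auto
qed

lemma incr_martingale:
 fixes Y :: "'a => real"
 assumes "0 <= s" "s <= t" "t <= T" "Y \<in> BM (F s)" "integrable M Y"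
 shows "integrable M (%om. Y om * incr k s t om)" "expectation (%om. Y om * incr k s t om) = 0"
 using incr_indep[OF assms, of "%x. x" k] incr_moments[OF assms(1-3), of k] by auto

lemma integrable_bounded:
 fixes f :: "'a => real"
 assumes "f \<in> BM M" "!!om. om \<in> space M ==> \<bar>f om\<bar> <= C"
 shows "integrable M f"
 by (rule integrable_const_bound[where B = C]) (use assms in auto)

lemma integrable_sq_mult:
 fixes f g :: "'a => real"
 assumes [measurable]: "f \<in> BM M" "g \<in> BM M"
  and "integrable M (%om. (f om)\<^sup>2)" "integrable M (%om. (g om)\<^sup>2)"
 shows "integrable M (%om. f om * g om)"
proof (rule Bochner_Integration.integrable_bound)
 show "integrable M (%om. (f om)\<^sup>2 + (g om)\<^sup>2)" using assms by simp
 show "AE om in M. norm (f om * g om) <= norm ((f om)\<^sup>2 + (g om)\<^sup>2)"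
 proof (rule AE_I2)
  fix om
  have "2 * (\<bar>f om\<bar> * \<bar>g om\<bar>) <= (f om)\<^sup>2 + (g om)\<^sup>2"
   using sum_squares_bound[of "\<bar>f om\<bar>" "\<bar>g om\<bar>"] by (simp add: mult.assoc)
  moreover have "\<bar>f om\<bar> * \<bar>g om\<bar> >= 0" by simp
  ultimately have "\<bar>f om\<bar> * \<bar>g om\<bar> <= (f om)\<^sup>2 + (g om)\<^sup>2" by linarith
  then show "norm (f om * g om) <= norm ((f om)\<^sup>2 + (g om)\<^sup>2)"
   by (simp add: abs_mult)
 qed
qed simp

lemma integrable_bounded_mult_left:
 fixes f g :: "'a => real"
 assumes "integrable M f" "g \<in> BM M" "!!om. om \<in> space M ==> \<bar>g om\<bar> <= C"
 shows "integrable M (%om. g om * f om)"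
proof (rule Bochner_Integration.integrable_bound)
 show "integrable M (%om. C * f om)" using assms by simp
 show "AE om in M. norm (g om * f om) <= norm (C * f om)"
 proof (rule AE_I2)
  fix om assume "om \<in> space M"
  from assms(3)[OF this] show "norm (g om * f om) <= norm (C * f om)"
   by (auto simp: abs_mult intro!: mult_right_mono)
 qed
qed (use assms in auto)

lemma indep_var_of_indep_vars:
 assumes ind: "indep_vars N X UNIV" and kl: "k \<noteq> l"
 shows "indep_var (N k) (X k) (N l) (X l)"
proof -
 let ?S = "%m. sigma_sets (space M) {X m -` A \<inter> space M |A. A \<in> sets (N m)}"
 have rv: "!!m. random_variable (N m) (X m)" and ind_sets: "indep_sets ?S UNIV"
  using ind unfolding indep_vars_def by auto
 have ev: "?S m \<subseteq> events" for m using ind_sets unfolding indep_sets_def by blast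
 show ?thesis
  unfolding indep_var_eq indep_sets2_eq
 proof (intro conjI ballI rv ev)
  fix a b assume a: "a \<in> ?S k" and b: "b \<in> ?S l"
  have "prob (\<Inter>m\<in>{k, l}. if m = k then a else b) = (\<Prod>m\<in>{k, l}. prob (if m = k then a else b))"
   by (rule indep_setsD[OF ind_sets]) (use a b in auto)
  then show "prob (a \<inter> b) = prob a * prob b" using kl by (simp add: Int_commute)
 qed
qed

text \<open>Each \<open>W k\<close> is only assumed to be a Brownian motion for the filtration, which does not make
 the increments of two of them jointly independent of the past. That their covariation vanishes is
 recovered from the independence of the processes by refining the partition of the interval.\<close>

lemma incr_cross:
 assumes st: "0 <= s" "s <= t" "t <= T" and kl: "k \<noteq> l"
  and Y: "Y \<in> BM (F s)" "!!om. om \<in> space M ==> \<bar>Y om\<bar> <= C"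
 shows "expectation (%om. Y om * (incr k s t om * incr l s t om)) = 0"
proof -
 have sT: "s \<in> {0..T}" using st by auto
 have YM [measurable]: "Y \<in> BM M" using Y(1) sT by (rule measurable_F_M)
 have C0: "C >= 0"
 proof -
  obtain om where "om \<in> space M" using not_empty by blast
  then show ?thesis using Y(2)[of om] by linarith
 qed
 \<comment> \<open>The sum \<open>X\<close> of diagonal products over a partition into n pieces has
   second moment (t - s)^2 / n, and |X| <= \<eta> + X^2 / \<eta> turns this into a first-moment
   bound. Later n tends to infinity before \<eta> tends to 0.\<close>
 have bound: "\<bar>expectation (%om. Y om * (incr k s t om * incr l s t om))\<bar> <= C * (\<eta> + (t - s)\<^sup>2 / (real n * \<eta>))"
  if n: "n > 0" and eta: "\<eta> > 0" for n :: nat and \<eta> :: real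
 proof -
  define h where "h = (t - s) / real n"
  define p where "p i = s + real i * h" for i :: nat
  have h0: "h >= 0" using st by (simp add: h_def)
  have pn: "p n = t" "p 0 = s" using n by (auto simp: p_def h_def)
  have pm: "p i <= p j" if "i <= j" for i j using that h0 by (simp add: p_def mult_right_mono)
  have p0: "0 <= p i" for i using st h0 by (simp add: p_def)
  have pT: "p i <= T" if "i <= n" for i using pm[OF that] pn st by simp
  have ps: "s <= p i" for i using pm[of 0 i] pn by simp
  define d where "d m i = incr m (p i) (p (Suc i))" for m i
  have dM [measurable]: "d m i \<in> BM M" if "i < n" for m i
   unfolding d_def using that p0 pT by (intro incr_meas) auto
  have dF: "d m i \<in> BM (F (p j))" if "i < j" "j <= n" for m i j
   unfolding d_def using that p0 pT pm
   by (intro measurable_F_mono[OF incr_meas_F, of "p i" "p (Suc i)"]) auto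
  have d2: "integrable M (%om. (d m i om)\<^sup>2)" "expectation (%om. (d m i om)\<^sup>2) = h"
   "integrable M (d m i)" if "i < n" for m i
  proof -
   have "p (Suc i) - p i = h" by (simp add: p_def algebra_simps)
   then show "integrable M (%om. (d m i om)\<^sup>2)" "expectation (%om. (d m i om)\<^sup>2) = h"
   "integrable M (d m i)"
   using incr_moments[of "p i" "p (Suc i)" m] that p0 pT[of "Suc i"] pm[of i "Suc i"]
   by (auto simp: d_def)
  qed
  have dd: "integrable M (%om. d m i om * d m' j om)" if "i < n" "j < n" for m m' i j
   using that by (intro integrable_sq_mult d2 dM)
  have tele: "incr m s t om = (\<Sum>i<n. d m i om)" for m om
  proof -
   have "(\<Sum>i<j. d m i om) = W m (p j) om - W m (p 0) om" for j
   by (induction j) (auto simp: d_def incr_def)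
   then show ?thesis using pn by (simp add: incr_def)
  qed
  \<comment> \<open>The later of two distinct increments has mean 0 given the past, whatever the
    indices of the Brownian motions.\<close>
  have off: "integrable M (%om. Y om * (d m i om * d m' j om))" "expectation (%om. Y om * (d m i om * d m' j om)) = 0"
   if "i < j" "j < n" for m m' i j
  proof -
   have YF: "Y \<in> BM (F (p j))"
   using that p0 ps pT st by (intro measurable_F_mono[OF Y(1)]) auto
   have F: "(%om. Y om * d m i om) \<in> BM (F (p j))"
   using dF[of i j m] YF that by (intro borel_measurable_times) auto
   have I: "integrable M (%om. Y om * d m i om)"
   using that by (intro integrable_bounded_mult_left[where C = C] d2 Y YM) auto
   have "integrable M (%om. (Y om * d m i om) * incr m' (p j) (p (Suc j)) om)"
   "expectation (%om. (Y om * d m i om) * incr m' (p j) (p (Suc j)) om) = 0"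
   using that p0 pT pm[of j "Suc j"] by (intro incr_martingale F I; simp)+
   then show "integrable M (%om. Y om * (d m i om * d m' j om))" "expectation (%om. Y om * (d m i om * d m' j om)) = 0"
   by (simp_all add: d_def mult.assoc)
  qed
  have all: "integrable M (%om. Y om * (d k i om * d l j om))" if "i < n" "j < n" for i j
   using that by (intro integrable_bounded_mult_left[where C = C] dd Y YM) auto
  have prod: "incr k s t om * incr l s t om = (\<Sum>i<n. \<Sum>j<n. d k i om * d l j om)" for om
   by (simp only: tele sum_product)
  have "expectation (%om. Y om * (incr k s t om * incr l s t om)) =
   expectation (%om. \<Sum>i<n. \<Sum>j<n. Y om * (d k i om * d l j om))"
   unfolding prod sum_distrib_left ..
  also have "\<dots> = (\<Sum>i<n. \<Sum>j<n. expectation (%om. Y om * (d k i om * d l j om)))"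
   by (rule integral_double_sum) (auto intro: all)
  also have "\<dots> = (\<Sum>i<n. expectation (%om. Y om * (d k i om * d l i om)))"
  proof (rule sum.cong[OF refl])
   fix i assume i: "i \<in> {..<n}"
   have "expectation (%om. Y om * (d k i om * d l j om)) = 0" if "j < n" "j \<noteq> i" for j
   proof (cases "i < j")
   case True then show ?thesis using off(2)[of i j k l] that by simp
   next
   case False
   then show ?thesis using off(2)[of j i l k] that i by (simp add: mult.commute)
   qed
   then have "(\<Sum>j<n. expectation (%om. Y om * (d k i om * d l j om))) =
   (\<Sum>j\<in>{i}. expectation (%om. Y om * (d k i om * d l j om)))"
   using i by (intro sum.mono_neutral_right) auto
   then show "(\<Sum>j<n. expectation (%om. Y om * (d k i om * d l j om))) = expectation (%om. Y om * (d k i om * d l i om))"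
   by simp
  qed
  also have "\<dots> = expectation (%om. Y om * (\<Sum>i<n. d k i om * d l i om))"
   unfolding sum_distrib_left by (rule Bochner_Integration.integral_sum[symmetric]) (auto intro: all)
  finally have eq: "expectation (%om. Y om * (incr k s t om * incr l s t om)) =
   expectation (%om. Y om * (\<Sum>i<n. d k i om * d l i om))" .
  define X where "X om = (\<Sum>i<n. d k i om * d l i om)" for om
  have XM [measurable]: "X \<in> BM M" unfolding X_def by measurable
  \<comment> \<open>The independence of the two processes enters here: the expectation factorises
    into one moment per process, and both factors vanish off the diagonal.\<close>
  have quad: "integrable M (%om. (d k i om * d l i om) * (d k j om * d l j om))"
   "expectation (%om. (d k i om * d l i om) * (d k j om * d l j om)) = (if i = j then h\<^sup>2 else 0)"
   if ij: "i < n" "j < n" for i j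
  proof -
   let ?P = "%m om. \<lambda>t\<in>{0..T}. W m t om"
   let ?\<Phi> = "%w :: real => real. (w (p (Suc i)) - w (p i)) * (w (p (Suc j)) - w (p j))"
   have pin: "p i \<in> {0..T}" "p j \<in> {0..T}" "p (Suc i) \<in> {0..T}" "p (Suc j) \<in> {0..T}"
   using ij p0 pT by auto
   have "indep_vars (%_. \<Pi>\<^sub>M t\<in>{0..T}. borel) ?P UNIV"
   using brownian by (simp add: independent_brownian_motions_def)
   then have ind: "indep_var (\<Pi>\<^sub>M t\<in>{0..T}. borel) (?P k) (\<Pi>\<^sub>M t\<in>{0..T}. borel) (?P l)"
   by (rule indep_var_of_indep_vars[OF _ kl])
   have \<Phi>m: "?\<Phi> \<in> BM (\<Pi>\<^sub>M t\<in>{0..T}. borel)"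
   proof -
   have m: "(%w :: real => real. w q) \<in> BM (\<Pi>\<^sub>M t\<in>{0..T}. borel)"
   if "q \<in> {0..T}" for q :: real
   by (rule measurable_component_singleton[OF that])
   show ?thesis
   using borel_measurable_times[OF borel_measurable_diff[OF m[OF pin(3)] m[OF pin(1)]]
   borel_measurable_diff[OF m[OF pin(4)] m[OF pin(2)]]] .
   qed
   have "indep_var borel (?\<Phi> \<circ> ?P k) borel (?\<Phi> \<circ> ?P l)"
   by (rule indep_var_compose[OF ind \<Phi>m \<Phi>m])
   moreover have "?\<Phi> \<circ> ?P m = (%om. d m i om * d m j om)" for m
   using pin by (simp add: fun_eq_iff d_def incr_def)
   ultimately have iv: "indep_var borel (%om. d k i om * d k j om) borel (%om. d l i om * d l j om)" by simp
   have e: "expectation (%om. d m i om * d m j om) = (if i = j then h else 0)" for m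
   proof -
   consider "i = j" | "i < j" | "j < i" by linarith
   then show ?thesis
   proof cases
   case 1 then show ?thesis using d2(2)[OF ij(1), of m] by (simp add: power2_eq_square)
   next
   case 2
   then show ?thesis
   using incr_martingale(2)[of "p j" "p (Suc j)" "d m i" m] ij p0 pT pm[of j "Suc j"] dF[of i j m] d2(3)[of i m]
   by (simp add: d_def[of m j])
   next
   case 3
   then show ?thesis
   using incr_martingale(2)[of "p i" "p (Suc i)" "d m j" m] ij p0 pT pm[of i "Suc i"] dF[of j i m] d2(3)[of j m]
   by (simp add: d_def[of m i] mult.commute)
   qed
   qed
   show "integrable M (%om. (d k i om * d l i om) * (d k j om * d l j om))"
   using indep_var_integrable[OF iv dd dd] ij by (simp add: mult_ac)
   show "expectation (%om. (d k i om * d l i om) * (d k j om * d l j om)) = (if i = j then h\<^sup>2 else 0)"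
   using indep_var_lebesgue_integral[OF iv dd dd] ij
   by (simp add: e mult_ac power2_eq_square)
  qed
  have X2: "(X om)\<^sup>2 = (\<Sum>i<n. \<Sum>j<n. (d k i om * d l i om) * (d k j om * d l j om))" for om
   by (simp add: X_def power2_eq_square sum_product)
  have X2i: "integrable M (%om. (X om)\<^sup>2)" unfolding X2 by (rule integrable_double_sum) (auto intro: quad)
  have "expectation (%om. (X om)\<^sup>2) =
   (\<Sum>i<n. \<Sum>j<n. expectation (%om. (d k i om * d l i om) * (d k j om * d l j om)))"
   unfolding X2 by (rule integral_double_sum) (auto intro: quad)
  also have "\<dots> = (\<Sum>i<n. \<Sum>j<n. if i = j then h\<^sup>2 else 0)"
   by (intro sum.cong refl quad) auto
  also have "\<dots> = real n * h\<^sup>2" by simp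
  also have "\<dots> = (t - s)\<^sup>2 / real n" using n by (simp add: h_def power2_eq_square)
  finally have EX2: "expectation (%om. (X om)\<^sup>2) = (t - s)\<^sup>2 / real n" .
  have Xi: "integrable M X"
  proof -
   have "integrable M (%om. X om * 1)" by (intro integrable_sq_mult X2i) auto
   then show ?thesis by simp
  qed
  have "\<bar>expectation (%om. Y om * X om)\<bar> <= expectation (%om. \<bar>Y om * X om\<bar>)" by (rule integral_abs_bound)
  also have "\<dots> <= expectation (%om. C * (\<eta> + (X om)\<^sup>2 / \<eta>))"
  proof (rule integral_mono)
   show "integrable M (%om. \<bar>Y om * X om\<bar>)"
   by (intro integrable_abs integrable_bounded_mult_left[where C = C] Xi YM Y)
   show "integrable M (%om. C * (\<eta> + (X om)\<^sup>2 / \<eta>))" using X2i by simp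
   fix om assume om: "om \<in> space M"
   have "\<bar>X om\<bar> <= \<eta> + (X om)\<^sup>2 / \<eta>"
   proof (cases "\<bar>X om\<bar> <= \<eta>")
   case False
   then have "\<bar>X om\<bar> * \<eta> <= \<bar>X om\<bar> * \<bar>X om\<bar>" by (intro mult_left_mono) auto
   then have "\<bar>X om\<bar> <= (X om)\<^sup>2 / \<eta>" using eta by (simp add: pos_le_divide_eq power2_eq_square)
   then show ?thesis using eta by linarith
   qed (use eta in \<open>simp add: add_increasing2\<close>)
   then show "\<bar>Y om * X om\<bar> <= C * (\<eta> + (X om)\<^sup>2 / \<eta>)"
   unfolding abs_mult using Y(2)[OF om] C0 by (intro mult_mono) auto
  qed
  also have "\<dots> = C * (\<eta> + (t - s)\<^sup>2 / (real n * \<eta>))"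
   using X2i EX2 prob_space by (simp add: divide_divide_eq_left)
  finally show ?thesis using eq by (simp add: X_def)
 qed
 have "\<bar>expectation (%om. Y om * (incr k s t om * incr l s t om))\<bar> <= C * \<eta>" if "\<eta> > 0" for \<eta> :: real
 proof (rule LIMSEQ_le_const)
  show "(%n. C * (\<eta> + (t - s)\<^sup>2 / (real n * \<eta>))) \<longlonglongrightarrow> C * \<eta>" using that by real_asymp
  show "\<exists>N. \<forall>n\<ge>N. \<bar>expectation (%om. Y om * (incr k s t om * incr l s t om))\<bar> <= C * (\<eta> + (t - s)\<^sup>2 / (real n * \<eta>))"
   using bound[OF _ that] by (intro exI[of _ 1]) auto
 qed
 note le = this
 have "\<bar>expectation (%om. Y om * (incr k s t om * incr l s t om))\<bar> <= 0"
 proof (rule field_le_epsilon)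
  fix e :: real assume e: "e > 0"
  have "C * (e / (C + 1)) <= e" using C0 e by (simp add: field_simps)
  moreover have "e / (C + 1) > 0" using C0 e by simp
  ultimately show "\<bar>expectation (%om. Y om * (incr k s t om * incr l s t om))\<bar> <= 0 + e"
   using le[of "e / (C + 1)"] by linarith
 qed
 then show ?thesis by simp
qed

end

section \<open>Simple integrands: isometry and martingale property\<close>

context filtered_brownian
begin

text \<open>Pairs a simple integrand with its integral. As an inductive sum of elementary pieces,
  with no order among the intervals, it is closed under differences at once, whereas partitions
  would have to be refined to a common one.\<close>

inductive simple_int :: "nat => (real => 'a => 'b::euclidean_space) => (real => 'a => 'b) => bool" for k where
 simple_int_zero: "simple_int k (%t om. 0) (%t om. 0)"
| simple_int_add: "simple_int k P Q ==> 0 <= a ==> a <= b ==> b <= T ==> Z \<in> BM (F a) ==>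
  bounded (Z ` space M) ==>
  simple_int k (%t om. P t om + indicator {a<..b} t *\<^sub>R Z om)
   (%t om. Q t om + (W k (min t b) om - W k (min t a) om) *\<^sub>R Z om)"

lemma simple_int_uminus: "simple_int k P Q ==> simple_int k (%t om. - P t om) (%t om. - Q t om)"
proof (induction rule: simple_int.induct)
 case (simple_int_add P Q a b Z)
 have "bounded ((%om. - Z om) ` space M)"
  using simple_int_add.hyps(6) by (simp add: bounded_iff)
 from simple_int.simple_int_add[OF simple_int_add.IH simple_int_add.hyps(2-4)
   borel_measurable_uminus[OF simple_int_add.hyps(5)] this]
 show ?case by (simp only: minus_add_distrib scaleR_minus_right)
qed (simp only: minus_zero simple_int_zero)

lemma simple_int_plus:
 assumes "simple_int k P Q"
 shows "simple_int k P' Q' ==> simple_int k (%t om. P t om + P' t om) (%t om. Q t om + Q' t om)"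
proof (induction rule: simple_int.induct)
 case (simple_int_add P' Q' a b Z)
 have "simple_int k (%t om. (P t om + P' t om) + indicator {a<..b} t *\<^sub>R Z om)
   (%t om. (Q t om + Q' t om) + (W k (min t b) om - W k (min t a) om) *\<^sub>R Z om)"
  by (rule simple_int.simple_int_add[OF simple_int_add.IH simple_int_add.hyps(2-6)])
 then show ?case by (simp only: add.assoc)
qed (simp add: assms)

lemma simple_int_diff:
 assumes "simple_int k P Q" "simple_int k P' Q'"
 shows "simple_int k (%t om. P t om - P' t om) (%t om. Q t om - Q' t om)"
 using simple_int_plus[OF assms(1) simple_int_uminus[OF assms(2)]] by simp

lemma measurable_Z: "Z \<in> BM (F a) ==> 0 <= a ==> a <= T ==> Z \<in> BM M"
 by (erule measurable_F_M) simp

lemma simple_int_meas: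
 assumes "simple_int k P Q"
 shows simple_int_meas_integrand: "(%(t, om). P t om) \<in> BM (borel \<Otimes>\<^sub>M M)"
  and simple_int_meas_integral: "t \<in> {0..T} ==> Q t \<in> BM M"
proof -
 show "(%(t, om). P t om) \<in> BM (borel \<Otimes>\<^sub>M M)"
  using assms
 proof induction
  case (simple_int_add P Q a b Z)
  have "a <= T" using simple_int_add by simp
  note Z = measurable_Z[OF simple_int_add.hyps(5) simple_int_add.hyps(2) this]
  have ind: "(%p. indicator {a<..b} (fst p) :: real) \<in> BM (borel \<Otimes>\<^sub>M M)"
   by (rule measurable_compose[OF measurable_fst borel_measurable_indicator]) simp
  show ?case
   using borel_measurable_add[OF simple_int_add.IH[unfolded split_beta']
   borel_measurable_scaleR[OF ind measurable_compose[OF measurable_snd Z]]]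
   unfolding split_beta' .
 qed simp
 show "Q t \<in> BM M" if "t \<in> {0..T}"
  using assms
 proof induction
  case (simple_int_add P Q a b Z)
  have "a <= T" using simple_int_add by simp
  note Z = measurable_Z[OF simple_int_add.hyps(5) simple_int_add.hyps(2) this]
  have "W k (min t b) \<in> BM M" "W k (min t a) \<in> BM M"
   by (rule W_meas; use simple_int_add.hyps that in auto)+
  from borel_measurable_add[OF simple_int_add.IH borel_measurable_scaleR[OF borel_measurable_diff[OF this] Z]]
  show ?case .
 qed simp
qed

text \<open>Cut [a,b] at c and both intervals at the end e of their overlap. A product of increments
  over disjoint pieces has mean 0, since the later one is independent of all that precedes it; only
  [c,e] contributes. Having a <= c makes Z \<bullet> Z' known at time c.\<close>

lemma elementary_product_le:
 fixes Z Z' :: "'a => 'b::euclidean_space"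
 assumes ac: "0 <= a" "a <= c" "a <= b" "c <= d" "b <= T" "d <= T"
  and Z: "Z \<in> BM (F a)" "bounded (Z ` space M)"
  and Z': "Z' \<in> BM (F c)" "bounded (Z' ` space M)"
 shows "integrable M (%om. (incr k a b om * incr l c d om) * (Z om \<bullet> Z' om))"
  "expectation (%om. (incr k a b om * incr l c d om) * (Z om \<bullet> Z' om)) =
   (if k = l then max 0 (min b d - c) * expectation (%om. Z om \<bullet> Z' om) else 0)"
proof -
 define Y where "Y om = Z om \<bullet> Z' om" for om
 have YF: "Y \<in> BM (F c)"
  unfolding Y_def using ac by (intro borel_measurable_inner measurable_F_mono[OF Z(1)] Z'(1)) auto
 have YM [measurable]: "Y \<in> BM M" using YF ac by (intro measurable_Z[of Y c]) auto
 obtain C where C: "\<bar>Y om\<bar> <= C" if "om \<in> space M" for om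
 proof -
  obtain C1 where "!!om. om \<in> space M ==> norm (Z om) <= C1" using Z(2) by (auto simp: bounded_iff)
  moreover obtain C2 where "!!om. om \<in> space M ==> norm (Z' om) <= C2" using Z'(2) by (auto simp: bounded_iff)
  ultimately have "\<bar>Y om\<bar> <= C1 * C2" if "om \<in> space M" for om
   unfolding Y_def using that
   by (intro order_trans[OF Cauchy_Schwarz_ineq2] mult_mono) (auto intro: order_trans[OF norm_ge_zero])
  then show thesis by (rule that)
 qed
 have Yi: "integrable M Y" by (rule integrable_bounded[OF YM C])
 have i2: "integrable M (%om. incr m u v om * incr m' u' v' om)"
  if "0 <= u" "u <= v" "v <= T" "0 <= u'" "u' <= v'" "v' <= T" for m m' u v u' v'
  using that by (intro integrable_sq_mult incr_moments incr_meas) auto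
 have i3: "integrable M (%om. Y om * (incr m u v om * incr m' u' v' om))"
  if "0 <= u" "u <= v" "v <= T" "0 <= u'" "u' <= v'" "v' <= T" for m m' u v u' v'
  by (rule integrable_bounded_mult_left[OF i2 YM C]) (use that in auto)
 show "integrable M (%om. (incr k a b om * incr l c d om) * (Z om \<bullet> Z' om))"
  using i3[of a b c d k l] ac by (simp add: Y_def mult.commute)
 have late: "expectation (%om. Y om * (incr m u v om * incr m' u' v' om)) = 0"
  if "0 <= u" "u <= v" "v <= u'" "c <= u'" "u' <= v'" "v' <= T" for m m' u v u' v'
 proof -
  have F: "(%om. Y om * incr m u v om) \<in> BM (F u')"
   using that ac by (intro borel_measurable_times measurable_F_mono[OF YF]
   measurable_F_mono[OF incr_meas_F, of u v]) auto
  have I: "integrable M (%om. Y om * incr m u v om)"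
   by (rule integrable_bounded_mult_left[OF incr_moments(2) YM C]) (use that in auto)
  show ?thesis using incr_martingale(2)[of u' v' _ m', OF _ _ _ F I] that by (simp add: mult.assoc)
 qed
 have diag: "expectation (%om. Y om * (incr k c e om * incr l c e om)) = (if k = l then (e - c) * expectation Y else 0)"
  if "c <= e" "e <= T" for e
 proof (cases "k = l")
  case True
  have c0: "0 <= c" using ac by simp
  show ?thesis
   using incr_indep(2)[OF c0 that YF Yi, of "%x. x\<^sup>2" k] incr_moments[OF c0 that, of k] True
   by (simp add: power2_eq_square mult.commute)
 next
  case False
  then show ?thesis using incr_cross[OF _ that False YF C] ac by simp
 qed
 have split: "incr m u w om = incr m u v om + incr m v w om" for m u v w om by (simp add: incr_def)
 have main: "expectation (%om. Y om * (incr k a b om * incr l c d om)) =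
   (if k = l then max 0 (min b d - c) * expectation Y else 0)"
 proof (cases "b <= c")
  case True
  then show ?thesis using late[of a b c d k l] ac by simp
 next
  case False
  then have cb: "c <= b" by simp
  define e where "e = min b d"
  have e: "c <= e" "e <= b" "e <= d" "e <= T" "0 <= c" using cb ac by (auto simp: e_def)
  have "expectation (%om. Y om * (incr k a b om * incr l c d om)) =
   expectation (%om. Y om * (incr k a c om * incr l c d om) + (Y om * (incr k c e om * incr l c e om)
   + (Y om * (incr l c e om * incr k e b om) + (Y om * (incr k c e om * incr l e d om)
   + Y om * (incr k e b om * incr l e d om)))))"
   unfolding split[of k a b _ c] split[of k c b _ e] split[of l c d _ e]
   by (simp add: algebra_simps)
  also have "\<dots> = 0 + ((if k = l then (e - c) * expectation Y else 0) + (0 + (0 + 0)))"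
  proof -
   have "e = b \<or> e = d" by (auto simp: e_def)
   then have z: "expectation (%om. Y om * (incr k e b om * incr l e d om)) = 0"
   by (auto simp: incr_def)
   have "expectation (%om. Y om * (incr k a c om * incr l c d om)) = 0"
   "expectation (%om. Y om * (incr l c e om * incr k e b om)) = 0"
   "expectation (%om. Y om * (incr k c e om * incr l e d om)) = 0"
   by (rule late; use e ac in simp)+
   note zeros = this z
   have i: "integrable M (%om. Y om * (incr k a c om * incr l c d om))"
   "integrable M (%om. Y om * (incr k c e om * incr l c e om))"
   "integrable M (%om. Y om * (incr l c e om * incr k e b om))"
   "integrable M (%om. Y om * (incr k c e om * incr l e d om))"
   "integrable M (%om. Y om * (incr k e b om * incr l e d om))"
   by (rule i3; use e ac in simp)+
   note i45 = Bochner_Integration.integrable_add[OF i(4,5)]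
   note i345 = Bochner_Integration.integrable_add[OF i(3) i45]
   note i2345 = Bochner_Integration.integrable_add[OF i(2) i345]
   show ?thesis
   unfolding Bochner_Integration.integral_add[OF i(1) i2345]
   Bochner_Integration.integral_add[OF i(2) i345] Bochner_Integration.integral_add[OF i(3) i45]
   Bochner_Integration.integral_add[OF i(4,5)] zeros diag[OF e(1,4)] ..
  qed
  finally show ?thesis using e by (simp add: e_def)
 qed
 then show "expectation (%om. (incr k a b om * incr l c d om) * (Z om \<bullet> Z' om)) =
   (if k = l then max 0 (min b d - c) * expectation (%om. Z om \<bullet> Z' om) else 0)"
  by (simp add: Y_def[abs_def] mult.commute)
qed

lemma elementary_product:
 fixes Z Z' :: "'a => 'b::euclidean_space"
 assumes "0 <= a" "a <= b" "b <= T" "0 <= c" "c <= d" "d <= T"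
  and Z: "Z \<in> BM (F a)" "bounded (Z ` space M)"
  and Z': "Z' \<in> BM (F c)" "bounded (Z' ` space M)"
 shows "integrable M (%om. (incr k a b om * incr l c d om) * (Z om \<bullet> Z' om))"
  "expectation (%om. (incr k a b om * incr l c d om) * (Z om \<bullet> Z' om)) =
   (if k = l then max 0 (min b d - max a c) * expectation (%om. Z om \<bullet> Z' om) else 0)"
proof -
 have "integrable M (%om. (incr k a b om * incr l c d om) * (Z om \<bullet> Z' om)) \<and>
  expectation (%om. (incr k a b om * incr l c d om) * (Z om \<bullet> Z' om)) =
   (if k = l then max 0 (min b d - max a c) * expectation (%om. Z om \<bullet> Z' om) else 0)"
 proof (cases "a <= c")
  case True
  then show ?thesis
   using elementary_product_le[of a c b d Z Z' k l] assms by (simp add: max_def)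
 next
  case False
  have e1: "(%om. (incr l c d om * incr k a b om) * (Z' om \<bullet> Z om)) =
   (%om. (incr k a b om * incr l c d om) * (Z om \<bullet> Z' om))"
   by (simp only: inner_commute[of "Z' _"] mult.commute[of "incr l c d _"])
  have e2: "(%om. Z' om \<bullet> Z om) = (%om. Z om \<bullet> Z' om)" by (simp only: inner_commute)
  have e3: "max 0 (min d b - a) = max 0 (min b d - max a c)" using False by auto
  have ca: "c <= a" using False by simp
  show ?thesis
   using elementary_product_le[OF assms(4) ca assms(5,2,6,3) Z' Z, of l k]
   unfolding e1 e2 e3 eq_commute[of l k] by blast
 qed
 then show "integrable M (%om. (incr k a b om * incr l c d om) * (Z om \<bullet> Z' om))"
  "expectation (%om. (incr k a b om * incr l c d om) * (Z om \<bullet> Z' om)) =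
   (if k = l then max 0 (min b d - max a c) * expectation (%om. Z om \<bullet> Z' om) else 0)"
  by auto
qed

text \<open>The polarised isometry up to time t, where the flag \<open>e\<close> will say that both
  Brownian motions are the same. Integrability is included so that the predicate is additive in each
  argument and a double induction over simple integrands goes through.\<close>

definition isom :: "bool => real => (real => 'a => 'b::euclidean_space) => (real => 'a => 'b) =>
  (real => 'a => 'b) => (real => 'a => 'b) => bool" where
 "isom e t P Q P' Q' \<longleftrightarrow> integrable M (%om. Q t om \<bullet> Q' t om) \<and>
   (\<forall>om. integrable lborel (%s. indicator {0..t} s * (P s om \<bullet> P' s om))) \<and>
   integrable M (%om. LBINT s. indicator {0..t} s * (P s om \<bullet> P' s om)) \<and>
   expectation (%om. Q t om \<bullet> Q' t om) =
   (if e then expectation (%om. LBINT s. indicator {0..t} s * (P s om \<bullet> P' s om)) else 0)"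

lemma isom_commute: "isom e t P Q P' Q' \<longleftrightarrow> isom e t P' Q' P Q"
proof -
 have c: "!!om. Q t om \<bullet> Q' t om = Q' t om \<bullet> Q t om" "!!s om. P s om \<bullet> P' s om = P' s om \<bullet> P s om"
  by (rule inner_commute)+
 show ?thesis unfolding isom_def c ..
qed

lemma isom_add:
 assumes "isom e t P1 Q1 P' Q'" "isom e t P2 Q2 P' Q'"
 shows "isom e t (%t om. P1 t om + P2 t om) (%t om. Q1 t om + Q2 t om) P' Q'"
proof -
 let ?I = "%P s om. indicator {0..t} s * (P s om \<bullet> P' s om)"
 have q: "integrable M (%om. Q1 t om \<bullet> Q' t om)" "integrable M (%om. Q2 t om \<bullet> Q' t om)"
  and p: "!!om. integrable lborel (%s. ?I P1 s om)" "!!om. integrable lborel (%s. ?I P2 s om)"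
  and l: "integrable M (%om. LBINT s. ?I P1 s om)" "integrable M (%om. LBINT s. ?I P2 s om)"
  and e: "expectation (%om. Q1 t om \<bullet> Q' t om) = (if e then expectation (%om. LBINT s. ?I P1 s om) else 0)"
   "expectation (%om. Q2 t om \<bullet> Q' t om) = (if e then expectation (%om. LBINT s. ?I P2 s om) else 0)"
  using assms unfolding isom_def by blast+
 show ?thesis
  unfolding isom_def inner_add_left distrib_left Bochner_Integration.integral_add[OF p]
   Bochner_Integration.integral_add[OF q] Bochner_Integration.integral_add[OF l] e
  using Bochner_Integration.integrable_add[OF q] Bochner_Integration.integrable_add[OF p]
   Bochner_Integration.integrable_add[OF l] by simp
qed

lemma isom_elementary:
 fixes Z Z' :: "'a => 'b::euclidean_space"
 assumes ab: "0 <= a" "a <= b" "b <= T" and cd: "0 <= c" "c <= d" "d <= T"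
  and Z: "Z \<in> BM (F a)" "bounded (Z ` space M)"
  and Z': "Z' \<in> BM (F c)" "bounded (Z' ` space M)"
  and t: "t \<in> {0..T}"
 shows "isom (k = l) t (%t om. indicator {a<..b} t *\<^sub>R Z om) (%t om. (W k (min t b) om - W k (min t a) om) *\<^sub>R Z om)
   (%t om. indicator {c<..d} t *\<^sub>R Z' om) (%t om. (W l (min t d) om - W l (min t c) om) *\<^sub>R Z' om)"
proof -
 let ?m = "max a c" and ?M = "min (min b d) t"
 have ind: "indicator {0..t} s * ((indicator {a<..b} s *\<^sub>R Z om) \<bullet> (indicator {c<..d} s *\<^sub>R Z' om)) =
   indicator {?m<..?M} s * (Z om \<bullet> Z' om)" for s om
  using ab cd by (auto simp: indicator_def)
 have vol: "emeasure lborel {?m<..?M} = ennreal (max 0 (?M - ?m))"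
 proof (cases "?m <= ?M")
  case True
  then show ?thesis by (simp only: emeasure_lborel_Ioc) simp
 next
  case False
  then have "{?m<..?M} = {}" "max 0 (?M - ?m) = 0" by auto
  then show ?thesis by simp
 qed
 have fin: "integrable lborel (indicator {?m<..?M} :: real => real)"
  by (rule integrable_real_indicator) (simp, simp only: vol ennreal_less_top infinity_ennreal_def)
 have len: "(LBINT s. indicator {?m<..?M} s) = max 0 (?M - ?m)"
 proof -
  have "(LBINT s. indicator {?m<..?M} s) = measure lborel {?m<..?M}" by simp
  also have "\<dots> = max 0 (?M - ?m)"
   unfolding measure_def vol by (rule enn2real_ennreal) simp
  finally show ?thesis .
 qed
 have i1: "integrable lborel (%s. indicator {?m<..?M} s * (Z om \<bullet> Z' om))" for om
  using fin by simp
 have i2: "(LBINT s. indicator {?m<..?M} s * (Z om \<bullet> Z' om)) = max 0 (?M - ?m) * (Z om \<bullet> Z' om)" for om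
  using len by simp
 have [measurable]: "Z \<in> BM M" "Z' \<in> BM M"
  using ab cd Z Z' by (auto intro!: measurable_Z)
 obtain C1 where C1: "!!om. om \<in> space M ==> norm (Z om) <= C1" using Z(2) by (auto simp: bounded_iff)
 obtain C2 where C2: "!!om. om \<in> space M ==> norm (Z' om) <= C2" using Z'(2) by (auto simp: bounded_iff)
 have ZZ: "integrable M (%om. Z om \<bullet> Z' om)"
 proof (rule integrable_bounded[where C = "C1 * C2"])
  show "\<bar>Z om \<bullet> Z' om\<bar> <= C1 * C2" if "om \<in> space M" for om
   using that C1 C2
   by (intro order_trans[OF Cauchy_Schwarz_ineq2] mult_mono) (auto intro: order_trans[OF norm_ge_zero])
 qed simp
 show ?thesis
 \<comment> \<open>If t lies before one of the starting points, that integral is still 0; otherwise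
   stopping at t only shortens the intervals at their right ends.\<close>
 proof (cases "t <= a \<or> t <= c")
  case True
  then have "max 0 (?M - ?m) = 0" by auto
  moreover have "W k (min t b) om - W k (min t a) om = 0 \<or> W l (min t d) om - W l (min t c) om = 0" for om
   using True ab cd by (auto simp: min_def)
  then have "((W k (min t b) om - W k (min t a) om) *\<^sub>R Z om) \<bullet> ((W l (min t d) om - W l (min t c) om) *\<^sub>R Z' om) = 0" for om
   by (metis inner_zero_left inner_zero_right scaleR_zero_left)
  ultimately show ?thesis unfolding isom_def ind using i1 by (simp only: i2) simp
 next
  case False
  have q: "((W k (min t b) om - W k (min t a) om) *\<^sub>R Z om) \<bullet> ((W l (min t d) om - W l (min t c) om) *\<^sub>R Z' om) =
   (incr k a (min t b) om * incr l c (min t d) om) * (Z om \<bullet> Z' om)" for om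
   using False by (simp add: incr_def min_def)
  have e: "min (min t b) (min t d) = ?M" by auto
  have "integrable M (%om. (incr k a (min t b) om * incr l c (min t d) om) * (Z om \<bullet> Z' om))"
   "expectation (%om. (incr k a (min t b) om * incr l c (min t d) om) * (Z om \<bullet> Z' om)) =
   (if k = l then max 0 (min (min t b) (min t d) - ?m) * expectation (%om. Z om \<bullet> Z' om) else 0)"
   using False ab cd t by (intro elementary_product Z Z'; auto)+
  then show ?thesis
   unfolding isom_def ind q i2 e using i1 ZZ by simp
 qed
qed

lemma isom_zero: "isom e t (%t om. 0) (%t om. 0) P' Q'"
 by (simp add: isom_def)

lemma simple_int_isometry:
 assumes "simple_int k P Q" "simple_int l P' Q'" and t: "t \<in> {0..T}"
 shows "isom (k = l) t P Q P' Q'"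
 using assms(1)
proof induction
 case (simple_int_add P Q a b Z)
 have "isom (k = l) t P' Q' (%t om. indicator {a<..b} t *\<^sub>R Z om) (%t om. (W k (min t b) om - W k (min t a) om) *\<^sub>R Z om)"
  using assms(2)
 proof induction
  case (simple_int_add P' Q' c d Z')
  have "isom (k = l) t (%t om. indicator {c<..d} t *\<^sub>R Z' om) (%t om. (W l (min t d) om - W l (min t c) om) *\<^sub>R Z' om)
   (%t om. indicator {a<..b} t *\<^sub>R Z om) (%t om. (W k (min t b) om - W k (min t a) om) *\<^sub>R Z om)"
   using isom_elementary[of a b c d Z Z' t k l] simple_int_add.hyps \<open>0 <= a\<close> \<open>a <= b\<close> \<open>b <= T\<close>
   \<open>Z \<in> BM (F a)\<close> \<open>bounded (Z ` space M)\<close> t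
   by (simp add: isom_commute)
  from isom_add[OF simple_int_add.IH this] show ?case .
 qed (rule isom_zero)
 then have "isom (k = l) t (%t om. indicator {a<..b} t *\<^sub>R Z om) (%t om. (W k (min t b) om - W k (min t a) om) *\<^sub>R Z om) P' Q'"
  by (simp add: isom_commute)
 from isom_add[OF simple_int_add.IH this] show ?case .
qed (rule isom_zero)

lemma simple_int_martingale:
 fixes g :: "'a => 'b::euclidean_space"
 assumes "simple_int k P Q" and st: "0 <= s" "s <= t" "t <= T"
  and g: "g \<in> BM (F s)" "bounded (g ` space M)"
 shows "integrable M (%om. g om \<bullet> (Q t om - Q s om)) \<and> expectation (%om. g om \<bullet> (Q t om - Q s om)) = 0"
 using assms(1)
proof induction
 case (simple_int_add P Q a b Z)
 \<comment> \<open>Over [s,t] the elementary integral on (a,b] moves by the increment over [u,v],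
   the overlap of the two intervals. The outer maximum in \<open>v\<close> shrinks [u,v] to a point
   when the overlap is empty.\<close>
 define u where "u = max s a"
 define v where "v = max u (min t b)"
 let ?I = "%om. (W k (min t b) om - W k (min t a) om) - (W k (min s b) om - W k (min s a) om)"
 have uv: "0 <= u" "u <= v" "v <= T" "s <= u" "a <= u"
  using st simple_int_add.hyps by (auto simp: u_def v_def)
 have I: "?I om = incr k u v om" for om
  using st simple_int_add.hyps by (auto simp: incr_def u_def v_def min_def max_def)
 obtain C1 where C1: "!!om. om \<in> space M ==> norm (g om) <= C1" using g(2) by (auto simp: bounded_iff)
 obtain C2 where C2: "!!om. om \<in> space M ==> norm (Z om) <= C2" using simple_int_add.hyps(6) by (auto simp: bounded_iff)
 have gF: "(%om. g om \<bullet> Z om) \<in> BM (F u)"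
  using uv st simple_int_add.hyps
  by (intro borel_measurable_inner measurable_F_mono[OF g(1)] measurable_F_mono[OF simple_int_add.hyps(5)]) auto
 have gi: "integrable M (%om. g om \<bullet> Z om)"
 proof (rule integrable_bounded[where C = "C1 * C2"])
  show "(%om. g om \<bullet> Z om) \<in> BM M" using gF uv by (intro measurable_Z[of _ u]) auto
  show "\<bar>g om \<bullet> Z om\<bar> <= C1 * C2" if "om \<in> space M" for om
   using that C1 C2
   by (intro order_trans[OF Cauchy_Schwarz_ineq2] mult_mono) (auto intro: order_trans[OF norm_ge_zero])
 qed
 note inc = incr_martingale[OF uv(1-3) gF gi, of k]
 have "g om \<bullet> ((Q t om + (W k (min t b) om - W k (min t a) om) *\<^sub>R Z om) - (Q s om + (W k (min s b) om - W k (min s a) om) *\<^sub>R Z om))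
   = g om \<bullet> (Q t om - Q s om) + (g om \<bullet> Z om) * incr k u v om" for om
  unfolding I[symmetric] by (simp add: inner_add_right inner_diff_right algebra_simps)
 then show ?case using simple_int_add.IH inc by simp
qed simp

end

section \<open>From simple integrands to series of Ito integrals\<close>

lemma norm_add_sq_le: "(norm (a + b))\<^sup>2 <= 2 * (norm a)\<^sup>2 + 2 * (norm b)\<^sup>2"
 for a b :: "'b::real_normed_vector"
proof -
 have "(norm (a + b))\<^sup>2 <= (norm a + norm b)\<^sup>2" by (intro power_mono norm_triangle_ineq) auto
 also have "\<dots> <= 2 * (norm a)\<^sup>2 + 2 * (norm b)\<^sup>2"
  using sum_squares_bound[of "norm a" "norm b"] by (simp add: power2_sum)
 finally show ?thesis .
qed

lemma ennreal_norm_add_sq_le: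
 "ennreal ((norm (a + b))\<^sup>2) <= 2 * (ennreal ((norm a)\<^sup>2) + ennreal ((norm b)\<^sup>2))"
 for a b :: "'b::real_normed_vector"
proof -
 have "ennreal ((norm (a + b))\<^sup>2) <= ennreal (2 * ((norm a)\<^sup>2 + (norm b)\<^sup>2))"
  using norm_add_sq_le[of a b] by (intro ennreal_leI) simp
 also have "\<dots> = 2 * (ennreal ((norm a)\<^sup>2) + ennreal ((norm b)\<^sup>2))"
  by (simp add: ennreal_mult)
 finally show ?thesis .
qed

context filtered_brownian
begin

text \<open>Squared L2 norms live in \<open>ennreal\<close>, so that estimates can precede any
  knowledge of finiteness.\<close>

definition sqn :: "('a => 'b::euclidean_space) => ennreal" where
 "sqn X = (\<integral>\<^sup>+om. ennreal ((norm (X om))\<^sup>2) \<partial>M)"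

definition sqi :: "real => (real => 'a => 'b::euclidean_space) => ennreal" where
 "sqi t H = (\<integral>\<^sup>+om. (\<integral>\<^sup>+s\<in>{0..t}. ennreal ((norm (H s om))\<^sup>2) \<partial>lborel) \<partial>M)"

lemma sqn_add:
 assumes [measurable]: "X \<in> BM M" "Y \<in> BM M"
 shows "sqn (%om. X om + Y om) <= 2 * (sqn X + sqn Y)"
proof -
 have "sqn (%om. X om + Y om) <= (\<integral>\<^sup>+om. 2 * (ennreal ((norm (X om))\<^sup>2) + ennreal ((norm (Y om))\<^sup>2)) \<partial>M)"
  unfolding sqn_def by (intro nn_integral_mono ennreal_norm_add_sq_le)
 also have "\<dots> = 2 * (sqn X + sqn Y)"
  unfolding sqn_def by (simp add: nn_integral_cmult nn_integral_add)
 finally show ?thesis .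
qed

lemma sqn_minus: "sqn (%om. X om - Y om) = sqn (%om. Y om - X om)"
 by (simp add: sqn_def norm_minus_commute)

lemma sqi_add:
 fixes H K :: "real => 'a => 'b::euclidean_space"
 assumes H: "(%(t, om). H t om) \<in> BM (borel \<Otimes>\<^sub>M M)"
  and K: "(%(t, om). K t om) \<in> BM (borel \<Otimes>\<^sub>M M)"
 shows "sqi t (%s om. H s om + K s om) <= 2 * (sqi t H + sqi t K)"
proof -
 have m: "(%p. ennreal ((norm (G (snd p) (fst p)))\<^sup>2) * indicator {0..t} (snd p)) \<in> BM (M \<Otimes>\<^sub>M lborel)"
  if "(%(t, om). G t om) \<in> BM (borel \<Otimes>\<^sub>M M)" for G :: "real => 'a => 'b"
 proof -
  have "(%p. (snd p, fst p)) \<in> M \<Otimes>\<^sub>M lborel \<rightarrow>\<^sub>M borel \<Otimes>\<^sub>M M" by measurable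
  from measurable_compose[OF this that] have [measurable]: "(%p. G (snd p) (fst p)) \<in> BM (M \<Otimes>\<^sub>M lborel)"
   by simp
  show ?thesis by measurable
 qed
 note mH = m[OF H] and mK = m[OF K]
 have sec: "(%s. ennreal ((norm (G s om))\<^sup>2) * indicator {0..t} s) \<in> BM lborel"
  if "(%p. ennreal ((norm (G (snd p) (fst p)))\<^sup>2) * indicator {0..t} (snd p)) \<in> BM (M \<Otimes>\<^sub>M lborel)"
   "om \<in> space M" for G :: "real => 'a => 'b" and om
  using measurable_compose[OF measurable_Pair1'[OF that(2)] that(1)] by simp
 have int: "(%om. \<integral>\<^sup>+s. ennreal ((norm (G s om))\<^sup>2) * indicator {0..t} s \<partial>lborel) \<in> BM M"
  if "(%p. ennreal ((norm (G (snd p) (fst p)))\<^sup>2) * indicator {0..t} (snd p)) \<in> BM (M \<Otimes>\<^sub>M lborel)"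
  for G :: "real => 'a => 'b"
  using lborel.borel_measurable_nn_integral_fst[OF that] by simp
 have "sqi t (%s om. H s om + K s om) <= (\<integral>\<^sup>+om. (\<integral>\<^sup>+s. 2 * (ennreal ((norm (H s om))\<^sup>2) * indicator {0..t} s
   + ennreal ((norm (K s om))\<^sup>2) * indicator {0..t} s) \<partial>lborel) \<partial>M)"
  unfolding sqi_def
 proof (intro nn_integral_mono)
  fix om s
  have "ennreal ((norm (H s om + K s om))\<^sup>2) * indicator {0..t} s
   <= 2 * (ennreal ((norm (H s om))\<^sup>2) + ennreal ((norm (K s om))\<^sup>2)) * indicator {0..t} s"
   by (intro mult_right_mono ennreal_norm_add_sq_le) simp
  then show "ennreal ((norm (H s om + K s om))\<^sup>2) * indicator {0..t} s \<le>
   2 * (ennreal ((norm (H s om))\<^sup>2) * indicator {0..t} s + ennreal ((norm (K s om))\<^sup>2) * indicator {0..t} s)"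
   by (simp add: distrib_left distrib_right mult.assoc)
 qed
 also have "\<dots> = (\<integral>\<^sup>+om. 2 * ((\<integral>\<^sup>+s. ennreal ((norm (H s om))\<^sup>2) * indicator {0..t} s \<partial>lborel)
   + (\<integral>\<^sup>+s. ennreal ((norm (K s om))\<^sup>2) * indicator {0..t} s \<partial>lborel)) \<partial>M)"
  by (intro nn_integral_cong) (subst nn_integral_cmult, intro borel_measurable_add sec mH mK, assumption+,
   subst nn_integral_add, intro sec mH mK, assumption+, intro sec mH mK, assumption+, rule refl)
 also have "\<dots> = 2 * (sqi t H + sqi t K)"
  unfolding sqi_def
  by (subst nn_integral_cmult, intro borel_measurable_add int mH mK,
   subst nn_integral_add, intro int mH, intro int mK, rule refl)
 finally show ?thesis .
qed

lemma sqi_minus: "sqi t (%s om. H s om - K s om) = sqi t (%s om. K s om - H s om)"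
 by (simp add: sqi_def norm_minus_commute)

lemma sqi_mono: "t <= t' ==> sqi t H <= sqi t' H"
 unfolding sqi_def by (intro nn_integral_mono mult_left_mono) (auto simp: indicator_def)

lemma simple_int_of_simple_integrand:
 assumes "simple_integrand T F m \<tau> Z"
 shows "simple_int k (simple_process m \<tau> Z) (simple_integral (W k) m \<tau> Z)"
proof -
 have step: "\<tau> i <= \<tau> (Suc i)" if "i < m" for i using assms that by (simp add: simple_integrand_def)
 have mono: "i <= j ==> j <= m ==> \<tau> i <= \<tau> j" for i j
 proof (induction j)
  case (Suc j)
  then show ?case using step[of j] by (cases "i = Suc j") (auto intro: order_trans)
 qed simp
 have range: "0 <= \<tau> i" "\<tau> i <= T" if "i <= m" for i
  using mono[of 0 i] mono[of i m] that assms by (auto simp: simple_integrand_def)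
 have "j <= m ==> simple_int k (simple_process j \<tau> Z) (simple_integral (W k) j \<tau> Z)" for j
 proof (induction j)
  case 0
  show ?case unfolding simple_process_def[abs_def] simple_integral_def[abs_def]
   by (simp add: simple_int_zero)
 next
  case (Suc j)
  have Z: "Z j \<in> BM (F (\<tau> j))" "bounded (Z j ` space M)"
  proof -
   have "j < m" using Suc.prems by simp
   then show "Z j \<in> BM (F (\<tau> j))" "bounded (Z j ` space M)"
   using assms space_F[of "\<tau> j"] range[of j] by (auto simp: simple_integrand_def)
  qed
  have "simple_int k (%t om. simple_process j \<tau> Z t om + indicator {\<tau> j<..\<tau> (Suc j)} t *\<^sub>R Z j om)
   (%t om. simple_integral (W k) j \<tau> Z t om + (W k (min t (\<tau> (Suc j))) om - W k (min t (\<tau> j)) om) *\<^sub>R Z j om)"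
   using Suc range[of j] range[of "Suc j"] step[of j] by (intro simple_int_add Z) auto
  then show ?case
   unfolding simple_process_def[abs_def] simple_integral_def[abs_def] by simp
 qed
 then show ?thesis by simp
qed

text \<open>One approximant serves two times at once, as the martingale property compares values at
  s and t. In this form the relation is stable under differences and under changes of the integrand
  outside [0,T].\<close>

definition ito_approx :: "nat => (real => 'a => 'b::euclidean_space) => (real => 'a => 'b) => bool" where
 "ito_approx k H I \<longleftrightarrow> (\<forall>s\<in>{0..T}. \<forall>t\<in>{0..T}. \<forall>e>0. \<exists>P Q. simple_int k P Q \<and>
   sqi T (%t om. P t om - H t om) <= ennreal e \<and> sqn (%om. Q s om - I s om) <= ennreal e \<and>
   sqn (%om. Q t om - I t om) <= ennreal e)"

lemma has_ito_integral_approx: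
 assumes "has_ito_integral M T F (W k) H I" shows "ito_approx k H I"
proof -
 from assms obtain m \<tau> Z where si: "!!n. simple_integrand T F (m n) (\<tau> n) (Z n)"
  and 1: "(%n. sqi T (%t om. simple_process (m n) (\<tau> n) (Z n) t om - H t om)) \<longlonglongrightarrow> 0"
  and 2: "!!t. t \<in> {0..T} ==> (%n. sqn (%om. simple_integral (W k) (m n) (\<tau> n) (Z n) t om - I t om)) \<longlonglongrightarrow> 0"
  unfolding has_ito_integral_def sqi_def sqn_def by blast
 show ?thesis
  unfolding ito_approx_def
 proof (intro ballI allI impI)
  fix s t e :: real assume st: "s \<in> {0..T}" "t \<in> {0..T}" and e: "e > 0"
  have e': "0 < ennreal e" using e by simp
  have "\<forall>\<^sub>F n in sequentially. sqi T (%t om. simple_process (m n) (\<tau> n) (Z n) t om - H t om) < ennreal e \<and>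
   sqn (%om. simple_integral (W k) (m n) (\<tau> n) (Z n) s om - I s om) < ennreal e \<and>
   sqn (%om. simple_integral (W k) (m n) (\<tau> n) (Z n) t om - I t om) < ennreal e"
   by (intro eventually_conj order_tendstoD(2)[OF 1 e'] order_tendstoD(2)[OF 2 e'] st)
  then obtain n where "sqi T (%t om. simple_process (m n) (\<tau> n) (Z n) t om - H t om) < ennreal e"
   "sqn (%om. simple_integral (W k) (m n) (\<tau> n) (Z n) s om - I s om) < ennreal e"
   "sqn (%om. simple_integral (W k) (m n) (\<tau> n) (Z n) t om - I t om) < ennreal e"
   by (auto simp: eventually_sequentially)
  then show "\<exists>P Q. simple_int k P Q \<and> sqi T (%t om. P t om - H t om) <= ennreal e \<and>
   sqn (%om. Q s om - I s om) <= ennreal e \<and> sqn (%om. Q t om - I t om) <= ennreal e"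
   using simple_int_of_simple_integrand[OF si[of n], of k] by (intro exI conjI) (auto intro: less_imp_le)
 qed
qed

text \<open>Admits the clamped flows, which agree with the given ones on [0,T] and are measurable
  for all times.\<close>

lemma ito_approx_cong:
 assumes "!!t om. t \<in> {0..T} ==> H t om = H' t om" "ito_approx k H I"
 shows "ito_approx k H' I"
proof -
 have "sqi T (%t om. P t om - H t om) = sqi T (%t om. P t om - H' t om)" for P
  unfolding sqi_def by (intro nn_integral_cong) (auto simp: indicator_def assms(1))
 with assms(2) show ?thesis unfolding ito_approx_def by simp
qed

lemma ito_approx_diff:
 fixes H H' :: "real => 'a => 'b::euclidean_space"
 assumes a: "ito_approx k H I" "ito_approx k H' I'"
  and mH: "(%(t, om). H t om) \<in> BM (borel \<Otimes>\<^sub>M M)"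
  and mH': "(%(t, om). H' t om) \<in> BM (borel \<Otimes>\<^sub>M M)"
  and mI: "!!t. t \<in> {0..T} ==> I t \<in> BM M"
  and mI': "!!t. t \<in> {0..T} ==> I' t \<in> BM M"
 shows "ito_approx k (%t om. H t om - H' t om) (%t om. I t om - I' t om)"
 unfolding ito_approx_def
proof (intro ballI allI impI)
 fix s t e :: real assume st: "s \<in> {0..T}" "t \<in> {0..T}" and e: "e > 0"
 then have e4: "e / 4 > 0" by simp
 obtain P Q where P: "simple_int k P Q" "sqi T (%t om. P t om - H t om) <= ennreal (e / 4)"
  "sqn (%om. Q s om - I s om) <= ennreal (e / 4)" "sqn (%om. Q t om - I t om) <= ennreal (e / 4)"
  using a(1) st e4 unfolding ito_approx_def by blast
 obtain P' Q' where P': "simple_int k P' Q'" "sqi T (%t om. P' t om - H' t om) <= ennreal (e / 4)"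
  "sqn (%om. Q' s om - I' s om) <= ennreal (e / 4)" "sqn (%om. Q' t om - I' t om) <= ennreal (e / 4)"
  using a(2) st e4 unfolding ito_approx_def by blast
 have four: "2 * (x + y) <= ennreal e" if "x <= ennreal (e / 4)" "y <= ennreal (e / 4)" for x y :: ennreal
 proof -
  have "2 * (x + y) <= 2 * (ennreal (e / 4) + ennreal (e / 4))" using that by (intro mult_left_mono add_mono) auto
  also have "\<dots> = ennreal 2 * ennreal (e / 4 + e / 4)"
   using e by (simp add: ennreal_plus[symmetric] del: ennreal_plus)
  also have "\<dots> = ennreal (2 * (e / 4 + e / 4))" using e by (intro ennreal_mult[symmetric]) auto
  finally show ?thesis by simp
 qed
 have mQ: "Q u \<in> BM M" "Q' u \<in> BM M" if "u \<in> {0..T}" for u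
  using simple_int_meas_integral[OF P(1) that] simple_int_meas_integral[OF P'(1) that] .
 have q: "sqn (%om. (Q u om - Q' u om) - (I u om - I' u om)) <= ennreal e"
  if u: "u \<in> {0..T}" "sqn (%om. Q u om - I u om) <= ennreal (e / 4)" "sqn (%om. Q' u om - I' u om) <= ennreal (e / 4)" for u
 proof -
  have "sqn (%om. (Q u om - Q' u om) - (I u om - I' u om)) = sqn (%om. (Q u om - I u om) + (I' u om - Q' u om))"
   by (simp add: algebra_simps)
  also have "\<dots> <= 2 * (sqn (%om. Q u om - I u om) + sqn (%om. I' u om - Q' u om))"
   using mQ mI mI' u(1) by (intro sqn_add borel_measurable_diff) auto
  also have "\<dots> <= ennreal e" using u(2,3) by (intro four) (auto simp: sqn_minus[of "I' u"])
  finally show ?thesis .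
 qed
 have "sqi T (%t om. (P t om - P' t om) - (H t om - H' t om)) = sqi T (%t om. (P t om - H t om) + (H' t om - P' t om))"
  by (simp add: algebra_simps)
 also have "\<dots> <= 2 * (sqi T (%t om. P t om - H t om) + sqi T (%t om. H' t om - P' t om))"
 proof (rule sqi_add)
  show "(%(t, om). P t om - H t om) \<in> BM (borel \<Otimes>\<^sub>M M)"
   using borel_measurable_diff[OF simple_int_meas_integrand[OF P(1)] mH] by (simp add: split_beta')
  show "(%(t, om). H' t om - P' t om) \<in> BM (borel \<Otimes>\<^sub>M M)"
   using borel_measurable_diff[OF mH' simple_int_meas_integrand[OF P'(1)]] by (simp add: split_beta')
 qed
 also have "\<dots> <= ennreal e" using P(2) P'(2) by (intro four) (auto simp: sqi_minus[of _ H'])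
 finally have "sqi T (%t om. (P t om - P' t om) - (H t om - H' t om)) <= ennreal e" .
 then show "\<exists>R S. simple_int k R S \<and> sqi T (%t om. R t om - (H t om - H' t om)) <= ennreal e \<and>
   sqn (%om. S s om - (I s om - I' s om)) <= ennreal e \<and> sqn (%om. S t om - (I t om - I' t om)) <= ennreal e"
  using simple_int_diff[OF P(1) P'(1)] q[OF st(1) P(3) P'(3)] q[OF st(2) P(4) P'(4)] by blast
qed

lemma sqn_sum:
 assumes "!!k. k < n ==> X k \<in> BM M"
 shows "sqn (%om. \<Sum>k<n. X k om) <= of_nat n * (\<Sum>k<n. sqn (X k))"
proof -
 have "sqn (%om. \<Sum>k<n. X k om) <= (\<integral>\<^sup>+om. of_nat n * (\<Sum>k<n. ennreal ((norm (X k om))\<^sup>2)) \<partial>M)"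
  unfolding sqn_def
 proof (intro nn_integral_mono)
  fix om
  have "(norm (\<Sum>k<n. X k om))\<^sup>2 <= (\<Sum>k<n. norm (X k om))\<^sup>2" by (intro power_mono norm_sum) auto
  also have "\<dots> <= real n * (\<Sum>k<n. (norm (X k om))\<^sup>2)"
   using sum_squared_le_sum_of_squares[of "%k. norm (X k om)" "{..<n}"] by (simp add: mult.commute)
  finally have "ennreal ((norm (\<Sum>k<n. X k om))\<^sup>2) <= ennreal (real n * (\<Sum>k<n. (norm (X k om))\<^sup>2))"
   by (rule ennreal_leI)
  also have "\<dots> = of_nat n * (\<Sum>k<n. ennreal ((norm (X k om))\<^sup>2))"
   by (simp add: ennreal_mult sum_nonneg ennreal_of_nat_eq_real_of_nat)
  finally show "ennreal ((norm (\<Sum>k<n. X k om))\<^sup>2) <= of_nat n * (\<Sum>k<n. ennreal ((norm (X k om))\<^sup>2))" .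
 qed
 also have "\<dots> = of_nat n * (\<Sum>k<n. sqn (X k))"
 proof -
  have m: "(%om. ennreal ((norm (X k om))\<^sup>2)) \<in> BM M" if "k \<in> {..<n}" for k
  proof -
   have [measurable]: "X k \<in> BM M" using assms[of k] that by simp
   show ?thesis by measurable
  qed
  show ?thesis
   unfolding sqn_def
   by (subst nn_integral_cmult, intro borel_measurable_sum m, assumption,
   subst nn_integral_sum, rule m, assumption, rule refl)
 qed
 finally show ?thesis .
qed

text \<open>Simple integrals against different Brownian motions are orthogonal, so the cross terms
  of the square vanish.\<close>

lemma simple_int_sum_isometry:
 assumes S: "!!k. k < n ==> simple_int k (P k) (Q k)" and t: "t \<in> {0..T}"
 shows "sqn (%om. \<Sum>k<n. Q k t om) = (\<Sum>k<n. sqi t (P k))"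
  "(\<Sum>k<n. sqi t (P k)) < \<infinity>"
proof -
 note iso = simple_int_isometry[OF S S t]
 have Qi: "integrable M (%om. Q k t om \<bullet> Q l t om)" if "k < n" "l < n" for k l
  using iso[OF that] by (simp add: isom_def)
 let ?L = "%k om. LBINT s. indicator {0..t} s * (P k s om \<bullet> P k s om)"
 have Pi: "integrable lborel (%s. indicator {0..t} s * (P k s om \<bullet> P k s om))"
  and Li: "integrable M (?L k)" if "k < n" for k om
  using iso[OF that that] by (auto simp: isom_def)
 have ex: "expectation (%om. Q k t om \<bullet> Q l t om) = (if k = l then expectation (?L k) else 0)"
  if "k < n" "l < n" for k l
  using iso[OF that] by (auto simp: isom_def)
 have sq: "sqi t (P k) = ennreal (expectation (?L k))" if k: "k < n" for k
 proof -
  have "ennreal (expectation (?L k)) = (\<integral>\<^sup>+om. ennreal (?L k om) \<partial>M)"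
   by (rule nn_integral_eq_integral[OF Li[OF k], symmetric]) auto
  also have "\<dots> = (\<integral>\<^sup>+om. (\<integral>\<^sup>+s. ennreal (indicator {0..t} s * (P k s om \<bullet> P k s om)) \<partial>lborel) \<partial>M)"
   by (intro nn_integral_cong nn_integral_eq_integral[OF Pi[OF k], symmetric]) auto
  also have "\<dots> = sqi t (P k)"
   unfolding sqi_def
   by (intro nn_integral_cong) (auto simp: indicator_def power2_norm_eq_inner)
  finally show ?thesis by simp
 qed
 have nn: "expectation (?L k) >= 0" for k by (intro Bochner_Integration.integral_nonneg) auto
 have e1: "(norm (\<Sum>k<n. Q k t om))\<^sup>2 = (\<Sum>k<n. \<Sum>l<n. Q k t om \<bullet> Q l t om)" for om
  unfolding power2_norm_eq_inner inner_sum_left inner_sum_right by (rule sum.swap)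
 have "sqn (%om. \<Sum>k<n. Q k t om) = ennreal (expectation (%om. (norm (\<Sum>k<n. Q k t om))\<^sup>2))"
  unfolding sqn_def
 proof (rule nn_integral_eq_integral)
  show "integrable M (%om. (norm (\<Sum>k<n. Q k t om))\<^sup>2)"
   unfolding e1 by (rule integrable_double_sum) (auto intro: Qi)
 qed simp
 also have "expectation (%om. (norm (\<Sum>k<n. Q k t om))\<^sup>2) = (\<Sum>k<n. \<Sum>l<n. expectation (%om. Q k t om \<bullet> Q l t om))"
  unfolding e1 by (rule integral_double_sum) (auto intro: Qi)
 also have "\<dots> = (\<Sum>k<n. \<Sum>l<n. if k = l then expectation (?L k) else 0)"
  by (intro sum.cong refl ex) auto
 also have "\<dots> = (\<Sum>k<n. expectation (?L k))" by simp
 also have "ennreal \<dots> = (\<Sum>k<n. ennreal (expectation (?L k)))" using nn by (simp add: sum_ennreal)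
 also have "\<dots> = (\<Sum>k<n. sqi t (P k))" by (intro sum.cong refl sq[symmetric]) auto
 finally show "sqn (%om. \<Sum>k<n. Q k t om) = (\<Sum>k<n. sqi t (P k))" .
 have "(\<Sum>k<n. sqi t (P k)) = (\<Sum>k<n. ennreal (expectation (?L k)))"
  by (intro sum.cong refl sq) auto
 also have "\<dots> = ennreal (\<Sum>k<n. expectation (?L k))" using nn by (simp add: sum_ennreal)
 finally show "(\<Sum>k<n. sqi t (P k)) < \<infinity>" by simp
qed

lemma sqn_finite_imp_integrable:
 assumes "X \<in> BM M" "sqn X < \<infinity>"
 shows "integrable M (%om. (norm (X om))\<^sup>2)"
 using assms by (intro integrableI_bounded) (auto simp: sqn_def)

lemma L1_le_sqn:
 assumes X: "X \<in> BM M" and sq: "sqn X <= ennreal (\<eta>\<^sup>2)" and eta: "\<eta> > 0"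
 shows "integrable M X" "expectation (%om. norm (X om)) <= 2 * \<eta>"
proof -
 have i2: "integrable M (%om. (norm (X om))\<^sup>2)"
  using sq le_less_trans[OF sq] by (intro sqn_finite_imp_integrable X) auto
 have le: "norm (X om) <= \<eta> + (norm (X om))\<^sup>2 / \<eta>" for om
 proof (cases "norm (X om) <= \<eta>")
  case False
  then have "norm (X om) * \<eta> <= norm (X om) * norm (X om)" by (intro mult_left_mono) auto
  then have "norm (X om) <= (norm (X om))\<^sup>2 / \<eta>" using eta by (simp add: pos_le_divide_eq power2_eq_square)
  then show ?thesis using eta by linarith
 qed (use eta in \<open>simp add: add_increasing2\<close>)
 have ib: "integrable M (%om. \<eta> + (norm (X om))\<^sup>2 / \<eta>)" using i2 by simp
 show i1: "integrable M X"
 proof (rule Bochner_Integration.integrable_bound[OF ib X])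
  show "AE om in M. norm (X om) <= norm (\<eta> + (norm (X om))\<^sup>2 / \<eta>)"
   using le by (intro AE_I2) (auto intro: order_trans[OF _ abs_ge_self])
 qed
 have "expectation (%om. norm (X om)) <= expectation (%om. \<eta> + (norm (X om))\<^sup>2 / \<eta>)"
  using i1 ib by (intro integral_mono le) auto
 also have "\<dots> = \<eta> + expectation (%om. (norm (X om))\<^sup>2) / \<eta>"
  using i2 prob_space by simp
 also have "expectation (%om. (norm (X om))\<^sup>2) <= \<eta>\<^sup>2"
 proof -
  have "ennreal (expectation (%om. (norm (X om))\<^sup>2)) = sqn X"
   unfolding sqn_def by (rule nn_integral_eq_integral[OF i2, symmetric]) auto
  then have "ennreal (expectation (%om. (norm (X om))\<^sup>2)) <= ennreal (\<eta>\<^sup>2)" using sq by simp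
  then show ?thesis by (subst (asm) ennreal_le_iff) auto
 qed
 finally show "expectation (%om. norm (X om)) <= 2 * \<eta>"
  using eta by (simp add: divide_right_mono power2_eq_square)
qed

text \<open>The tail at the two times fixes the truncation n; only then is each of the n integrals
  approximated, with an accuracy depending on n.\<close>

lemma ito_series_approx:
 fixes D :: "nat => real => 'a => 'b::euclidean_space"
 assumes J: "!!k. ito_approx k (D k) (J k)"
  and mJ: "!!k t. t \<in> {0..T} ==> J k t \<in> BM M"
  and mN: "!!t. t \<in> {0..T} ==> N t \<in> BM M"
  and lim: "!!t. t \<in> {0..T} ==> (%n. sqn (%om. (\<Sum>k<n. J k t om) - N t om)) \<longlonglongrightarrow> 0"
  and st: "s \<in> {0..T}" "t \<in> {0..T}" and e: "e > 0"
 shows "\<exists>n P Q. (\<forall>k<n. simple_int k (P k) (Q k)) \<and>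
  (\<Sum>k<n. sqi T (%t om. P k t om - D k t om)) <= ennreal e \<and>
  sqn (%om. (\<Sum>k<n. Q k s om) - N s om) <= ennreal e \<and>
  sqn (%om. (\<Sum>k<n. Q k t om) - N t om) <= ennreal e"
proof -
 have e4: "0 < ennreal (e / 4)" using e by simp
 have "\<forall>\<^sub>F n in sequentially. sqn (%om. (\<Sum>k<n. J k s om) - N s om) < ennreal (e / 4) \<and>
   sqn (%om. (\<Sum>k<n. J k t om) - N t om) < ennreal (e / 4)"
  by (intro eventually_conj order_tendstoD(2)[OF lim e4] st)
 then obtain n where n: "sqn (%om. (\<Sum>k<n. J k s om) - N s om) < ennreal (e / 4)"
   "sqn (%om. (\<Sum>k<n. J k t om) - N t om) < ennreal (e / 4)"
  by (auto simp: eventually_sequentially)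
 define m where "m = real n + 1"
 \<comment> \<open>Replacing n integrals multiplies the squared error by up to n^2, once in
   \<open>sqn_sum\<close> and once by summation. Using m = n + 1 avoids division by zero.\<close>
 define \<delta> where "\<delta> = e / (4 * m * m)"
 have m: "m >= 1" "real n <= m" by (auto simp: m_def)
 have d: "\<delta> > 0" using e m by (simp add: \<delta>_def)
 have nd: "real n * \<delta> <= e" "real n * (real n * \<delta>) <= e / 4"
 proof -
  have mm: "m * (m * \<delta>) = e / 4" using m by (simp add: \<delta>_def field_simps)
  have 1: "real n * \<delta> <= m * \<delta>" using m d by (intro mult_right_mono) auto
  also have "\<dots> <= m * (m * \<delta>)" using mult_right_mono[of 1 m "m * \<delta>"] m d by simp
  finally show "real n * \<delta> <= e" using mm e by simp
  have "real n * (real n * \<delta>) <= m * (m * \<delta>)" using m d 1 by (intro mult_mono) auto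
  then show "real n * (real n * \<delta>) <= e / 4" using mm by simp
 qed
 define R where "R k X \<longleftrightarrow> simple_int k (fst X) (snd X) \<and> sqi T (%t om. fst X t om - D k t om) <= ennreal \<delta> \<and>
   sqn (%om. snd X s om - J k s om) <= ennreal \<delta> \<and> sqn (%om. snd X t om - J k t om) <= ennreal \<delta>" for k X
 have "\<exists>X. R k X" for k
 proof -
  from J[of k, unfolded ito_approx_def, rule_format, OF st d] obtain P Q where
   "R k (P, Q)" unfolding R_def fst_conv snd_conv by (elim exE)
  then show ?thesis ..
 qed
 then have R: "R k (SOME X. R k X)" for k by (rule someI_ex)
 define P where "P k = fst (SOME X. R k X)" for k
 define Q where "Q k = snd (SOME X. R k X)" for k
 have PQ: "simple_int k (P k) (Q k)" "sqi T (%t om. P k t om - D k t om) <= ennreal \<delta>"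
  "sqn (%om. Q k s om - J k s om) <= ennreal \<delta>" "sqn (%om. Q k t om - J k t om) <= ennreal \<delta>" for k
  using R[of k] unfolding R_def P_def Q_def by auto
 have sumd: "(\<Sum>k<n. x k) <= ennreal (real n * \<delta>)" if "!!k. x k <= ennreal \<delta>" for x :: "nat => ennreal"
 proof -
  have "(\<Sum>k<n. x k) <= (\<Sum>k<n. ennreal \<delta>)" by (intro sum_mono that)
  also have "\<dots> = ennreal (real n * \<delta>)" using d by (simp add: ennreal_mult ennreal_of_nat_eq_real_of_nat)
  finally show ?thesis .
 qed
 have main: "sqn (%om. (\<Sum>k<n. Q k u om) - N u om) <= ennreal e"
  if u: "u \<in> {0..T}" and a: "!!k. sqn (%om. Q k u om - J k u om) <= ennreal \<delta>"
   and b: "sqn (%om. (\<Sum>k<n. J k u om) - N u om) < ennreal (e / 4)" for u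
 proof -
  have mQ: "Q k u \<in> BM M" for k by (rule simple_int_meas_integral[OF PQ(1) u])
  have "sqn (%om. \<Sum>k<n. Q k u om - J k u om) <= of_nat n * (\<Sum>k<n. sqn (%om. Q k u om - J k u om))"
   using mQ mJ[OF u] by (intro sqn_sum borel_measurable_diff)
  also have "\<dots> <= of_nat n * ennreal (real n * \<delta>)" by (intro mult_left_mono sumd a) simp
  also have "\<dots> = ennreal (real n * (real n * \<delta>))" using d by (simp add: ennreal_mult ennreal_of_nat_eq_real_of_nat)
  also have "\<dots> <= ennreal (e / 4)" by (intro ennreal_leI nd)
  finally have c: "sqn (%om. \<Sum>k<n. Q k u om - J k u om) <= ennreal (e / 4)" .
  have "sqn (%om. (\<Sum>k<n. Q k u om) - N u om) =
   sqn (%om. (\<Sum>k<n. Q k u om - J k u om) + ((\<Sum>k<n. J k u om) - N u om))"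
   by (simp add: sum_subtractf)
  also have "\<dots> <= 2 * (sqn (%om. \<Sum>k<n. Q k u om - J k u om) + sqn (%om. (\<Sum>k<n. J k u om) - N u om))"
   using mQ mJ[OF u] mN[OF u] by (intro sqn_add borel_measurable_diff borel_measurable_sum)
  also have "\<dots> <= 2 * (ennreal (e / 4) + ennreal (e / 4))"
   using b c by (intro mult_left_mono add_mono) auto
  also have "\<dots> = ennreal 2 * ennreal (e / 4 + e / 4)"
   using e by (simp add: ennreal_plus[symmetric] del: ennreal_plus)
  also have "\<dots> = ennreal (2 * (e / 4 + e / 4))" using e by (intro ennreal_mult[symmetric]) auto
  finally show ?thesis by simp
 qed
 show ?thesis
 proof (intro exI conjI allI impI)
  show "simple_int k (P k) (Q k)" for k by (rule PQ)
  show "sqn (%om. (\<Sum>k<n. Q k s om) - N s om) <= ennreal e" by (rule main[OF st(1) PQ(3) n(1)])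
  show "sqn (%om. (\<Sum>k<n. Q k t om) - N t om) <= ennreal e" by (rule main[OF st(2) PQ(4) n(2)])
  show "(\<Sum>k<n. sqi T (%t om. P k t om - D k t om)) <= ennreal e"
   using sumd[of "%k. sqi T (%t om. P k t om - D k t om)", OF PQ(2)] ennreal_leI[OF nd(1)] by (rule order_trans)
 qed
qed

context
 fixes D :: "nat => real => 'a => 'b::euclidean_space" and J :: "nat => real => 'a => 'b" and N :: "real => 'a => 'b"
 assumes J: "!!k. ito_approx k (D k) (J k)"
  and mD: "!!k. (%(t, om). D k t om) \<in> BM (borel \<Otimes>\<^sub>M M)"
  and mJ: "!!k t. t \<in> {0..T} ==> J k t \<in> BM M"
  and mN: "!!t. t \<in> {0..T} ==> N t \<in> BM M"
  and lim: "!!t. t \<in> {0..T} ==> (%n. sqn (%om. (\<Sum>k<n. J k t om) - N t om)) \<longlonglongrightarrow> 0"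
begin

lemma series_approx:
 assumes "s \<in> {0..T}" "t \<in> {0..T}" "e > 0"
 shows "\<exists>n P Q. (\<forall>k<n. simple_int k (P k) (Q k)) \<and>
  (\<Sum>k<n. sqi T (%t om. P k t om - D k t om)) <= ennreal e \<and>
  sqn (%om. (\<Sum>k<n. Q k s om) - N s om) <= ennreal e \<and>
  sqn (%om. (\<Sum>k<n. Q k t om) - N t om) <= ennreal e"
 by (rule ito_series_approx[OF J mJ mN lim assms])

text \<open>An approximant at time t is bounded by its own isometry, and its integrands by
  comparison with \<open>D\<close>. The factor 4 stems from two uses of |p + q|^2 <= 2 |p|^2 + 2
  |q|^2.\<close>

lemma ito_series_sqn_le:
 assumes t: "t \<in> {0..T}" and R: "!!n. (\<Sum>k<n. sqi t (D k)) <= R"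
 shows "sqn (N t) <= 4 * R" "sqn (N t) < \<infinity>"
proof -
 have bound: "sqn (N t) <= ennreal (6 * e) + 4 * R \<and> sqn (N t) < \<infinity>" if e: "e > 0" for e :: real
 proof -
  obtain n P Q where PQ': "\<forall>k<n. simple_int k (P k) (Q k)"
   and PQ2: "(\<Sum>k<n. sqi T (%t om. P k t om - D k t om)) <= ennreal e"
   and PQ3: "sqn (%om. (\<Sum>k<n. Q k t om) - N t om) <= ennreal e"
   using series_approx[OF t t e] by (elim exE conjE)
  have PQ: "!!k. k < n ==> simple_int k (P k) (Q k)" using PQ' by simp
  have mQ: "Q k t \<in> BM M" if "k < n" for k
   by (rule simple_int_meas_integral[OF PQ[OF that] t])
  have msum: "(%om. \<Sum>k<n. Q k t om) \<in> BM M"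
   using mQ by (intro borel_measurable_sum) auto
  have "sqn (N t) = sqn (%om. (N t om - (\<Sum>k<n. Q k t om)) + (\<Sum>k<n. Q k t om))" by simp
  also have "\<dots> <= 2 * (sqn (%om. N t om - (\<Sum>k<n. Q k t om)) + sqn (%om. \<Sum>k<n. Q k t om))"
   by (intro sqn_add borel_measurable_diff mN t msum)
  also have "\<dots> <= 2 * (ennreal e + (\<Sum>k<n. sqi t (P k)))"
   using PQ3 simple_int_sum_isometry(1)[of n P Q t, OF PQ t]
   by (intro mult_left_mono add_mono) (auto simp: sqn_minus[of "N t"])
  finally have 1: "sqn (N t) <= 2 * (ennreal e + (\<Sum>k<n. sqi t (P k)))" .
  have fin: "2 * (ennreal e + (\<Sum>k<n. sqi t (P k))) < \<infinity>"
   using simple_int_sum_isometry(2)[of n P Q t, OF PQ t] by (simp add: ennreal_mult_less_top)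
  have "(\<Sum>k<n. sqi t (P k)) <= (\<Sum>k<n. 2 * (sqi T (%t om. P k t om - D k t om) + sqi t (D k)))"
  proof (rule sum_mono)
   fix k assume k: "k \<in> {..<n}"
   have "sqi t (P k) = sqi t (%s om. (P k s om - D k s om) + D k s om)" by simp
   also have "\<dots> <= 2 * (sqi t (%s om. P k s om - D k s om) + sqi t (D k))"
   proof (rule sqi_add[OF _ mD])
   show "(%(t, om). P k t om - D k t om) \<in> BM (borel \<Otimes>\<^sub>M M)"
   using borel_measurable_diff[OF simple_int_meas_integrand[OF PQ] mD, of k k] k by (simp add: split_beta')
   qed
   also have "\<dots> <= 2 * (sqi T (%s om. P k s om - D k s om) + sqi t (D k))"
   using t by (intro mult_left_mono add_mono sqi_mono) auto
   finally show "sqi t (P k) <= 2 * (sqi T (%t om. P k t om - D k t om) + sqi t (D k))" .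
  qed
  also have "\<dots> = 2 * ((\<Sum>k<n. sqi T (%t om. P k t om - D k t om)) + (\<Sum>k<n. sqi t (D k)))"
   by (simp add: sum.distrib sum_distrib_left distrib_left)
  also have "\<dots> <= 2 * (ennreal e + R)" by (intro mult_left_mono add_mono PQ2 R) auto
  finally have 2: "(\<Sum>k<n. sqi t (P k)) <= 2 * (ennreal e + R)" .
  have "sqn (N t) <= 2 * (ennreal e + 2 * (ennreal e + R))"
   by (rule order_trans[OF 1]) (intro mult_left_mono add_left_mono 2, simp)
  also have "\<dots> = ennreal (6 * e) + 4 * R"
   using e by (simp add: ennreal_mult distrib_left mult.assoc[symmetric] add.assoc[symmetric] distrib_right[symmetric])
  finally show ?thesis using le_less_trans[OF 1 fin] by simp
 qed
 from bound[of 1] show "sqn (N t) < \<infinity>" by simp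
 show "sqn (N t) <= 4 * R"
 proof (rule ennreal_le_epsilon)
  fix e :: real assume "0 < e"
  then show "sqn (N t) <= 4 * R + ennreal e" using bound[of "e / 6"] by (simp add: add.commute)
 qed
qed

text \<open>The identity is exact for simple integrands, and since g is bounded by C the errors at
  the times s and t cost at most 2 C \<eta> each.\<close>

lemma ito_series_martingale:
 assumes st: "0 <= s" "s <= t" "t <= T"
  and g: "g \<in> BM (F s)" "!!om. om \<in> space M ==> norm (g om) <= C"
  and fin: "sqn (N s) < \<infinity>" "sqn (N t) < \<infinity>"
 shows "expectation (%om. g om \<bullet> (N t om - N s om)) = 0"
proof -
 have s: "s \<in> {0..T}" and t: "t \<in> {0..T}" using st by auto
 have gM [measurable]: "g \<in> BM M" using g(1) s by (rule measurable_F_M)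
 have [measurable]: "N s \<in> BM M" "N t \<in> BM M" by (intro mN s t)+
 have C0: "C >= 0"
  using not_empty g(2) norm_ge_zero order_trans by blast
 have gb: "bounded (g ` space M)" using g(2) by (auto simp: bounded_iff)
 have N1: "integrable M (N u)" if u: "u \<in> {0..T}" "sqn (N u) < \<infinity>" for u
 proof -
  obtain r where r: "sqn (N u) = ennreal r" "r >= 0" using u(2) by (cases "sqn (N u)") auto
  have "sqn (N u) <= ennreal ((sqrt (r + 1))\<^sup>2)" using r by (simp add: ennreal_leI)
  then show ?thesis using r by (intro L1_le_sqn(1)[where \<eta> = "sqrt (r + 1)"] mN u) auto
 qed
 have gi: "integrable M (%om. g om \<bullet> X om)" if X: "integrable M X" for X
 proof (rule Bochner_Integration.integrable_bound)
  show "integrable M (%om. C * norm (X om))" using X by simp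
  have [measurable]: "X \<in> BM M" using X by auto
  show "(%om. g om \<bullet> X om) \<in> BM M" by measurable
  show "AE om in M. norm (g om \<bullet> X om) <= norm (C * norm (X om))"
  proof (rule AE_I2)
   fix om assume om: "om \<in> space M"
   have "norm (g om \<bullet> X om) <= norm (g om) * norm (X om)" by (simp add: Cauchy_Schwarz_ineq2)
   also have "\<dots> <= C * norm (X om)" using g(2)[OF om] by (intro mult_right_mono) auto
   finally show "norm (g om \<bullet> X om) <= norm (C * norm (X om))" by simp
  qed
 qed
 have gle: "\<bar>expectation (%om. g om \<bullet> X om)\<bar> <= C * (2 * \<eta>)"
  if X: "X \<in> BM M" "sqn X <= ennreal (\<eta>\<^sup>2)" "\<eta> > 0" for X \<eta>
 proof -
  note L = L1_le_sqn[OF X]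
  have "\<bar>expectation (%om. g om \<bullet> X om)\<bar> <= expectation (%om. \<bar>g om \<bullet> X om\<bar>)" by (rule integral_abs_bound)
  also have "\<dots> <= expectation (%om. C * norm (X om))"
  proof (rule integral_mono)
   show "integrable M (%om. \<bar>g om \<bullet> X om\<bar>)" by (intro integrable_abs gi L)
   show "integrable M (%om. C * norm (X om))" using L by simp
   fix om assume om: "om \<in> space M"
   have "\<bar>g om \<bullet> X om\<bar> <= norm (g om) * norm (X om)" by (rule Cauchy_Schwarz_ineq2)
   also have "\<dots> <= C * norm (X om)" using g(2)[OF om] by (intro mult_right_mono) auto
   finally show "\<bar>g om \<bullet> X om\<bar> <= C * norm (X om)" .
  qed
  also have "\<dots> <= C * (2 * \<eta>)" using L(2) C0 by (simp add: mult_left_mono)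
  finally show ?thesis .
 qed
 have "\<bar>expectation (%om. g om \<bullet> (N t om - N s om))\<bar> <= C * (4 * \<eta>)" if \<eta>: "\<eta> > 0" for \<eta>
 proof -
  have \<eta>2: "\<eta>\<^sup>2 > 0" using \<eta> by simp
  obtain n P Q where PQ': "\<forall>k<n. simple_int k (P k) (Q k)"
   and PQs: "sqn (%om. (\<Sum>k<n. Q k s om) - N s om) <= ennreal (\<eta>\<^sup>2)"
   and PQt: "sqn (%om. (\<Sum>k<n. Q k t om) - N t om) <= ennreal (\<eta>\<^sup>2)"
   using series_approx[OF s t \<eta>2] by (elim exE conjE)
  have PQ: "!!k. k < n ==> simple_int k (P k) (Q k)" using PQ' by simp
  have mQ: "(%om. (\<Sum>k<n. Q k u om) - N u om) \<in> BM M" if "u \<in> {0..T}" for u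
   using simple_int_meas_integral[OF PQ that] mN[OF that]
   by (intro borel_measurable_diff borel_measurable_sum) auto
  let ?X = "%u om. (\<Sum>k<n. Q k u om) - N u om"
  note mart = simple_int_martingale[OF PQ st g(1) gb]
  have z: "integrable M (%om. \<Sum>k<n. g om \<bullet> (Q k t om - Q k s om))"
   "expectation (%om. \<Sum>k<n. g om \<bullet> (Q k t om - Q k s om)) = 0"
   using mart by (auto simp: Bochner_Integration.integral_sum)
  have i: "integrable M (%om. g om \<bullet> ?X s om)" "integrable M (%om. g om \<bullet> ?X t om)"
   by (rule gi, rule L1_le_sqn(1)[OF mQ[OF s] PQs \<eta>], rule gi, rule L1_le_sqn(1)[OF mQ[OF t] PQt \<eta>])
  have "g om \<bullet> (N t om - N s om) = (\<Sum>k<n. g om \<bullet> (Q k t om - Q k s om)) + (g om \<bullet> ?X s om - g om \<bullet> ?X t om)" for om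
   by (simp add: inner_diff_right inner_sum_right sum_subtractf)
  then have "expectation (%om. g om \<bullet> (N t om - N s om)) =
   expectation (%om. g om \<bullet> ?X s om) - expectation (%om. g om \<bullet> ?X t om)"
   using z i by simp
  moreover have "\<bar>expectation (%om. g om \<bullet> ?X s om)\<bar> <= C * (2 * \<eta>)" "\<bar>expectation (%om. g om \<bullet> ?X t om)\<bar> <= C * (2 * \<eta>)"
   by (rule gle[OF mQ[OF s] PQs \<eta>], rule gle[OF mQ[OF t] PQt \<eta>])
  ultimately show ?thesis by linarith
 qed
 note le = this
 have "\<bar>expectation (%om. g om \<bullet> (N t om - N s om))\<bar> <= 0"
 proof (rule field_le_epsilon)
  fix e :: real assume e: "e > 0"
  have "C * (4 * (e / (4 * C + 4))) <= e" using C0 e by (simp add: field_simps)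
  moreover have "e / (4 * C + 4) > 0" using C0 e by simp
  ultimately show "\<bar>expectation (%om. g om \<bullet> (N t om - N s om))\<bar> <= 0 + e"
   using le[of "e / (4 * C + 4)"] by linarith
 qed
 then show ?thesis by simp
qed

end

end

section \<open>Lifting paths and comparing drifts\<close>

text \<open>The representative in [-1/2, 1/2)^2: a Borel map that inverts \<open>proj\<close> near
  0.\<close>

definition short_lift :: "torus2 => real^2" where
 "short_lift u = sec (u + proj (\<chi> i. 1/2)) - (\<chi> i. 1/2)"

lemma short_lift_proj:
 assumes "norm v < 1/2" shows "short_lift (proj v) = v"
proof -
 have "v + (\<chi> i. 1/2) \<in> unit_cell"
  unfolding unit_cell_def
 proof (intro CollectI allI)
  fix i
  have "\<bar>v $ i\<bar> < 1/2" using assms component_le_norm_cart[of v i] by linarith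
  then show "0 <= (v + (\<chi> i. 1/2)) $ i \<and> (v + (\<chi> i. 1/2)) $ i < 1" by auto
 qed
 then show ?thesis unfolding short_lift_def proj_add[symmetric] by (simp add: sec_proj)
qed

lemma borel_measurable_short_lift [measurable]: "short_lift \<in> BM borel"
 unfolding short_lift_def[abs_def] by measurable

text \<open>Path lifting by an explicit limit instead of a choice for each path, so that the lifted
  process stays jointly measurable. For a path with a continuous lift starting at 0 the sums are
  eventually constant.\<close>

definition path_lift :: "(real => torus2) => real => real^2" where
 "path_lift y t = lim (%n. \<Sum>i<n. short_lift (y (t * (real (Suc i) / real n)) - y (t * (real i / real n))))"

lemma borel_measurable_path_lift:
 assumes Y: "(%(t, p). Y t p) \<in> BM (borel \<Otimes>\<^sub>M P)"
 shows "(%(t, p). path_lift (%s. Y s p) t) \<in> BM (borel \<Otimes>\<^sub>M P)"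
proof -
 have m: "(%q. Y (fst q * c) (snd q)) \<in> BM (borel \<Otimes>\<^sub>M P)" for c
 proof -
  have "(%q. (fst q * c, snd q)) \<in> borel \<Otimes>\<^sub>M P \<rightarrow>\<^sub>M borel \<Otimes>\<^sub>M P" by measurable
  from measurable_compose[OF this Y] show ?thesis by simp
 qed
 note [measurable] = m
 show ?thesis unfolding path_lift_def split_beta'
  by (intro borel_measurable_lim_metric) measurable
qed

text \<open>By uniform continuity all increments are shorter than 1/2 for large n. The short lifts
  are then the exact increments of z, and they telescope.\<close>

lemma path_lift_eq:
 assumes c: "continuous_on {0..T} z" and z0: "z 0 = 0" and y: "!!s. s \<in> {0..T} ==> proj (z s) = y s"
  and t: "t \<in> {0..T}"
 shows "path_lift y t = z t"
proof -
 have "uniformly_continuous_on {0..T} z" by (intro compact_uniformly_continuous c) simp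
 then obtain d where d: "d > 0" "!!a b. a \<in> {0..T} ==> b \<in> {0..T} ==> dist b a < d ==> dist (z b) (z a) < 1/2"
  unfolding uniformly_continuous_on_def by (metis half_gt_zero zero_less_one)
 obtain n0 :: nat where n0: "real n0 > t / d" using reals_Archimedean2 by blast
 have eq: "(\<Sum>i<n. short_lift (y (t * (real (Suc i) / real n)) - y (t * (real i / real n)))) = z t"
  if n: "n >= max n0 1" for n
 proof -
  have pos: "real n > 0" using n by simp
  have r: "t * (real i / real n) \<in> {0..T}" if "i <= n" for i
  proof -
   have "real i / real n <= 1" using that pos by simp
   then have "t * (real i / real n) <= t * 1" using t by (intro mult_left_mono) auto
   then show ?thesis using t by auto
  qed
  have "short_lift (y (t * (real (Suc i) / real n)) - y (t * (real i / real n))) =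
   z (t * (real (Suc i) / real n)) - z (t * (real i / real n))" if i: "i < n" for i
  proof -
   have "t * (real (Suc i) / real n) - t * (real i / real n) = t / real n"
   using pos by (simp add: field_simps)
   moreover have "t / real n < d"
   proof -
   have "t / d < real n" using n0 n by simp
   then show ?thesis using d(1) pos by (simp add: field_simps)
   qed
   ultimately have "dist (t * (real (Suc i) / real n)) (t * (real i / real n)) < d"
   using t pos by (simp add: dist_real_def)
   moreover have le: "Suc i <= n" "i <= n" using i by auto
   ultimately have "norm (z (t * (real (Suc i) / real n)) - z (t * (real i / real n))) < 1/2"
   unfolding dist_norm[symmetric] by (intro d(2) r)
   from short_lift_proj[OF this] show ?thesis
   unfolding proj_diff y[OF r[OF le(1)]] y[OF r[OF le(2)]] .
  qed
  then have "(\<Sum>i<n. short_lift (y (t * (real (Suc i) / real n)) - y (t * (real i / real n)))) =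
   (\<Sum>i<n. z (t * (real (Suc i) / real n)) - z (t * (real i / real n)))" by (intro sum.cong) auto
  also have "\<dots> = z (t * (real n / real n)) - z (t * (real 0 / real n))"
   by (rule sum_lessThan_telescope)
  also have "\<dots> = z t" using pos z0 by simp
  finally show ?thesis .
 qed
 have "(%n. \<Sum>i<n. short_lift (y (t * (real (Suc i) / real n)) - y (t * (real i / real n)))) \<longlonglongrightarrow> z t"
  by (rule tendsto_eventually, rule eventually_sequentiallyI, rule eq)
 then show ?thesis unfolding path_lift_def by (rule limI)
qed

section \<open>Drifts generated by measure-preserving maps\<close>

lemma ennreal_add_sq_le: "(a + b)\<^sup>2 <= 2 * (a\<^sup>2 + b\<^sup>2)" for a b :: ennreal
proof (cases "a = \<top> \<or> b = \<top>")
 case False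
 then obtain x y where "a = ennreal x" "b = ennreal y" "x >= 0" "y >= 0"
  by (cases a; cases b) auto
 note xy = this
 have "(a + b)\<^sup>2 = ennreal ((x + y)\<^sup>2)" using xy by (simp add: ennreal_power ennreal_plus[symmetric] del: ennreal_plus)
 also have "\<dots> <= ennreal (2 * (x\<^sup>2 + y\<^sup>2))" using norm_add_sq_le[of x y] by (intro ennreal_leI) simp
 also have "\<dots> = 2 * (a\<^sup>2 + b\<^sup>2)" using xy by (simp add: ennreal_power ennreal_mult)
 finally show ?thesis .
qed (auto simp: power2_eq_square ennreal_top_mult ennreal_mult_top)

definition torus_mp :: "(torus2 => torus2) => bool" where
 "torus_mp \<phi> \<longleftrightarrow> \<phi> \<in> measurable TL TL \<and> distr TL TL \<phi> = TL"

lemma torus_mp_borel: "torus_mp \<phi> ==> \<phi> \<in> BM borel"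
 unfolding torus_mp_def by (simp cong: measurable_cong_sets)

lemma nn_integral_torus_mp:
 assumes "torus_mp \<phi>" and f: "f \<in> BM borel"
 shows "(\<integral>\<^sup>+x. f (\<phi> x) \<partial>TL) = (\<integral>\<^sup>+x. f x \<partial>TL)"
proof -
 have "f \<in> BM TL" using f by (simp cong: measurable_cong_sets)
 then have "(\<integral>\<^sup>+x. f (\<phi> x) \<partial>TL) = (\<integral>\<^sup>+x. f x \<partial>distr TL TL \<phi>)"
  using assms(1) by (intro nn_integral_distr[symmetric]) (auto simp: torus_mp_def)
 then show ?thesis using assms(1) by (simp add: torus_mp_def)
qed

lemma nn_integral_torus_mp_diff:
 assumes \<phi>: "torus_mp \<phi>" and f [measurable]: "f \<in> BM borel"
 shows "(\<integral>\<^sup>+y. f (a - \<phi> y) \<partial>TL) = (\<integral>\<^sup>+x. f x \<partial>TL)"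
  "(\<integral>\<^sup>+y. f (\<phi> y - a) \<partial>TL) = (\<integral>\<^sup>+x. f x \<partial>TL)"
proof -
 have 1: "(%y. f (a - y)) \<in> BM borel" "(%y. f (y - a)) \<in> BM borel" by measurable
 show "(\<integral>\<^sup>+y. f (a - \<phi> y) \<partial>TL) = (\<integral>\<^sup>+x. f x \<partial>TL)"
  unfolding nn_integral_torus_mp[OF \<phi> 1(1)] by (rule nn_integral_torus_reflect) fact
 show "(\<integral>\<^sup>+y. f (\<phi> y - a) \<partial>TL) = (\<integral>\<^sup>+x. f x \<partial>TL)"
  unfolding nn_integral_torus_mp[OF \<phi> 1(2)] using nn_integral_torus_translate[OF f, of "- a"] by simp
qed

lemma AE_torus_mp_diff:
 assumes \<phi>: "torus_mp \<phi>" and g: "AE x in TL. good x"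
 shows "AE y in TL. good (a - \<phi> y)"
proof -
 have [measurable]: "\<phi> \<in> BM borel" by (rule torus_mp_borel[OF \<phi>])
 from g obtain N where N: "{x. \<not> good x} \<subseteq> N" "emeasure TL N = 0" "N \<in> sets borel"
  by (elim AE_E) auto
 have [measurable]: "N \<in> sets borel" by fact
 have i: "indicator N \<in> BM (borel :: torus2 measure)" using N(3) by simp
 have "(\<integral>\<^sup>+y. indicator N (a - \<phi> y) \<partial>TL) = (\<integral>\<^sup>+x. indicator N x \<partial>TL)"
  by (rule nn_integral_torus_mp_diff(1)[OF \<phi> i])
 also have "\<dots> = 0" using N by simp
 finally have "AE y in TL. indicator N (a - \<phi> y) = (0::ennreal)"
  by (subst (asm) nn_integral_0_iff_AE) auto
 then show ?thesis by eventually_elim (use N(1) in \<open>auto simp: indicator_def split: if_splits\<close>)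
qed

definition drift :: "(torus2 => real) => (torus2 => real^2) => (torus2 => torus2) => torus2 => real^2" where
 "drift \<xi> H \<phi> x = (LINT y|TL. \<xi> y *\<^sub>R H (\<phi> x - \<phi> y))"

context
 fixes \<xi> :: "torus2 => real" and B :: real
 assumes xi [measurable]: "\<xi> \<in> BM borel" and B: "AE y in TL. \<bar>\<xi> y\<bar> <= B" "B >= 0"
begin

lemma nn_integral_xi_le:
 assumes f [measurable]: "f \<in> BM borel"
 shows "(\<integral>\<^sup>+y. ennreal (norm (\<xi> y *\<^sub>R f y)) \<partial>TL) <= ennreal B * (\<integral>\<^sup>+y. ennreal (norm (f y :: real^2)) \<partial>TL)"
proof -
 have "(\<integral>\<^sup>+y. ennreal (norm (\<xi> y *\<^sub>R f y)) \<partial>TL) <= (\<integral>\<^sup>+y. ennreal B * ennreal (norm (f y)) \<partial>TL)"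
 proof (rule nn_integral_mono_AE)
  show "AE y in TL. ennreal (norm (\<xi> y *\<^sub>R f y)) <= ennreal B * ennreal (norm (f y))"
   using B(1) by eventually_elim (auto simp: ennreal_mult[symmetric] B(2) intro!: ennreal_leI mult_right_mono)
 qed
 also have "\<dots> = ennreal B * (\<integral>\<^sup>+y. ennreal (norm (f y :: real^2)) \<partial>TL)"
  by (rule nn_integral_cmult) simp
 finally show ?thesis .
qed

lemma drift_integrable:
 fixes H :: "torus2 => real^2"
 assumes H: "integrable TL H" and \<phi>: "torus_mp \<phi>"
 shows "integrable TL (%y. \<xi> y *\<^sub>R H (a - \<phi> y))"
  "(\<integral>\<^sup>+y. ennreal (norm (\<xi> y *\<^sub>R H (a - \<phi> y))) \<partial>TL)
   <= ennreal B * (\<integral>\<^sup>+y. ennreal (norm (H y)) \<partial>TL)"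
proof -
 have [measurable]: "\<phi> \<in> BM borel" by (rule torus_mp_borel[OF \<phi>])
 have [measurable]: "H \<in> BM borel"
  using borel_measurable_integrable[OF H] by (simp cong: measurable_cong_sets)
 have "(\<integral>\<^sup>+y. ennreal (norm (\<xi> y *\<^sub>R H (a - \<phi> y))) \<partial>TL)
   <= ennreal B * (\<integral>\<^sup>+y. ennreal (norm (H (a - \<phi> y))) \<partial>TL)"
  by (rule nn_integral_xi_le[of "%y. H (a - \<phi> y)"]) measurable
 also have "(\<integral>\<^sup>+y. ennreal (norm (H (a - \<phi> y))) \<partial>TL) = (\<integral>\<^sup>+y. ennreal (norm (H y)) \<partial>TL)"
  by (rule nn_integral_torus_mp_diff(1)[OF \<phi>]) measurable
 finally show le: "(\<integral>\<^sup>+y. ennreal (norm (\<xi> y *\<^sub>R H (a - \<phi> y))) \<partial>TL)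
   <= ennreal B * (\<integral>\<^sup>+y. ennreal (norm (H y)) \<partial>TL)" .
 have "(\<integral>\<^sup>+y. ennreal (norm (H y)) \<partial>TL) < \<infinity>" using H by (simp add: integrable_iff_bounded)
 then have "ennreal B * (\<integral>\<^sup>+y. ennreal (norm (H y)) \<partial>TL) < \<infinity>"
  by (simp add: ennreal_mult_less_top)
 then show "integrable TL (%y. \<xi> y *\<^sub>R H (a - \<phi> y))"
  using le by (intro integrableI_bounded) (auto intro: le_less_trans)
qed

lemma drift_le:
 fixes H :: "torus2 => real^2"
 assumes H: "integrable TL H" and \<phi>: "torus_mp \<phi>"
 shows "norm (drift \<xi> H \<phi> x) <= B * (LINT y|TL. norm (H y))"
proof -
 have "ennreal (norm (drift \<xi> H \<phi> x)) <= ennreal B * (\<integral>\<^sup>+y. ennreal (norm (H y)) \<partial>TL)"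
  unfolding drift_def
  by (rule order_trans[OF integral_norm_bound_ennreal drift_integrable(2)]) (intro drift_integrable H \<phi>)+
 also have "\<dots> = ennreal (B * (LINT y|TL. norm (H y)))"
  using H B(2) by (subst nn_integral_eq_integral) (auto simp: ennreal_mult)
 finally show ?thesis by (subst (asm) ennreal_le_iff) (use B(2) in auto)
qed

text \<open>Insert H2 (\<phi> x - \<phi> y). The change of kernel along \<phi> becomes, by
  invariance of the measure, the L1 distance of the kernels; the change of flow under one kernel is
  left to the Hoelder estimate.\<close>

lemma drift_difference_le:
 assumes H1: "integrable TL H1" and H2: "integrable TL H2"
  and \<phi>: "torus_mp \<phi>" and \<theta>: "torus_mp \<theta>"
 shows "ennreal (norm (drift \<xi> H1 \<phi> x - drift \<xi> H2 \<theta> x)) <= ennreal B *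
   ((\<integral>\<^sup>+y. ennreal (norm (H1 y - H2 y)) \<partial>TL)
   + (\<integral>\<^sup>+y. ennreal (norm (H2 (\<phi> x - \<phi> y) - H2 (\<theta> x - \<theta> y))) \<partial>TL))"
proof -
 have [measurable]: "\<phi> \<in> BM borel" "\<theta> \<in> BM borel"
  by (rule torus_mp_borel[OF \<phi>], rule torus_mp_borel[OF \<theta>])
 have [measurable]: "H1 \<in> BM borel" "H2 \<in> BM borel"
  using borel_measurable_integrable[OF H1] borel_measurable_integrable[OF H2]
  by (simp_all cong: measurable_cong_sets)
 let ?f = "%y. (H1 (\<phi> x - \<phi> y) - H2 (\<phi> x - \<phi> y)) + (H2 (\<phi> x - \<phi> y) - H2 (\<theta> x - \<theta> y))"
 have i: "integrable TL (%y. \<xi> y *\<^sub>R H1 (\<phi> x - \<phi> y))" "integrable TL (%y. \<xi> y *\<^sub>R H2 (\<theta> x - \<theta> y))"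
  by (intro drift_integrable H1 H2 \<phi> \<theta>)+
 have "drift \<xi> H1 \<phi> x - drift \<xi> H2 \<theta> x = (LINT y|TL. \<xi> y *\<^sub>R H1 (\<phi> x - \<phi> y) - \<xi> y *\<^sub>R H2 (\<theta> x - \<theta> y))"
  unfolding drift_def by (rule Bochner_Integration.integral_diff[OF i, symmetric])
 also have "ennreal (norm \<dots>) <= (\<integral>\<^sup>+y. ennreal (norm (\<xi> y *\<^sub>R H1 (\<phi> x - \<phi> y) - \<xi> y *\<^sub>R H2 (\<theta> x - \<theta> y))) \<partial>TL)"
  by (intro integral_norm_bound_ennreal Bochner_Integration.integrable_diff i)
 also have "\<dots> = (\<integral>\<^sup>+y. ennreal (norm (\<xi> y *\<^sub>R ?f y)) \<partial>TL)"
  by (simp add: scaleR_diff_right)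
 also have "\<dots> <= ennreal B * (\<integral>\<^sup>+y. ennreal (norm (?f y)) \<partial>TL)"
  by (rule nn_integral_xi_le) measurable
 also have "(\<integral>\<^sup>+y. ennreal (norm (?f y)) \<partial>TL) \<le>
   (\<integral>\<^sup>+y. ennreal (norm (H1 (\<phi> x - \<phi> y) - H2 (\<phi> x - \<phi> y))) + ennreal (norm (H2 (\<phi> x - \<phi> y) - H2 (\<theta> x - \<theta> y))) \<partial>TL)"
  by (rule nn_integral_mono) (auto simp: ennreal_plus[symmetric] simp del: ennreal_plus intro!: ennreal_leI norm_diff_triangle_le[OF order_refl order_refl])
 also have "\<dots> = (\<integral>\<^sup>+y. ennreal (norm (H1 (\<phi> x - \<phi> y) - H2 (\<phi> x - \<phi> y))) \<partial>TL)
   + (\<integral>\<^sup>+y. ennreal (norm (H2 (\<phi> x - \<phi> y) - H2 (\<theta> x - \<theta> y))) \<partial>TL)"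
  by (rule nn_integral_add) measurable
 also have "(\<integral>\<^sup>+y. ennreal (norm (H1 (\<phi> x - \<phi> y) - H2 (\<phi> x - \<phi> y))) \<partial>TL) = (\<integral>\<^sup>+y. ennreal (norm (H1 y - H2 y)) \<partial>TL)"
  by (rule nn_integral_torus_mp_diff(1)[OF \<phi>, of "%z. ennreal (norm (H1 z - H2 z))"]) measurable
 finally show ?thesis by (simp add: mult_left_mono)
qed

text \<open>A Schur test: the weight \<open>k\<close> has the same integral m, twice that of g, in x
  as in y, because both maps preserve the measure. Subadditivity of the power splits the Hoelder
  bound into D x and D y; the term with D y is squared by Cauchy-Schwarz for the measure of density
  \<open>k x\<close> and integrated in x. With m <= 2 G this yields 16 G^2.\<close>

lemma drift_difference_L2:
 assumes H1: "integrable TL H1" and H2: "integrable TL H2"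
  and \<phi>: "torus_mp \<phi>" and \<theta>: "torus_mp \<theta>"
  and \<alpha>: "0 < \<alpha>" "\<alpha> <= 1" and good: "AE x in TL. good x"
  and g [measurable]: "g \<in> BM borel" and G: "(\<integral>\<^sup>+x. g x \<partial>TL) <= ennreal G" "G >= 0"
  and holder: "!!x y. good x ==> good y ==> ennreal (norm (H2 x - H2 y)) <= ennreal (dist x y powr \<alpha>) * (g x + g y)"
 shows "(\<integral>\<^sup>+x. ennreal ((norm (drift \<xi> H1 \<phi> x - drift \<xi> H2 \<theta> x))\<^sup>2) \<partial>TL) \<le>
   ennreal (2 * B\<^sup>2) * ((\<integral>\<^sup>+y. ennreal (norm (H1 y - H2 y)) \<partial>TL)\<^sup>2
   + ennreal (16 * G\<^sup>2) * (\<integral>\<^sup>+x. ennreal (dist (\<phi> x) (\<theta> x) powr (2 * \<alpha>)) \<partial>TL))"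
proof -
 interpret P: pair_sigma_finite TL TL ..
 have [measurable]: "\<phi> \<in> BM borel" "\<theta> \<in> BM borel"
  by (rule torus_mp_borel[OF \<phi>], rule torus_mp_borel[OF \<theta>])
 let ?e = "\<integral>\<^sup>+y. ennreal (norm (H1 y - H2 y)) \<partial>TL"
 define D where "D y = ennreal (dist (\<phi> y) (\<theta> y) powr \<alpha>)" for y
 define k where "k x y = g (\<phi> x - \<phi> y) + g (\<theta> x - \<theta> y)" for x y
 define m where "m = 2 * (\<integral>\<^sup>+x. g x \<partial>TL)"
 have [measurable]: "D \<in> BM borel" unfolding D_def[abs_def] by measurable
 have [measurable]: "(%p. k (fst p) (snd p)) \<in> BM (borel \<Otimes>\<^sub>M borel)" unfolding k_def by measurable
 have [measurable]: "k x \<in> BM borel" for x unfolding k_def[abs_def] by measurable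
 have k1: "(\<integral>\<^sup>+y. k x y \<partial>TL) = m" for x
  unfolding k_def m_def
  by (subst nn_integral_add) (auto simp: nn_integral_torus_mp_diff[OF \<phi> g] nn_integral_torus_mp_diff[OF \<theta> g] mult_2)
 have k2: "(\<integral>\<^sup>+x. k x y \<partial>TL) = m" for y
  unfolding k_def m_def
  by (subst nn_integral_add) (auto simp: nn_integral_torus_mp_diff[OF \<phi> g] nn_integral_torus_mp_diff[OF \<theta> g] mult_2)
 let ?I = "%x. \<integral>\<^sup>+y. ennreal (norm (H2 (\<phi> x - \<phi> y) - H2 (\<theta> x - \<theta> y))) \<partial>TL"
 let ?J = "%x. \<integral>\<^sup>+y. D y * k x y \<partial>TL"
 have I: "?I x <= D x * m + ?J x" for x
 proof -
  have "?I x <= (\<integral>\<^sup>+y. D x * k x y + D y * k x y \<partial>TL)"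
  proof (rule nn_integral_mono_AE)
   show "AE y in TL. ennreal (norm (H2 (\<phi> x - \<phi> y) - H2 (\<theta> x - \<theta> y))) <= D x * k x y + D y * k x y"
   using AE_torus_mp_diff[OF \<phi> good, of "\<phi> x"] AE_torus_mp_diff[OF \<theta> good, of "\<theta> x"]
   proof eventually_elim
   fix y assume gd: "good (\<phi> x - \<phi> y)" "good (\<theta> x - \<theta> y)"
   have "dist (\<phi> x - \<phi> y) (\<theta> x - \<theta> y) <= dist (\<phi> x) (\<theta> x) + dist (\<phi> y) (\<theta> y)"
   proof -
   have "(\<phi> x - \<phi> y) - (\<theta> x - \<theta> y) = (\<phi> x - \<theta> x) + - (\<phi> y - \<theta> y)" by simp
   then show ?thesis unfolding dist_torus2_def
   by (metis torus_norm_triangle torus_norm_uminus)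
   qed
   then have "dist (\<phi> x - \<phi> y) (\<theta> x - \<theta> y) powr \<alpha> <= (dist (\<phi> x) (\<theta> x) + dist (\<phi> y) (\<theta> y)) powr \<alpha>"
   using \<alpha> by (intro powr_mono2) auto
   also have "\<dots> <= dist (\<phi> x) (\<theta> x) powr \<alpha> + dist (\<phi> y) (\<theta> y) powr \<alpha>"
   using \<alpha> by (intro powr_subadd) auto
   finally have "ennreal (dist (\<phi> x - \<phi> y) (\<theta> x - \<theta> y) powr \<alpha>) <= D x + D y"
   unfolding D_def using ennreal_plus[of "dist (\<phi> x) (\<theta> x) powr \<alpha>" "dist (\<phi> y) (\<theta> y) powr \<alpha>"]
   by (metis ennreal_leI powr_ge_zero)
   then have "ennreal (dist (\<phi> x - \<phi> y) (\<theta> x - \<theta> y) powr \<alpha>) * k x y <= (D x + D y) * k x y"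
   by (rule mult_right_mono) simp
   then show "ennreal (norm (H2 (\<phi> x - \<phi> y) - H2 (\<theta> x - \<theta> y))) <= D x * k x y + D y * k x y"
   using holder[OF gd] unfolding k_def[symmetric] distrib_right[symmetric] by (rule order_trans[rotated])
   qed
  qed
  also have "\<dots> = (\<integral>\<^sup>+y. D x * k x y \<partial>TL) + ?J x" by (rule nn_integral_add) measurable
  also have "(\<integral>\<^sup>+y. D x * k x y \<partial>TL) = D x * m" unfolding k1[of x, symmetric] by (rule nn_integral_cmult) measurable
  finally show ?thesis .
 qed
 have J: "(?J x)\<^sup>2 <= (\<integral>\<^sup>+y. (D y)\<^sup>2 * k x y \<partial>TL) * m" for x
 proof -
  let ?\<nu> = "density TL (k x)"
  have d: "(\<integral>\<^sup>+y. f y \<partial>?\<nu>) = (\<integral>\<^sup>+y. f y * k x y \<partial>TL)" if [measurable]: "f \<in> BM borel" for f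
   by (subst nn_integral_density) (auto simp: mult.commute)
  have "(\<integral>\<^sup>+y. D y * 1 \<partial>?\<nu>)\<^sup>2 <= (\<integral>\<^sup>+y. (D y)\<^sup>2 \<partial>?\<nu>) * (\<integral>\<^sup>+y. 1\<^sup>2 \<partial>?\<nu>)"
   by (rule Cauchy_Schwarz_nn_integral) auto
  moreover have "(\<integral>\<^sup>+y. D y * 1 \<partial>?\<nu>) = ?J x" by (subst d) simp_all
  moreover have "(\<integral>\<^sup>+y. (D y)\<^sup>2 \<partial>?\<nu>) = (\<integral>\<^sup>+y. (D y)\<^sup>2 * k x y \<partial>TL)" by (rule d) measurable
  moreover have "(\<integral>\<^sup>+y. 1\<^sup>2 \<partial>?\<nu>) = m" by (subst d) (simp_all add: k1)
  ultimately show ?thesis by (simp only:)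
 qed
 have pt: "ennreal ((norm (drift \<xi> H1 \<phi> x - drift \<xi> H2 \<theta> x))\<^sup>2) \<le>
   ennreal (2 * B\<^sup>2) * (?e\<^sup>2 + 2 * ((D x)\<^sup>2 * m\<^sup>2 + (\<integral>\<^sup>+y. (D y)\<^sup>2 * k x y \<partial>TL) * m))" for x
 proof -
  have "ennreal ((norm (drift \<xi> H1 \<phi> x - drift \<xi> H2 \<theta> x))\<^sup>2) = (ennreal (norm (drift \<xi> H1 \<phi> x - drift \<xi> H2 \<theta> x)))\<^sup>2"
   by (simp add: ennreal_power)
  also have "\<dots> <= (ennreal B * (?e + (D x * m + ?J x)))\<^sup>2"
   by (rule power_mono[OF order_trans[OF drift_difference_le[OF H1 H2 \<phi> \<theta>] mult_left_mono[OF add_left_mono[OF I]]]]) auto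
  also have "\<dots> = ennreal (B\<^sup>2) * (?e + (D x * m + ?J x))\<^sup>2" using B(2) by (simp add: power_mult_distrib ennreal_power)
  also have "\<dots> <= ennreal (B\<^sup>2) * (2 * (?e\<^sup>2 + (D x * m + ?J x)\<^sup>2))"
   by (rule mult_left_mono[OF ennreal_add_sq_le]) simp
  also have "\<dots> <= ennreal (B\<^sup>2) * (2 * (?e\<^sup>2 + 2 * ((D x * m)\<^sup>2 + (\<integral>\<^sup>+y. (D y)\<^sup>2 * k x y \<partial>TL) * m)))"
   by (rule mult_left_mono[OF mult_left_mono[OF add_left_mono[OF order_trans[OF ennreal_add_sq_le mult_left_mono[OF add_left_mono[OF J]]]]]]) auto
  also have "\<dots> = ennreal (2 * B\<^sup>2) * (?e\<^sup>2 + 2 * ((D x)\<^sup>2 * m\<^sup>2 + (\<integral>\<^sup>+y. (D y)\<^sup>2 * k x y \<partial>TL) * m))"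
  proof -
   have 2: "ennreal (2 * B\<^sup>2) = ennreal (B\<^sup>2) * 2" by (simp add: ennreal_mult mult.commute)
   show ?thesis unfolding 2 power_mult_distrib[of "D x" m] by (simp only: mult.assoc)
  qed
  finally show ?thesis .
 qed
 have m1: "(%x. \<integral>\<^sup>+y. (D y)\<^sup>2 * k x y \<partial>TL) \<in> BM TL"
  using torus.borel_measurable_nn_integral_fst[of "%p. (D (snd p))\<^sup>2 * k (fst p) (snd p)" TL] by simp
 have "(\<integral>\<^sup>+x. ennreal ((norm (drift \<xi> H1 \<phi> x - drift \<xi> H2 \<theta> x))\<^sup>2) \<partial>TL) \<le>
   (\<integral>\<^sup>+x. ennreal (2 * B\<^sup>2) * (?e\<^sup>2 + 2 * ((D x)\<^sup>2 * m\<^sup>2 + (\<integral>\<^sup>+y. (D y)\<^sup>2 * k x y \<partial>TL) * m)) \<partial>TL)"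
  by (rule nn_integral_mono) (rule pt)
 also have "\<dots> = ennreal (2 * B\<^sup>2) * (?e\<^sup>2 + 2 * ((\<integral>\<^sup>+x. (D x)\<^sup>2 \<partial>TL) * m\<^sup>2
   + (\<integral>\<^sup>+x. (\<integral>\<^sup>+y. (D y)\<^sup>2 * k x y \<partial>TL) \<partial>TL) * m))"
  using m1 torus.emeasure_space_1 by (simp add: nn_integral_cmult nn_integral_add nn_integral_multc)
 also have "(\<integral>\<^sup>+x. (\<integral>\<^sup>+y. (D y)\<^sup>2 * k x y \<partial>TL) \<partial>TL) =
   (\<integral>\<^sup>+y. (\<integral>\<^sup>+x. (D y)\<^sup>2 * k x y \<partial>TL) \<partial>TL)"
  using P.Fubini[of "%p. (D (snd p))\<^sup>2 * k (fst p) (snd p)"] by simp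
 also have "\<dots> = (\<integral>\<^sup>+y. (D y)\<^sup>2 * m \<partial>TL)"
 proof (rule nn_integral_cong)
  fix y
  have [measurable]: "(%x. k x y) \<in> BM borel" unfolding k_def by measurable
  show "(\<integral>\<^sup>+x. (D y)\<^sup>2 * k x y \<partial>TL) = (D y)\<^sup>2 * m"
   unfolding k2[of y, symmetric] by (rule nn_integral_cmult) measurable
 qed
 also have "\<dots> = (\<integral>\<^sup>+y. (D y)\<^sup>2 \<partial>TL) * m" by (rule nn_integral_multc) measurable
 also have "(\<integral>\<^sup>+x. (D x)\<^sup>2 \<partial>TL) * m\<^sup>2 + (\<integral>\<^sup>+y. (D y)\<^sup>2 \<partial>TL) * m * m
   = 2 * m\<^sup>2 * (\<integral>\<^sup>+x. (D x)\<^sup>2 \<partial>TL)"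
 proof -
  have "X * m\<^sup>2 + X * m * m = 2 * m\<^sup>2 * X" for X :: ennreal
  proof -
   have "X * m * m = X * m\<^sup>2" by (simp only: power2_eq_square mult.assoc)
   then have "X * m\<^sup>2 + X * m * m = 2 * (X * m\<^sup>2)" by (simp only: mult_2)
   then show ?thesis by (simp only: mult.assoc mult.commute[of X])
  qed
  then show ?thesis .
 qed
 finally have main: "(\<integral>\<^sup>+x. ennreal ((norm (drift \<xi> H1 \<phi> x - drift \<xi> H2 \<theta> x))\<^sup>2) \<partial>TL) \<le>
   ennreal (2 * B\<^sup>2) * (?e\<^sup>2 + 2 * (2 * m\<^sup>2 * (\<integral>\<^sup>+x. (D x)\<^sup>2 \<partial>TL)))" .
 have m2: "2 * (2 * m\<^sup>2 * X) <= ennreal (16 * G\<^sup>2) * X" for X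
 proof -
  have "m <= ennreal (2 * G)" unfolding m_def using mult_left_mono[OF G(1), of 2] G(2) by (simp add: ennreal_mult)
  then have "m\<^sup>2 <= (ennreal (2 * G))\<^sup>2" by (intro power_mono) auto
  also have "\<dots> = ennreal (4 * G\<^sup>2)" using G(2) by (simp add: ennreal_power power_mult_distrib)
  finally have 1: "m\<^sup>2 <= ennreal (4 * G\<^sup>2)" .
  have "ennreal 4 * m\<^sup>2 <= ennreal 4 * ennreal (4 * G\<^sup>2)" by (rule mult_left_mono[OF 1]) (rule zero_le)
  also have "\<dots> = ennreal (4 * (4 * G\<^sup>2))" by (rule ennreal_mult[symmetric]) auto
  also have "4 * (4 * G\<^sup>2) = 16 * G\<^sup>2" by simp
  finally have 4: "ennreal 4 * m\<^sup>2 * X <= ennreal (16 * G\<^sup>2) * X" by (rule mult_right_mono) (rule zero_le)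
  have "2 * (2 * m\<^sup>2 * X) = (2 * 2) * m\<^sup>2 * X" by (simp only: mult.assoc)
  also have "(2 * 2 :: ennreal) = ennreal 4" by simp
  finally show ?thesis using 4 by (simp only:)
 qed
 have D2: "(D x)\<^sup>2 = ennreal (dist (\<phi> x) (\<theta> x) powr (2 * \<alpha>))" for x
 proof -
  have "(u powr \<alpha>)\<^sup>2 = u powr (2 * \<alpha>)" for u :: real
   by (simp only: power2_eq_square powr_add[symmetric] mult_2)
  then show ?thesis unfolding D_def by (simp add: ennreal_power)
 qed
 show ?thesis
  by (rule order_trans[OF main[unfolded D2] mult_left_mono[OF add_left_mono[OF m2]]]) simp
qed

end

section \<open>Mollification and the Osgood barrier\<close>

lemma mollifier_family_D:
 assumes "mollifier_family \<rho>" "\<epsilon> > 0"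
 shows "\<rho> \<epsilon> \<in> BM borel" "\<rho> \<epsilon> z >= 0" "(\<integral>\<^sup>+z. ennreal (\<rho> \<epsilon> z) \<partial>lborel) = 1"
proof -
 have *: "smooth (\<rho> \<epsilon>)" "!!z. \<rho> \<epsilon> z >= 0" "(LINT z|lborel. \<rho> \<epsilon> z) = 1"
  using assms by (auto simp: mollifier_family_def)
 have "C_k 0 (\<rho> \<epsilon>)" using *(1) unfolding smooth_def by blast
 then show m: "\<rho> \<epsilon> \<in> BM borel" by (simp add: borel_measurable_continuous_onI)
 show "\<rho> \<epsilon> z >= 0" by fact
 \<comment> \<open>A non-integrable function has Bochner integral 0, so the value 1 implies
   integrability.\<close>
 have "integrable lborel (\<rho> \<epsilon>)" using *(3) not_integrable_integral_eq by fastforce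
 from nn_integral_eq_integral[OF this] show "(\<integral>\<^sup>+z. ennreal (\<rho> \<epsilon> z) \<partial>lborel) = 1"
  using * by simp
qed

context
 fixes K :: "torus2 => real^2" and \<rho> :: "real^2 => real"
 assumes K: "integrable TL K" and rho [measurable]: "\<rho> \<in> BM borel"
  and rho_nonneg: "!!z. \<rho> z >= 0" and rho1: "(\<integral>\<^sup>+z. ennreal (\<rho> z) \<partial>lborel) = 1"
begin

lemma borel_measurable_kernel: "K \<in> BM borel"
 using borel_measurable_integrable[OF K] by (simp cong: measurable_cong_sets)

lemma borel_measurable_mollify: "mollify K \<rho> \<in> BM borel"
proof -
 note [measurable] = borel_measurable_kernel
 have "(%(x, z). \<rho> z *\<^sub>R K (x - proj z)) \<in> BM (TL \<Otimes>\<^sub>M lborel)" by measurable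
 from lborel.borel_measurable_lebesgue_integral[OF this] show ?thesis
  unfolding mollify_def[abs_def] by (simp cong: measurable_cong_sets)
qed

lemma nn_integral_rho_swap:
 assumes [measurable]: "(%p. f (fst p) (snd p)) \<in> BM (borel \<Otimes>\<^sub>M borel)"
  and le: "!!z. \<rho> z \<noteq> 0 ==> (\<integral>\<^sup>+x. f x z \<partial>TL) <= R"
 shows "(\<integral>\<^sup>+x. (\<integral>\<^sup>+z. ennreal (\<rho> z) * f x z \<partial>lborel) \<partial>TL) <= R"
proof -
 interpret P: pair_sigma_finite TL lborel ..
 have "(\<integral>\<^sup>+x. (\<integral>\<^sup>+z. ennreal (\<rho> z) * f x z \<partial>lborel) \<partial>TL) =
   (\<integral>\<^sup>+z. (\<integral>\<^sup>+x. ennreal (\<rho> z) * f x z \<partial>TL) \<partial>lborel)"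
  using P.Fubini[of "%p. ennreal (\<rho> (snd p)) * f (fst p) (snd p)"] by simp
 also have "\<dots> <= (\<integral>\<^sup>+z. ennreal (\<rho> z) * R \<partial>lborel)"
 proof (rule nn_integral_mono)
  fix z :: "real^2"
  have "(%x :: torus2. (x, z)) \<in> borel \<rightarrow>\<^sub>M borel \<Otimes>\<^sub>M borel" by measurable
  from measurable_compose[OF this assms(1)] have [measurable]: "(%x. f x z) \<in> BM borel" by simp
  have "(\<integral>\<^sup>+x. ennreal (\<rho> z) * f x z \<partial>TL) = ennreal (\<rho> z) * (\<integral>\<^sup>+x. f x z \<partial>TL)"
   by (rule nn_integral_cmult) simp
  also have "\<dots> <= ennreal (\<rho> z) * R"
   using le[of z] by (cases "\<rho> z = 0") (auto intro: mult_left_mono)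
  finally show "(\<integral>\<^sup>+x. ennreal (\<rho> z) * f x z \<partial>TL) <= ennreal (\<rho> z) * R" .
 qed
 also have "\<dots> = R" by (subst nn_integral_multc) (auto simp: rho1)
 finally show ?thesis .
qed

lemma AE_integrable_mollify: "AE x in TL. integrable lborel (%z. \<rho> z *\<^sub>R K (x - proj z))"
proof -
 note [measurable] = borel_measurable_kernel
 have "(\<integral>\<^sup>+x. (\<integral>\<^sup>+z. ennreal (\<rho> z) * ennreal (norm (K (x - proj z))) \<partial>lborel) \<partial>TL)
   <= (\<integral>\<^sup>+x. ennreal (norm (K x)) \<partial>TL)"
 proof (rule nn_integral_rho_swap)
  show "(\<integral>\<^sup>+x. ennreal (norm (K (x - proj z))) \<partial>TL) <= (\<integral>\<^sup>+x. ennreal (norm (K x)) \<partial>TL)" for z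
   using nn_integral_torus_translate[of "%x. ennreal (norm (K x))" "- proj z"] by simp
 qed measurable
 also have "\<dots> < \<infinity>" using K by (simp add: integrable_iff_bounded)
 finally have "AE x in TL. (\<integral>\<^sup>+z. ennreal (\<rho> z) * ennreal (norm (K (x - proj z))) \<partial>lborel) \<noteq> \<infinity>"
  by (intro nn_integral_PInf_AE) (auto intro!: lborel.borel_measurable_nn_integral)
 then show ?thesis
 proof eventually_elim
  fix x assume "(\<integral>\<^sup>+z. ennreal (\<rho> z) * ennreal (norm (K (x - proj z))) \<partial>lborel) \<noteq> \<infinity>"
  then show "integrable lborel (%z. \<rho> z *\<^sub>R K (x - proj z))"
   by (intro integrableI_bounded) (auto simp: rho_nonneg ennreal_mult top.not_eq_extremum)
 qed
qed

lemma integrable_mollify: "integrable TL (mollify K \<rho>)"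
proof (rule integrableI_bounded)
 note [measurable] = borel_measurable_kernel
 show "mollify K \<rho> \<in> BM TL" using borel_measurable_mollify by (simp cong: measurable_cong_sets)
 have "(\<integral>\<^sup>+x. ennreal (norm (mollify K \<rho> x)) \<partial>TL) \<le>
   (\<integral>\<^sup>+x. (\<integral>\<^sup>+z. ennreal (\<rho> z) * ennreal (norm (K (x - proj z))) \<partial>lborel) \<partial>TL)"
 proof (rule nn_integral_mono_AE)
  show "AE x in TL. ennreal (norm (mollify K \<rho> x)) <= (\<integral>\<^sup>+z. ennreal (\<rho> z) * ennreal (norm (K (x - proj z))) \<partial>lborel)"
   using AE_integrable_mollify
  proof eventually_elim
   fix x assume "integrable lborel (%z. \<rho> z *\<^sub>R K (x - proj z))"
   from integral_norm_bound_ennreal[OF this]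
   show "ennreal (norm (mollify K \<rho> x)) <= (\<integral>\<^sup>+z. ennreal (\<rho> z) * ennreal (norm (K (x - proj z))) \<partial>lborel)"
   unfolding mollify_def by (simp add: rho_nonneg ennreal_mult)
  qed
 qed
 also have "\<dots> <= (\<integral>\<^sup>+x. ennreal (norm (K x)) \<partial>TL)"
 proof (rule nn_integral_rho_swap)
  show "(\<integral>\<^sup>+x. ennreal (norm (K (x - proj z))) \<partial>TL) <= (\<integral>\<^sup>+x. ennreal (norm (K x)) \<partial>TL)" for z
   using nn_integral_torus_translate[of "%x. ennreal (norm (K x))" "- proj z"] by simp
 qed measurable
 also have "\<dots> < \<infinity>" using K by (simp add: integrable_iff_bounded)
 finally show "(\<integral>\<^sup>+x. ennreal (norm (mollify K \<rho> x)) \<partial>TL) < \<infinity>" .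
qed

text \<open>The error averages the increments K (x - z) - K x over |z| <= r. The kernel estimate
  bounds them by r powr \<alpha> times values of g at two points, whose integrals in x coincide by
  translation invariance.\<close>

lemma mollify_L1_error:
 assumes supp: "!!z. \<rho> z \<noteq> 0 ==> norm z <= r" and r: "r >= 0"
  and good: "AE x in TL. good x" and g [measurable]: "g \<in> BM borel"
  and \<alpha>: "\<alpha> > 0"
  and holder: "!!x y. good x ==> good y ==> ennreal (norm (K x - K y)) <= ennreal (dist x y powr \<alpha>) * (g x + g y)"
 shows "(\<integral>\<^sup>+x. ennreal (norm (mollify K \<rho> x - K x)) \<partial>TL) <= ennreal (r powr \<alpha>) * (2 * (\<integral>\<^sup>+x. g x \<partial>TL))"
proof -
 note [measurable] = borel_measurable_kernel
 have "(\<integral>\<^sup>+x. ennreal (norm (mollify K \<rho> x - K x)) \<partial>TL) \<le>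
   (\<integral>\<^sup>+x. (\<integral>\<^sup>+z. ennreal (\<rho> z) * ennreal (norm (K (x - proj z) - K x)) \<partial>lborel) \<partial>TL)"
 proof (rule nn_integral_mono_AE)
  show "AE x in TL. ennreal (norm (mollify K \<rho> x - K x)) <= (\<integral>\<^sup>+z. ennreal (\<rho> z) * ennreal (norm (K (x - proj z) - K x)) \<partial>lborel)"
   using AE_integrable_mollify
  proof eventually_elim
   fix x assume i: "integrable lborel (%z. \<rho> z *\<^sub>R K (x - proj z))"
   have ri: "integrable lborel \<rho>" by (rule integrableI_bounded) (auto simp: rho_nonneg rho1)
   then have i2: "integrable lborel (%z. \<rho> z *\<^sub>R K x)" by simp
   have "ennreal (LINT z|lborel. \<rho> z) = 1" using nn_integral_eq_integral[OF ri] rho_nonneg rho1 by simp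
   then have "(LINT z|lborel. \<rho> z) = 1" by simp
   then have "mollify K \<rho> x - K x = (LINT z|lborel. \<rho> z *\<^sub>R K (x - proj z)) - (LINT z|lborel. \<rho> z *\<^sub>R K x)"
   using ri by (simp add: mollify_def)
   also have "\<dots> = (LINT z|lborel. \<rho> z *\<^sub>R K (x - proj z) - \<rho> z *\<^sub>R K x)"
   by (rule Bochner_Integration.integral_diff[OF i i2, symmetric])
   also have "ennreal (norm \<dots>) <= (\<integral>\<^sup>+z. ennreal (norm (\<rho> z *\<^sub>R K (x - proj z) - \<rho> z *\<^sub>R K x)) \<partial>lborel)"
   by (intro integral_norm_bound_ennreal Bochner_Integration.integrable_diff i i2)
   also have "\<dots> = (\<integral>\<^sup>+z. ennreal (\<rho> z) * ennreal (norm (K (x - proj z) - K x)) \<partial>lborel)"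
   by (rule nn_integral_cong) (simp add: scaleR_diff_right[symmetric] rho_nonneg ennreal_mult)
   finally show "ennreal (norm (mollify K \<rho> x - K x)) <= (\<integral>\<^sup>+z. ennreal (\<rho> z) * ennreal (norm (K (x - proj z) - K x)) \<partial>lborel)" .
  qed
 qed
 also have "\<dots> <= ennreal (r powr \<alpha>) * (2 * (\<integral>\<^sup>+x. g x \<partial>TL))"
 proof (rule nn_integral_rho_swap)
  fix z assume z: "\<rho> z \<noteq> 0"
  \<comment> \<open>x - z is written as 0 - (z - x), so that the null set is transported by the
    measure-preserving reflection of x into z - x.\<close>
  have gz: "AE x in TL. good (x - proj z)"
  proof -
   have "torus_mp (%x. proj z - x)"
   unfolding torus_mp_def
   proof
   show m: "(%x. proj z - x) \<in> TL \<rightarrow>\<^sub>M TL" by measurable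
   show "distr TL TL (%x. proj z - x) = TL"
   proof (rule measure_eqI)
   fix A assume "A \<in> sets (distr TL TL (%x. proj z - x))"
   then have A [measurable]: "A \<in> sets borel" by simp
   have i: "indicator A \<in> BM (borel :: torus2 measure)" by simp
   have "emeasure (distr TL TL (%x. proj z - x)) A =
   (\<integral>\<^sup>+x. indicator A (proj z - x) \<partial>TL)"
   using nn_integral_distr[OF m, of "indicator A"] by simp
   also have "\<dots> = (\<integral>\<^sup>+x. indicator A x \<partial>TL)" by (rule nn_integral_torus_reflect[OF i])
   finally show "emeasure (distr TL TL (%x. proj z - x)) A = emeasure TL A"
   using A by simp
   qed simp
   qed
   from AE_torus_mp_diff[OF this good, of 0] show ?thesis by simp
  qed
  have "(\<integral>\<^sup>+x. ennreal (norm (K (x - proj z) - K x)) \<partial>TL) \<le>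
   (\<integral>\<^sup>+x. ennreal (r powr \<alpha>) * (g (x - proj z) + g x) \<partial>TL)"
  proof (rule nn_integral_mono_AE)
   show "AE x in TL. ennreal (norm (K (x - proj z) - K x)) <= ennreal (r powr \<alpha>) * (g (x - proj z) + g x)"
   using gz good
   proof eventually_elim
   fix x assume gd: "good (x - proj z)" "good x"
   have "dist (x - proj z) x = torus_norm (- proj z)" by (simp add: dist_torus2_def)
   also have "\<dots> <= norm z" by (simp add: torus_norm_uminus torus_norm_le)
   also have "\<dots> <= r" by (rule supp[OF z])
   finally have "dist (x - proj z) x powr \<alpha> <= r powr \<alpha>" using \<alpha> by (intro powr_mono2) auto
   then have "ennreal (dist (x - proj z) x powr \<alpha>) * (g (x - proj z) + g x) <= ennreal (r powr \<alpha>) * (g (x - proj z) + g x)"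
   by (intro mult_right_mono ennreal_leI) auto
   then show "ennreal (norm (K (x - proj z) - K x)) <= ennreal (r powr \<alpha>) * (g (x - proj z) + g x)"
   by (rule order_trans[OF holder[OF gd]])
   qed
  qed
  also have "\<dots> = ennreal (r powr \<alpha>) * ((\<integral>\<^sup>+x. g (x - proj z) \<partial>TL) + (\<integral>\<^sup>+x. g x \<partial>TL))"
   by (simp add: nn_integral_cmult nn_integral_add)
  also have "(\<integral>\<^sup>+x. g (x - proj z) \<partial>TL) = (\<integral>\<^sup>+x. g x \<partial>TL)"
   using nn_integral_torus_translate[OF g, of "- proj z"] by simp
  finally show "(\<integral>\<^sup>+x. ennreal (norm (K (x - proj z) - K x)) \<partial>TL) <= ennreal (r powr \<alpha>) * (2 * (\<integral>\<^sup>+x. g x \<partial>TL))"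
   by (simp add: mult_2)
 qed measurable
 finally show ?thesis .
qed

end

text \<open>\<psi> solves \<psi>' = \<beta> \<Lambda> exp(-\<beta> s) \<psi>. At the first time
  \<tau> at which the integral of h reaches \<psi>, integrating the bound on h gives at most \<psi>
  \<tau> - \<psi> 0, which is too small because \<psi> 0 > 0. The argument follows the integral
  \<open>f\<close> of h, which is Lipschitz, and not w, which may be discontinuous.\<close>

lemma osgood_barrier:
 fixes h w :: "real => ennreal"
 assumes hm [measurable]: "h \<in> BM borel" and hb: "!!s. s \<in> {0..T} ==> h s <= ennreal Hb"
  and w: "!!t. t \<in> {0..T} ==> w t <= (\<integral>\<^sup>+s\<in>{0..t}. h s \<partial>lborel)"
  and beta: "\<beta> >= 0" "\<Lambda> >= 0"
  and psi: "!!s. \<psi> s = exp (- (\<Lambda> * exp (- (\<beta> * s))))"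
  and h: "!!s. s \<in> {0..T} ==> w s <= ennreal (\<psi> s) ==> h s <= ennreal (\<beta> * (\<Lambda> * exp (- (\<beta> * s))) * \<psi> s)"
  and t: "t \<in> {0..T}"
 shows "w t <= ennreal (\<psi> t)"
proof -
 define f where "f t = (\<integral>\<^sup>+s\<in>{0..t}. h s \<partial>lborel)" for t
 have Hb: "(\<integral>\<^sup>+s\<in>{a<..b}. h s \<partial>lborel) <= ennreal (max 0 Hb * (b - a))" if "0 <= a" "a <= b" "b <= T" for a b
 proof -
  have "(\<integral>\<^sup>+s\<in>{a<..b}. h s \<partial>lborel) <= (\<integral>\<^sup>+s\<in>{a<..b}. ennreal (max 0 Hb) \<partial>lborel)"
  proof (rule nn_integral_mono)
   fix s show "h s * indicator {a<..b} s <= ennreal (max 0 Hb) * indicator {a<..b} s"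
   using hb[of s] that by (auto simp: indicator_def ennreal_max_0)
  qed
  also have "\<dots> = ennreal (max 0 Hb * (b - a))" using that by (subst nn_integral_cmult_indicator) (auto simp: ennreal_mult)
  finally show ?thesis .
 qed
 have split: "f b = f a + (\<integral>\<^sup>+s\<in>{a<..b}. h s \<partial>lborel)" if "0 <= a" "a <= b" for a b
 proof -
  have "f b = (\<integral>\<^sup>+s. h s * indicator {0..a} s + h s * indicator {a<..b} s \<partial>lborel)"
   unfolding f_def using that by (intro nn_integral_cong) (auto simp: indicator_def)
  also have "\<dots> = f a + (\<integral>\<^sup>+s\<in>{a<..b}. h s \<partial>lborel)" unfolding f_def by (rule nn_integral_add) measurable
  finally show ?thesis .
 qed
 have f0: "f 0 = 0"
 proof -
  have "AE s in lborel. h s * indicator {0..0} s = 0"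
   using AE_lborel_singleton[of "0::real"] by eventually_elim (auto simp: indicator_def)
  then show ?thesis unfolding f_def by (subst nn_integral_0_iff_AE) auto
 qed
 have fin: "f t < \<infinity>" if "t \<in> {0..T}" for t
  using split[of 0 t] Hb[of 0 t] that f0 by (auto intro: le_less_trans)
 define fr where "fr t = enn2real (f t)" for t
 have fr: "f t = ennreal (fr t)" "fr t >= 0" if "t \<in> {0..T}" for t
  using fin[OF that] by (auto simp: fr_def)
 have lip: "fr b - fr a <= max 0 Hb * (b - a) \<and> 0 <= fr b - fr a" if ab: "0 <= a" "a <= b" "b <= T" for a b
 proof -
  have "ennreal (fr b) <= ennreal (fr a) + ennreal (max 0 Hb * (b - a))"
   using split[OF ab(1,2)] Hb[OF ab] ab fr(1)[of a] fr(1)[of b] by (simp add: add_left_mono)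
  also have "\<dots> = ennreal (fr a + max 0 Hb * (b - a))" using ab fr(2)[of a] by (subst ennreal_plus) auto
  finally have 1: "fr b <= fr a + max 0 Hb * (b - a)"
   using ab fr(2)[of a] by (subst (asm) ennreal_le_iff) auto
  have "ennreal (fr a) <= ennreal (fr b)"
   using split[OF ab(1,2)] ab fr(1)[of a] fr(1)[of b] by simp
  then have "fr a <= fr b" using ab fr(2)[of b] by (subst (asm) ennreal_le_iff) auto
  with 1 show ?thesis by simp
 qed
 have "(max 0 Hb)-lipschitz_on {0..T} fr"
 proof (rule lipschitz_onI)
  fix a b assume "a \<in> {0..T}" "b \<in> {0..T}"
  then show "dist (fr a) (fr b) <= max 0 Hb * dist a b"
   using lip[of a b] lip[of b a] by (cases "a <= b") (auto simp: dist_real_def abs_if)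
 qed simp
 then have cont: "continuous_on {0..T} fr" by (rule lipschitz_on_continuous_on)
 have psic: "continuous_on {0..T} \<psi>" unfolding psi by (intro continuous_intros)
 have "fr t < \<psi> t"
 proof (rule ccontr)
  assume "\<not> fr t < \<psi> t"
  define A where "A = {s \<in> {0..T}. \<psi> s <= fr s}"
  have A: "t \<in> A" "bdd_below A" "A \<subseteq> {0..T}" using t \<open>\<not> fr t < \<psi> t\<close> by (auto simp: A_def intro!: bdd_belowI[of _ 0])
  have "closed A" unfolding A_def using cont psic by (intro continuous_on_closed_Collect_le) auto
  then have \<tau>: "Inf A \<in> A" using A by (intro closed_contains_Inf) auto
  define \<tau> where "\<tau> = Inf A"
  have \<tau>T: "\<tau> \<in> {0..T}" "\<psi> \<tau> <= fr \<tau>" using \<tau> by (auto simp: \<tau>_def A_def)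
  have below: "w s <= ennreal (\<psi> s)" if s: "0 <= s" "s < \<tau>" for s
  proof -
   have sT: "s \<in> {0..T}" using s \<tau>T by auto
   have "s \<notin> A" using s A(2) cInf_lower[of s A] by (auto simp: \<tau>_def)
   then have "fr s <= \<psi> s" using sT by (auto simp: A_def)
   then show ?thesis using w[OF sT] fr(1)[OF sT] unfolding f_def by (metis ennreal_leI order_trans)
  qed
  have "f \<tau> <= (\<integral>\<^sup>+s. ennreal (\<beta> * (\<Lambda> * exp (- (\<beta> * s))) * \<psi> s) * indicator {0..\<tau>} s \<partial>lborel)"
   unfolding f_def
  proof (rule nn_integral_mono_AE)
   show "AE s in lborel. h s * indicator {0..\<tau>} s <= ennreal (\<beta> * (\<Lambda> * exp (- (\<beta> * s))) * \<psi> s) * indicator {0..\<tau>} s"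
   \<comment> \<open>The comparison with the barrier is available strictly before \<tau>; the
     endpoint is a null set.\<close>
   using AE_lborel_singleton[of \<tau>]
   proof eventually_elim
   fix s assume "s \<noteq> \<tau>"
   then show "h s * indicator {0..\<tau>} s <= ennreal (\<beta> * (\<Lambda> * exp (- (\<beta> * s))) * \<psi> s) * indicator {0..\<tau>} s"
   using h[of s] below[of s] \<tau>T by (cases "s \<in> {0..\<tau>}") auto
   qed
  qed
  also have "\<dots> = ennreal (\<psi> \<tau> - \<psi> 0)"
  proof (rule nn_integral_FTC_Icc)
   show "DERIV \<psi> s :> \<beta> * (\<Lambda> * exp (- (\<beta> * s))) * \<psi> s" for s
   unfolding psi by (auto intro!: derivative_eq_intros)
   show "0 <= \<beta> * (\<Lambda> * exp (- (\<beta> * s))) * \<psi> s" for s using beta by (simp add: psi)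
  qed (use \<tau>T in \<open>auto simp: psi\<close>)
  finally have le: "ennreal (fr \<tau>) <= ennreal (\<psi> \<tau> - \<psi> 0)" using fr(1)[OF \<tau>T(1)] by simp
  have "\<psi> 0 > 0" "\<psi> \<tau> > 0" by (auto simp: psi)
  with le \<tau>T(2) show False
   by (cases "\<psi> \<tau> - \<psi> 0 >= 0") (auto simp: ennreal_le_iff ennreal_neg)
 qed
 then show ?thesis using w[OF t] fr(1)[OF t] unfolding f_def
  by (metis ennreal_leI order_trans less_imp_le)
qed

section \<open>The energy inequality\<close>

abbreviation tm :: "real => real measure" where
 "tm t \<equiv> restrict_space lborel {0..t}"

lemma finite_time_measure: "finite_measure (tm t)"
 by (rule finite_measureI) (auto simp: emeasure_restrict_space space_restrict_space emeasure_lborel_Icc_eq)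

lemma measure_time_measure: "t >= 0 ==> emeasure (tm t) (space (tm t)) = ennreal t"
 by (auto simp: emeasure_restrict_space space_restrict_space)

lemma measurable_time_measure: "f \<in> borel \<rightarrow>\<^sub>M N ==> f \<in> tm t \<rightarrow>\<^sub>M N"
 by (rule measurable_restrict_space1) simp

lemma measurable_time_measure_pair:
 assumes "f \<in> borel \<Otimes>\<^sub>M N \<rightarrow>\<^sub>M P" shows "f \<in> tm t \<Otimes>\<^sub>M N \<rightarrow>\<^sub>M P"
proof -
 have "(%x. x) \<in> tm t \<rightarrow>\<^sub>M borel" by (rule measurable_time_measure) simp
 then have "(%p. (fst p, snd p)) \<in> tm t \<Otimes>\<^sub>M N \<rightarrow>\<^sub>M borel \<Otimes>\<^sub>M N"
  by (intro measurable_Pair measurable_compose[OF measurable_fst] measurable_snd)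
 from measurable_compose[OF this assms] show ?thesis by simp
qed

text \<open>A non-integrable function has integral 0 by default, so the bound holds for every sample
  path without a measurability condition.\<close>

lemma norm_integral_time_measure_le:
 fixes f :: "real => 'b::{banach, second_countable_topology}"
 assumes "!!s. norm (f s) <= C" "C >= 0" "t >= 0"
 shows "norm (LINT s|tm t. f s) <= C * t"
proof (cases "integrable (tm t) f")
 case True
 interpret finite_measure "tm t" by (rule finite_time_measure)
 have "norm (LINT s|tm t. f s) <= (LINT s|tm t. norm (f s))" by simp
 also have "\<dots> <= (LINT s|tm t. C)" using True assms by (intro integral_mono) auto
 also have "\<dots> = C * t" using measure_time_measure[OF assms(3)] assms(3) by (simp add: measure_def)
 finally show ?thesis .
next
 case False
 then show ?thesis using assms by (simp add: not_integrable_integral_eq)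
qed

lemma integral_time_measure_restrict:
 fixes f :: "real => 'b::{banach, second_countable_topology}"
 assumes "s \<in> {0..t}"
 shows "(LINT r|tm s. f r) = (LINT r|tm t. indicator {..s} r *\<^sub>R f r)"
proof -
 have "(LINT r|tm t. indicator {..s} r *\<^sub>R f r) = (LINT r|lborel. indicator {0..t} r *\<^sub>R (indicator {..s} r *\<^sub>R f r))"
  by (rule integral_restrict_space) simp
 also have "\<dots> = (LINT r|lborel. indicator {0..s} r *\<^sub>R f r)"
  using assms by (intro Bochner_Integration.integral_cong) (auto simp: indicator_def)
 also have "\<dots> = (LINT r|tm s. f r)" by (rule integral_restrict_space[symmetric]) simp
 finally show ?thesis by simp
qed

text \<open>The Lebesgue-integral form of \<open>d(|A|\<^sup>2) = 2 A \<bullet> dA\<close>: fold the square \<open>[0,t]\<^sup>2\<close> along its diagonal.\<close>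

lemma square_integral_fold:
 fixes a :: "real => 'b::euclidean_space"
 assumes [measurable]: "a \<in> BM borel" and b: "!!s. norm (a s) <= C"
 shows "(LINT s|tm t. a s) \<bullet> (LINT s|tm t. a s) =
  2 * (LINT s|tm t. a s \<bullet> (LINT r|tm t. indicator {..s} r *\<^sub>R a r))"
proof -
 let ?L = "tm t"
 interpret L: finite_measure ?L by (rule finite_time_measure)
 interpret LL: pair_sigma_finite ?L ?L ..
 interpret FL: finite_measure "?L \<Otimes>\<^sub>M ?L" by (rule finite_measure_pair_measure) unfold_locales
 have C: "C >= 0" using b[of 0] norm_ge_zero order_trans by blast
 have ma: "a \<in> BM ?L" by (rule measurable_time_measure) measurable
 have ai: "integrable ?L a" using b by (intro L.integrable_const_bound[where B = C] ma) auto
 have mid: "(%x. x) \<in> ?L \<rightarrow>\<^sub>M borel" by (rule measurable_time_measure) simp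
 note [measurable] = ma mid
 have ab: "\<bar>a s \<bullet> a r\<bar> <= C * C" for s r
  by (rule order_trans[OF Cauchy_Schwarz_ineq2]) (intro mult_mono b C norm_ge_zero)
 have le: "{p \<in> space (?L \<Otimes>\<^sub>M ?L). snd p <= fst p} \<in> sets (?L \<Otimes>\<^sub>M ?L)" "{p \<in> space (?L \<Otimes>\<^sub>M ?L). fst p < snd p} \<in> sets (?L \<Otimes>\<^sub>M ?L)"
  by measurable
 have pi: "integrable (?L \<Otimes>\<^sub>M ?L) (%(s, r). indicator (U s) r * (a s \<bullet> a r))"
  if m: "(%(s, r). indicator (U s) r :: real) \<in> BM (?L \<Otimes>\<^sub>M ?L)" for U
 proof (rule FL.integrable_const_bound[where B = "C * C"])
  have [measurable]: "(%p. indicator (U (fst p)) (snd p) :: real) \<in> BM (?L \<Otimes>\<^sub>M ?L)" using m by (simp add: split_beta')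
  show "(%(s, r). indicator (U s) r * (a s \<bullet> a r)) \<in> BM (?L \<Otimes>\<^sub>M ?L)"
   unfolding split_beta' by measurable
  show "AE p in ?L \<Otimes>\<^sub>M ?L. norm (case p of (s, r) => indicator (U s) r * (a s \<bullet> a r)) <= C * C"
   using ab C by (intro AE_I2) (auto simp: indicator_def split: prod.split)
 qed
 have m1: "(%(s, r). indicator {..s} r :: real) \<in> BM (?L \<Otimes>\<^sub>M ?L)"
  by (rule measurable_cong[THEN iffD1, OF _ borel_measurable_indicator[OF le(1)]]) (auto simp: indicator_def)
 have m2: "(%(s, r). indicator {s<..} r :: real) \<in> BM (?L \<Otimes>\<^sub>M ?L)"
  by (rule measurable_cong[THEN iffD1, OF _ borel_measurable_indicator[OF le(2)]]) (auto simp: indicator_def)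
 note p1 = pi[OF m1] and p2 = pi[OF m2]
 have inner: "a s \<bullet> (LINT r|?L. indicator (U s) r *\<^sub>R a r) = (LINT r|?L. indicator (U s) r * (a s \<bullet> a r))"
  if "U s \<in> sets borel" for U :: "real => real set" and s
 proof -
  have mU: "(%r. indicator (U s) r :: real) \<in> BM ?L" using that by (intro measurable_time_measure) simp
  have "integrable ?L (%r. indicator (U s) r *\<^sub>R a r)"
   using b C by (intro L.integrable_const_bound[where B = C] borel_measurable_scaleR mU ma) (auto simp: indicator_def)
  from integral_inner_right[OF this, of "a s"] show ?thesis by simp
 qed
 let ?U = "LINT s|?L. (LINT r|?L. indicator {..s} r * (a s \<bullet> a r))"
 let ?V = "LINT s|?L. (LINT r|?L. indicator {s<..} r * (a s \<bullet> a r))"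
 have "(LINT s|?L. a s) \<bullet> (LINT s|?L. a s) = (LINT s|?L. a s \<bullet> (LINT r|?L. a r))"
  using integral_inner_left[OF ai, of "LINT r|?L. a r"] by simp
 also have "\<dots> = (LINT s|?L. (LINT r|?L. indicator {..s} r * (a s \<bullet> a r)) + (LINT r|?L. indicator {s<..} r * (a s \<bullet> a r)))"
 proof (rule Bochner_Integration.integral_cong[OF refl])
  fix s
  have i: "integrable ?L (%r. indicator U r * (a s \<bullet> a r))" if "U \<in> sets borel" for U :: "real set"
  proof (rule L.integrable_const_bound[where B = "C * C"])
   have "(%r. indicator U r :: real) \<in> BM ?L" using that by (intro measurable_time_measure) simp
   then show "(%r. indicator U r * (a s \<bullet> a r)) \<in> BM ?L" by measurable
  qed (use ab C in \<open>auto simp: indicator_def\<close>)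
  have "a s \<bullet> (LINT r|?L. a r) = (LINT r|?L. a s \<bullet> a r)" using integral_inner_right[OF ai, of "a s"] by simp
  also have "\<dots> = (LINT r|?L. indicator {..s} r * (a s \<bullet> a r) + indicator {s<..} r * (a s \<bullet> a r))"
   by (rule Bochner_Integration.integral_cong) (auto simp: indicator_def)
  also have "\<dots> = (LINT r|?L. indicator {..s} r * (a s \<bullet> a r)) + (LINT r|?L. indicator {s<..} r * (a s \<bullet> a r))"
   by (rule Bochner_Integration.integral_add) (rule i, simp)+
  finally show "a s \<bullet> (LINT r|?L. a r) = (LINT r|?L. indicator {..s} r * (a s \<bullet> a r)) + (LINT r|?L. indicator {s<..} r * (a s \<bullet> a r))" .
 qed
 also have "\<dots> = ?U + ?V"
  using LL.integrable_fst[OF p1] LL.integrable_fst[OF p2] by (rule Bochner_Integration.integral_add)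
 also have "?V = (LINT r|?L. (LINT s|?L. indicator {s<..} r * (a s \<bullet> a r)))"
  using LL.Fubini_integral[OF p2] by simp
 also have "\<dots> = ?U"
 proof (rule Bochner_Integration.integral_cong[OF refl])
  fix r
  \<comment> \<open>The two triangles of the square differ along the diagonal, which is a null set
    on each slice.\<close>
  have ne: "AE s in ?L. s \<noteq> r"
   using AE_lborel_singleton[of r] by (subst AE_restrict_space_iff) auto
  have "(%s. indicator {..r} s :: real) \<in> BM ?L" "(%s. indicator {..<r} s :: real) \<in> BM ?L"
   by (rule measurable_time_measure, simp)+
  then have [measurable]: "(%s. indicator {..r} s :: real) \<in> BM ?L" "(%s. indicator {..<r} s :: real) \<in> BM ?L" .
  have "(LINT s|?L. indicator {s<..} r * (a s \<bullet> a r)) = (LINT s|?L. indicator {..<r} s * (a s \<bullet> a r))"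
   by (rule Bochner_Integration.integral_cong) (auto simp: indicator_def)
  also have "\<dots> = (LINT s|?L. indicator {..r} s * (a r \<bullet> a s))"
  proof (rule integral_cong_AE)
   show "AE s in ?L. indicator {..<r} s * (a s \<bullet> a r) = indicator {..r} s * (a r \<bullet> a s)"
   using ne by eventually_elim (auto simp: indicator_def inner_commute)
  qed measurable
  finally show "(LINT s|?L. indicator {s<..} r * (a s \<bullet> a r)) = (LINT s|?L. indicator {..r} s * (a r \<bullet> a s))" .
 qed
 also have "?U = (LINT s|?L. a s \<bullet> (LINT r|?L. indicator {..s} r *\<^sub>R a r))"
  by (intro Bochner_Integration.integral_cong refl inner[symmetric]) simp
 finally show ?thesis by simp
qed

context filtered_brownian
begin

lemma integrable_time_pair:
 fixes f :: "real \<times> 'a => real"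
 assumes f: "f \<in> BM (borel \<Otimes>\<^sub>M M)" and t: "t >= 0"
  and le: "!!s. s \<in> {0..t} ==> (\<integral>\<^sup>+om. ennreal \<bar>f (s, om)\<bar> \<partial>M) <= ennreal R"
 shows "integrable (tm t \<Otimes>\<^sub>M M) f"
proof (rule integrableI_bounded)
 show m: "f \<in> BM (tm t \<Otimes>\<^sub>M M)" by (rule measurable_time_measure_pair[OF f])
 have "(\<integral>\<^sup>+p. ennreal (norm (f p)) \<partial>(tm t \<Otimes>\<^sub>M M)) = (\<integral>\<^sup>+s. (\<integral>\<^sup>+om. ennreal (norm (f (s, om))) \<partial>M) \<partial>tm t)"
  by (rule nn_integral_fst[symmetric], rule measurable_compose[OF m]) measurable
 also have "\<dots> <= (\<integral>\<^sup>+s. ennreal R \<partial>tm t)"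
  using le by (intro nn_integral_mono) (auto simp: space_restrict_space)
 also have "\<dots> < \<infinity>" using measure_time_measure[OF t] by (simp add: ennreal_mult_less_top)
 finally show "(\<integral>\<^sup>+p. ennreal (norm (f p)) \<partial>(tm t \<Otimes>\<^sub>M M)) < \<infinity>" .
qed

lemma L1_le_sqn_one:
 assumes "X \<in> BM M" "sqn X <= ennreal R" "R >= 0"
 shows "(\<integral>\<^sup>+om. ennreal (norm (X om)) \<partial>M) <= ennreal (1 + R)"
proof -
 have "(\<integral>\<^sup>+om. ennreal (norm (X om)) \<partial>M) <= (\<integral>\<^sup>+om. 1 + ennreal ((norm (X om))\<^sup>2) \<partial>M)"
 proof (rule nn_integral_mono)
  fix om
  have "norm (X om) <= 1 + (norm (X om))\<^sup>2"
   using sum_squares_bound[of "norm (X om)" 1] norm_ge_zero[of "X om"] zero_le_power2[of "norm (X om)"]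
   by (simp only: power_one mult_1_right)
  then show "ennreal (norm (X om)) <= 1 + ennreal ((norm (X om))\<^sup>2)"
   using ennreal_plus[of 1 "(norm (X om))\<^sup>2"] by (metis ennreal_1 ennreal_leI zero_le_one zero_le_power2)
 qed
 also have "\<dots> = 1 + sqn X" using assms(1) by (subst nn_integral_add) (auto simp: sqn_def emeasure_space_1)
 also have "\<dots> <= 1 + ennreal R" by (rule add_left_mono[OF assms(2)])
 also have "\<dots> = ennreal (1 + R)" using assms(3) by (subst ennreal_plus) auto
 finally show ?thesis .
qed

text \<open>Expand |A + N|^2 in expectation. The square of A folds to twice the integral of a
  \<bullet> A. The mixed term becomes the integral of a s \<bullet> N t, where \<open>mart\<close>
  replaces N t by N s. Together they give twice the integral of a \<bullet> Z. The second conclusion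
  is a crude bound that secures finiteness.\<close>

lemma energy_inequality:
 fixes a Z :: "real => 'a => real^2"
 assumes a: "(%(s, om). a s om) \<in> BM (borel \<Otimes>\<^sub>M M)" and aC: "!!s om. norm (a s om) <= C" "C >= 0"
  and Z: "(%(s, om). Z s om) \<in> BM (borel \<Otimes>\<^sub>M M)" and t: "t >= 0"
  and N: "!!s om. N s om = Z s om - (LINT r|tm s. a r om)"
  and R: "!!s. s \<in> {0..t} ==> sqn (N s) <= ennreal R" "R >= 0"
  and mart: "!!s. s \<in> {0..t} ==> expectation (%om. a s om \<bullet> (N t om - N s om)) = 0"
 shows "sqn (Z t) <= 2 * (\<integral>\<^sup>+s. (\<integral>\<^sup>+om. ennreal (norm (a s om) * norm (Z s om)) \<partial>M) \<partial>tm t) + sqn (N t)"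
  "sqn (Z t) <= ennreal (2 * ((C * t)\<^sup>2 + R))"
proof -
 let ?L = "tm t"
 interpret L: finite_measure ?L by (rule finite_time_measure)
 interpret LM: pair_sigma_finite ?L M ..
 \<comment> \<open>The running integral of a, written over the fixed measure \<open>tm t\<close>
   with an indicator so that it is jointly measurable in s and the sample point.\<close>
 define A where "A s om = (LINT r|?L. indicator {..s} r *\<^sub>R a r om)" for s om
 define N' where "N' s om = Z s om - A s om" for s om
 have NN: "N s = N' s" if "s \<in> {0..t}" for s
 proof
  fix om show "N s om = N' s om"
   using integral_time_measure_restrict[OF that, of "%r. a r om"] by (simp add: N N'_def A_def)
 qed
 have am: "a s \<in> BM M" "Z s \<in> BM M" for s
  using measurable_compose[OF measurable_Pair1' a, of s] measurable_compose[OF measurable_Pair1' Z, of s] by auto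
 have aw: "(%s. a s om) \<in> BM borel" if "om \<in> space M" for om
  using measurable_compose[OF measurable_Pair2'[OF that] a] by simp
 have Am: "(%(s, om). A s om) \<in> BM (borel \<Otimes>\<^sub>M M)"
 proof -
  have id: "(%x. x) \<in> ?L \<rightarrow>\<^sub>M borel" by (rule measurable_time_measure) simp
  have 1: "(%q. (snd q, snd (fst q))) \<in> (borel \<Otimes>\<^sub>M M) \<Otimes>\<^sub>M ?L \<rightarrow>\<^sub>M borel \<Otimes>\<^sub>M M"
   by (intro measurable_Pair measurable_compose[OF measurable_snd id] measurable_compose[OF measurable_fst measurable_snd])
  have 2: "(%q. a (snd q) (snd (fst q))) \<in> BM ((borel \<Otimes>\<^sub>M M) \<Otimes>\<^sub>M ?L)"
   using measurable_compose[OF 1 a] by simp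
  have [measurable]: "(%q. snd q) \<in> (borel \<Otimes>\<^sub>M M) \<Otimes>\<^sub>M ?L \<rightarrow>\<^sub>M borel" by (rule measurable_compose[OF measurable_snd id])
  have "{q \<in> space ((borel \<Otimes>\<^sub>M M) \<Otimes>\<^sub>M ?L). snd q <= fst (fst q)} \<in> sets ((borel \<Otimes>\<^sub>M M) \<Otimes>\<^sub>M ?L)" by measurable
  from borel_measurable_indicator[OF this]
  have "(%q. indicator {..fst (fst q)} (snd q) :: real) \<in> BM ((borel \<Otimes>\<^sub>M M) \<Otimes>\<^sub>M ?L)"
   by (rule measurable_cong[THEN iffD1, rotated]) (auto simp: indicator_def)
  from borel_measurable_scaleR[OF this 2]
  have "(%(p, r). indicator {..fst p} r *\<^sub>R a r (snd p)) \<in> BM ((borel \<Otimes>\<^sub>M M) \<Otimes>\<^sub>M ?L)"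
   by (simp add: split_beta')
  from L.borel_measurable_lebesgue_integral[OF this] show ?thesis by (simp add: A_def split_beta')
 qed
 have N'm: "(%(s, om). N' s om) \<in> BM (borel \<Otimes>\<^sub>M M)"
  using borel_measurable_diff[OF Z Am] by (simp add: N'_def split_beta')
 have N's: "N' s \<in> BM M" and As: "A s \<in> BM M" for s
  using measurable_compose[OF measurable_Pair1' N'm, of s] measurable_compose[OF measurable_Pair1' Am, of s] by auto
 have AC: "norm (A s om) <= C * t" for s om
  unfolding A_def using aC t by (intro norm_integral_time_measure_le) (auto simp: indicator_def)
 have R': "sqn (N' s) <= ennreal R" if "s \<in> {0..t}" for s using R(1)[OF that] NN[OF that] by simp
 have tt: "t \<in> {0..t}" using t by simp
 have an: "(\<integral>\<^sup>+om. ennreal \<bar>a s om \<bullet> X om\<bar> \<partial>M) <= ennreal (C * (1 + R))"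
  if X: "X \<in> BM M" "sqn X <= ennreal R" for s X
 proof -
  have "(\<integral>\<^sup>+om. ennreal \<bar>a s om \<bullet> X om\<bar> \<partial>M) <= (\<integral>\<^sup>+om. ennreal C * ennreal (norm (X om)) \<partial>M)"
  proof (rule nn_integral_mono)
   fix om
   have "\<bar>a s om \<bullet> X om\<bar> <= C * norm (X om)"
   by (rule order_trans[OF Cauchy_Schwarz_ineq2]) (intro mult_right_mono aC norm_ge_zero)
   then show "ennreal \<bar>a s om \<bullet> X om\<bar> <= ennreal C * ennreal (norm (X om))"
   using aC(2) by (simp add: ennreal_mult[symmetric] ennreal_leI)
  qed
  also have "\<dots> = ennreal C * (\<integral>\<^sup>+om. ennreal (norm (X om)) \<partial>M)" using X(1) by (intro nn_integral_cmult) measurable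
  also have "\<dots> <= ennreal C * ennreal (1 + R)" by (rule mult_left_mono[OF L1_le_sqn_one[OF X R(2)]]) simp
  also have "\<dots> = ennreal (C * (1 + R))" using aC(2) R(2) by (intro ennreal_mult[symmetric]) auto
  finally show ?thesis .
 qed
 have aNt: "integrable (?L \<Otimes>\<^sub>M M) (%(s, om). a s om \<bullet> N' t om)"
 proof (rule integrable_time_pair[OF _ t])
  show "(%(s, om). a s om \<bullet> N' t om) \<in> BM (borel \<Otimes>\<^sub>M M)"
   using borel_measurable_inner[OF a measurable_compose[OF measurable_snd N's, of t borel]] by (simp add: split_beta')
  show "(\<integral>\<^sup>+om. ennreal \<bar>case (s, om) of (s, om) => a s om \<bullet> N' t om\<bar> \<partial>M) <= ennreal (C * (1 + R))" for s
   using an[OF N's R'[OF tt], of s] by simp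
 qed
 have aNs: "integrable (?L \<Otimes>\<^sub>M M) (%(s, om). a s om \<bullet> N' s om)"
 proof (rule integrable_time_pair[OF _ t])
  show "(%(s, om). a s om \<bullet> N' s om) \<in> BM (borel \<Otimes>\<^sub>M M)"
   using borel_measurable_inner[OF a N'm] by (simp add: split_beta')
  show "(\<integral>\<^sup>+om. ennreal \<bar>case (s, om) of (s, om) => a s om \<bullet> N' s om\<bar> \<partial>M) <= ennreal (C * (1 + R))" if "s \<in> {0..t}" for s
   using an[OF N's R'[OF that], of s] by simp
 qed
 have aAb: "\<bar>a s om \<bullet> A s om\<bar> <= C * (C * t)" for s om
  by (rule order_trans[OF Cauchy_Schwarz_ineq2]) (intro mult_mono aC AC norm_ge_zero)
 have aAs: "integrable (?L \<Otimes>\<^sub>M M) (%(s, om). a s om \<bullet> A s om)"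
 proof (rule integrable_time_pair[OF _ t])
  show "(%(s, om). a s om \<bullet> A s om) \<in> BM (borel \<Otimes>\<^sub>M M)"
   using borel_measurable_inner[OF a Am] by (simp add: split_beta')
  have "(\<integral>\<^sup>+om. ennreal \<bar>a s om \<bullet> A s om\<bar> \<partial>M) <= (\<integral>\<^sup>+om. ennreal (C * (C * t)) \<partial>M)" for s
   by (rule nn_integral_mono) (rule ennreal_leI[OF aAb])
  then show "(\<integral>\<^sup>+om. ennreal \<bar>case (s, om) of (s, om) => a s om \<bullet> A s om\<bar> \<partial>M) <= ennreal (C * (C * t))" for s
   by (simp add: emeasure_space_1)
 qed
 have aZ: "integrable (?L \<Otimes>\<^sub>M M) (%(s, om). a s om \<bullet> Z s om)"
  using Bochner_Integration.integrable_add[OF aAs aNs] by (simp add: N'_def split_beta' inner_add_right[symmetric])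
 have N2: "integrable M (%om. (norm (N' t om))\<^sup>2)"
  by (intro sqn_finite_imp_integrable N's le_less_trans[OF R'[OF tt]]) simp
 have ai: "integrable ?L (%s. a s om)" if "om \<in> space M" for om
  by (rule L.integrable_const_bound[where B = C]) (auto intro: aC measurable_time_measure[OF aw[OF that]])
 have At: "A t om = (LINT r|?L. a r om)" for om
  using integral_time_measure_restrict[OF tt, of "%r. a r om"] by (simp add: A_def)
 have e1: "expectation (%om. A t om \<bullet> A t om) = 2 * (LINT s|?L. expectation (%om. a s om \<bullet> A s om))"
 proof -
  have "expectation (%om. A t om \<bullet> A t om) = expectation (%om. 2 * (LINT s|?L. a s om \<bullet> A s om))"
   unfolding At by (rule Bochner_Integration.integral_cong[OF refl])
   (subst square_integral_fold[OF aw aC(1)], assumption, simp add: A_def)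
  also have "\<dots> = 2 * expectation (%om. LINT s|?L. a s om \<bullet> A s om)" by simp
  also have "expectation (%om. LINT s|?L. a s om \<bullet> A s om) = (LINT s|?L. expectation (%om. a s om \<bullet> A s om))"
   by (rule LM.Fubini_integral[OF aAs])
  finally show ?thesis .
 qed
 \<comment> \<open>Adaptedness of the drift enters here, through \<open>mart\<close>: under the time
   integral N t is exchanged for N s.\<close>
 have e2: "expectation (%om. A t om \<bullet> N' t om) = (LINT s|?L. expectation (%om. a s om \<bullet> N' s om))"
 proof -
  have "expectation (%om. A t om \<bullet> N' t om) = expectation (%om. LINT s|?L. a s om \<bullet> N' t om)"
   unfolding At by (rule Bochner_Integration.integral_cong[OF refl]) (rule integral_inner_left[symmetric], rule ai)
  also have "\<dots> = (LINT s|?L. expectation (%om. a s om \<bullet> N' t om))" by (rule LM.Fubini_integral[OF aNt])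
  also have "\<dots> = (LINT s|?L. expectation (%om. a s om \<bullet> N' s om))"
  proof (rule Bochner_Integration.integral_cong[OF refl])
   fix s assume "s \<in> space ?L"
   then have s: "s \<in> {0..t}" by (simp add: space_restrict_space)
   have i: "integrable M (%om. a s om \<bullet> N' u om)" if "u \<in> {0..t}" for u
   using an[OF N's R'[OF that], of s]
   by (intro integrableI_bounded borel_measurable_inner am N's) (auto intro: le_less_trans)
   have "expectation (%om. a s om \<bullet> N' t om) - expectation (%om. a s om \<bullet> N' s om) = expectation (%om. a s om \<bullet> (N t om - N s om))"
   using i[OF tt] i[OF s] by (simp add: NN[OF tt] NN[OF s] inner_diff_right)
   then show "expectation (%om. a s om \<bullet> N' t om) = expectation (%om. a s om \<bullet> N' s om)" using mart[OF s] by simp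
  qed
  finally show ?thesis .
 qed
 have iAA: "integrable M (%om. A t om \<bullet> A t om)"
 proof (rule integrable_const_bound[where B = "(C * t) * (C * t)"])
  show "AE om in M. norm (A t om \<bullet> A t om) <= C * t * (C * t)"
  proof (rule AE_I2)
   fix om show "norm (A t om \<bullet> A t om) <= C * t * (C * t)"
   unfolding real_norm_def by (rule order_trans[OF Cauchy_Schwarz_ineq2]) (use aC t in \<open>intro mult_mono AC norm_ge_zero mult_nonneg_nonneg\<close>)
  qed
 qed (intro borel_measurable_inner As)
 have iAN: "integrable M (%om. A t om \<bullet> N' t om)"
 proof (rule Bochner_Integration.integrable_bound)
  show "integrable M (%om. A t om \<bullet> A t om + (norm (N' t om))\<^sup>2)" by (intro Bochner_Integration.integrable_add iAA N2)
  show "AE om in M. norm (A t om \<bullet> N' t om) <= norm (A t om \<bullet> A t om + (norm (N' t om))\<^sup>2)"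
  proof (rule AE_I2)
   fix om
   have "\<bar>A t om \<bullet> N' t om\<bar> <= norm (A t om) * norm (N' t om)" by (rule Cauchy_Schwarz_ineq2)
   also have "\<dots> <= (norm (A t om))\<^sup>2 + (norm (N' t om))\<^sup>2"
   using sum_squares_bound[of "norm (A t om)" "norm (N' t om)"] mult_nonneg_nonneg[OF norm_ge_zero norm_ge_zero, of "A t om" "N' t om"] by linarith
   finally show "norm (A t om \<bullet> N' t om) <= norm (A t om \<bullet> A t om + (norm (N' t om))\<^sup>2)"
   by (simp add: power2_norm_eq_inner)
  qed
 qed (intro borel_measurable_inner As N's)
 have Zt: "(norm (Z t om))\<^sup>2 = A t om \<bullet> A t om + 2 * (A t om \<bullet> N' t om) + (norm (N' t om))\<^sup>2" for om
  by (simp add: N'_def power2_norm_eq_inner inner_diff_left inner_diff_right inner_commute)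
 have iZ: "integrable M (%om. (norm (Z t om))\<^sup>2)"
  unfolding Zt by (intro Bochner_Integration.integrable_add iAA N2 integrable_mult_right iAN)
 have Es: "expectation (%om. a s om \<bullet> A s om) + expectation (%om. a s om \<bullet> N' s om) = expectation (%om. a s om \<bullet> Z s om)"
  if s: "s \<in> {0..t}" for s
 proof -
  have 1: "integrable M (%om. a s om \<bullet> N' s om)"
   using an[OF N's R'[OF s], of s]
   by (intro integrableI_bounded borel_measurable_inner am N's) (auto intro: le_less_trans)
  have 2: "integrable M (%om. a s om \<bullet> A s om)"
   by (rule integrable_const_bound[where B = "C * (C * t)"]) (use aAb in \<open>auto intro!: borel_measurable_inner am As\<close>)
  from Bochner_Integration.integral_add[OF 2 1] show ?thesis by (simp add: N'_def inner_add_right[symmetric])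
 qed
 have "expectation (%om. (norm (Z t om))\<^sup>2) =
   2 * (LINT s|?L. expectation (%om. a s om \<bullet> A s om)) + 2 * (LINT s|?L. expectation (%om. a s om \<bullet> N' s om)) + expectation (%om. (norm (N' t om))\<^sup>2)"
  unfolding Zt e1[symmetric] e2[symmetric] using iAA iAN N2 by simp
 also have "2 * (LINT s|?L. expectation (%om. a s om \<bullet> A s om)) + 2 * (LINT s|?L. expectation (%om. a s om \<bullet> N' s om)) =
   2 * (LINT s|?L. expectation (%om. a s om \<bullet> A s om) + expectation (%om. a s om \<bullet> N' s om))"
  by (subst Bochner_Integration.integral_add[OF LM.integrable_fst[OF aAs] LM.integrable_fst[OF aNs]]) simp
 also have "(LINT s|?L. expectation (%om. a s om \<bullet> A s om) + expectation (%om. a s om \<bullet> N' s om)) = (LINT s|?L. expectation (%om. a s om \<bullet> Z s om))"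
  by (rule Bochner_Integration.integral_cong[OF refl]) (auto intro: Es simp: space_restrict_space)
 finally have E: "expectation (%om. (norm (Z t om))\<^sup>2) = 2 * (LINT s|?L. expectation (%om. a s om \<bullet> Z s om)) + expectation (%om. (norm (N' t om))\<^sup>2)" .
 have "ennreal \<bar>LINT s|?L. expectation (%om. a s om \<bullet> Z s om)\<bar> <= (\<integral>\<^sup>+s. ennreal \<bar>expectation (%om. a s om \<bullet> Z s om)\<bar> \<partial>?L)"
  using integral_norm_bound_ennreal[OF LM.integrable_fst[OF aZ]] by simp
 also have "\<dots> <= (\<integral>\<^sup>+s. (\<integral>\<^sup>+om. ennreal (norm (a s om) * norm (Z s om)) \<partial>M) \<partial>?L)"
 proof (rule nn_integral_mono)
  fix s
  have "ennreal \<bar>expectation (%om. a s om \<bullet> Z s om)\<bar> <= (\<integral>\<^sup>+om. ennreal \<bar>a s om \<bullet> Z s om\<bar> \<partial>M)"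
  proof (cases "integrable M (%om. a s om \<bullet> Z s om)")
   case True
   from integral_norm_bound_ennreal[OF this] show ?thesis by simp
  qed (simp add: not_integrable_integral_eq)
  also have "\<dots> <= (\<integral>\<^sup>+om. ennreal (norm (a s om) * norm (Z s om)) \<partial>M)"
   by (rule nn_integral_mono) (rule ennreal_leI[OF Cauchy_Schwarz_ineq2])
  finally show "ennreal \<bar>expectation (%om. a s om \<bullet> Z s om)\<bar> <= (\<integral>\<^sup>+om. ennreal (norm (a s om) * norm (Z s om)) \<partial>M)" .
 qed
 finally have I: "ennreal \<bar>LINT s|?L. expectation (%om. a s om \<bullet> Z s om)\<bar> <= (\<integral>\<^sup>+s. (\<integral>\<^sup>+om. ennreal (norm (a s om) * norm (Z s om)) \<partial>M) \<partial>?L)" .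
 have "sqn (Z t) = ennreal (expectation (%om. (norm (Z t om))\<^sup>2))"
  unfolding sqn_def by (rule nn_integral_eq_integral[OF iZ]) simp
 also have "\<dots> <= ennreal (2 * \<bar>LINT s|?L. expectation (%om. a s om \<bullet> Z s om)\<bar> + expectation (%om. (norm (N' t om))\<^sup>2))"
  unfolding E by (rule ennreal_leI) simp
 also have "\<dots> = 2 * ennreal \<bar>LINT s|?L. expectation (%om. a s om \<bullet> Z s om)\<bar> + ennreal (expectation (%om. (norm (N' t om))\<^sup>2))"
  by (subst ennreal_plus) (auto simp: ennreal_mult)
 also have "ennreal (expectation (%om. (norm (N' t om))\<^sup>2)) = sqn (N t)"
  unfolding sqn_def NN[OF tt] by (rule nn_integral_eq_integral[OF N2, symmetric]) simp
 finally show "sqn (Z t) <= 2 * (\<integral>\<^sup>+s. (\<integral>\<^sup>+om. ennreal (norm (a s om) * norm (Z s om)) \<partial>M) \<partial>?L) + sqn (N t)"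
  by (rule order_trans) (intro add_right_mono mult_left_mono I zero_le)
 have "sqn (Z t) = sqn (%om. A t om + N' t om)" by (simp add: N'_def)
 also have "\<dots> <= 2 * (sqn (A t) + sqn (N' t))" by (intro sqn_add As N's)
 also have "\<dots> <= 2 * (ennreal ((C * t)\<^sup>2) + ennreal R)"
 proof -
  have "sqn (A t) <= (\<integral>\<^sup>+om. ennreal ((C * t)\<^sup>2) \<partial>M)"
   unfolding sqn_def by (intro nn_integral_mono ennreal_leI power_mono AC norm_ge_zero)
  then have "sqn (A t) <= ennreal ((C * t)\<^sup>2)" by (simp add: emeasure_space_1)
  then show ?thesis using R'[OF tt] by (intro mult_left_mono add_mono) auto
 qed
 also have "\<dots> = ennreal (2 * ((C * t)\<^sup>2 + R))"
  using R(2) by (simp add: ennreal_mult)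
 finally show "sqn (Z t) <= ennreal (2 * ((C * t)\<^sup>2 + R))" .
qed

end

section \<open>Comparison of two flows\<close>

lemma borel_measurable_drift:
 fixes H :: "torus2 => real^2"
 assumes xi: "\<xi> \<in> BM borel" and H: "H \<in> BM borel"
  and Y: "(%(p, y). Y y p) \<in> BM (P \<Otimes>\<^sub>M TL)" and X: "X \<in> BM P"
 shows "(%p. LINT y|TL. \<xi> y *\<^sub>R H (X p - Y y p)) \<in> BM P"
proof -
 have 1: "(%q. \<xi> (snd q)) \<in> BM (P \<Otimes>\<^sub>M TL)"
  by (rule measurable_compose[OF measurable_snd]) (use xi in \<open>simp cong: measurable_cong_sets\<close>)
 have "(%q. X (fst q) - Y (snd q) (fst q)) \<in> BM (P \<Otimes>\<^sub>M TL)"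
  using borel_measurable_torus_diff[OF measurable_compose[OF measurable_fst X] Y] by (simp add: split_beta')
 from borel_measurable_scaleR[OF 1 measurable_compose[OF this H]]
 have "(%(p, y). \<xi> y *\<^sub>R H (X p - Y y p)) \<in> BM (P \<Otimes>\<^sub>M TL)"
  by (simp add: split_beta')
 from torus.borel_measurable_lebesgue_integral[OF this] show ?thesis .
qed

context filtered_brownian
begin

text \<open>Each Y y is measurable for F s, but joint measurability in y is known only for M, so the
  drift is not tested as a whole. Fubini pulls the y-integral out, and for fixed y the variable Hn n
  (Y x - Y y) is a bounded test variable known at time s. Truncation of H at level n supplies the
  boundedness, and dominated convergence removes it.\<close>

lemma drift_martingale:
 fixes H :: "torus2 => real^2" and Y :: "torus2 => 'a => torus2"
 assumes xi: "\<xi> \<in> BM borel" "AE y in TL. \<bar>\<xi> y\<bar> <= B" "B >= 0"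
  and H: "integrable TL H" and s: "s \<in> {0..T}"
  and Y: "!!y. Y y \<in> BM (F s)"
  and Ym: "(%(om, y). Y y om) \<in> BM (M \<Otimes>\<^sub>M TL)"
  and mp: "AE om in M. torus_mp (%y. Y y om)"
  and D: "integrable M \<Delta>"
  and zero: "!!g C. g \<in> BM (F s) ==> (!!om. om \<in> space M ==> norm (g om) <= C) ==>
   expectation (%om. g om \<bullet> \<Delta> om) = 0"
 shows "expectation (%om. drift \<xi> H (%y. Y y om) x \<bullet> \<Delta> om) = 0"
proof -
 interpret P: pair_sigma_finite TL M ..
 have Hm [measurable]: "H \<in> BM borel"
  using borel_measurable_integrable[OF H] by (simp cong: measurable_cong_sets)
 have Dm: "\<Delta> \<in> BM M" using D by (rule borel_measurable_integrable)
 define Hn where "Hn n v = indicator {v. norm (H v) <= real n} v *\<^sub>R H v" for n v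
 have Hnm [measurable]: "Hn n \<in> BM borel" for n unfolding Hn_def[abs_def] by measurable
 have Hn_le: "norm (Hn n v) <= norm (H v)" "norm (Hn n v) <= real n" for n v
  by (auto simp: Hn_def indicator_def)
 have Hni: "integrable TL (Hn n)" for n
  by (rule Bochner_Integration.integrable_bound[OF H]) (use Hn_le(1) Hnm in \<open>auto cong: measurable_cong_sets\<close>)
 have Hnlim: "(%n. Hn n v) \<longlonglongrightarrow> H v" for v
 proof (rule tendsto_eventually)
  obtain n0 :: nat where "norm (H v) <= real n0" using real_arch_simple by blast
  then show "\<forall>\<^sub>F n in sequentially. Hn n v = H v"
   by (intro eventually_sequentiallyI[of n0]) (auto simp: Hn_def indicator_def)
 qed
 have xim: "\<xi> \<in> BM TL" using xi(1) by (simp cong: measurable_cong_sets)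
 have xii: "integrable TL \<xi>"
  by (rule torus.integrable_const_bound[OF _ xim]) (use xi(2) in simp)
 have YM: "Y y \<in> BM M" for y by (rule measurable_F_M[OF Y s])
 have dm: "(%om. drift \<xi> G (%y. Y y om) x) \<in> BM M" if "G \<in> BM borel" for G
  unfolding drift_def by (rule borel_measurable_drift[OF xi(1) that Ym YM])
 have zn: "expectation (%om. drift \<xi> (Hn n) (%y. Y y om) x \<bullet> \<Delta> om) = 0" for n
 proof -
  let ?f = "%y om. \<xi> y * (Hn n (Y x om - Y y om) \<bullet> \<Delta> om)"
  have Ym': "(%(y, om). Y y om) \<in> BM (TL \<Otimes>\<^sub>M M)"
   using measurable_pair_swap[OF Ym] by (simp add: split_beta')
  have "(%p. Y x (snd p) - Y (fst p) (snd p)) \<in> BM (TL \<Otimes>\<^sub>M M)"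
   using borel_measurable_torus_diff[OF measurable_compose[OF measurable_snd YM, of x TL] Ym'] by (simp add: split_beta')
  then have fm: "(%p. ?f (fst p) (snd p)) \<in> BM (TL \<Otimes>\<^sub>M M)"
   by (intro borel_measurable_times borel_measurable_inner measurable_compose[OF measurable_fst xim]
   measurable_compose[OF measurable_snd Dm] measurable_compose[OF _ Hnm])
  have fle: "\<bar>?f y om\<bar> <= \<bar>\<xi> y\<bar> * (real n * norm (\<Delta> om))" for y om
   unfolding abs_mult
   by (intro mult_left_mono order_trans[OF Cauchy_Schwarz_ineq2] mult_right_mono Hn_le) auto
  have "integrable (TL \<Otimes>\<^sub>M M) (%p. ?f (fst p) (snd p))"
  proof (rule integrableI_bounded[OF fm])
   have "(\<integral>\<^sup>+p. ennreal (norm (?f (fst p) (snd p))) \<partial>(TL \<Otimes>\<^sub>M M)) =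
   (\<integral>\<^sup>+y. (\<integral>\<^sup>+om. ennreal (norm (?f y om)) \<partial>M) \<partial>TL)"
   by (subst nn_integral_fst[symmetric], rule measurable_compose[OF fm]) simp_all
   also have "\<dots> <= (\<integral>\<^sup>+y. ennreal \<bar>\<xi> y\<bar> * (\<integral>\<^sup>+om. ennreal (real n * norm (\<Delta> om)) \<partial>M) \<partial>TL)"
   proof (rule nn_integral_mono)
   fix y
   have "(\<integral>\<^sup>+om. ennreal (norm (?f y om)) \<partial>M) <= (\<integral>\<^sup>+om. ennreal \<bar>\<xi> y\<bar> * ennreal (real n * norm (\<Delta> om)) \<partial>M)"
   proof (rule nn_integral_mono)
   fix om
   have "ennreal (norm (?f y om)) <= ennreal (\<bar>\<xi> y\<bar> * (real n * norm (\<Delta> om)))"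
   unfolding real_norm_def by (rule ennreal_leI[OF fle])
   also have "\<dots> = ennreal \<bar>\<xi> y\<bar> * ennreal (real n * norm (\<Delta> om))" by (rule ennreal_mult) auto
   finally show "ennreal (norm (?f y om)) <= ennreal \<bar>\<xi> y\<bar> * ennreal (real n * norm (\<Delta> om))" .
   qed
   also have "\<dots> = ennreal \<bar>\<xi> y\<bar> * (\<integral>\<^sup>+om. ennreal (real n * norm (\<Delta> om)) \<partial>M)"
   by (rule nn_integral_cmult) (use Dm in measurable)
   finally show "(\<integral>\<^sup>+om. ennreal (norm (?f y om)) \<partial>M) <= ennreal \<bar>\<xi> y\<bar> * (\<integral>\<^sup>+om. ennreal (real n * norm (\<Delta> om)) \<partial>M)" .
   qed
   also have "\<dots> = (\<integral>\<^sup>+y. ennreal \<bar>\<xi> y\<bar> \<partial>TL) * (\<integral>\<^sup>+om. ennreal (real n * norm (\<Delta> om)) \<partial>M)"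
   by (rule nn_integral_multc) (use xim in measurable)
   also have "\<dots> < \<infinity>"
   proof -
   have "(\<integral>\<^sup>+y. ennreal \<bar>\<xi> y\<bar> \<partial>TL) < \<infinity>" using xii by (simp add: integrable_iff_bounded)
   moreover have "integrable M (%om. real n * norm (\<Delta> om))" using D by simp
   then have "(\<integral>\<^sup>+om. ennreal (real n * norm (\<Delta> om)) \<partial>M) < \<infinity>"
   unfolding integrable_iff_bounded by (simp add: abs_mult)
   ultimately show ?thesis by (simp add: ennreal_mult_less_top)
   qed
   finally show "(\<integral>\<^sup>+p. ennreal (norm (?f (fst p) (snd p))) \<partial>(TL \<Otimes>\<^sub>M M)) < \<infinity>" .
  qed
  then have fi: "integrable (TL \<Otimes>\<^sub>M M) (%(y, om). ?f y om)" by (simp add: split_beta')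
  have "expectation (%om. drift \<xi> (Hn n) (%y. Y y om) x \<bullet> \<Delta> om) = expectation (%om. LINT y|TL. ?f y om)"
  proof (rule Bochner_Integration.integral_cong[OF refl])
   fix om assume om: "om \<in> space M"
   have Yb: "(%y. Y y om) \<in> BM TL"
   using measurable_compose[OF measurable_Pair1'[OF om] Ym] by simp
   have "(%y. Y x om - Y y om) \<in> BM TL" by (rule borel_measurable_torus_diff[OF _ Yb]) simp
   from measurable_compose[OF this Hnm] have hm: "(%y. Hn n (Y x om - Y y om)) \<in> BM TL" .
   have "integrable TL (%y. \<xi> y *\<^sub>R Hn n (Y x om - Y y om))"
   proof (rule Bochner_Integration.integrable_bound)
   show "integrable TL (%y. real n * \<bar>\<xi> y\<bar>)" using xii by simp
   show "AE y in TL. norm (\<xi> y *\<^sub>R Hn n (Y x om - Y y om)) <= norm (real n * \<bar>\<xi> y\<bar>)"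
   proof (rule AE_I2)
   fix y show "norm (\<xi> y *\<^sub>R Hn n (Y x om - Y y om)) <= norm (real n * \<bar>\<xi> y\<bar>)"
   using mult_left_mono[OF Hn_le(2)[of n "Y x om - Y y om"], of "\<bar>\<xi> y\<bar>"] by (simp add: mult.commute)
   qed
   qed (rule borel_measurable_scaleR[OF xim hm])
   from integral_inner_left[OF this, of "\<Delta> om"]
   show "drift \<xi> (Hn n) (%y. Y y om) x \<bullet> \<Delta> om = (LINT y|TL. ?f y om)"
   by (simp add: drift_def)
  qed
  also have "\<dots> = (LINT y|TL. expectation (%om. ?f y om))" by (rule P.Fubini_integral[OF fi])
  also have "\<dots> = (LINT y|TL. 0)"
  proof (rule Bochner_Integration.integral_cong[OF refl])
   fix y
   have "(%om. Hn n (Y x om - Y y om)) \<in> BM (F s)"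
   by (rule measurable_compose[OF borel_measurable_torus_diff[OF Y Y] Hnm])
   from zero[OF this Hn_le(2)] show "expectation (%om. ?f y om) = 0" by simp
  qed
  finally show ?thesis by simp
 qed
 let ?C = "B * (LINT y|TL. norm (H y))"
 have "(%n. expectation (%om. drift \<xi> (Hn n) (%y. Y y om) x \<bullet> \<Delta> om)) \<longlonglongrightarrow> expectation (%om. drift \<xi> H (%y. Y y om) x \<bullet> \<Delta> om)"
 proof (rule integral_dominated_convergence)
  show "(%om. drift \<xi> H (%y. Y y om) x \<bullet> \<Delta> om) \<in> BM M" by (intro borel_measurable_inner dm Dm Hm)
  show "(%om. drift \<xi> (Hn n) (%y. Y y om) x \<bullet> \<Delta> om) \<in> BM M" for n by (intro borel_measurable_inner dm Dm Hnm)
  show "integrable M (%om. ?C * norm (\<Delta> om))" using D by simp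
  show "AE om in M. norm (drift \<xi> (Hn n) (%y. Y y om) x \<bullet> \<Delta> om) <= ?C * norm (\<Delta> om)" for n
   using mp
  proof eventually_elim
   fix om assume m: "torus_mp (%y. Y y om)"
   have "norm (drift \<xi> (Hn n) (%y. Y y om) x) <= B * (LINT y|TL. norm (Hn n y))"
   by (rule drift_le[OF xi Hni m])
   also have "\<dots> <= ?C" using xi(3) Hni H Hn_le(1) by (intro mult_left_mono integral_mono integrable_norm) auto
   finally have "norm (drift \<xi> (Hn n) (%y. Y y om) x) * norm (\<Delta> om) <= ?C * norm (\<Delta> om)" by (rule mult_right_mono) simp
   then show "norm (drift \<xi> (Hn n) (%y. Y y om) x \<bullet> \<Delta> om) <= ?C * norm (\<Delta> om)"
   unfolding real_norm_def by (rule order_trans[OF Cauchy_Schwarz_ineq2])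
  qed
  show "AE om in M. (%n. drift \<xi> (Hn n) (%y. Y y om) x \<bullet> \<Delta> om) \<longlonglongrightarrow> drift \<xi> H (%y. Y y om) x \<bullet> \<Delta> om"
   using mp
  proof eventually_elim
   fix om assume m: "torus_mp (%y. Y y om)"
   note di = drift_integrable(1)[OF xi _ m]
   have "(%n. drift \<xi> (Hn n) (%y. Y y om) x) \<longlonglongrightarrow> drift \<xi> H (%y. Y y om) x"
   unfolding drift_def
   proof (rule integral_dominated_convergence)
   show "integrable TL (%y. norm (\<xi> y *\<^sub>R H (Y x om - Y y om)))" by (rule integrable_norm[OF di[OF H]])
   show "(%y. \<xi> y *\<^sub>R H (Y x om - Y y om)) \<in> BM TL"
   by (rule borel_measurable_integrable[OF di[OF H]])
   show "(%y. \<xi> y *\<^sub>R Hn n (Y x om - Y y om)) \<in> BM TL" for n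
   by (rule borel_measurable_integrable[OF di[OF Hni]])
   show "AE y in TL. (%n. \<xi> y *\<^sub>R Hn n (Y x om - Y y om)) \<longlonglongrightarrow> \<xi> y *\<^sub>R H (Y x om - Y y om)"
   by (rule AE_I2) (rule tendsto_scaleR[OF tendsto_const Hnlim])
   show "AE y in TL. norm (\<xi> y *\<^sub>R Hn n (Y x om - Y y om)) <= norm (\<xi> y *\<^sub>R H (Y x om - Y y om))" for n
   using Hn_le(1) by (intro AE_I2) (auto intro!: mult_left_mono)
   qed
   then show "(%n. drift \<xi> (Hn n) (%y. Y y om) x \<bullet> \<Delta> om) \<longlonglongrightarrow> drift \<xi> H (%y. Y y om) x \<bullet> \<Delta> om"
   by (rule tendsto_inner[OF _ tendsto_const])
  qed
 qed
 then show ?thesis unfolding zn by (simp add: LIMSEQ_const_iff)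
qed

section \<open>The difference of the two noise terms\<close>

lemma sqi_pair:
 fixes D :: "real => 'a => 'b::euclidean_space"
 assumes D: "(%(s, om). D s om) \<in> BM (borel \<Otimes>\<^sub>M M)"
 shows "sqi t D = (\<integral>\<^sup>+p. ennreal ((norm (D (fst p) (snd p)))\<^sup>2) \<partial>(tm t \<Otimes>\<^sub>M M))"
proof -
 interpret L: finite_measure "tm t" by (rule finite_time_measure)
 interpret LM: pair_sigma_finite "tm t" M ..
 have "(%p. D (fst p) (snd p)) \<in> BM (tm t \<Otimes>\<^sub>M M)"
  using measurable_time_measure_pair[OF D] by (simp add: split_beta')
 then have m: "(%p. ennreal ((norm (D (fst p) (snd p)))\<^sup>2)) \<in> BM (tm t \<Otimes>\<^sub>M M)" by measurable
 have "sqi t D = (\<integral>\<^sup>+om. (\<integral>\<^sup>+s. ennreal ((norm (D s om))\<^sup>2) \<partial>tm t) \<partial>M)"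
  unfolding sqi_def by (subst nn_integral_restrict_space) auto
 also have "\<dots> = (\<integral>\<^sup>+p. ennreal ((norm (D (fst p) (snd p)))\<^sup>2) \<partial>(tm t \<Otimes>\<^sub>M M))"
  using LM.nn_integral_snd[OF m] by simp
 finally show ?thesis .
qed

text \<open>Flows are known to be measurable for times in [0,T]. Composition with
  \<open>clamp\<close> makes them jointly measurable over the whole line without changing them on
  [0,T].\<close>

definition clamp :: "real => real" where "clamp s = max 0 (min T s)"

lemma clamp_in [simp]: "clamp s \<in> {0..T}" using T by (auto simp: clamp_def)
lemma clamp_id [simp]: "s \<in> {0..T} ==> clamp s = s" by (auto simp: clamp_def)
lemma measurable_clamp: "clamp \<in> borel \<rightarrow>\<^sub>M restrict_space borel {0..T}"
 unfolding clamp_def[abs_def] using T by (intro measurable_restrict_space2) auto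

context
 fixes \<sigma> :: "nat => torus2 => real^2" and X1 X2 :: "real => 'a => torus2" and S1 S2 :: "real => 'a => real^2" and L :: real
 assumes S1: "has_ito_series M T F W (%k r om. \<sigma> k (X1 r om)) S1"
  and S2: "has_ito_series M T F W (%k r om. \<sigma> k (X2 r om)) S2"
  and X1: "(%(s, om). X1 (clamp s) om) \<in> BM (borel \<Otimes>\<^sub>M M)"
  and X2: "(%(s, om). X2 (clamp s) om) \<in> BM (borel \<Otimes>\<^sub>M M)"
  and sig: "!!k. \<sigma> k \<in> BM borel"
  and L: "!!n x y. (\<Sum>k<n. (norm (\<sigma> k x - \<sigma> k y))\<^sup>2) <= L * (dist x y)\<^sup>2" "L >= 0"
begin

text \<open>The difference of the two noise series is again a limit of simple integrals. Its
  integrands are the differences of \<sigma> k along the two flows, and the Lipschitz estimate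
  summed over k bounds their total square uniformly in n.\<close>

lemma noise_difference_approx:
 obtains J D where "!!k. ito_approx k (D k) (J k)"
  "!!k. (%(t, om). D k t om) \<in> BM (borel \<Otimes>\<^sub>M M)"
  "!!k t. t \<in> {0..T} ==> J k t \<in> BM M"
  "!!t. t \<in> {0..T} ==> (%om. S1 t om - S2 t om) \<in> BM M"
  "!!t. t \<in> {0..T} ==> (%n. sqn (%om. (\<Sum>k<n. J k t om) - (S1 t om - S2 t om))) \<longlonglongrightarrow> 0"
  "!!t n. t \<in> {0..T} ==> (\<Sum>k<n. sqi t (D k)) <= (\<integral>\<^sup>+s. (\<integral>\<^sup>+om. ennreal (L * (dist (X1 s om) (X2 s om))\<^sup>2) \<partial>M) \<partial>tm t)"
proof -
 have "\<exists>I. (\<forall>k. has_ito_integral M T F (W k) (%r om. \<sigma> k (X1 r om)) (I k)) \<and>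
   (\<forall>t\<in>{0..T}. (%n. sqn (%om. (\<Sum>k<n. I k t om) - S1 t om)) \<longlonglongrightarrow> 0)"
  using S1 unfolding has_ito_series_def sqn_def by blast
 then obtain I1 where I1: "!!k. has_ito_integral M T F (W k) (%r om. \<sigma> k (X1 r om)) (I1 k)"
  "!!t. t \<in> {0..T} ==> (%n. sqn (%om. (\<Sum>k<n. I1 k t om) - S1 t om)) \<longlonglongrightarrow> 0" by blast
 have "\<exists>I. (\<forall>k. has_ito_integral M T F (W k) (%r om. \<sigma> k (X2 r om)) (I k)) \<and>
   (\<forall>t\<in>{0..T}. (%n. sqn (%om. (\<Sum>k<n. I k t om) - S2 t om)) \<longlonglongrightarrow> 0)"
  using S2 unfolding has_ito_series_def sqn_def by blast
 then obtain I2 where I2: "!!k. has_ito_integral M T F (W k) (%r om. \<sigma> k (X2 r om)) (I2 k)"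
  "!!t. t \<in> {0..T} ==> (%n. sqn (%om. (\<Sum>k<n. I2 k t om) - S2 t om)) \<longlonglongrightarrow> 0" by blast
 have mS: "S1 t \<in> BM M" "S2 t \<in> BM M" if "t \<in> {0..T}" for t
  using S1 S2 that by (auto simp: has_ito_series_def)
 have mI: "I1 k t \<in> BM M" "I2 k t \<in> BM M" if "t \<in> {0..T}" for k t
  using I1(1)[of k] I2(1)[of k] that by (auto simp: has_ito_integral_def)
 define D where "D k s om = \<sigma> k (X1 (clamp s) om) - \<sigma> k (X2 (clamp s) om)" for k s om
 define J where "J k t om = I1 k t om - I2 k t om" for k t om
 have c: "(%(s, om). \<sigma> k (X1 (clamp s) om)) \<in> BM (borel \<Otimes>\<^sub>M M)"
  "(%(s, om). \<sigma> k (X2 (clamp s) om)) \<in> BM (borel \<Otimes>\<^sub>M M)" for k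
  using measurable_compose[OF X1 sig, of k] measurable_compose[OF X2 sig, of k] by (simp_all add: split_beta')
 have a: "ito_approx k (D k) (J k)" for k
  unfolding D_def[abs_def] J_def[abs_def]
 proof (rule ito_approx_diff[OF _ _ c mI])
  show "ito_approx k (%t om. \<sigma> k (X1 (clamp t) om)) (I1 k)" "ito_approx k (%t om. \<sigma> k (X2 (clamp t) om)) (I2 k)"
   by (rule ito_approx_cong[OF _ has_ito_integral_approx[OF I1(1)]], simp,
   rule ito_approx_cong[OF _ has_ito_integral_approx[OF I2(1)]], simp)
 qed
 have mD: "(%(t, om). D k t om) \<in> BM (borel \<Otimes>\<^sub>M M)" for k
  using borel_measurable_diff[OF c] by (simp add: D_def split_beta')
 have lim: "(%n. sqn (%om. (\<Sum>k<n. J k t om) - (S1 t om - S2 t om))) \<longlonglongrightarrow> 0" if t: "t \<in> {0..T}" for t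
 proof (rule tendsto_sandwich[OF _ _ tendsto_const])
  show "(%n. 2 * (sqn (%om. (\<Sum>k<n. I1 k t om) - S1 t om) + sqn (%om. (\<Sum>k<n. I2 k t om) - S2 t om))) \<longlonglongrightarrow> 0"
   using ennreal_tendsto_cmult[OF _ tendsto_add[OF I1(2)[OF t] I2(2)[OF t]], of 2] by simp
  have "sqn (%om. (\<Sum>k<n. J k t om) - (S1 t om - S2 t om)) \<le>
   2 * (sqn (%om. (\<Sum>k<n. I1 k t om) - S1 t om) + sqn (%om. (\<Sum>k<n. I2 k t om) - S2 t om))" for n
  proof -
   have "sqn (%om. (\<Sum>k<n. J k t om) - (S1 t om - S2 t om)) =
   sqn (%om. ((\<Sum>k<n. I1 k t om) - S1 t om) + (S2 t om - (\<Sum>k<n. I2 k t om)))"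
   by (simp add: J_def sum_subtractf algebra_simps)
   also have "\<dots> <= 2 * (sqn (%om. (\<Sum>k<n. I1 k t om) - S1 t om) + sqn (%om. S2 t om - (\<Sum>k<n. I2 k t om)))"
   by (rule sqn_add) (intro borel_measurable_diff borel_measurable_sum mI mS t)+
   finally show ?thesis by (simp add: sqn_minus[of "S2 t"])
  qed
  then show "\<forall>\<^sub>F n in sequentially. sqn (%om. (\<Sum>k<n. J k t om) - (S1 t om - S2 t om)) \<le>
   2 * (sqn (%om. (\<Sum>k<n. I1 k t om) - S1 t om) + sqn (%om. (\<Sum>k<n. I2 k t om) - S2 t om))" by simp
 qed simp
 have bound: "(\<Sum>k<n. sqi t (D k)) <= (\<integral>\<^sup>+s. (\<integral>\<^sup>+om. ennreal (L * (dist (X1 s om) (X2 s om))\<^sup>2) \<partial>M) \<partial>tm t)"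
  if t: "t \<in> {0..T}" for t n
 proof -
  have Dm: "(%p. D k (fst p) (snd p)) \<in> BM (tm t \<Otimes>\<^sub>M M)" for k
   using measurable_time_measure_pair[OF mD] by (simp add: split_beta')
  have "(\<Sum>k<n. sqi t (D k)) = (\<integral>\<^sup>+p. (\<Sum>k<n. ennreal ((norm (D k (fst p) (snd p)))\<^sup>2)) \<partial>(tm t \<Otimes>\<^sub>M M))"
   unfolding sqi_pair[OF mD] by (rule nn_integral_sum[symmetric]) (use Dm in measurable)
  also have "\<dots> <= (\<integral>\<^sup>+p. ennreal (L * (dist (X1 (clamp (fst p)) (snd p)) (X2 (clamp (fst p)) (snd p)))\<^sup>2) \<partial>(tm t \<Otimes>\<^sub>M M))"
  proof (rule nn_integral_mono)
   fix p
   have "(\<Sum>k<n. ennreal ((norm (D k (fst p) (snd p)))\<^sup>2)) = ennreal (\<Sum>k<n. (norm (D k (fst p) (snd p)))\<^sup>2)"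
   by (rule sum_ennreal) simp
   also have "\<dots> <= ennreal (L * (dist (X1 (clamp (fst p)) (snd p)) (X2 (clamp (fst p)) (snd p)))\<^sup>2)"
   unfolding D_def by (rule ennreal_leI[OF L(1)])
   finally show "(\<Sum>k<n. ennreal ((norm (D k (fst p) (snd p)))\<^sup>2)) \<le>
   ennreal (L * (dist (X1 (clamp (fst p)) (snd p)) (X2 (clamp (fst p)) (snd p)))\<^sup>2)" .
  qed
  also have "\<dots> = (\<integral>\<^sup>+s. (\<integral>\<^sup>+om. ennreal (L * (dist (X1 (clamp s) om) (X2 (clamp s) om))\<^sup>2) \<partial>M) \<partial>tm t)"
  proof -
   have "(%p. dist (X1 (clamp (fst p)) (snd p)) (X2 (clamp (fst p)) (snd p))) \<in> BM (borel \<Otimes>\<^sub>M M)"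
   using borel_measurable_dist[OF X1 X2] by (simp add: split_beta')
   from measurable_time_measure_pair[OF this, of t]
   have "(%p. ennreal (L * (dist (X1 (clamp (fst p)) (snd p)) (X2 (clamp (fst p)) (snd p)))\<^sup>2)) \<in> BM (tm t \<Otimes>\<^sub>M M)"
   by measurable
   from nn_integral_fst[OF this] show ?thesis by simp
  qed
  also have "\<dots> = (\<integral>\<^sup>+s. (\<integral>\<^sup>+om. ennreal (L * (dist (X1 s om) (X2 s om))\<^sup>2) \<partial>M) \<partial>tm t)"
   using t by (intro nn_integral_cong) (auto simp: space_restrict_space)
  finally show ?thesis .
 qed
 show thesis by (rule that[OF a mD _ _ lim bound]) (auto simp: J_def[abs_def] intro!: borel_measurable_diff mI mS)
qed

lemma noise_difference:
 assumes t: "t \<in> {0..T}"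
 shows "sqn (%om. S1 t om - S2 t om) \<le>
   4 * (\<integral>\<^sup>+s. (\<integral>\<^sup>+om. ennreal (L * (dist (X1 s om) (X2 s om))\<^sup>2) \<partial>M) \<partial>tm t)"
  "(%om. S1 t om - S2 t om) \<in> BM M"
  "[|s \<in> {0..t}; g \<in> BM (F s); !!om. om \<in> space M ==> norm (g om) <= C|] ==>
   expectation (%om. g om \<bullet> ((S1 t om - S2 t om) - (S1 s om - S2 s om))) = 0"
proof -
 obtain J D where JD: "!!k. ito_approx k (D k) (J k)"
  "!!k. (%(t, om). D k t om) \<in> BM (borel \<Otimes>\<^sub>M M)"
  "!!k t. t \<in> {0..T} ==> J k t \<in> BM M"
  "!!t. t \<in> {0..T} ==> (%om. S1 t om - S2 t om) \<in> BM M"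
  "!!t. t \<in> {0..T} ==> (%n. sqn (%om. (\<Sum>k<n. J k t om) - (S1 t om - S2 t om))) \<longlonglongrightarrow> 0"
  "!!t n. t \<in> {0..T} ==> (\<Sum>k<n. sqi t (D k)) <= (\<integral>\<^sup>+s. (\<integral>\<^sup>+om. ennreal (L * (dist (X1 s om) (X2 s om))\<^sup>2) \<partial>M) \<partial>tm t)"
  by (rule noise_difference_approx) blast
 show "sqn (%om. S1 t om - S2 t om) \<le>
   4 * (\<integral>\<^sup>+s. (\<integral>\<^sup>+om. ennreal (L * (dist (X1 s om) (X2 s om))\<^sup>2) \<partial>M) \<partial>tm t)"
  by (rule ito_series_sqn_le(1)[where N = "%t om. S1 t om - S2 t om", OF JD(1-5) t JD(6)[OF t]])
 have fin: "sqn (%om. S1 u om - S2 u om) < \<infinity>" if "u \<in> {0..T}" for u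
  by (rule ito_series_sqn_le(2)[where N = "%t om. S1 t om - S2 t om", OF JD(1-5) that JD(6)[OF that]])
 show "(%om. S1 t om - S2 t om) \<in> BM M" by (rule JD(4)[OF t])
 show "expectation (%om. g om \<bullet> ((S1 t om - S2 t om) - (S1 s om - S2 s om))) = 0"
  if s: "s \<in> {0..t}" and g: "g \<in> BM (F s)" "!!om. om \<in> space M ==> norm (g om) <= C"
 proof -
  have st: "0 <= s" "s <= t" "t <= T" "s \<in> {0..T}" using s t by auto
  show ?thesis
   by (rule ito_series_martingale[where N = "%t om. S1 t om - S2 t om", OF JD(1-5) st(1-3) g fin[OF st(4)] fin[OF t]])
 qed
qed

lemma noise_difference_finite:
 assumes t: "t \<in> {0..T}"
 shows "sqn (%om. S1 t om - S2 t om) <= ennreal (4 * L * t)"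
proof -
 have "(\<integral>\<^sup>+s. (\<integral>\<^sup>+om. ennreal (L * (dist (X1 s om) (X2 s om))\<^sup>2) \<partial>M) \<partial>tm t) <= (\<integral>\<^sup>+s. (\<integral>\<^sup>+om. ennreal L \<partial>M) \<partial>tm t)"
 proof (intro nn_integral_mono ennreal_leI)
  fix s om
  have "(dist (X1 s om) (X2 s om))\<^sup>2 <= 1" by (rule power_le_one) (auto intro: dist_torus_le_1)
  then show "L * (dist (X1 s om) (X2 s om))\<^sup>2 <= L" using mult_left_mono[OF _ L(2)] by fastforce
 qed
 also have "\<dots> = ennreal (L * t)"
  using measure_time_measure[of t] t L(2) by (simp add: emeasure_space_1 ennreal_mult)
 finally have "4 * (\<integral>\<^sup>+s. (\<integral>\<^sup>+om. ennreal (L * (dist (X1 s om) (X2 s om))\<^sup>2) \<partial>M) \<partial>tm t) <= ennreal 4 * ennreal (L * t)"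
  using mult_left_mono[of _ "ennreal (L * t)" 4] by simp
 also have "\<dots> = ennreal (4 * L * t)" using t L(2) by (subst ennreal_mult[symmetric]) (auto simp: mult.assoc)
 finally show ?thesis by (rule order_trans[OF noise_difference(1)[OF t]])
qed

end

end

section \<open>Energy estimate for a pair of flows\<close>

lemma integrable_time_bounded:
 fixes f :: "real => real^2"
 assumes f: "f \<in> BM borel" and b: "!!r. norm (f r) <= C"
 shows "integrable (tm s) f"
proof -
 interpret L: finite_measure "tm s" by (rule finite_time_measure)
 show ?thesis by (rule L.integrable_const_bound[where B = C]) (auto intro: b measurable_time_measure[OF f])
qed

lemma continuous_time_integral:
 fixes f :: "real => real^2"
 assumes f: "f \<in> BM borel" and b: "!!r. norm (f r) <= C"
 shows "continuous_on {0..T} (%s. LINT r|tm s. f r)"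
proof -
 have si: "set_integrable lborel {0..s} f" for s
  using integrable_time_bounded[OF f b, of s] unfolding set_integrable_def
  by (subst (asm) integrable_restrict_space) auto
 have eq: "(LINT r|tm s. f r) = integral {0..s} f" for s
  using set_borel_integral_eq_integral(2)[OF si, of s] unfolding set_lebesgue_integral_def
  by (subst integral_restrict_space) auto
 have "continuous_on {0..T} (%s. integral {0..s} f)"
  by (rule indefinite_integral_continuous_1[OF set_borel_integral_eq_integral(1)[OF si]])
 then show ?thesis unfolding eq .
qed

context filtered_brownian
begin

lemma flow_clamped:
 assumes "stochastic_continuous_flow M T F \<Phi>"
 shows "(%(s, x, om). \<Phi> (clamp s) x om) \<in> BM (borel \<Otimes>\<^sub>M (borel \<Otimes>\<^sub>M M))"
proof -
 have \<Phi>: "(%(t, x, om). \<Phi> t x om) \<in> BM (restrict_space borel {0..T} \<Otimes>\<^sub>M (borel \<Otimes>\<^sub>M M))"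
  using assms by (simp add: stochastic_continuous_flow_def)
 have "(%p. (clamp (fst p), snd p)) \<in> borel \<Otimes>\<^sub>M (borel \<Otimes>\<^sub>M M) \<rightarrow>\<^sub>M restrict_space borel {0..T} \<Otimes>\<^sub>M (borel \<Otimes>\<^sub>M M)"
  by (intro measurable_Pair measurable_compose[OF measurable_fst measurable_clamp] measurable_snd)
 from measurable_compose[OF this \<Phi>] show ?thesis by (simp add: split_beta')
qed

lemma
 assumes "stochastic_continuous_flow M T F \<Phi>"
 shows flow_clamped_time: "(%(s, om). \<Phi> (clamp s) x om) \<in> BM (borel \<Otimes>\<^sub>M M)"
  and flow_clamped_space: "(%(om, y). \<Phi> (clamp s) y om) \<in> BM (M \<Otimes>\<^sub>M TL)"
  and flow_adapted: "s \<in> {0..T} ==> \<Phi> s x \<in> BM (F s)"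
proof -
 note m = flow_clamped[OF assms]
 have "(%p. (fst p, x, snd p)) \<in> borel \<Otimes>\<^sub>M M \<rightarrow>\<^sub>M borel \<Otimes>\<^sub>M (borel \<Otimes>\<^sub>M M)" by measurable
 from measurable_compose[OF this m] show "(%(s, om). \<Phi> (clamp s) x om) \<in> BM (borel \<Otimes>\<^sub>M M)"
  by (simp add: split_beta')
 have "(%p. (s, snd p, fst p)) \<in> M \<Otimes>\<^sub>M TL \<rightarrow>\<^sub>M borel \<Otimes>\<^sub>M (borel \<Otimes>\<^sub>M M)" by measurable
 from measurable_compose[OF this m] show "(%(om, y). \<Phi> (clamp s) y om) \<in> BM (M \<Otimes>\<^sub>M TL)"
  by (simp add: split_beta')
 assume s: "s \<in> {0..T}"
 have "progressive T F (%t. \<Phi> t x)" using assms by (simp add: stochastic_continuous_flow_def)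
 then have p: "(%(r, om). \<Phi> r x om) \<in> BM (restrict_space borel {0..s} \<Otimes>\<^sub>M F s)"
  using s unfolding progressive_def by blast
 have "s \<in> space (restrict_space borel {0..s})" using s by (simp add: space_restrict_space)
 from measurable_compose[OF measurable_Pair1'[OF this] p] show "\<Phi> s x \<in> BM (F s)" by simp
qed

lemma flow_torus_mp:
 assumes "measure_preserving_flow M T \<Phi>"
 shows "AE om in M. \<forall>s\<in>{0..T}. torus_mp (%x. \<Phi> s x om)"
 using assms unfolding measure_preserving_flow_def torus_mp_def .

lemma flow_drift_measurable:
 fixes H :: "torus2 => real^2"
 assumes fl: "stochastic_continuous_flow M T F \<Phi>" and xi: "\<xi> \<in> BM borel" and H: "H \<in> BM borel"
 shows "(%(s, x, om). drift \<xi> H (%y. \<Phi> (clamp s) y om) x) \<in> BM (borel \<Otimes>\<^sub>M (borel \<Otimes>\<^sub>M M))"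
proof -
 note m = flow_clamped[OF fl]
 have "(%q. (fst (fst q), snd q, snd (snd (fst q)))) \<in> (borel \<Otimes>\<^sub>M (borel \<Otimes>\<^sub>M M)) \<Otimes>\<^sub>M TL \<rightarrow>\<^sub>M borel \<Otimes>\<^sub>M (borel \<Otimes>\<^sub>M M)"
  by measurable
 from measurable_compose[OF this m]
 have Y: "(%(p, y). \<Phi> (clamp (fst p)) y (snd (snd p))) \<in> BM ((borel \<Otimes>\<^sub>M (borel \<Otimes>\<^sub>M M)) \<Otimes>\<^sub>M TL)"
  by (simp add: split_beta')
 have X: "(%p. \<Phi> (clamp (fst p)) (fst (snd p)) (snd (snd p))) \<in> BM (borel \<Otimes>\<^sub>M (borel \<Otimes>\<^sub>M M))"
  using m by (simp add: split_beta')
 show ?thesis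
  using borel_measurable_drift[OF xi H Y X] by (simp add: drift_def split_beta')
qed

lemma integrable_drift_inner:
 fixes H :: "torus2 => real^2" and Y :: "torus2 => 'a => torus2"
 assumes xi: "\<xi> \<in> BM borel" "AE y in TL. \<bar>\<xi> y\<bar> <= B" "B >= 0"
  and H: "integrable TL H"
  and YM: "!!y. Y y \<in> BM M"
  and Ym: "(%(om, y). Y y om) \<in> BM (M \<Otimes>\<^sub>M TL)"
  and mp: "AE om in M. torus_mp (%y. Y y om)"
  and D: "integrable M \<Delta>"
 shows "integrable M (%om. drift \<xi> H (%y. Y y om) x \<bullet> \<Delta> om)"
proof (rule Bochner_Integration.integrable_bound)
 let ?C = "B * (LINT y|TL. norm (H y))"
 have Hm: "H \<in> BM borel"
  using borel_measurable_integrable[OF H] by (simp cong: measurable_cong_sets)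
 show "integrable M (%om. ?C * norm (\<Delta> om))" using D by simp
 show "(%om. drift \<xi> H (%y. Y y om) x \<bullet> \<Delta> om) \<in> BM M"
  unfolding drift_def
  by (intro borel_measurable_inner borel_measurable_drift[OF xi(1) Hm Ym YM] borel_measurable_integrable[OF D])
 show "AE om in M. norm (drift \<xi> H (%y. Y y om) x \<bullet> \<Delta> om) <= norm (?C * norm (\<Delta> om))"
  using mp
 proof eventually_elim
  fix om assume m: "torus_mp (%y. Y y om)"
  have "norm (drift \<xi> H (%y. Y y om) x \<bullet> \<Delta> om) <= norm (drift \<xi> H (%y. Y y om) x) * norm (\<Delta> om)"
   unfolding real_norm_def by (rule Cauchy_Schwarz_ineq2)
  also have "\<dots> <= ?C * norm (\<Delta> om)" by (rule mult_right_mono[OF drift_le[OF xi H m]]) simp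
  also have "\<dots> <= norm (?C * norm (\<Delta> om))" by simp
  finally show "norm (drift \<xi> H (%y. Y y om) x \<bullet> \<Delta> om) <= norm (?C * norm (\<Delta> om))" .
 qed
qed

text \<open>All data are bundled in one existential because a and Z must be jointly measurable in
  time, space and chance before x is integrated out. The null set for the drifts is common to all x;
  the one for the lift depends on x.\<close>

lemma flow_pair_energy:
 fixes \<sigma> :: "nat => torus2 => real^2"
 assumes f1: "flow_solution M T F W \<sigma> \<xi> H1 \<Phi>1" and f2: "flow_solution M T F W \<sigma> \<xi> H2 \<Phi>2"
  and xi: "\<xi> \<in> BM borel" "AE y in TL. \<bar>\<xi> y\<bar> <= B" "B >= 0"
  and H1: "integrable TL H1" and H2: "integrable TL H2"
  and sig: "!!k. \<sigma> k \<in> BM borel"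
  and L: "!!n x y. (\<Sum>k<n. (norm (\<sigma> k x - \<sigma> k y))\<^sup>2) <= L * (dist x y)\<^sup>2" "L >= 0"
 shows "\<exists>a Z C R.
  (%(s, x, om). a s x om) \<in> BM (borel \<Otimes>\<^sub>M (borel \<Otimes>\<^sub>M M)) \<and>
  (%(s, x, om). Z s x om) \<in> BM (borel \<Otimes>\<^sub>M (borel \<Otimes>\<^sub>M M)) \<and>
  (\<forall>s x om. norm (a s x om) <= C) \<and> C >= 0 \<and> R >= 0 \<and>
  (\<forall>s\<in>{0..T}. \<forall>x. sqn (Z s x :: 'a => real^2) <= ennreal R) \<and>
  (AE om in M. \<forall>s\<in>{0..T}. torus_mp (%x. \<Phi>1 s x om) \<and> torus_mp (%x. \<Phi>2 s x om) \<and>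
   (\<forall>x. a s x om = drift \<xi> H1 (%x. \<Phi>1 s x om) x - drift \<xi> H2 (%x. \<Phi>2 s x om) x)) \<and>
  (\<forall>x. AE om in M. \<forall>s\<in>{0..T}. dist (\<Phi>1 s x om) (\<Phi>2 s x om) <= norm (Z s x om)) \<and>
  (\<forall>t\<in>{0..T}. \<forall>x. sqn (Z t x) \<le>
   2 * (\<integral>\<^sup>+s. (\<integral>\<^sup>+om. ennreal (norm (a s x om) * norm (Z s x om)) \<partial>M) \<partial>tm t) +
   4 * (\<integral>\<^sup>+s. (\<integral>\<^sup>+om. ennreal (L * (dist (\<Phi>1 s x om) (\<Phi>2 s x om))\<^sup>2) \<partial>M) \<partial>tm t))"
proof -
 have s1: "stochastic_continuous_flow M T F \<Phi>1" and s2: "stochastic_continuous_flow M T F \<Phi>2"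
  and p1: "measure_preserving_flow M T \<Phi>1" and p2: "measure_preserving_flow M T \<Phi>2"
  and e1: "solves_flow_equation M T F W \<sigma> \<xi> H1 \<Phi>1" and e2: "solves_flow_equation M T F W \<sigma> \<xi> H2 \<Phi>2"
  using f1 f2 by (auto simp: flow_solution_def)
 have Hm: "H1 \<in> BM borel" "H2 \<in> BM borel"
  using borel_measurable_integrable[OF H1] borel_measurable_integrable[OF H2] by (simp_all cong: measurable_cong_sets)
 define C1 where "C1 = B * (LINT y|TL. norm (H1 y))"
 define C2 where "C2 = B * (LINT y|TL. norm (H2 y))"
 define C where "C = C1 + C2"
 have C0: "C1 >= 0" "C2 >= 0" "C >= 0" using xi(3) by (auto simp: C1_def C2_def C_def)
 define d1 where "d1 s x om = drift \<xi> H1 (%y. \<Phi>1 (clamp s) y om) x" for s x om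
 define d2 where "d2 s x om = drift \<xi> H2 (%y. \<Phi>2 (clamp s) y om) x" for s x om
 \<comment> \<open>The cutoff acts at most on the null set where a flow fails to preserve the
   measure; it makes a bounded at every sample point.\<close>
 define a where "a s x om = (if norm (d1 s x om - d2 s x om) <= C then d1 s x om - d2 s x om else 0)" for s x om
 define Z where "Z s x om = path_lift (%u. \<Phi>1 (clamp u) x om - \<Phi>2 (clamp u) x om) s" for s x om
 have dm: "(%(s, x, om). d1 s x om) \<in> BM (borel \<Otimes>\<^sub>M (borel \<Otimes>\<^sub>M M))"
  "(%(s, x, om). d2 s x om) \<in> BM (borel \<Otimes>\<^sub>M (borel \<Otimes>\<^sub>M M))"
  unfolding d1_def d2_def by (rule flow_drift_measurable[OF s1 xi(1) Hm(1)], rule flow_drift_measurable[OF s2 xi(1) Hm(2)])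
 have am: "(%(s, x, om). a s x om) \<in> BM (borel \<Otimes>\<^sub>M (borel \<Otimes>\<^sub>M M))"
 proof -
  have dd: "(%p. d1 (fst p) (fst (snd p)) (snd (snd p)) - d2 (fst p) (fst (snd p)) (snd (snd p))) \<in> BM (borel \<Otimes>\<^sub>M (borel \<Otimes>\<^sub>M M))"
   using borel_measurable_diff[OF dm] by (simp add: split_beta')
  have g: "(%v :: real^2. if norm v <= C then v else 0) \<in> BM borel" by measurable
  from measurable_compose[OF dd g] show ?thesis by (simp add: a_def split_beta')
 qed
 have aC: "norm (a s x om) <= C" for s x om using C0 by (simp add: a_def)
 have Zm: "(%(s, x, om). Z s x om) \<in> BM (borel \<Otimes>\<^sub>M (borel \<Otimes>\<^sub>M M))"
 proof -
  have "(%(t, p). \<Phi>1 (clamp t) (fst p) (snd p) - \<Phi>2 (clamp t) (fst p) (snd p)) \<in> BM (borel \<Otimes>\<^sub>M (borel \<Otimes>\<^sub>M M))"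
   using borel_measurable_torus_diff[OF flow_clamped[OF s1] flow_clamped[OF s2]] by (simp add: split_beta')
  from borel_measurable_path_lift[OF this] show ?thesis by (simp add: Z_def split_beta')
 qed
 have good: "AE om in M. \<forall>s. torus_mp (%x. \<Phi>1 (clamp s) x om) \<and> torus_mp (%x. \<Phi>2 (clamp s) x om) \<and>
   (\<forall>x. norm (d1 s x om) <= C1 \<and> norm (d2 s x om) <= C2 \<and> a s x om = d1 s x om - d2 s x om)"
  using flow_torus_mp[OF p1] flow_torus_mp[OF p2]
 proof eventually_elim
  fix om assume m: "\<forall>s\<in>{0..T}. torus_mp (%x. \<Phi>1 s x om)" "\<forall>s\<in>{0..T}. torus_mp (%x. \<Phi>2 s x om)"
  have 1: "torus_mp (%x. \<Phi>1 (clamp s) x om)" and 2: "torus_mp (%x. \<Phi>2 (clamp s) x om)" for s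
   using m clamp_in by blast+
  have b: "norm (d1 s x om) <= C1" "norm (d2 s x om) <= C2" for s x
   unfolding d1_def d2_def C1_def C2_def by (rule drift_le[OF xi H1 1], rule drift_le[OF xi H2 2])
  have "norm (d1 s x om - d2 s x om) <= C" for s x
   using norm_triangle_ineq4[of "d1 s x om" "d2 s x om"] b[of s x] by (simp add: C_def)
  then show "\<forall>s. torus_mp (%x. \<Phi>1 (clamp s) x om) \<and> torus_mp (%x. \<Phi>2 (clamp s) x om) \<and>
   (\<forall>x. norm (d1 s x om) <= C1 \<and> norm (d2 s x om) <= C2 \<and> a s x om = d1 s x om - d2 s x om)"
   using 1 2 b by (simp add: a_def)
 qed
 have per_point: "(AE om in M. \<forall>s\<in>{0..T}. dist (\<Phi>1 s x om) (\<Phi>2 s x om) <= norm (Z s x om)) \<and>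
  (\<forall>t\<in>{0..T}. sqn (Z t x) \<le>
   2 * (\<integral>\<^sup>+s. (\<integral>\<^sup>+om. ennreal (norm (a s x om) * norm (Z s x om)) \<partial>M) \<partial>tm t) +
   4 * (\<integral>\<^sup>+s. (\<integral>\<^sup>+om. ennreal (L * (dist (\<Phi>1 s x om) (\<Phi>2 s x om))\<^sup>2) \<partial>M) \<partial>tm t)) \<and>
  (\<forall>t\<in>{0..T}. sqn (Z t x) <= ennreal (2 * ((C * t)\<^sup>2 + 4 * L * T)))" for x
 proof -
  obtain S1 where S1: "has_ito_series M T F W (%k r om. \<sigma> k (\<Phi>1 r x om)) S1"
   and q1: "AE om in M. \<forall>t\<in>{0..T}. \<Phi>1 t x om = x + proj ((LINT r:{0..t}|lborel. LINT y|TL. \<xi> y *\<^sub>R H1 (\<Phi>1 r x om - \<Phi>1 r y om)) + S1 t om)"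
   using e1 unfolding solves_flow_equation_def by blast
  obtain S2 where S2: "has_ito_series M T F W (%k r om. \<sigma> k (\<Phi>2 r x om)) S2"
   and q2: "AE om in M. \<forall>t\<in>{0..T}. \<Phi>2 t x om = x + proj ((LINT r:{0..t}|lborel. LINT y|TL. \<xi> y *\<^sub>R H2 (\<Phi>2 r x om - \<Phi>2 r y om)) + S2 t om)"
   using e2 unfolding solves_flow_equation_def by blast
  note nd = noise_difference[OF S1 S2 flow_clamped_time[OF s1] flow_clamped_time[OF s2] sig L]
  note ndf = noise_difference_finite[OF S1 S2 flow_clamped_time[OF s1] flow_clamped_time[OF s2] sig L]
  define N where "N s om = S1 s om - S2 s om" for s om
  have Nm: "N s \<in> BM M" if "s \<in> {0..T}" for s
   using nd(2)[OF that] by (simp add: N_def[abs_def])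
  have Nfin: "sqn (N s) <= ennreal (4 * L * s)" if "s \<in> {0..T}" for s
   using ndf[OF that] by (simp add: N_def[abs_def])
  have T0: "0 \<in> {0..T}" using T by simp
  \<comment> \<open>The isometry bound at time 0 is 0, so the lifted path starts at the
    origin.\<close>
  have N0: "AE om in M. N 0 om = 0"
  proof -
   have "(\<integral>\<^sup>+om. ennreal ((norm (N 0 om))\<^sup>2) \<partial>M) = 0" using Nfin[OF T0] by (simp add: sqn_def)
   moreover have "(%om. ennreal ((norm (N 0 om))\<^sup>2)) \<in> BM M" using Nm[OF T0] by measurable
   ultimately have "AE om in M. ennreal ((norm (N 0 om))\<^sup>2) = 0" using nn_integral_0_iff_AE by blast
   then show ?thesis by eventually_elim simp
  qed
  have cS: "AE om in M. continuous_on {0..T} (%t. S1 t om)" "AE om in M. continuous_on {0..T} (%t. S2 t om)"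
   using S1 S2 by (auto simp: has_ito_series_def)
  have sec: "(%s. h s x om) \<in> BM borel"
   if "(%(s, x, om). h s x om) \<in> BM (borel \<Otimes>\<^sub>M (borel \<Otimes>\<^sub>M M))" "om \<in> space M"
   for h :: "real => torus2 => 'a => real^2" and om
  proof -
   have "(%s. (s, x, om)) \<in> borel \<rightarrow>\<^sub>M borel \<Otimes>\<^sub>M (borel \<Otimes>\<^sub>M M)" using that(2) by measurable
   from measurable_compose[OF this that(1)] show ?thesis by simp
  qed
  have secx: "(%(s, om). h s x om) \<in> BM (borel \<Otimes>\<^sub>M M)"
   if "(%(s, x, om). h s x om) \<in> BM (borel \<Otimes>\<^sub>M (borel \<Otimes>\<^sub>M M))"
   for h :: "real => torus2 => 'a => real^2"
  proof -
   have "(%p. (fst p, x, snd p)) \<in> borel \<Otimes>\<^sub>M M \<rightarrow>\<^sub>M borel \<Otimes>\<^sub>M (borel \<Otimes>\<^sub>M M)" by measurable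
   from measurable_compose[OF this that] show ?thesis by (simp add: split_beta')
  qed
  \<comment> \<open>The integral of a plus N is a continuous lift of the difference of the flows
    that starts at 0, hence it is the path computed by \<open>path_lift\<close>.\<close>
  have lift: "AE om in M. \<forall>s\<in>{0..T}. Z s x om = (LINT r|tm s. a r x om) + N s om \<and>
   proj (Z s x om) = \<Phi>1 s x om - \<Phi>2 s x om"
   using good q1 q2 cS N0 AE_space
  proof eventually_elim
   fix om
   assume g: "\<forall>s. torus_mp (%x. \<Phi>1 (clamp s) x om) \<and> torus_mp (%x. \<Phi>2 (clamp s) x om) \<and>
   (\<forall>x. norm (d1 s x om) <= C1 \<and> norm (d2 s x om) <= C2 \<and> a s x om = d1 s x om - d2 s x om)"
   and q: "\<forall>t\<in>{0..T}. \<Phi>1 t x om = x + proj ((LINT r:{0..t}|lborel. LINT y|TL. \<xi> y *\<^sub>R H1 (\<Phi>1 r x om - \<Phi>1 r y om)) + S1 t om)"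
   "\<forall>t\<in>{0..T}. \<Phi>2 t x om = x + proj ((LINT r:{0..t}|lborel. LINT y|TL. \<xi> y *\<^sub>R H2 (\<Phi>2 r x om - \<Phi>2 r y om)) + S2 t om)"
   and c: "continuous_on {0..T} (%t. S1 t om)" "continuous_on {0..T} (%t. S2 t om)"
   and n0: "N 0 om = 0" and om: "om \<in> space M"
   define z where "z s = (LINT r|tm s. a r x om) + N s om" for s
   have zc: "continuous_on {0..T} z"
   unfolding z_def N_def by (intro continuous_on_add continuous_on_diff c continuous_time_integral[OF sec[OF am om] aC])
   have z0: "z 0 = 0"
   using norm_integral_time_measure_le[of "%r. a r x om" C 0, OF aC C0(3)] n0 by (simp add: z_def)
   have zp: "proj (z s) = \<Phi>1 s x om - \<Phi>2 s x om" if s: "s \<in> {0..T}" for s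
   proof -
   have i: "integrable (tm s) (%r. d1 r x om)" "integrable (tm s) (%r. d2 r x om)"
   by (rule integrable_time_bounded[OF sec[OF dm(1) om], of C1], use g in blast,
   rule integrable_time_bounded[OF sec[OF dm(2) om], of C2], use g in blast)
   have D1: "(LINT r:{0..s}|lborel. LINT y|TL. \<xi> y *\<^sub>R H1 (\<Phi>1 r x om - \<Phi>1 r y om)) = (LINT r|tm s. d1 r x om)"
   unfolding set_lebesgue_integral_def integral_restrict_space[of "{0..s}" lborel, simplified]
   using s by (intro Bochner_Integration.integral_cong refl) (auto simp: indicator_def d1_def drift_def)
   have D2: "(LINT r:{0..s}|lborel. LINT y|TL. \<xi> y *\<^sub>R H2 (\<Phi>2 r x om - \<Phi>2 r y om)) = (LINT r|tm s. d2 r x om)"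
   unfolding set_lebesgue_integral_def integral_restrict_space[of "{0..s}" lborel, simplified]
   using s by (intro Bochner_Integration.integral_cong refl) (auto simp: indicator_def d2_def drift_def)
   have "(LINT r|tm s. a r x om) = (LINT r|tm s. d1 r x om - d2 r x om)"
   using g by (intro Bochner_Integration.integral_cong refl) blast
   also have "\<dots> = (LINT r|tm s. d1 r x om) - (LINT r|tm s. d2 r x om)"
   by (rule Bochner_Integration.integral_diff[OF i])
   finally have "z s = ((LINT r|tm s. d1 r x om) + S1 s om) - ((LINT r|tm s. d2 r x om) + S2 s om)"
   by (simp add: z_def N_def)
   moreover have "\<Phi>1 s x om = x + proj ((LINT r|tm s. d1 r x om) + S1 s om)" using q(1) s D1 by simp
   moreover have "\<Phi>2 s x om = x + proj ((LINT r|tm s. d2 r x om) + S2 s om)" using q(2) s D2 by simp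
   ultimately show ?thesis by (simp add: proj_diff)
   qed
   have "Z s x om = z s" if s: "s \<in> {0..T}" for s
   unfolding Z_def by (rule path_lift_eq[OF zc z0 _ s]) (simp add: zp)
   then show "\<forall>s\<in>{0..T}. Z s x om = (LINT r|tm s. a r x om) + N s om \<and> proj (Z s x om) = \<Phi>1 s x om - \<Phi>2 s x om"
   using zp by (auto simp: z_def)
  qed
  have d: "AE om in M. \<forall>s\<in>{0..T}. dist (\<Phi>1 s x om) (\<Phi>2 s x om) <= norm (Z s x om)"
   using lift by eventually_elim (auto simp: dist_torus2_def intro!: torus_norm_le)
  \<comment> \<open>Agrees with the noise difference almost surely, but is defined from Z and a so
    that the decomposition holds at every sample point.\<close>
  define N' where "N' s om = Z s x om - (LINT r|tm s. a r x om)" for s om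
  have NN: "AE om in M. \<forall>s\<in>{0..T}. N' s om = N s om"
   using lift by eventually_elim (simp add: N'_def)
  have sq: "sqn (N' s) = sqn (N s)" if s: "s \<in> {0..T}" for s
   unfolding sqn_def
  proof (rule nn_integral_cong_AE)
   show "AE om in M. ennreal ((norm (N' s om))\<^sup>2) = ennreal ((norm (N s om))\<^sup>2)"
   using NN by eventually_elim (use s in simp)
  qed
  have Ni: "integrable M (N s)" if s: "s \<in> {0..T}" for s
  proof (rule integrableI_bounded[OF Nm[OF s]])
   show "(\<integral>\<^sup>+om. ennreal (norm (N s om)) \<partial>M) < \<infinity>"
   using L1_le_sqn_one[OF Nm[OF s] Nfin[OF s]] L(2) s by (auto intro: le_less_trans)
  qed
  have mart: "expectation (%om. a s x om \<bullet> (N' t om - N' s om)) = 0" if t: "t \<in> {0..T}" and s: "s \<in> {0..t}" for s t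
  proof -
   have sT: "s \<in> {0..T}" using s t by auto
   have \<Delta>: "integrable M (%om. N t om - N s om)" by (intro Bochner_Integration.integrable_diff Ni t sT)
   have zero: "expectation (%om. g om \<bullet> (N t om - N s om)) = 0"
   if "g \<in> BM (F s)" "!!om. om \<in> space M ==> norm (g om) <= Cg" for g Cg
   using nd(3)[OF t s that] by (simp add: N_def)
   have m1: "AE om in M. torus_mp (%y. \<Phi>1 s y om)" using flow_torus_mp[OF p1] by eventually_elim (use sT in blast)
   have m2: "AE om in M. torus_mp (%y. \<Phi>2 s y om)" using flow_torus_mp[OF p2] by eventually_elim (use sT in blast)
   have Y1: "(%(om, y). \<Phi>1 s y om) \<in> BM (M \<Otimes>\<^sub>M TL)" using flow_clamped_space[OF s1, of s] sT by simp
   have Y2: "(%(om, y). \<Phi>2 s y om) \<in> BM (M \<Otimes>\<^sub>M TL)" using flow_clamped_space[OF s2, of s] sT by simp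
   have ad: "\<Phi>1 s y \<in> BM (F s)" "\<Phi>2 s y \<in> BM (F s)" for y
   by (rule flow_adapted[OF s1 sT], rule flow_adapted[OF s2 sT])
   have adM: "\<Phi>1 s y \<in> BM M" "\<Phi>2 s y \<in> BM M" for y
   by (rule measurable_F_M[OF ad(1) sT], rule measurable_F_M[OF ad(2) sT])
   have z1: "expectation (%om. drift \<xi> H1 (%y. \<Phi>1 s y om) x \<bullet> (N t om - N s om)) = 0"
   by (rule drift_martingale[OF xi H1 sT ad(1) Y1 m1 \<Delta> zero])
   have z2: "expectation (%om. drift \<xi> H2 (%y. \<Phi>2 s y om) x \<bullet> (N t om - N s om)) = 0"
   by (rule drift_martingale[OF xi H2 sT ad(2) Y2 m2 \<Delta> zero])
   have i1: "integrable M (%om. drift \<xi> H1 (%y. \<Phi>1 s y om) x \<bullet> (N t om - N s om))"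
   by (rule integrable_drift_inner[OF xi H1 adM(1) Y1 m1 \<Delta>])
   have i2: "integrable M (%om. drift \<xi> H2 (%y. \<Phi>2 s y om) x \<bullet> (N t om - N s om))"
   by (rule integrable_drift_inner[OF xi H2 adM(2) Y2 m2 \<Delta>])
   let ?f = "%om. drift \<xi> H1 (%y. \<Phi>1 s y om) x \<bullet> (N t om - N s om) - drift \<xi> H2 (%y. \<Phi>2 s y om) x \<bullet> (N t om - N s om)"
   have aN: "(%om. a s x om \<bullet> (N' t om - N' s om)) \<in> BM M"
   proof -
   have am': "a r x \<in> BM M" "Z r x \<in> BM M" for r
   using measurable_compose[OF measurable_Pair1' secx[OF am], of r] measurable_compose[OF measurable_Pair1' secx[OF Zm], of r] by auto
   have id: "(%x. x) \<in> tm u \<rightarrow>\<^sub>M borel" for u by (rule measurable_time_measure) simp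
   have IA: "(%om. LINT r|tm u. a r x om) \<in> BM M" for u
   proof -
   interpret L: finite_measure "tm u" by (rule finite_time_measure)
   have "(%q. (snd q, fst q)) \<in> M \<Otimes>\<^sub>M tm u \<rightarrow>\<^sub>M borel \<Otimes>\<^sub>M M"
   by (intro measurable_Pair measurable_compose[OF measurable_snd id] measurable_fst)
   from measurable_compose[OF this secx[OF am]]
   have "(%(om, r). a r x om) \<in> BM (M \<Otimes>\<^sub>M tm u)" by (simp add: split_beta')
   from L.borel_measurable_lebesgue_integral[OF this] show ?thesis .
   qed
   show ?thesis unfolding N'_def by (intro borel_measurable_inner borel_measurable_diff am' IA)
   qed
   have "expectation (%om. a s x om \<bullet> (N' t om - N' s om)) = expectation ?f"
   proof (rule integral_cong_AE)
   show "AE om in M. a s x om \<bullet> (N' t om - N' s om) = ?f om"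
   using good NN
   proof eventually_elim
   fix om assume g: "\<forall>s. torus_mp (%x. \<Phi>1 (clamp s) x om) \<and> torus_mp (%x. \<Phi>2 (clamp s) x om) \<and>
   (\<forall>x. norm (d1 s x om) <= C1 \<and> norm (d2 s x om) <= C2 \<and> a s x om = d1 s x om - d2 s x om)"
   and n: "\<forall>s\<in>{0..T}. N' s om = N s om"
   have "a s x om = drift \<xi> H1 (%y. \<Phi>1 s y om) x - drift \<xi> H2 (%y. \<Phi>2 s y om) x"
   using g clamp_id[OF sT] unfolding d1_def d2_def by simp
   then show "a s x om \<bullet> (N' t om - N' s om) = ?f om" using n t sT by (simp add: inner_diff_left)
   qed
   qed (rule aN, rule borel_measurable_integrable[OF Bochner_Integration.integrable_diff[OF i1 i2]])
   also have "\<dots> = 0" using i1 i2 z1 z2 by simp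
   finally show ?thesis .
  qed
  have en: "sqn (Z t x) <= 2 * (\<integral>\<^sup>+s. (\<integral>\<^sup>+om. ennreal (norm (a s x om) * norm (Z s x om)) \<partial>M) \<partial>tm t) + sqn (N' t)"
   "sqn (Z t x) <= ennreal (2 * ((C * t)\<^sup>2 + 4 * L * T))" if t: "t \<in> {0..T}" for t
  proof -
   have t0: "t >= 0" using t by simp
   have R: "sqn (N' s) <= ennreal (4 * L * T)" if s: "s \<in> {0..t}" for s
   proof -
   have sT: "s \<in> {0..T}" using s t by auto
   have "4 * L * s <= 4 * L * T" using sT L(2) by (intro mult_left_mono) auto
   then show ?thesis unfolding sq[OF sT] by (rule order_trans[OF Nfin[OF sT] ennreal_leI])
   qed
   have R0: "4 * L * T >= 0" using L(2) T by simp
   note E = energy_inequality[of "%s om. a s x om" C "%s om. Z s x om" t N', OF secx[OF am] aC C0(3) secx[OF Zm] t0 N'_def R R0 mart[OF t]]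
   from E show "sqn (Z t x) <= 2 * (\<integral>\<^sup>+s. (\<integral>\<^sup>+om. ennreal (norm (a s x om) * norm (Z s x om)) \<partial>M) \<partial>tm t) + sqn (N' t)"
   "sqn (Z t x) <= ennreal (2 * ((C * t)\<^sup>2 + 4 * L * T))" by simp_all
  qed
  have "sqn (Z t x) <= 2 * (\<integral>\<^sup>+s. (\<integral>\<^sup>+om. ennreal (norm (a s x om) * norm (Z s x om)) \<partial>M) \<partial>tm t) +
   4 * (\<integral>\<^sup>+s. (\<integral>\<^sup>+om. ennreal (L * (dist (\<Phi>1 s x om) (\<Phi>2 s x om))\<^sup>2) \<partial>M) \<partial>tm t)" if t: "t \<in> {0..T}" for t
   by (rule order_trans[OF en(1)[OF t]], rule add_left_mono, unfold sq[OF t], unfold N_def, rule nd(1)[OF t])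
  then show ?thesis using d en(2) by blast
 qed
 have R: "sqn (Z t x) <= ennreal (2 * ((C * T)\<^sup>2 + 4 * L * T))" if t: "t \<in> {0..T}" for t x
 proof -
  have "(C * t)\<^sup>2 <= (C * T)\<^sup>2" using t C0 by (intro power_mono mult_left_mono) auto
  then have "ennreal (2 * ((C * t)\<^sup>2 + 4 * L * T)) <= ennreal (2 * ((C * T)\<^sup>2 + 4 * L * T))" by (intro ennreal_leI) simp
  then show ?thesis using per_point[of x] t by (meson order_trans)
 qed
 have good': "AE om in M. \<forall>s\<in>{0..T}. torus_mp (%x. \<Phi>1 s x om) \<and> torus_mp (%x. \<Phi>2 s x om) \<and>
   (\<forall>x. a s x om = drift \<xi> H1 (%x. \<Phi>1 s x om) x - drift \<xi> H2 (%x. \<Phi>2 s x om) x)"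
  using good
 proof eventually_elim
  fix om assume g: "\<forall>s. torus_mp (%x. \<Phi>1 (clamp s) x om) \<and> torus_mp (%x. \<Phi>2 (clamp s) x om) \<and>
   (\<forall>x. norm (d1 s x om) <= C1 \<and> norm (d2 s x om) <= C2 \<and> a s x om = d1 s x om - d2 s x om)"
  show "\<forall>s\<in>{0..T}. torus_mp (%x. \<Phi>1 s x om) \<and> torus_mp (%x. \<Phi>2 s x om) \<and>
   (\<forall>x. a s x om = drift \<xi> H1 (%x. \<Phi>1 s x om) x - drift \<xi> H2 (%x. \<Phi>2 s x om) x)"
  proof
   fix s assume "s \<in> {0..T}"
   then show "torus_mp (%x. \<Phi>1 s x om) \<and> torus_mp (%x. \<Phi>2 s x om) \<and>
   (\<forall>x. a s x om = drift \<xi> H1 (%x. \<Phi>1 s x om) x - drift \<xi> H2 (%x. \<Phi>2 s x om) x)"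
   using g[rule_format, of s] unfolding d1_def d2_def by simp
  qed
 qed
 have R0: "2 * ((C * T)\<^sup>2 + 4 * L * T) >= 0" using L(2) T by simp
 show ?thesis
  by (rule exI[of _ a], rule exI[of _ Z], rule exI[of _ C], rule exI[of _ "2 * ((C * T)\<^sup>2 + 4 * L * T)"])
   (intro conjI am Zm allI aC C0(3) R0 ballI R good' per_point[THEN conjunct1]
   per_point[THEN conjunct2, THEN conjunct1, rule_format])
qed

end

section \<open>The Osgood argument for the mean square distance\<close>

lemma powr_le_linear:
 fixes d \<psi> \<alpha> :: real
 assumes "d >= 0" "\<psi> > 0" "0 < \<alpha>" "\<alpha> <= 1"
 shows "d powr (2 * \<alpha>) <= \<psi> powr \<alpha> * (d\<^sup>2 / \<psi> + 1)"
proof -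
 \<comment> \<open>u powr \<alpha> <= u + 1 linearises the power around the level \<psi> of the
   squared distance.\<close>
 define u where "u = d\<^sup>2 / \<psi>"
 have u: "u >= 0" using assms by (simp add: u_def)
 have "u powr \<alpha> <= u + 1"
 proof (cases "u <= 1")
  case True
  then have "u powr \<alpha> <= 1 powr \<alpha>" using u assms by (intro powr_mono2) auto
  then show ?thesis using u by simp
 next
  case False
  then have "u powr \<alpha> <= u powr 1" using assms by (intro powr_mono) auto
  then show ?thesis using False by simp
 qed
 then have "\<psi> powr \<alpha> * u powr \<alpha> <= \<psi> powr \<alpha> * (u + 1)" by (rule mult_left_mono) simp
 moreover have "\<psi> powr \<alpha> * u powr \<alpha> = (\<psi> * u) powr \<alpha>" using u assms by (simp add: powr_mult)
 moreover have "\<psi> * u = d\<^sup>2" using assms by (simp add: u_def)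
 moreover have "(d\<^sup>2) powr \<alpha> = d powr (2 * \<alpha>)" using assms(1) by (cases "d = 0") (simp_all add: powr_powr[symmetric])
 ultimately show ?thesis unfolding u_def by simp
qed

lemma young_weighted: "2 * (a * b) <= a\<^sup>2 / l + l * b\<^sup>2" if "l > 0" for a b l :: real
proof -
 have "0 <= (a - l * b)\<^sup>2 / l" using that by simp
 also have "(a - l * b)\<^sup>2 / l = a\<^sup>2 / l + l * b\<^sup>2 - 2 * (a * b)"
  using that by (simp add: power2_eq_square field_simps)
 finally show ?thesis by simp
qed

lemma le_add_square_div: "d <= \<eta> + d\<^sup>2 / \<eta>" if "\<eta> > 0" "d >= 0" for d \<eta> :: real
proof -
 have "2 * (d * 1) <= d\<^sup>2 / \<eta> + \<eta> * 1\<^sup>2" by (rule young_weighted[OF that(1)])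
 then show ?thesis using that by simp
qed

context filtered_brownian
begin

text \<open>In \<beta> the first summand comes from the drift, 1 from the weight in Young's
  inequality, and 4 L from the noise. The condition \<Lambda> exp(-\<beta> T) >= 2 keeps the
  exponents \<alpha> at or above 1/2 up to time T.\<close>

lemma flow_distance_bound:
 fixes \<sigma> :: "nat => torus2 => real^2" and B L Ck \<Lambda> \<beta> :: real and g :: "real => torus2 => ennreal"
 assumes f1: "flow_solution M T F W \<sigma> \<xi> H1 \<Phi>1" and f2: "flow_solution M T F W \<sigma> \<xi> H2 \<Phi>2"
  and xi: "\<xi> \<in> BM borel" "AE y in TL. \<bar>\<xi> y\<bar> <= B" "B >= 0"
  and H1: "integrable TL H1" and H2: "integrable TL H2"
  and sig: "!!k. \<sigma> k \<in> BM borel"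
  and L: "!!n x y. (\<Sum>k<n. (norm (\<sigma> k x - \<sigma> k y))\<^sup>2) <= L * (dist x y)\<^sup>2" "L >= 0"
  and good: "AE x in TL. good x" and Ck: "Ck >= 0"
  and g: "!!\<alpha>. 1/2 <= \<alpha> ==> \<alpha> < 1 ==> g \<alpha> \<in> BM borel"
   "!!\<alpha>. 1/2 <= \<alpha> ==> \<alpha> < 1 ==> (\<integral>\<^sup>+x. g \<alpha> x \<partial>TL) <= ennreal (Ck / (1 - \<alpha>))"
   "!!\<alpha> x y. 1/2 <= \<alpha> ==> \<alpha> < 1 ==> good x ==> good y ==>
   ennreal (norm (H2 x - H2 y)) <= ennreal (dist x y powr \<alpha>) * (g \<alpha> x + g \<alpha> y)"
  and \<beta>: "\<beta> = 2 * B\<^sup>2 * (1 + 32 * exp 1 * Ck\<^sup>2) + 1 + 4 * L"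
  and \<Lambda>: "\<Lambda> * exp (- (\<beta> * T)) >= 2"
  and err: "(\<integral>\<^sup>+y. ennreal (norm (H1 y - H2 y)) \<partial>TL)\<^sup>2 <= ennreal (exp (- \<Lambda>))"
  and t: "t \<in> {0..T}"
 shows "(\<integral>\<^sup>+x. (\<integral>\<^sup>+om. ennreal (dist (\<Phi>1 t x om) (\<Phi>2 t x om)) \<partial>M) \<partial>TL) \<le>
  ennreal (2 * sqrt (exp (- (\<Lambda> * exp (- (\<beta> * T))))))"
proof -
 let ?Q = "TL \<Otimes>\<^sub>M M"
 interpret TM: pair_prob_space TL M ..
 obtain a Z C R where
  am: "(%(s, x, om). a s x om) \<in> BM (borel \<Otimes>\<^sub>M (borel \<Otimes>\<^sub>M M))"
  and Zm: "(%(s, x, om). Z s x om :: real^2) \<in> BM (borel \<Otimes>\<^sub>M (borel \<Otimes>\<^sub>M M))"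
  and aC: "\<forall>s x om. norm (a s x om) <= C" "C >= 0" and R0: "R >= 0"
  and R: "\<forall>s\<in>{0..T}. \<forall>x. sqn (Z s x) <= ennreal R"
  and ad: "AE om in M. \<forall>s\<in>{0..T}. torus_mp (%x. \<Phi>1 s x om) \<and> torus_mp (%x. \<Phi>2 s x om) \<and>
   (\<forall>x. a s x om = drift \<xi> H1 (%x. \<Phi>1 s x om) x - drift \<xi> H2 (%x. \<Phi>2 s x om) x)"
  and dZ: "\<forall>x. AE om in M. \<forall>s\<in>{0..T}. dist (\<Phi>1 s x om) (\<Phi>2 s x om) <= norm (Z s x om)"
  and en: "\<forall>t\<in>{0..T}. \<forall>x. sqn (Z t x) \<le>
   2 * (\<integral>\<^sup>+s. (\<integral>\<^sup>+om. ennreal (norm (a s x om) * norm (Z s x om)) \<partial>M) \<partial>tm t) +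
   4 * (\<integral>\<^sup>+s. (\<integral>\<^sup>+om. ennreal (L * (dist (\<Phi>1 s x om) (\<Phi>2 s x om))\<^sup>2) \<partial>M) \<partial>tm t)"
  using flow_pair_energy[OF f1 f2 xi H1 H2 sig L] by (elim exE conjE)
 have sQ: "sets (borel \<Otimes>\<^sub>M ?Q) = sets (borel \<Otimes>\<^sub>M (borel \<Otimes>\<^sub>M M))" "sets ?Q = sets (borel \<Otimes>\<^sub>M M)"
  by (intro sets_pair_measure_cong) simp_all
 have aQ: "(%p. a (fst p) (fst (snd p)) (snd (snd p))) \<in> BM (borel \<Otimes>\<^sub>M ?Q)"
  and ZQ: "(%p. Z (fst p) (fst (snd p)) (snd (snd p))) \<in> BM (borel \<Otimes>\<^sub>M ?Q)"
  using am Zm unfolding split_beta' by (simp_all cong: measurable_cong_sets add: measurable_cong_sets[OF sQ(1) refl])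
 have a1: "(%q. a s (fst q) (snd q)) \<in> BM ?Q" and Z1: "(%q. Z s (fst q) (snd q)) \<in> BM ?Q" for s
  using measurable_compose[OF measurable_Pair1' aQ, of s] measurable_compose[OF measurable_Pair1' ZQ, of s] by simp_all
 define d where "d s x om = dist (\<Phi>1 s x om) (\<Phi>2 s x om)" for s x om
 have d0: "d s x om >= 0" for s x om by (simp add: d_def)
 have dm: "(%q. d s (fst q) (snd q)) \<in> BM ?Q" if s: "s \<in> {0..T}" for s
 proof -
  have s12: "stochastic_continuous_flow M T F \<Phi>1" "stochastic_continuous_flow M T F \<Phi>2"
   using f1 f2 by (auto simp: flow_solution_def)
  have "(%p. dist (\<Phi>1 (clamp (fst p)) (fst (snd p)) (snd (snd p))) (\<Phi>2 (clamp (fst p)) (fst (snd p)) (snd (snd p)))) \<in> BM (borel \<Otimes>\<^sub>M (borel \<Otimes>\<^sub>M M))"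
   using borel_measurable_dist[OF flow_clamped[OF s12(1)] flow_clamped[OF s12(2)]] by (simp add: split_beta')
  from measurable_compose[OF measurable_Pair1' this, of s]
  have "(%q. d s (fst q) (snd q)) \<in> BM (borel \<Otimes>\<^sub>M M)" using clamp_id[OF s] by (simp add: d_def)
  then show ?thesis by (simp add: measurable_cong_sets[OF sQ(2) refl])
 qed
 define w where "w s = (\<integral>\<^sup>+q. ennreal ((norm (Z s (fst q) (snd q)))\<^sup>2) \<partial>?Q)" for s
 define h where "h s = (\<integral>\<^sup>+q. ennreal (2 * (norm (a s (fst q) (snd q)) * norm (Z s (fst q) (snd q))) + 4 * L * (norm (Z s (fst q) (snd q)))\<^sup>2) \<partial>?Q)" for s
 define \<kappa> where "\<kappa> s = \<Lambda> * exp (- (\<beta> * s))" for s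
 define \<psi> where "\<psi> s = exp (- \<kappa> s)" for s
 have fQ: "(\<integral>\<^sup>+q. f (fst q) (snd q) \<partial>?Q) = (\<integral>\<^sup>+x. (\<integral>\<^sup>+om. f x om \<partial>M) \<partial>TL)"
  if "(%q. f (fst q) (snd q)) \<in> BM ?Q" for f :: "torus2 => 'a => ennreal"
  using nn_integral_fst[OF that] by simp
 have w_sqn: "w s = (\<integral>\<^sup>+x. sqn (Z s x) \<partial>TL)" for s
  unfolding w_def sqn_def by (rule fQ) (use Z1[of s] in measurable)
 have wR: "w s <= ennreal R" if "s \<in> {0..T}" for s
 proof -
  have "w s <= (\<integral>\<^sup>+x. ennreal R \<partial>TL)" unfolding w_sqn using R that by (intro nn_integral_mono) auto
  then show ?thesis using torus.emeasure_space_1 by simp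
 qed
 have beta0: "\<beta> >= 1" using xi(3) L(2) by (simp add: \<beta>)
 have Lam0: "\<Lambda> >= 0"
 proof (rule ccontr)
  assume "\<not> \<Lambda> >= 0"
  then have "\<Lambda> * exp (- (\<beta> * T)) <= 0" by (intro mult_nonpos_nonneg) auto
  then show False using \<Lambda> by simp
 qed
 have lam: "\<kappa> s >= 2" if "s \<in> {0..T}" for s
 proof -
  have "exp (- (\<beta> * T)) <= exp (- (\<beta> * s))" using that beta0 by simp
  then have "\<Lambda> * exp (- (\<beta> * T)) <= \<kappa> s" unfolding \<kappa>_def using Lam0 by (rule mult_left_mono)
  then show ?thesis using \<Lambda> by simp
 qed
 have d2w: "(\<integral>\<^sup>+q. ennreal ((d s (fst q) (snd q))\<^sup>2) \<partial>?Q) <= w s" if s: "s \<in> {0..T}" for s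
 proof -
  have "(\<integral>\<^sup>+q. ennreal ((d s (fst q) (snd q))\<^sup>2) \<partial>?Q) = (\<integral>\<^sup>+x. (\<integral>\<^sup>+om. ennreal ((d s x om)\<^sup>2) \<partial>M) \<partial>TL)"
   by (rule fQ) (use dm[OF s] in measurable)
  also have "\<dots> <= (\<integral>\<^sup>+x. sqn (Z s x) \<partial>TL)"
   unfolding sqn_def
  proof (rule nn_integral_mono, rule nn_integral_mono_AE)
   fix x
   show "AE om in M. ennreal ((d s x om)\<^sup>2) <= ennreal ((norm (Z s x om))\<^sup>2)"
   using dZ[rule_format, of x] by eventually_elim (use s d0 in \<open>auto simp: d_def intro!: ennreal_leI power_mono\<close>)
  qed
  finally show ?thesis unfolding w_sqn .
 qed
 \<comment> \<open>16 (Ck \<kappa>)^2 from the drift estimate times 2 e \<psi> from the interpolated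
   distance gives 32 e Ck^2. The squared kernel error is at most \<psi> s, because \<psi> increases
   from exp (-\<Lambda>).\<close>
 have aL2: "(\<integral>\<^sup>+q. ennreal ((norm (a s (fst q) (snd q)))\<^sup>2) \<partial>?Q) \<le>
   ennreal (2 * B\<^sup>2 * (1 + 32 * exp 1 * Ck\<^sup>2) * (\<kappa> s)\<^sup>2 * \<psi> s)"
  if s: "s \<in> {0..T}" and ws: "w s <= ennreal (\<psi> s)" for s
 proof -
  \<comment> \<open>With this choice 1/(1 - \<alpha>) = \<kappa> s and \<psi> s powr \<alpha> = e
    \<psi> s: lowering the exponent costs only the fixed factor e.\<close>
  define \<alpha> where "\<alpha> = 1 - 1 / \<kappa> s"
  note l2 = lam[OF s]
  have \<alpha>: "1/2 <= \<alpha>" "\<alpha> < 1" "0 < \<alpha>" "\<alpha> <= 1" using l2 by (auto simp: \<alpha>_def field_simps)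
  have G: "Ck / (1 - \<alpha>) = Ck * \<kappa> s" using l2 by (simp add: \<alpha>_def)
  have \<psi>0: "\<psi> s > 0" by (simp add: \<psi>_def)
  have \<psi>\<alpha>: "\<psi> s powr \<alpha> = exp 1 * \<psi> s"
  proof -
   have "\<psi> s powr \<alpha> = exp (\<alpha> * - \<kappa> s)" using \<psi>0 by (simp add: powr_def \<psi>_def)
   also have "\<alpha> * - \<kappa> s = 1 + - \<kappa> s" using l2 by (simp add: \<alpha>_def field_simps)
   finally show ?thesis by (simp only: exp_add \<psi>_def)
  qed
  have gi: "(\<integral>\<^sup>+x. g \<alpha> x \<partial>TL) <= ennreal (Ck * \<kappa> s)" using g(2)[OF \<alpha>(1,2)] G by simp
  have G0: "Ck * \<kappa> s >= 0" using Ck l2 by simp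
  have am2: "(%q. ennreal ((norm (a s (fst q) (snd q)))\<^sup>2)) \<in> BM ?Q" using a1[of s] by measurable
  have dm2: "(%q. ennreal (d s (fst q) (snd q) powr (2 * \<alpha>))) \<in> BM ?Q" using dm[OF s] by measurable
  have d\<alpha>: "(\<integral>\<^sup>+q. ennreal (d s (fst q) (snd q) powr (2 * \<alpha>)) \<partial>?Q) <= ennreal (2 * exp 1 * \<psi> s)"
  proof -
   have "(\<integral>\<^sup>+q. ennreal (d s (fst q) (snd q) powr (2 * \<alpha>)) \<partial>?Q) \<le>
   (\<integral>\<^sup>+q. ennreal (exp 1) * ennreal ((d s (fst q) (snd q))\<^sup>2) + ennreal (exp 1 * \<psi> s) \<partial>?Q)"
   proof (rule nn_integral_mono)
   fix q
   have "d s (fst q) (snd q) powr (2 * \<alpha>) <= \<psi> s powr \<alpha> * ((d s (fst q) (snd q))\<^sup>2 / \<psi> s + 1)"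
   by (rule powr_le_linear[OF d0 \<psi>0 \<alpha>(3,4)])
   also have "\<dots> = exp 1 * (d s (fst q) (snd q))\<^sup>2 + exp 1 * \<psi> s" unfolding \<psi>\<alpha> using \<psi>0 by (simp add: field_simps)
   finally have "ennreal (d s (fst q) (snd q) powr (2 * \<alpha>)) <= ennreal (exp 1 * (d s (fst q) (snd q))\<^sup>2 + exp 1 * \<psi> s)"
   by (rule ennreal_leI)
   also have "\<dots> = ennreal (exp 1) * ennreal ((d s (fst q) (snd q))\<^sup>2) + ennreal (exp 1 * \<psi> s)"
   using \<psi>0 by (subst ennreal_plus) (auto simp: ennreal_mult)
   finally show "ennreal (d s (fst q) (snd q) powr (2 * \<alpha>)) <= ennreal (exp 1) * ennreal ((d s (fst q) (snd q))\<^sup>2) + ennreal (exp 1 * \<psi> s)" .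
   qed
   also have "\<dots> = ennreal (exp 1) * (\<integral>\<^sup>+q. ennreal ((d s (fst q) (snd q))\<^sup>2) \<partial>?Q) + ennreal (exp 1 * \<psi> s)"
   proof -
   have 1: "(%q. ennreal ((d s (fst q) (snd q))\<^sup>2)) \<in> BM ?Q" using dm[OF s] by measurable
   have "(\<integral>\<^sup>+q. ennreal (exp 1) * ennreal ((d s (fst q) (snd q))\<^sup>2) + ennreal (exp 1 * \<psi> s) \<partial>?Q) =
   (\<integral>\<^sup>+q. ennreal (exp 1) * ennreal ((d s (fst q) (snd q))\<^sup>2) \<partial>?Q) + (\<integral>\<^sup>+q. ennreal (exp 1 * \<psi> s) \<partial>?Q)"
   by (rule nn_integral_add) (use 1 in measurable)
   then show ?thesis using nn_integral_cmult[OF 1, of "ennreal (exp 1)"] TM.emeasure_space_1 by simp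
   qed
   also have "\<dots> <= ennreal (exp 1) * ennreal (\<psi> s) + ennreal (exp 1 * \<psi> s)"
   by (intro add_right_mono mult_left_mono order_trans[OF d2w[OF s] ws]) simp
   also have "\<dots> = ennreal (2 * exp 1 * \<psi> s)"
   using \<psi>0 by (simp add: ennreal_mult[symmetric] ennreal_plus[symmetric] del: ennreal_plus)
   finally show ?thesis .
  qed
  have err\<psi>: "(\<integral>\<^sup>+y. ennreal (norm (H1 y - H2 y)) \<partial>TL)\<^sup>2 <= ennreal (\<psi> s)"
  proof -
   have "\<kappa> s <= \<Lambda> * 1" unfolding \<kappa>_def using Lam0 s beta0 by (intro mult_left_mono) auto
   then have "exp (- \<Lambda>) <= \<psi> s" by (simp add: \<psi>_def)
   then show ?thesis by (rule order_trans[OF err ennreal_leI])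
  qed
  let ?E = "ennreal (2 * B\<^sup>2)"
  have "(\<integral>\<^sup>+q. ennreal ((norm (a s (fst q) (snd q)))\<^sup>2) \<partial>?Q) = (\<integral>\<^sup>+om. (\<integral>\<^sup>+x. ennreal ((norm (a s x om))\<^sup>2) \<partial>TL) \<partial>M)"
   using TM.nn_integral_snd[OF am2] by simp
  also have "\<dots> <= (\<integral>\<^sup>+om. ?E * (ennreal (\<psi> s) + ennreal (16 * (Ck * \<kappa> s)\<^sup>2) * (\<integral>\<^sup>+x. ennreal (d s x om powr (2 * \<alpha>)) \<partial>TL)) \<partial>M)"
  proof (rule nn_integral_mono_AE)
   show "AE om in M. (\<integral>\<^sup>+x. ennreal ((norm (a s x om))\<^sup>2) \<partial>TL) \<le>
   ?E * (ennreal (\<psi> s) + ennreal (16 * (Ck * \<kappa> s)\<^sup>2) * (\<integral>\<^sup>+x. ennreal (d s x om powr (2 * \<alpha>)) \<partial>TL))"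
   using ad
   proof eventually_elim
   fix om assume A: "\<forall>s\<in>{0..T}. torus_mp (%x. \<Phi>1 s x om) \<and> torus_mp (%x. \<Phi>2 s x om) \<and>
   (\<forall>x. a s x om = drift \<xi> H1 (%x. \<Phi>1 s x om) x - drift \<xi> H2 (%x. \<Phi>2 s x om) x)"
   have m: "torus_mp (%x. \<Phi>1 s x om)" "torus_mp (%x. \<Phi>2 s x om)"
   and ae: "a s x om = drift \<xi> H1 (%x. \<Phi>1 s x om) x - drift \<xi> H2 (%x. \<Phi>2 s x om) x" for x
   using A s by blast+
   note D = drift_difference_L2[OF xi H1 H2 m \<alpha>(3,4) good g(1)[OF \<alpha>(1,2)] gi G0 g(3)[OF \<alpha>(1,2)]]
   have "(\<integral>\<^sup>+x. ennreal ((norm (a s x om))\<^sup>2) \<partial>TL) \<le>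
   ?E * ((\<integral>\<^sup>+y. ennreal (norm (H1 y - H2 y)) \<partial>TL)\<^sup>2 + ennreal (16 * (Ck * \<kappa> s)\<^sup>2) * (\<integral>\<^sup>+x. ennreal (d s x om powr (2 * \<alpha>)) \<partial>TL))"
   unfolding ae d_def by (rule D)
   also have "\<dots> <= ?E * (ennreal (\<psi> s) + ennreal (16 * (Ck * \<kappa> s)\<^sup>2) * (\<integral>\<^sup>+x. ennreal (d s x om powr (2 * \<alpha>)) \<partial>TL))"
   by (rule mult_left_mono[OF add_right_mono[OF err\<psi>]]) simp
   finally show "(\<integral>\<^sup>+x. ennreal ((norm (a s x om))\<^sup>2) \<partial>TL) \<le>
   ?E * (ennreal (\<psi> s) + ennreal (16 * (Ck * \<kappa> s)\<^sup>2) * (\<integral>\<^sup>+x. ennreal (d s x om powr (2 * \<alpha>)) \<partial>TL))" .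
   qed
  qed
  also have "\<dots> = ?E * (ennreal (\<psi> s) + ennreal (16 * (Ck * \<kappa> s)\<^sup>2) * (\<integral>\<^sup>+om. (\<integral>\<^sup>+x. ennreal (d s x om powr (2 * \<alpha>)) \<partial>TL) \<partial>M))"
  proof -
   have 1: "(%om. \<integral>\<^sup>+x. ennreal (d s x om powr (2 * \<alpha>)) \<partial>TL) \<in> BM M"
   proof -
   have "(%(om, x). ennreal (d s x om powr (2 * \<alpha>))) \<in> BM (M \<Otimes>\<^sub>M TL)"
   using measurable_pair_swap[OF dm2] by (simp add: split_beta')
   from torus.borel_measurable_nn_integral[OF this] show ?thesis .
   qed
   then have 2: "(%om. ennreal (16 * (Ck * \<kappa> s)\<^sup>2) * (\<integral>\<^sup>+x. ennreal (d s x om powr (2 * \<alpha>)) \<partial>TL)) \<in> BM M" by measurable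
   show ?thesis
   by (subst nn_integral_cmult, use 2 in measurable, subst nn_integral_add, simp, rule 2,
   subst nn_integral_cmult, rule 1, simp add: emeasure_space_1)
  qed
  also have "(\<integral>\<^sup>+om. (\<integral>\<^sup>+x. ennreal (d s x om powr (2 * \<alpha>)) \<partial>TL) \<partial>M) = (\<integral>\<^sup>+q. ennreal (d s (fst q) (snd q) powr (2 * \<alpha>)) \<partial>?Q)"
   using TM.nn_integral_snd[OF dm2] by simp
  finally have 1: "(\<integral>\<^sup>+q. ennreal ((norm (a s (fst q) (snd q)))\<^sup>2) \<partial>?Q) \<le>
   ?E * (ennreal (\<psi> s) + ennreal (16 * (Ck * \<kappa> s)\<^sup>2) * (\<integral>\<^sup>+q. ennreal (d s (fst q) (snd q) powr (2 * \<alpha>)) \<partial>?Q))" .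
  have "?E * (ennreal (\<psi> s) + ennreal (16 * (Ck * \<kappa> s)\<^sup>2) * (\<integral>\<^sup>+q. ennreal (d s (fst q) (snd q) powr (2 * \<alpha>)) \<partial>?Q)) \<le>
   ?E * (ennreal (\<psi> s) + ennreal (16 * (Ck * \<kappa> s)\<^sup>2) * ennreal (2 * exp 1 * \<psi> s))"
   by (rule mult_left_mono[OF add_left_mono[OF mult_left_mono[OF d\<alpha>]]]) simp_all
  also have "\<dots> = ennreal (2 * B\<^sup>2 * (\<psi> s + 16 * (Ck * \<kappa> s)\<^sup>2 * (2 * exp 1 * \<psi> s)))"
  proof -
   have "ennreal (16 * (Ck * \<kappa> s)\<^sup>2) * ennreal (2 * exp 1 * \<psi> s) = ennreal (16 * (Ck * \<kappa> s)\<^sup>2 * (2 * exp 1 * \<psi> s))"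
   using \<psi>0 by (intro ennreal_mult[symmetric]) auto
   moreover have "ennreal (\<psi> s) + ennreal (16 * (Ck * \<kappa> s)\<^sup>2 * (2 * exp 1 * \<psi> s)) = ennreal (\<psi> s + 16 * (Ck * \<kappa> s)\<^sup>2 * (2 * exp 1 * \<psi> s))"
   using \<psi>0 by (intro ennreal_plus[symmetric]) auto
   moreover have "?E * ennreal (\<psi> s + 16 * (Ck * \<kappa> s)\<^sup>2 * (2 * exp 1 * \<psi> s)) = ennreal (2 * B\<^sup>2 * (\<psi> s + 16 * (Ck * \<kappa> s)\<^sup>2 * (2 * exp 1 * \<psi> s)))"
   using \<psi>0 by (intro ennreal_mult[symmetric]) auto
   ultimately show ?thesis by (simp only:)
  qed
  also have "\<dots> <= ennreal (2 * B\<^sup>2 * (1 + 32 * exp 1 * Ck\<^sup>2) * (\<kappa> s)\<^sup>2 * \<psi> s)"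
  proof (rule ennreal_leI)
   have "1 <= (\<kappa> s)\<^sup>2" using l2 by (simp add: power2_eq_square) (use mult_mono[of 1 "\<kappa> s" 1 "\<kappa> s"] in simp)
   then have "\<psi> s <= (\<kappa> s)\<^sup>2 * \<psi> s" using \<psi>0 by simp
   then have "\<psi> s + 16 * (Ck * \<kappa> s)\<^sup>2 * (2 * exp 1 * \<psi> s) <= (1 + 32 * exp 1 * Ck\<^sup>2) * (\<kappa> s)\<^sup>2 * \<psi> s"
   by (simp add: algebra_simps power_mult_distrib)
   then have "2 * B\<^sup>2 * (\<psi> s + 16 * (Ck * \<kappa> s)\<^sup>2 * (2 * exp 1 * \<psi> s)) <= 2 * B\<^sup>2 * ((1 + 32 * exp 1 * Ck\<^sup>2) * (\<kappa> s)\<^sup>2 * \<psi> s)"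
   by (rule mult_left_mono) simp
   then show "2 * B\<^sup>2 * (\<psi> s + 16 * (Ck * \<kappa> s)\<^sup>2 * (2 * exp 1 * \<psi> s)) <= 2 * B\<^sup>2 * (1 + 32 * exp 1 * Ck\<^sup>2) * (\<kappa> s)\<^sup>2 * \<psi> s"
   by (simp only: mult.assoc)
  qed
  finally show ?thesis by (rule order_trans[OF 1])
 qed
 \<comment> \<open>Young's inequality with a free weight: l = 1 yields the crude bound
   \<open>hb\<close>, while l = \<kappa> s makes the drift contribution and the weighted
   \<open>w\<close> both of order \<kappa> s * \<psi> s.\<close>
 have split: "h s <= ennreal (1 / l) * (\<integral>\<^sup>+q. ennreal ((norm (a s (fst q) (snd q)))\<^sup>2) \<partial>?Q) + ennreal (l + 4 * L) * w s"
  if l: "l > 0" for s l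
 proof -
  have m: "(%q. ennreal ((norm (a s (fst q) (snd q)))\<^sup>2)) \<in> BM ?Q" "(%q. ennreal ((norm (Z s (fst q) (snd q)))\<^sup>2)) \<in> BM ?Q"
   using a1[of s] Z1[of s] by measurable
  have "h s <= (\<integral>\<^sup>+q. ennreal (1 / l) * ennreal ((norm (a s (fst q) (snd q)))\<^sup>2) + ennreal (l + 4 * L) * ennreal ((norm (Z s (fst q) (snd q)))\<^sup>2) \<partial>?Q)"
   unfolding h_def
  proof (rule nn_integral_mono)
   fix q
   let ?u = "norm (a s (fst q) (snd q))" and ?v = "norm (Z s (fst q) (snd q))"
   have "2 * (?u * ?v) + 4 * L * ?v\<^sup>2 <= 1 / l * ?u\<^sup>2 + (l + 4 * L) * ?v\<^sup>2"
   using young_weighted[OF l, of ?u ?v] by (simp add: algebra_simps)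
   then have "ennreal (2 * (?u * ?v) + 4 * L * ?v\<^sup>2) <= ennreal (1 / l * ?u\<^sup>2 + (l + 4 * L) * ?v\<^sup>2)" by (rule ennreal_leI)
   also have "\<dots> = ennreal (1 / l * ?u\<^sup>2) + ennreal ((l + 4 * L) * ?v\<^sup>2)" using l L(2) by (intro ennreal_plus) auto
   also have "ennreal (1 / l * ?u\<^sup>2) = ennreal (1 / l) * ennreal (?u\<^sup>2)" using l by (intro ennreal_mult) auto
   also have "ennreal ((l + 4 * L) * ?v\<^sup>2) = ennreal (l + 4 * L) * ennreal (?v\<^sup>2)" using l L(2) by (intro ennreal_mult) auto
   finally show "ennreal (2 * (?u * ?v) + 4 * L * ?v\<^sup>2) <= ennreal (1 / l) * ennreal (?u\<^sup>2) + ennreal (l + 4 * L) * ennreal (?v\<^sup>2)" .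
  qed
  also have "\<dots> = ennreal (1 / l) * (\<integral>\<^sup>+q. ennreal ((norm (a s (fst q) (snd q)))\<^sup>2) \<partial>?Q) + ennreal (l + 4 * L) * w s"
   unfolding w_def nn_integral_cmult[OF m(1), symmetric] nn_integral_cmult[OF m(2), symmetric]
   by (rule nn_integral_add) (use m in measurable)
  finally show ?thesis .
 qed
 have hQ: "(%p. ennreal (2 * (norm (a (fst p) (fst (snd p)) (snd (snd p))) * norm (Z (fst p) (fst (snd p)) (snd (snd p)))) + 4 * L * (norm (Z (fst p) (fst (snd p)) (snd (snd p))))\<^sup>2)) \<in> BM (borel \<Otimes>\<^sub>M ?Q)"
  using aQ ZQ by measurable
 have hm: "h \<in> BM borel"
 proof -
  have "(%(s, q). ennreal (2 * (norm (a s (fst q) (snd q)) * norm (Z s (fst q) (snd q))) + 4 * L * (norm (Z s (fst q) (snd q)))\<^sup>2)) \<in> BM (borel \<Otimes>\<^sub>M ?Q)"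
   using hQ by (simp add: split_beta')
  from TM.borel_measurable_nn_integral[OF this] show ?thesis unfolding h_def[abs_def] .
 qed
 have hb: "h s <= ennreal (C\<^sup>2 + (1 + 4 * L) * R)" if s: "s \<in> {0..T}" for s
 proof -
  have "(\<integral>\<^sup>+q. ennreal ((norm (a s (fst q) (snd q)))\<^sup>2) \<partial>?Q) <= (\<integral>\<^sup>+q. ennreal (C\<^sup>2) \<partial>?Q)"
   using aC by (intro nn_integral_mono ennreal_leI power_mono) auto
  then have aC2: "(\<integral>\<^sup>+q. ennreal ((norm (a s (fst q) (snd q)))\<^sup>2) \<partial>?Q) <= ennreal (C\<^sup>2)" using TM.emeasure_space_1 by simp
  have "h s <= ennreal (1 / 1) * (\<integral>\<^sup>+q. ennreal ((norm (a s (fst q) (snd q)))\<^sup>2) \<partial>?Q) + ennreal (1 + 4 * L) * w s" by (rule split) simp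
  also have "\<dots> <= ennreal (1 / 1) * ennreal (C\<^sup>2) + ennreal (1 + 4 * L) * ennreal R"
   by (intro add_mono mult_left_mono aC2 wR s zero_le)
  also have "\<dots> = ennreal (C\<^sup>2) + ennreal ((1 + 4 * L) * R)" using L(2) R0 by (subst ennreal_mult[of "1 + 4 * L" R]) auto
  also have "\<dots> = ennreal (C\<^sup>2 + (1 + 4 * L) * R)" using L(2) R0 by (intro ennreal_plus[symmetric]) auto
  finally show ?thesis .
 qed
 \<comment> \<open>The energy inequality is integrated over x and the order exchanged. In the noise
   term the distance is replaced by the larger norm of Z, almost surely for each x.\<close>
 have wh: "w u <= (\<integral>\<^sup>+s\<in>{0..u}. h s \<partial>lborel)" if u: "u \<in> {0..T}" for u
 proof -
  interpret Lu: finite_measure "tm u" by (rule finite_time_measure)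
  interpret TL: pair_sigma_finite TL "tm u" ..
  let ?f = "%s x om. ennreal (2 * (norm (a s x om) * norm (Z s x om)) + 4 * L * (norm (Z s x om))\<^sup>2)"
  have id: "(%x. x) \<in> tm u \<rightarrow>\<^sub>M borel" by (rule measurable_time_measure) simp
  have mid: "(%q. (snd (fst q), (fst (fst q), snd q))) \<in> (TL \<Otimes>\<^sub>M tm u) \<Otimes>\<^sub>M M \<rightarrow>\<^sub>M borel \<Otimes>\<^sub>M ?Q"
   by (intro measurable_Pair measurable_compose[OF measurable_fst] measurable_compose[OF measurable_snd id] measurable_fst measurable_snd)
  have f3: "(%(r, om). ?f (snd r) (fst r) om) \<in> BM ((TL \<Otimes>\<^sub>M tm u) \<Otimes>\<^sub>M M)"
   using measurable_compose[OF mid hQ] by (simp add: split_beta')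
  have fx: "(%r. \<integral>\<^sup>+om. ?f (snd r) (fst r) om \<partial>M) \<in> BM (TL \<Otimes>\<^sub>M tm u)"
   by (rule borel_measurable_nn_integral[OF f3])
  have aZm: "(%om. a s x om) \<in> BM M" "(%om. Z s x om) \<in> BM M" for s x
   using measurable_compose[OF measurable_Pair1' a1, of x s] measurable_compose[OF measurable_Pair1' Z1, of x s] by simp_all
  have m1: "(%s. \<integral>\<^sup>+om. ennreal (norm (a s x om) * norm (Z s x om)) \<partial>M) \<in> BM (tm u)"
   and m2: "(%s. \<integral>\<^sup>+om. ennreal (L * (norm (Z s x om))\<^sup>2) \<partial>M) \<in> BM (tm u)" for x
  proof -
   have "(%q. (fst q, (x, snd q))) \<in> tm u \<Otimes>\<^sub>M M \<rightarrow>\<^sub>M borel \<Otimes>\<^sub>M ?Q"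
   by (intro measurable_Pair measurable_compose[OF measurable_fst id] measurable_snd measurable_const) simp
   from measurable_compose[OF this aQ] measurable_compose[OF this ZQ]
   have az: "(%q. a (fst q) x (snd q)) \<in> BM (tm u \<Otimes>\<^sub>M M)" "(%q. Z (fst q) x (snd q)) \<in> BM (tm u \<Otimes>\<^sub>M M)"
   by simp_all
   have "(%(s, om). ennreal (norm (a s x om) * norm (Z s x om))) \<in> BM (tm u \<Otimes>\<^sub>M M)"
   "(%(s, om). ennreal (L * (norm (Z s x om))\<^sup>2)) \<in> BM (tm u \<Otimes>\<^sub>M M)"
   unfolding split_beta' using az by measurable
   then show "(%s. \<integral>\<^sup>+om. ennreal (norm (a s x om) * norm (Z s x om)) \<partial>M) \<in> BM (tm u)"
   "(%s. \<integral>\<^sup>+om. ennreal (L * (norm (Z s x om))\<^sup>2) \<partial>M) \<in> BM (tm u)"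
   using borel_measurable_nn_integral by blast+
  qed
  have sp: "(\<integral>\<^sup>+om. ?f s x om \<partial>M) = 2 * (\<integral>\<^sup>+om. ennreal (norm (a s x om) * norm (Z s x om)) \<partial>M) + 4 * (\<integral>\<^sup>+om. ennreal (L * (norm (Z s x om))\<^sup>2) \<partial>M)" for s x
  proof -
   have m: "(%om. ennreal (norm (a s x om) * norm (Z s x om))) \<in> BM M" "(%om. ennreal (L * (norm (Z s x om))\<^sup>2)) \<in> BM M"
   using aZm[of s x] by measurable
   have "(\<integral>\<^sup>+om. ?f s x om \<partial>M) = (\<integral>\<^sup>+om. 2 * ennreal (norm (a s x om) * norm (Z s x om)) + 4 * ennreal (L * (norm (Z s x om))\<^sup>2) \<partial>M)"
   proof (rule nn_integral_cong)
   fix om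
   have "?f s x om = ennreal (2 * (norm (a s x om) * norm (Z s x om))) + ennreal (4 * (L * (norm (Z s x om))\<^sup>2))"
   using L(2) by (subst ennreal_plus[symmetric]) (auto simp: mult.assoc)
   then show "?f s x om = 2 * ennreal (norm (a s x om) * norm (Z s x om)) + 4 * ennreal (L * (norm (Z s x om))\<^sup>2)"
   using L(2) ennreal_mult[of 2 "norm (a s x om) * norm (Z s x om)"] ennreal_mult[of 4 "L * (norm (Z s x om))\<^sup>2"] by simp
   qed
   also have "\<dots> = (\<integral>\<^sup>+om. 2 * ennreal (norm (a s x om) * norm (Z s x om)) \<partial>M) + (\<integral>\<^sup>+om. 4 * ennreal (L * (norm (Z s x om))\<^sup>2) \<partial>M)"
   by (rule nn_integral_add) (use m in measurable)
   also have "\<dots> = 2 * (\<integral>\<^sup>+om. ennreal (norm (a s x om) * norm (Z s x om)) \<partial>M) + 4 * (\<integral>\<^sup>+om. ennreal (L * (norm (Z s x om))\<^sup>2) \<partial>M)"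
   unfolding nn_integral_cmult[OF m(1)] nn_integral_cmult[OF m(2)] ..
   finally show ?thesis .
  qed
  have "w u <= (\<integral>\<^sup>+x. (\<integral>\<^sup>+s. (\<integral>\<^sup>+om. ?f s x om \<partial>M) \<partial>tm u) \<partial>TL)"
   unfolding w_sqn
  proof (rule nn_integral_mono)
   fix x
   let ?I = "\<integral>\<^sup>+s. (\<integral>\<^sup>+om. ennreal (norm (a s x om) * norm (Z s x om)) \<partial>M) \<partial>tm u"
   have dd: "(\<integral>\<^sup>+s. (\<integral>\<^sup>+om. ennreal (L * (dist (\<Phi>1 s x om) (\<Phi>2 s x om))\<^sup>2) \<partial>M) \<partial>tm u)
   <= (\<integral>\<^sup>+s. (\<integral>\<^sup>+om. ennreal (L * (norm (Z s x om))\<^sup>2) \<partial>M) \<partial>tm u)"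
   proof (rule nn_integral_mono, rule nn_integral_mono_AE)
   fix s assume "s \<in> space (tm u)"
   then have s: "s \<in> {0..T}" using u by (auto simp: space_restrict_space)
   show "AE om in M. ennreal (L * (dist (\<Phi>1 s x om) (\<Phi>2 s x om))\<^sup>2) <= ennreal (L * (norm (Z s x om))\<^sup>2)"
   using dZ[rule_format, of x]
   proof eventually_elim
   fix om assume "\<forall>s\<in>{0..T}. dist (\<Phi>1 s x om) (\<Phi>2 s x om) <= norm (Z s x om)"
   then have "dist (\<Phi>1 s x om) (\<Phi>2 s x om) <= norm (Z s x om)" using s by blast
   then show "ennreal (L * (dist (\<Phi>1 s x om) (\<Phi>2 s x om))\<^sup>2) <= ennreal (L * (norm (Z s x om))\<^sup>2)"
   using L(2) by (intro ennreal_leI mult_left_mono power_mono) auto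
   qed
   qed
   have "sqn (Z u x) <= 2 * ?I + 4 * (\<integral>\<^sup>+s. (\<integral>\<^sup>+om. ennreal (L * (norm (Z s x om))\<^sup>2) \<partial>M) \<partial>tm u)"
   by (rule order_trans[OF en[rule_format, OF u] add_left_mono[OF mult_left_mono[OF dd]]]) simp
   also have "\<dots> = (\<integral>\<^sup>+s. 2 * (\<integral>\<^sup>+om. ennreal (norm (a s x om) * norm (Z s x om)) \<partial>M) + 4 * (\<integral>\<^sup>+om. ennreal (L * (norm (Z s x om))\<^sup>2) \<partial>M) \<partial>tm u)"
   unfolding nn_integral_cmult[OF m1, symmetric] nn_integral_cmult[OF m2, symmetric]
   by (rule nn_integral_add[symmetric]) (use m1[of x] m2[of x] in measurable)
   also have "\<dots> = (\<integral>\<^sup>+s. (\<integral>\<^sup>+om. ?f s x om \<partial>M) \<partial>tm u)" unfolding sp ..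
   finally show "sqn (Z u x) <= (\<integral>\<^sup>+s. (\<integral>\<^sup>+om. ?f s x om \<partial>M) \<partial>tm u)" .
  qed
  also have "\<dots> = (\<integral>\<^sup>+s. (\<integral>\<^sup>+x. (\<integral>\<^sup>+om. ?f s x om \<partial>M) \<partial>TL) \<partial>tm u)"
   using TL.Fubini[OF fx] by simp
  also have "\<dots> = (\<integral>\<^sup>+s. h s \<partial>tm u)"
  proof (rule nn_integral_cong)
   fix s
   show "(\<integral>\<^sup>+x. (\<integral>\<^sup>+om. ?f s x om \<partial>M) \<partial>TL) = h s"
   unfolding h_def by (rule fQ[symmetric]) (use a1[of s] Z1[of s] in measurable)
  qed
  also have "\<dots> = (\<integral>\<^sup>+s\<in>{0..u}. h s \<partial>lborel)" by (rule nn_integral_restrict_space) simp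
  finally show ?thesis .
 qed
 have hpsi: "h s <= ennreal (\<beta> * (\<Lambda> * exp (- (\<beta> * s))) * \<psi> s)" if s: "s \<in> {0..T}" and ws: "w s <= ennreal (\<psi> s)" for s
 proof -
  let ?D = "2 * B\<^sup>2 * (1 + 32 * exp 1 * Ck\<^sup>2)"
  note l2 = lam[OF s]
  have \<psi>0: "\<psi> s > 0" by (simp add: \<psi>_def)
  have D0: "?D >= 0" by simp
  have l0: "\<kappa> s > 0" using l2 by simp
  have "h s <= ennreal (1 / \<kappa> s) * ennreal (?D * (\<kappa> s)\<^sup>2 * \<psi> s) + ennreal (\<kappa> s + 4 * L) * ennreal (\<psi> s)"
   by (rule order_trans[OF split[OF l0]]) (intro add_mono mult_left_mono aL2 s ws zero_le)
  also have "\<dots> = ennreal (1 / \<kappa> s * (?D * (\<kappa> s)\<^sup>2 * \<psi> s)) + ennreal ((\<kappa> s + 4 * L) * \<psi> s)"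
  proof -
   have "ennreal (1 / \<kappa> s) * ennreal (?D * (\<kappa> s)\<^sup>2 * \<psi> s) = ennreal (1 / \<kappa> s * (?D * (\<kappa> s)\<^sup>2 * \<psi> s))"
   using l0 D0 \<psi>0 by (intro ennreal_mult[symmetric] mult_nonneg_nonneg) auto
   moreover have "ennreal (\<kappa> s + 4 * L) * ennreal (\<psi> s) = ennreal ((\<kappa> s + 4 * L) * \<psi> s)"
   using l0 L(2) \<psi>0 by (intro ennreal_mult[symmetric]) auto
   ultimately show ?thesis by (simp only:)
  qed
  also have "\<dots> = ennreal (1 / \<kappa> s * (?D * (\<kappa> s)\<^sup>2 * \<psi> s) + (\<kappa> s + 4 * L) * \<psi> s)"
   using l0 L(2) \<psi>0 D0 by (intro ennreal_plus[symmetric] mult_nonneg_nonneg) auto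
  also have "\<dots> <= ennreal (\<beta> * \<kappa> s * \<psi> s)"
  proof (rule ennreal_leI)
   have "1 / \<kappa> s * (?D * (\<kappa> s)\<^sup>2 * \<psi> s) = ?D * \<kappa> s * \<psi> s" using l0 by (simp add: power2_eq_square)
   moreover have "(\<kappa> s + 4 * L) * \<psi> s <= ((1 + 4 * L) * \<kappa> s) * \<psi> s"
   proof (rule mult_right_mono)
   have "4 * L * 1 <= 4 * L * \<kappa> s" using L(2) l2 by (intro mult_left_mono) auto
   then show "\<kappa> s + 4 * L <= (1 + 4 * L) * \<kappa> s" by (simp add: algebra_simps)
   qed (use \<psi>0 in simp)
   ultimately have "1 / \<kappa> s * (?D * (\<kappa> s)\<^sup>2 * \<psi> s) + (\<kappa> s + 4 * L) * \<psi> s <= ?D * \<kappa> s * \<psi> s + (1 + 4 * L) * \<kappa> s * \<psi> s" by linarith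
   also have "\<dots> = \<beta> * \<kappa> s * \<psi> s" unfolding \<beta> by (simp only: distrib_right add.assoc)
   finally show "1 / \<kappa> s * (?D * (\<kappa> s)\<^sup>2 * \<psi> s) + (\<kappa> s + 4 * L) * \<psi> s <= \<beta> * \<kappa> s * \<psi> s" .
  qed
  finally show ?thesis unfolding \<kappa>_def .
 qed
 have "w t <= ennreal (\<psi> t)"
  by (rule osgood_barrier[where T = T and \<beta> = \<beta> and \<Lambda> = \<Lambda>, OF hm hb wh _ Lam0 _ hpsi t])
   (use beta0 in \<open>auto simp: \<psi>_def \<kappa>_def\<close>)
 moreover have "\<psi> t <= \<psi> T"
 proof -
  have "\<kappa> T <= \<kappa> t" unfolding \<kappa>_def using Lam0 t beta0 by (intro mult_left_mono) auto
  then show ?thesis by (simp add: \<psi>_def)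
 qed
 ultimately have wT: "w t <= ennreal (\<psi> T)" by (meson ennreal_leI order_trans)
 \<comment> \<open>L1 from L2: d <= \<eta> + d^2 / \<eta>, with \<eta>^2 the bound on the second
   moment.\<close>
 define \<eta> where "\<eta> = sqrt (\<psi> T)"
 have \<eta>: "\<eta> > 0" "\<eta> * \<eta> = \<psi> T" by (auto simp: \<eta>_def \<psi>_def)
 have dm2: "(%q. ennreal ((d t (fst q) (snd q))\<^sup>2)) \<in> BM ?Q" using dm[OF t] by measurable
 have "(\<integral>\<^sup>+x. (\<integral>\<^sup>+om. ennreal (d t x om) \<partial>M) \<partial>TL) = (\<integral>\<^sup>+q. ennreal (d t (fst q) (snd q)) \<partial>?Q)"
  by (rule fQ[symmetric]) (use dm[OF t] in measurable)
 also have "\<dots> <= (\<integral>\<^sup>+q. ennreal \<eta> + ennreal (1 / \<eta>) * ennreal ((d t (fst q) (snd q))\<^sup>2) \<partial>?Q)"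
 proof (rule nn_integral_mono)
  fix q
  have "ennreal (d t (fst q) (snd q)) <= ennreal (\<eta> + 1 / \<eta> * (d t (fst q) (snd q))\<^sup>2)"
   using le_add_square_div[OF \<eta>(1) d0, of t "fst q" "snd q"] by (intro ennreal_leI) simp
  also have "\<dots> = ennreal \<eta> + ennreal (1 / \<eta> * (d t (fst q) (snd q))\<^sup>2)" using \<eta>(1) by (intro ennreal_plus) auto
  also have "ennreal (1 / \<eta> * (d t (fst q) (snd q))\<^sup>2) = ennreal (1 / \<eta>) * ennreal ((d t (fst q) (snd q))\<^sup>2)"
   using \<eta>(1) by (intro ennreal_mult) auto
  finally show "ennreal (d t (fst q) (snd q)) <= ennreal \<eta> + ennreal (1 / \<eta>) * ennreal ((d t (fst q) (snd q))\<^sup>2)" .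
 qed
 also have "\<dots> = (\<integral>\<^sup>+q. ennreal \<eta> \<partial>?Q) + (\<integral>\<^sup>+q. ennreal (1 / \<eta>) * ennreal ((d t (fst q) (snd q))\<^sup>2) \<partial>?Q)"
  by (rule nn_integral_add) (use dm2 in measurable)
 also have "\<dots> = ennreal \<eta> + ennreal (1 / \<eta>) * (\<integral>\<^sup>+q. ennreal ((d t (fst q) (snd q))\<^sup>2) \<partial>?Q)"
  unfolding nn_integral_cmult[OF dm2] using TM.emeasure_space_1 by simp
 also have "\<dots> <= ennreal \<eta> + ennreal (1 / \<eta>) * ennreal (\<psi> T)"
  by (rule add_left_mono[OF mult_left_mono[OF order_trans[OF d2w[OF t] wT]]]) simp
 also have "\<dots> = ennreal (2 * \<eta>)"
 proof -
  have "ennreal (1 / \<eta>) * ennreal (\<psi> T) = ennreal (1 / \<eta> * (\<eta> * \<eta>))" unfolding \<eta>(2)[symmetric] using \<eta>(1) by (intro ennreal_mult[symmetric]) auto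
  also have "1 / \<eta> * (\<eta> * \<eta>) = \<eta>" using \<eta>(1) by simp
  finally have "ennreal \<eta> + ennreal (1 / \<eta>) * ennreal (\<psi> T) = ennreal \<eta> + ennreal \<eta>" by simp
  also have "\<dots> = ennreal (\<eta> + \<eta>)" using \<eta>(1) by (intro ennreal_plus[symmetric]) auto
  finally show ?thesis by simp
 qed
 finally show ?thesis unfolding d_def \<eta>_def \<psi>_def \<kappa>_def .
qed

end

theorem proposition6p1:
  fixes M :: "'a measure" and T c :: real
    and F :: "real \<Rightarrow> 'a measure" and W :: "nat \<Rightarrow> real \<Rightarrow> 'a \<Rightarrow> real"
    and \<sigma> :: "nat \<Rightarrow> torus2 \<Rightarrow> real^2" and D\<sigma> :: "nat \<Rightarrow> torus2 \<Rightarrow> real^2^2"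
    and \<xi>\<^sub>0 :: "torus2 \<Rightarrow> real" and G :: "torus2 \<Rightarrow> real" and K :: "torus2 \<Rightarrow> real^2"
    and \<rho> :: "real \<Rightarrow> real^2 \<Rightarrow> real"
    and \<Phi> :: "real \<Rightarrow> torus2 \<Rightarrow> 'a \<Rightarrow> torus2"
    and \<Phi>\<epsilon> :: "real \<Rightarrow> real \<Rightarrow> torus2 \<Rightarrow> 'a \<Rightarrow> torus2"
  assumes "T > 0"
    and "\<xi>\<^sub>0 \<in> borel_measurable torus_lebesgue"
    and "esssup torus_lebesgue (\<lambda>x. ennreal \<bar>\<xi>\<^sub>0 x\<bar>) < \<infinity>"
    and "prob_space M"
    and "filtration_upto M T F"
    and "independent_brownian_motions M T F W"
    and "\<And>k. \<exists>L. L-lipschitz_on UNIV (\<sigma> k)"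
    and "\<And>k. divergence_free (\<sigma> k)"
    and "\<And>k. weak_jacobian (\<sigma> k) (D\<sigma> k)"
    and "(SUP x. \<Sum>k. ennreal ((norm (\<sigma> k x))\<^sup>2))
           + esssup torus_lebesgue (\<lambda>x. \<Sum>k. ennreal ((norm (D\<sigma> k x))\<^sup>2)) < \<infinity>"
    and "c \<ge> 0"
    and "\<And>x. (\<lambda>k. \<chi> i j. \<sigma> k x $ i * \<sigma> k x $ j) sums (mat c :: real^2^2)"
    and "torus_green G"
    and "perp_gradient G K"
    and "mollifier_family \<rho>"
    and "flow_solution M T F W \<sigma> \<xi>\<^sub>0 K \<Phi>"
    and "\<And>\<epsilon>. \<epsilon> > 0 \<Longrightarrow> flow_solution M T F W \<sigma> \<xi>\<^sub>0 (mollify K (\<rho> \<epsilon>)) (\<Phi>\<epsilon> \<epsilon>)"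
  shows "((\<lambda>\<epsilon>. SUP t\<in>{0..T}. \<integral>\<^sup>+x. (\<integral>\<^sup>+\<omega>. ennreal (dist (\<Phi>\<epsilon> \<epsilon> t x \<omega>) (\<Phi> t x \<omega>)) \<partial>M)
             \<partial>torus_lebesgue) \<longlongrightarrow> 0) (at_right 0)"
proof -
 interpret filtered_brownian M T F W
  by (intro filtered_brownian.intro filtered_brownian_axioms.intro assms)
 have xi: "\<xi>\<^sub>0 \<in> BM borel" using assms(2) by (simp cong: measurable_cong_sets)
 define B where "B = enn2real (esssup TL (%x. ennreal \<bar>\<xi>\<^sub>0 x\<bar>))"
 have B0: "B >= 0" by (simp add: B_def)
 have B: "AE y in TL. \<bar>\<xi>\<^sub>0 y\<bar> <= B"
  using esssup_AE[of "%x. ennreal \<bar>\<xi>\<^sub>0 x\<bar>" TL]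
 proof eventually_elim
  fix y assume "ennreal \<bar>\<xi>\<^sub>0 y\<bar> <= esssup TL (%x. ennreal \<bar>\<xi>\<^sub>0 x\<bar>)"
  also have "\<dots> = ennreal B" using assms(3) unfolding B_def by (intro ennreal_enn2real[symmetric]) simp
  finally show "\<bar>\<xi>\<^sub>0 y\<bar> <= B" by (subst (asm) ennreal_le_iff) (use B0 in auto)
 qed
 have sigc: "continuous_on UNIV (\<sigma> k)" for k
  using assms(7)[of k] lipschitz_on_continuous_on by blast
 have sig: "\<sigma> k \<in> BM borel" for k by (rule borel_measurable_continuous_onI[OF sigc])
 have fin: "esssup TL (%x. \<Sum>k. ennreal ((norm (D\<sigma> k x))\<^sup>2)) < \<infinity>"
 proof (rule le_less_trans[OF _ assms(10)])
  show "x <= y + x" for x y :: ennreal using add_right_mono[OF zero_le[of y], of x] by simp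
 qed
 show ?thesis
 proof (rule sigma_lipschitz[OF sigc assms(9) fin])
 fix L
 assume L0: "L >= 0" and L: "!!n x y. (\<Sum>k<n. (norm (\<sigma> k x - \<sigma> k y))\<^sup>2) <= L * (dist x y)\<^sup>2"
 show ?thesis
 proof (rule biot_savart_holder[OF assms(13,14)])
 fix Ck good
 assume Ck: "Ck >= 0" and good: "AE x in TL. good x"
  and hold: "!!\<alpha>. 1/2 <= \<alpha> ==> \<alpha> < 1 ==> \<exists>g. g \<in> BM borel \<and>
   (\<integral>\<^sup>+x. g x \<partial>TL) <= ennreal (Ck / (1 - \<alpha>)) \<and>
   (\<forall>x y. good x \<longrightarrow> good y \<longrightarrow> ennreal (norm (K x - K y)) <= ennreal (dist x y powr \<alpha>) * (g x + g y))"
 \<comment> \<open>One function g is selected for each \<alpha>, since the exponent varies with time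
   in the comparison.\<close>
 define Hg where "Hg \<alpha> g \<longleftrightarrow> g \<in> BM borel \<and>
   (\<integral>\<^sup>+x. g x \<partial>TL) <= ennreal (Ck / (1 - \<alpha>)) \<and>
   (\<forall>x y. good x \<longrightarrow> good y \<longrightarrow> ennreal (norm (K x - K y)) <= ennreal (dist x y powr \<alpha>) * (g x + g y))" for \<alpha> g
 define g where "g \<alpha> = (SOME g. Hg \<alpha> g)" for \<alpha>
 have Hg: "Hg \<alpha> (g \<alpha>)" if "1/2 <= \<alpha>" "\<alpha> < 1" for \<alpha>
 proof -
  have "\<exists>g. Hg \<alpha> g" unfolding Hg_def by (rule hold[OF that])
  then show ?thesis unfolding g_def by (rule someI_ex)
 qed
 have g1: "g \<alpha> \<in> BM borel" if "1/2 <= \<alpha>" "\<alpha> < 1" for \<alpha>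
  using Hg[OF that] unfolding Hg_def by (elim conjE)
 have g2: "(\<integral>\<^sup>+x. g \<alpha> x \<partial>TL) <= ennreal (Ck / (1 - \<alpha>))" if "1/2 <= \<alpha>" "\<alpha> < 1" for \<alpha>
  using Hg[OF that] unfolding Hg_def by (elim conjE)
 have g3: "ennreal (norm (K x - K y)) <= ennreal (dist x y powr \<alpha>) * (g \<alpha> x + g \<alpha> y)"
  if "1/2 <= \<alpha>" "\<alpha> < 1" "good x" "good y" for \<alpha> x y
  using Hg[OF that(1,2)] that(3,4) unfolding Hg_def by (elim conjE) (simp only: simp_thms)
 have K: "integrable TL K" using assms(14) by (simp add: perp_gradient_def)
 define \<beta> where "\<beta> = 2 * B\<^sup>2 * (1 + 32 * exp 1 * Ck\<^sup>2) + 1 + 4 * L"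
 have main: "\<forall>\<^sub>F \<epsilon> in at_right 0. (SUP t\<in>{0..T}. \<integral>\<^sup>+x. (\<integral>\<^sup>+om. ennreal (dist (\<Phi>\<epsilon> \<epsilon> t x om) (\<Phi> t x om)) \<partial>M)
   \<partial>TL) <= ennreal \<delta>" if \<delta>: "\<delta> > 0" for \<delta>
 proof -
  \<comment> \<open>2 sqrt(exp(-\<mu>)) <= \<delta> as soon as \<mu> >= 2 ln(2/\<delta>); the lower
    bound 2 is the condition on \<Lambda> in \<open>flow_distance_bound\<close>.\<close>
  define \<mu> where "\<mu> = max 2 (2 * ln (2 / \<delta>))"
  define \<Lambda> where "\<Lambda> = \<mu> * exp (\<beta> * T)"
  have \<Lambda>\<mu>: "\<Lambda> * exp (- (\<beta> * T)) = \<mu>" by (simp add: \<Lambda>_def mult.assoc exp_add[symmetric])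
  have \<mu>2: "\<Lambda> * exp (- (\<beta> * T)) >= 2" unfolding \<Lambda>\<mu> by (simp add: \<mu>_def)
  have small: "2 * sqrt (exp (- (\<Lambda> * exp (- (\<beta> * T))))) <= \<delta>"
  proof -
   have "sqrt (exp (- \<mu>)) = exp (- (\<mu> / 2))"
   by (rule real_sqrt_unique) (simp_all add: power2_eq_square exp_add[symmetric])
   also have "\<dots> <= exp (- ln (2 / \<delta>))" by (simp add: \<mu>_def)
   also have "\<dots> = \<delta> / 2" using \<delta> by (simp add: exp_minus)
   finally show ?thesis unfolding \<Lambda>\<mu> by simp
  qed
  \<comment> \<open>At \<alpha> = 1/2 the squared kernel error is at most 16 Ck^2 r. The summand 1
    keeps the denominator positive when Ck = 0.\<close>
  define r where "r = exp (- \<Lambda>) / (16 * Ck\<^sup>2 + 1)"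
  have den: "16 * Ck\<^sup>2 + 1 > 0" by (rule add_nonneg_pos) auto
  have r: "r > 0" using den by (simp add: r_def)
  have "\<forall>\<^sub>F \<epsilon> in at_right 0. \<forall>z. \<rho> \<epsilon> z \<noteq> 0 \<longrightarrow> norm z < r"
   using assms(15) r unfolding mollifier_family_def by blast
  moreover have "\<forall>\<^sub>F \<epsilon> :: real in at_right 0. \<epsilon> > 0" by (rule eventually_at_right_less)
  ultimately show ?thesis
  proof eventually_elim
   fix \<epsilon> :: real assume supp: "\<forall>z. \<rho> \<epsilon> z \<noteq> 0 \<longrightarrow> norm z < r" and \<epsilon>: "\<epsilon> > 0"
   note rho = mollifier_family_D[OF assms(15) \<epsilon>]
   have Ke: "integrable TL (mollify K (\<rho> \<epsilon>))" by (rule integrable_mollify[OF K rho])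
   have half: "1/2 <= (1/2::real)" "(1/2::real) < 1" by simp_all
   have supp': "norm z <= r" if "\<rho> \<epsilon> z \<noteq> 0" for z using supp that less_imp_le by blast
   have h0: "(1/2::real) > 0" by simp
   have r0: "r >= 0" using r by simp
   have "(\<integral>\<^sup>+x. ennreal (norm (mollify K (\<rho> \<epsilon>) x - K x)) \<partial>TL) <= ennreal (r powr (1/2)) * (2 * (\<integral>\<^sup>+x. g (1/2) x \<partial>TL))"
   by (rule mollify_L1_error[OF K rho supp' r0 good g1[OF half] h0 g3[OF half]])
   also have "\<dots> <= ennreal (r powr (1/2)) * (2 * ennreal (Ck / (1 - 1/2)))"
   by (rule mult_left_mono[OF mult_left_mono[OF g2[OF half]]]) simp_all
   also have "\<dots> = ennreal (r powr (1/2) * (4 * Ck))"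
   proof -
   have "2 * ennreal (Ck / (1 - 1/2)) = ennreal 2 * ennreal (Ck / (1 - 1/2))" by simp
   also have "\<dots> = ennreal (2 * (Ck / (1 - 1/2)))" using Ck by (intro ennreal_mult[symmetric]) auto
   also have "2 * (Ck / (1 - 1/2)) = 4 * Ck" by simp
   finally have "ennreal (r powr (1/2)) * (2 * ennreal (Ck / (1 - 1/2))) = ennreal (r powr (1/2)) * ennreal (4 * Ck)" by (simp only:)
   also have "\<dots> = ennreal (r powr (1/2) * (4 * Ck))" using Ck by (intro ennreal_mult[symmetric]) auto
   finally show ?thesis .
   qed
   finally have "(\<integral>\<^sup>+x. ennreal (norm (mollify K (\<rho> \<epsilon>) x - K x)) \<partial>TL)\<^sup>2 <= (ennreal (r powr (1/2) * (4 * Ck)))\<^sup>2"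
   by (rule power_mono) simp
   also have "\<dots> = ennreal ((r powr (1/2) * (4 * Ck))\<^sup>2)" using Ck by (intro ennreal_power) auto
   also have "\<dots> <= ennreal (exp (- \<Lambda>))"
   proof (rule ennreal_leI)
   have "(r powr (1/2) * (4 * Ck))\<^sup>2 = r * (16 * Ck\<^sup>2)" using r by (simp add: powr_half_sqrt power_mult_distrib)
   also have "\<dots> <= r * (16 * Ck\<^sup>2 + 1)" using r by (intro mult_left_mono) auto
   also have "\<dots> = exp (- \<Lambda>)" using den by (simp add: r_def)
   finally show "(r powr (1/2) * (4 * Ck))\<^sup>2 <= exp (- \<Lambda>)" .
   qed
   finally have err: "(\<integral>\<^sup>+x. ennreal (norm (mollify K (\<rho> \<epsilon>) x - K x)) \<partial>TL)\<^sup>2 <= ennreal (exp (- \<Lambda>))" .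
   have "(\<integral>\<^sup>+x. (\<integral>\<^sup>+om. ennreal (dist (\<Phi>\<epsilon> \<epsilon> t x om) (\<Phi> t x om)) \<partial>M) \<partial>TL) <= ennreal \<delta>" if t: "t \<in> {0..T}" for t
   by (rule order_trans[OF flow_distance_bound[OF assms(17)[OF \<epsilon>] assms(16) xi B B0 Ke K sig L L0 good Ck g1 g2 g3 \<beta>_def \<mu>2 err t] ennreal_leI[OF small]])
   then show "(SUP t\<in>{0..T}. \<integral>\<^sup>+x. (\<integral>\<^sup>+om. ennreal (dist (\<Phi>\<epsilon> \<epsilon> t x om) (\<Phi> t x om)) \<partial>M) \<partial>TL) <= ennreal \<delta>"
   by (rule SUP_least)
  qed
 qed
 show ?thesis
 proof (rule order_tendstoI)
  fix c :: ennreal assume "0 < c"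
  then obtain y where y: "0 < y" "y < c" using dense by blast
  then obtain \<delta> where \<delta>: "y = ennreal \<delta>" "\<delta> > 0" by (cases y) auto
  show "\<forall>\<^sub>F \<epsilon> in at_right 0. (SUP t\<in>{0..T}. \<integral>\<^sup>+x. (\<integral>\<^sup>+om. ennreal (dist (\<Phi>\<epsilon> \<epsilon> t x om) (\<Phi> t x om)) \<partial>M)
   \<partial>TL) < c"
   using main[OF \<delta>(2)] by eventually_elim (use y(2) \<delta>(1) in \<open>auto intro: le_less_trans\<close>)
 qed simp
 qed
 qed
qed

end
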